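(* Let $n\ge1$, $d=n+1$. There exists a constant $c_n>0$ depending only on $n$ such that the following holds. Let $T>0$ and let $f(t,y,v)\ge0$, $(t,y,v)\in(0,T)\times\mathbb{R}^n\times\mathbb{R}^n$, be an admissible flow of a kinetic equation $(\partial_t+v\cdot\nabla_y)f=Q[f(t,y,\cdot)]$ whose collision operator conserves mass, momentum and energy ($\int Q[g]\,dv=0$, $\int Q[g]\,v\,dv=0$, $\int Q[g]|v|^2dv=0$); concretely, with $\rho=\int f\,dv$, $m=\int fv\,dv$, $S=\int f\,v\otimes v\,dv$, assume $\partial_t\rho+\mathrm{div}_ym=0$ and $\partial_tm+\mathrm{Div}_yS=0$ in distributions on $(0,T)\times\mathbb{R}^n$, that $f$ has initial value $f_0$ at $t=0$ and a well-defined value at $t=T$ (with $\rho,m$ weakly continuous in time with values in $L^1(\mathbb{R}^n)$), that the total mass $\int\!\!\int f(t,y,v)\,dv\,dy$ equals $M_0=\int\!\!\int f_0(y,v)\,dv\,dy<\infty$ for all $t$, and that $\int\!\!\int f(t,y,v)\frac{|v|^2}2\,dv\,dy\le E_0:=\int\!\!\int f_0(y,v)\frac{|v|^2}2\,dv\,dy<\infty$ for all $t\in[0,T]$. Assume further that $\rho$ and $\mathrm{Tr}\,S=\int f|v|^2dv$ belong to $L^{\frac d{d-1}}_{\rm loc}((0,T)\times\mathbb{R}^n)$. Then $$\int_0^T\!\!dt\int_{\mathbb{R}^n}\!dy\left(\frac1{d!}\int_{(\mathbb{R}^n)^{n+1}}f(t,y,v^0)\cdots f(t,y,v^n)\,\Delta(v^0,\ldots,v^n)^2\,dv^0\cdots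 dv^n\right)^{\frac1n}\le 2c_n\,M_0^{\frac1n}D_0^{\frac12},$$ where $\Delta(v^0,\ldots,v^n)=\det\begin{pmatrix}1&\cdots&1\\ v^0&\cdots&v^n\end{pmatrix}$ (a $d\times d$ determinant) and $$D_0=\frac12\int_{(\mathbb{R}^n)^4}f_0(y,v)f_0(y',v')|v'-v|^2\,dy\,dy'\,dv\,dv'.$$
   Context: $\mathrm{Div}_y$ denotes row-wise divergence in $y$ of a matrix field; $v\otimes v$ is the matrix $(v_iv_j)$. *)

theory Defs
  imports "HOL-Analysis.Analysis"
begin

fun iter_dderiv :: "('a::real_normed_vector \<Rightarrow> real) \<Rightarrow> 'a list \<Rightarrow> 'a \<Rightarrow> real" where
  "iter_dderiv g [] = g"
| "iter_dderiv g (u # us) = (\<lambda>x. frechet_derivative (iter_dderiv g us) (at x) u)"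

definition C_infinity :: "('a::real_normed_vector \<Rightarrow> real) \<Rightarrow> bool" where
  "C_infinity g \<longleftrightarrow> (\<forall>us x. iter_dderiv g us differentiable (at x))"

definition test_fun :: "'a::euclidean_space set \<Rightarrow> ('a \<Rightarrow> real) \<Rightarrow> bool" where
  "test_fun U g \<longleftrightarrow> C_infinity g \<and>
     (\<exists>K. compact K \<and> K \<subseteq> U \<and> (\<forall>x. x \<notin> K \<longrightarrow> g x = 0))"

definition dt :: "(real \<times> (real^'n) \<Rightarrow> real) \<Rightarrow> real \<times> (real^'n) \<Rightarrow> real" where
  "dt g p = frechet_derivative g (at p) (1, 0)"

definition dy :: "(real \<times> (real^'n) \<Rightarrow> real) \<Rightarrow> 'n \<Rightarrow> real \<times> (real^'n) \<Rightarrow> real" where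
  "dy g j p = frechet_derivative g (at p) (0, axis j 1)"

definition rho :: "(real \<Rightarrow> real^'n \<Rightarrow> real^'n \<Rightarrow> real) \<Rightarrow> real \<Rightarrow> real^'n \<Rightarrow> ennreal" where
  "rho f t y = (\<integral>\<^sup>+ v. ennreal (f t y v) \<partial>lborel)"

definition trS :: "(real \<Rightarrow> real^'n \<Rightarrow> real^'n \<Rightarrow> real) \<Rightarrow> real \<Rightarrow> real^'n \<Rightarrow> ennreal" where
  "trS f t y = (\<integral>\<^sup>+ v. ennreal (f t y v * (norm v)\<^sup>2) \<partial>lborel)"

definition mom :: "(real \<Rightarrow> real^'n \<Rightarrow> real^'n \<Rightarrow> real) \<Rightarrow> real \<Rightarrow> real^'n \<Rightarrow> 'n \<Rightarrow> real" where
  "mom f t y i = (\<integral> v. f t y v * v$i \<partial>lborel)"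

definition str :: "(real \<Rightarrow> real^'n \<Rightarrow> real^'n \<Rightarrow> real) \<Rightarrow> real \<Rightarrow> real^'n \<Rightarrow> 'n \<Rightarrow> 'n \<Rightarrow> real" where
  "str f t y i j = (\<integral> v. f t y v * v$i * v$j \<partial>lborel)"

definition mass :: "(real^'n \<Rightarrow> real^'n \<Rightarrow> real) \<Rightarrow> ennreal" where
  "mass g = (\<integral>\<^sup>+ y. \<integral>\<^sup>+ v. ennreal (g y v) \<partial>lborel \<partial>lborel)"

definition energy :: "(real^'n \<Rightarrow> real^'n \<Rightarrow> real) \<Rightarrow> ennreal" where
  "energy g = (\<integral>\<^sup>+ y. \<integral>\<^sup>+ v. ennreal (g y v * (norm v)\<^sup>2 / 2) \<partial>lborel \<partial>lborel)"

definition Dzero :: "(real^'n \<Rightarrow> real^'n \<Rightarrow> real) \<Rightarrow> ennreal" where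
  "Dzero g = (\<integral>\<^sup>+ y. \<integral>\<^sup>+ y'. \<integral>\<^sup>+ v. \<integral>\<^sup>+ v'.
      ennreal (g y v * g y' v' * (norm (v' - v))\<^sup>2 / 2) \<partial>lborel \<partial>lborel \<partial>lborel \<partial>lborel)"

definition Lp_loc :: "real \<Rightarrow> 'a::euclidean_space set \<Rightarrow> ('a \<Rightarrow> ennreal) \<Rightarrow> bool" where
  "Lp_loc p U g \<longleftrightarrow> g \<in> borel_measurable (restrict_space lborel U) \<and>
     (AE x in lborel. x \<in> U \<longrightarrow> g x \<noteq> \<infinity>) \<and>
     (\<forall>K. compact K \<and> K \<subseteq> U \<longrightarrow>
        (\<integral>\<^sup>+ x \<in> K. ennreal (enn2real (g x) powr p) \<partial>lborel) < \<infinity>)"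

definition admissible_flow ::
  "real \<Rightarrow> (real \<Rightarrow> real^'n \<Rightarrow> real^'n \<Rightarrow> real) \<Rightarrow> (real^'n \<Rightarrow> real^'n \<Rightarrow> real) \<Rightarrow> bool" where
  "admissible_flow T f f0 \<longleftrightarrow>
     \<comment> \<open>measurable, nonnegative, with initial value f0\<close>
     (\<lambda>(t, y, v). f t y v) \<in> borel_measurable lborel \<and>
     (\<forall>t\<in>{0..T}. \<forall>y v. f t y v \<ge> 0) \<and>
     (\<forall>y v. f 0 y v = f0 y v) \<and>
     \<comment> \<open>conservation of mass in distributions on (0,T) x R^n\<close>
     (\<forall>\<phi>. test_fun ({0<..<T} \<times> UNIV) \<phi> \<longrightarrow>
        (\<integral> p. enn2real (rho f (fst p) (snd p)) * dt \<phi> p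
              + (\<Sum>j\<in>UNIV. mom f (fst p) (snd p) j * dy \<phi> j p) \<partial>lborel) = 0) \<and>
     \<comment> \<open>conservation of momentum in distributions on (0,T) x R^n\<close>
     (\<forall>\<phi> i. test_fun ({0<..<T} \<times> UNIV) \<phi> \<longrightarrow>
        (\<integral> p. mom f (fst p) (snd p) i * dt \<phi> p
              + (\<Sum>j\<in>UNIV. str f (fst p) (snd p) i j * dy \<phi> j p) \<partial>lborel) = 0) \<and>
     \<comment> \<open>rho and m take values in L^1 and are weakly continuous on [0,T]\<close>
     (\<forall>t\<in>{0..T}. integrable lborel (\<lambda>y. enn2real (rho f t y)) \<and>
                   (\<forall>i. integrable lborel (\<lambda>y. mom f t y i))) \<and>
     (\<forall>\<psi>::real^'n \<Rightarrow> real. \<psi> \<in> borel_measurable lborel \<and> bounded (range \<psi>) \<longrightarrow>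
        continuous_on {0..T} (\<lambda>t. \<integral> y. enn2real (rho f t y) * \<psi> y \<partial>lborel) \<and>
        (\<forall>i. continuous_on {0..T} (\<lambda>t. \<integral> y. mom f t y i * \<psi> y \<partial>lborel))) \<and>
     \<comment> \<open>conservation of total mass, finite initial mass\<close>
     mass f0 < \<infinity> \<and>
     (\<forall>t\<in>{0..T}. mass (f t) = mass f0) \<and>
     \<comment> \<open>energy inequality, finite initial energy\<close>
     energy f0 < \<infinity> \<and>
     (\<forall>t\<in>{0..T}. energy (f t) \<le> energy f0) \<and>
     \<comment> \<open>rho and Tr S in L^{d/(d-1)}_loc, d = n+1\<close>
     Lp_loc (real (CARD('n) + 1) / real CARD('n)) ({0<..<T} \<times> UNIV) (\<lambda>p. rho f (fst p) (snd p)) \<and>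
     Lp_loc (real (CARD('n) + 1) / real CARD('n)) ({0<..<T} \<times> UNIV) (\<lambda>p. trS f (fst p) (snd p))"

text \<open>Delta(v^0,...,v^n): the (n+1)x(n+1) determinant with a row of ones over the
  columns v^0..v^n; the n+1 vectors are indexed by the type 'n option.\<close>
definition Delta :: "('n::finite option \<Rightarrow> real^'n) \<Rightarrow> real" where
  "Delta V = det ((\<chi> r c. case r of None \<Rightarrow> 1 | Some j \<Rightarrow> (V c) $ j) :: real^('n option)^('n option))"

definition enn_root :: "nat \<Rightarrow> ennreal \<Rightarrow> ennreal" where
  "enn_root k x = (if x = \<infinity> then \<infinity> else ennreal (enn2real x powr (1 / real k)))"

definition det_functional :: "(real \<Rightarrow> real^'n::finite \<Rightarrow> real^'n \<Rightarrow> real) \<Rightarrow> real \<Rightarrow> real^'n \<Rightarrow> ennreal" where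
  "det_functional f t y =
     (\<integral>\<^sup>+ V. ennreal ((\<Prod>i\<in>UNIV. f t y (V i)) * (Delta V)\<^sup>2) \<partial>(PiM UNIV (\<lambda>_::'n option. lborel)))
     / ennreal (fact (CARD('n) + 1))"

end

theory Submission
  imports Defs
begin

text \<open>With \<open>w = (1, v)\<close>, the matrix \<open>A(t, y) = \<integral> f w w\<^sup>T dv\<close> is positive semidefinite of size
  \<open>d = n + 1\<close>, its rows are divergence free on the slab, and by Andreief's identity the integrand
  is \<open>(det A)\<close> to the power \<open>1/n\<close>. Its integral is bounded by Serre's compensated
  integrability, in a form that avoids the Monge--Ampere equation.

  For a smooth convex \<open>\<phi>\<close> whose gradients lie in a compact set \<open>K\<close>, testing the conservation
  laws with a cutoff times the gradient of \<open>\<phi>\<close> bounds \<open>\<integral> tr (A D\<^sup>2\<phi>)\<close> by twice the supremum over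
  \<open>t\<close> of \<open>\<integral>\<integral> f sup {\<bar>\<xi> \<bullet> w\<bar> | \<xi> \<in> K}\<close>. Conversely, cut the region into small ellipsoids adapted to
  \<open>A\<close>, send the mass \<open>(det A)\<close> to the power \<open>1/n\<close> carried by each of them to Lebesgue measure on \<open>K\<close> by
  semidiscrete optimal transport, and pick two distant slopes in each transport cell. The smoothed
  maximum of the affine functions with these slopes has \<open>\<integral> tr (A D\<^sup>2\<phi>)\<close> at least a constant times
  the volume of \<open>K\<close>, as soon as \<open>K\<close> is no larger than the total mass.

  It remains to take for \<open>K\<close> the box \<open>\<bar>\<xi>\<^sub>0 + u \<bullet> \<xi>'\<bar> \<le> \<alpha>\<close>, \<open>\<bar>\<xi>'\<^sub>k\<bar> \<le> \<beta>\<close>, where \<open>u\<close> is the conserved mean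
  velocity, and to optimise in \<open>\<alpha>\<close> and \<open>\<beta>\<close>; by conservation of mass and momentum and decay of energy,
  \<open>M\<^sub>0 \<integral>\<integral> f \<bar>v - u\<bar>\<^sup>2 \<le> D\<^sub>0\<close> at all times.\<close>

text \<open>The obstacle is regularity: the transport potential of finitely many masses is piecewise
  affine, and its Hessian is a singular measure. Only a lower bound for the trace is wanted,
  however, and integrating the Hessian by parts against a bump on one ellipsoid sees little more
  than the distance between two slopes available at its centre. Two slopes per cell therefore
  suffice. Log-sum-exp smooths the maximum while keeping the gradients in any convex set that
  contains the slopes; the slopes are fixed before the temperature \<open>e\<close>, so the
  smoothing error vanishes as \<open>e\<close> tends to 0.

  The final estimate is a matter of degrees. The measure of the slope box has degree n + 1 in
  (\<open>\<alpha>\<close>, \<open>\<beta>\<close>), the flux bound has degree 1. If the integral of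
  (det A)^(1/n) exceeded four times the measure of a box, that measure would be at most a constant
  times the flux bound of the box. A box violating this exists, and four times its measure is the
  estimate.\<close>

section \<open>Semidiscrete optimal transport\<close>

text \<open>The weights \<open>h\<close> minimise the dual functional \<open>F\<close>: lowering \<open>h i\<close> cannot decrease \<open>F\<close>, which bounds
  the measure of the \<open>i\<close>-th cell below.\<close>

lemma semidiscrete_transport:
  fixes K :: "'a::euclidean_space set" and x :: "'i \<Rightarrow> 'a" and g :: "'i \<Rightarrow> real"
  assumes K: "compact K" and I: "finite I" "I \<noteq> {}"
    and g: "\<And>i. i \<in> I \<Longrightarrow> 0 < g i" and sum_g: "(\<Sum>i\<in>I. g i) = measure lborel K"
  obtains h :: "'i \<Rightarrow> real" where
    "\<And>i. i \<in> I \<Longrightarrow> g i \<le> measure lborel {p\<in>K. \<forall>j\<in>I. p \<bullet> x j - h j \<le> p \<bullet> x i - h i}"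
proof -
  define u where "u h p = Max ((\<lambda>i. p \<bullet> x i - h i) ` I)" for h p
  have u_ge: "p \<bullet> x i - h i \<le> u h p" if "i \<in> I" for h p i
    unfolding u_def using I that by (intro Max_ge) auto
  have u_le: "u h p \<le> z" if "\<And>i. i \<in> I \<Longrightarrow> p \<bullet> x i - h i \<le> z" for h p z
    unfolding u_def using I that by (intro Max.boundedI) auto
  have u_attained: "\<exists>i\<in>I. u h p = p \<bullet> x i - h i" for h p
    unfolding u_def using Max_in[of "(\<lambda>i. p \<bullet> x i - h i) ` I"] I by fastforce
  have u_cont: "continuous_on K (u h)" for h
  proof -
    have "continuous_on K (\<lambda>p. Max ((\<lambda>i. p \<bullet> x i - h i) ` J))" if "finite J" "J \<noteq> {}" for J
      using that
    proof (induction rule: finite_ne_induct)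
      case (singleton i)
      then show ?case by (auto intro!: continuous_intros)
    next
      case (insert i J)
      have "(\<lambda>p. Max ((\<lambda>i. p \<bullet> x i - h i) ` insert i J)) = (\<lambda>p. max (p \<bullet> x i - h i) (Max ((\<lambda>i. p \<bullet> x i - h i) ` J)))"
        using insert by auto
      then show ?case
        using insert by (auto intro!: continuous_intros)
    qed
    then show ?thesis
      unfolding u_def using I by blast
  qed
  have cont_int: "set_integrable lborel K f" if "continuous_on K f" for f :: "'a \<Rightarrow> real"
    unfolding set_integrable_def using K that by (intro borel_integrable_compact) auto
  have u_int: "set_integrable lborel K (u h)" for h
    using u_cont by (rule cont_int)
  have Ks: "K \<in> sets lborel" "emeasure lborel K \<noteq> \<infinity>"
    using K emeasure_compact_finite[of K] by (auto simp: compact_imp_closed borel_closed)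
  have const: "(LINT p:K|lborel. c) = measure lborel K * c" for c :: real
    using set_integral_const[OF Ks, of c] by simp
  \<comment> \<open>The Kantorovich dual. Formally its derivative in \<open>h i\<close> is
    \<open>g i\<close> minus the measure of the cell where \<open>i\<close> attains the maximum, so
    at a minimum every cell has the prescribed measure.\<close>
  define F where "F h = (LINT p:K|lborel. u h p) + (\<Sum>i\<in>I. g i * h i)" for h
  obtain R where R: "\<And>p i. p \<in> K \<Longrightarrow> i \<in> I \<Longrightarrow> \<bar>p \<bullet> x i\<bar> \<le> R"
  proof -
    obtain B where B: "\<And>p. p \<in> K \<Longrightarrow> norm p \<le> B"
      using compact_imp_bounded[OF K] by (auto simp: bounded_iff)
    have "\<bar>p \<bullet> x i\<bar> \<le> \<bar>B\<bar> * (\<Sum>i\<in>I. norm (x i))" if "p \<in> K" "i \<in> I" for p i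
    proof -
      have "\<bar>p \<bullet> x i\<bar> \<le> norm p * norm (x i)"
        by (rule Cauchy_Schwarz_ineq2)
      also have "\<dots> \<le> \<bar>B\<bar> * (\<Sum>i\<in>I. norm (x i))"
        using B[OF that(1)] I that member_le_sum[of i I "\<lambda>i. norm (x i)"] by (intro mult_mono) auto
      finally show ?thesis .
    qed
    then show ?thesis using that by blast
  qed
  have F_diff: "F h' - F h \<le> (2 * measure lborel K) * (\<Sum>i\<in>I. \<bar>h' i - h i\<bar>)" for h h'
  proof -
    have "u h' p \<le> u h p + (\<Sum>i\<in>I. \<bar>h' i - h i\<bar>)" for p
    proof (rule u_le)
      fix i assume "i \<in> I"
      then have "\<bar>h' i - h i\<bar> \<le> (\<Sum>i\<in>I. \<bar>h' i - h i\<bar>)"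
        using I member_le_sum[of i I "\<lambda>i. \<bar>h' i - h i\<bar>"] by auto
      then show "p \<bullet> x i - h' i \<le> u h p + (\<Sum>i\<in>I. \<bar>h' i - h i\<bar>)"
        using u_ge[OF \<open>i \<in> I\<close>, of p h] by linarith
    qed
    then have "(LINT p:K|lborel. u h' p) \<le> (LINT p:K|lborel. u h p + (\<Sum>i\<in>I. \<bar>h' i - h i\<bar>))"
      using u_int u_cont by (intro set_integral_mono cont_int continuous_intros) auto
    also have "\<dots> = (LINT p:K|lborel. u h p) + measure lborel K * (\<Sum>i\<in>I. \<bar>h' i - h i\<bar>)"
      using u_int by (subst set_integral_add) (auto intro!: cont_int simp: const)
    finally have 1: "(LINT p:K|lborel. u h' p) - (LINT p:K|lborel. u h p) \<le> measure lborel K * (\<Sum>i\<in>I. \<bar>h' i - h i\<bar>)"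
      by simp
    have "(\<Sum>i\<in>I. g i * h' i) - (\<Sum>i\<in>I. g i * h i) = (\<Sum>i\<in>I. g i * (h' i - h i))"
      by (simp add: sum_subtractf right_diff_distrib)
    also have "\<dots> \<le> (\<Sum>i\<in>I. measure lborel K * \<bar>h' i - h i\<bar>)"
    proof (rule sum_mono)
      fix i assume i: "i \<in> I"
      have "g i \<le> measure lborel K"
        unfolding sum_g[symmetric] using I i g by (intro member_le_sum) (auto intro: less_imp_le)
      then have "g i * \<bar>h' i - h i\<bar> \<le> measure lborel K * \<bar>h' i - h i\<bar>"
        by (intro mult_right_mono) auto
      moreover have "g i * (h' i - h i) \<le> g i * \<bar>h' i - h i\<bar>"
        using g[OF i] by (intro mult_left_mono) auto
      ultimately show "g i * (h' i - h i) \<le> measure lborel K * \<bar>h' i - h i\<bar>" by linarith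
    qed
    finally show ?thesis
      using 1 unfolding F_def sum_distrib_left[symmetric] by (simp add: algebra_simps)
  qed
  \<comment> \<open>Adding a constant to \<open>h\<close> leaves \<open>F\<close> unchanged because
    the masses \<open>g\<close> add up to the measure of \<open>K\<close>, so the least weight may
    be normalised to 0. Then \<open>u\<close> is at least \<open>-R\<close> on \<open>K\<close>, and
    one weight above \<open>H\<close> already pushes \<open>F\<close> to at least its value at zero
    weights. Hence the minimum over the box \<open>S\<close> is global.\<close>
  define H where "H = (\<Sum>i\<in>I. (\<bar>F (\<lambda>_. 0)\<bar> + R * measure lborel K) / g i)"
  \<comment> \<open>All coordinates are bounded, also those outside \<open>I\<close>, so that
    Tychonoff gives compactness for an arbitrary index type.\<close>
  define S where "S = {h :: 'i \<Rightarrow> real. \<forall>i. 0 \<le> h i \<and> h i \<le> H}"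
  have S_PiE: "S = Pi\<^sub>E UNIV (\<lambda>_. {0..H})"
    unfolding S_def by (auto simp: PiE_iff)
  have R0: "0 \<le> R * measure lborel K"
  proof (cases "K = {}")
    case False
    then obtain p i where "p \<in> K" "i \<in> I" using I by auto
    then have "0 \<le> R" using R[of p i] by linarith
    then show ?thesis by simp
  qed simp
  have H0: "0 \<le> H"
    unfolding H_def using R0 g by (intro sum_nonneg divide_nonneg_nonneg) (auto intro: less_imp_le)
  have "compact S"
  proof -
    have "compactin (product_topology (\<lambda>_. euclidean) UNIV) S"
      unfolding S_PiE by (subst compactin_PiE) auto
    then show ?thesis by (simp add: euclidean_product_topology)
  qed
  moreover have zero: "(\<lambda>_. 0) \<in> S"
    using H0 by (simp add: S_def)
  moreover from zero have "S \<noteq> {}" by auto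
  moreover have "continuous_on S F"
    unfolding continuous_on_def
  proof
    fix h assume "h \<in> S"
    let ?b = "\<lambda>h'. (2 * measure lborel K) * (\<Sum>i\<in>I. \<bar>h' i - h i\<bar>)"
    have "((\<lambda>h'. h' i) \<longlongrightarrow> h i) (at h within S)" for i
      using continuous_on_subset[OF continuous_on_product_coordinates[of i], of S] \<open>h \<in> S\<close>
      unfolding continuous_on_def by blast
    then have "(?b \<longlongrightarrow> (2 * measure lborel K) * (\<Sum>i\<in>I. \<bar>h i - h i\<bar>)) (at h within S)"
      by (intro tendsto_intros) auto
    then have b: "(?b \<longlongrightarrow> 0) (at h within S)" by simp
    have "\<bar>F h' - F h\<bar> \<le> ?b h'" for h'
      using F_diff[of h' h] F_diff[of h h'] by (auto simp: abs_minus_commute abs_le_iff)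
    then have "((\<lambda>h'. F h' - F h) \<longlongrightarrow> 0) (at h within S)"
      by (intro Lim_null_comparison[OF _ b]) auto
    then show "(F \<longlongrightarrow> F h) (at h within S)"
      by (simp add: LIM_zero_iff)
  qed
  ultimately obtain h where h: "h \<in> S" "\<And>h'. h' \<in> S \<Longrightarrow> F h \<le> F h'"
    using continuous_attains_inf[of S F] by blast
  have F_cong: "F h1 = F h2" if "\<And>i. i \<in> I \<Longrightarrow> h1 i = h2 i" for h1 h2
  proof -
    have "u h1 = u h2" unfolding u_def using that by (intro ext arg_cong[where f=Max] image_cong) auto
    then show ?thesis unfolding F_def using that by simp
  qed
  have F_shift: "F (\<lambda>i. h' i - m) = F h'" for h' m
  proof -
    have "u (\<lambda>i. h' i - m) p = u h' p + m" for p
    proof (rule antisym)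
      show "u (\<lambda>i. h' i - m) p \<le> u h' p + m"
      proof (rule u_le)
        fix i assume "i \<in> I" then show "p \<bullet> x i - (h' i - m) \<le> u h' p + m"
          using u_ge[of i p h'] by linarith
      qed
      obtain i where "i \<in> I" "u h' p = p \<bullet> x i - h' i" using u_attained by blast
      then show "u h' p + m \<le> u (\<lambda>i. h' i - m) p"
        using u_ge[of i p "\<lambda>i. h' i - m"] by linarith
    qed
    then have "(LINT p:K|lborel. u (\<lambda>i. h' i - m) p) = (LINT p:K|lborel. u h' p) + measure lborel K * m"
      using u_int by (simp, subst set_integral_add) (auto intro!: cont_int simp: const)
    moreover have "(\<Sum>i\<in>I. g i * (h' i - m)) = (\<Sum>i\<in>I. g i * h' i) - measure lborel K * m"
      by (simp add: right_diff_distrib sum_subtractf sum_distrib_right[symmetric] sum_g)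
    ultimately show ?thesis unfolding F_def by simp
  qed
  have min: "F h \<le> F h'" for h'
  proof -
    define m where "m = Min (h' ` I)"
    have "m \<in> h' ` I"
      using I unfolding m_def by (intro Min_in) auto
    then obtain k where k: "k \<in> I" "h' k = m"
      by blast
    define h2 where "h2 i = (if i \<in> I then h' i - m else 0)" for i
    have F2: "F h2 = F h'"
      using F_shift[of h' m] F_cong[of h2 "\<lambda>i. h' i - m"] by (simp add: h2_def)
    have "m \<le> h' i" if "i \<in> I" for i
      unfolding m_def using I that by (intro Min_le) auto
    then have h2_nonneg: "0 \<le> h2 i" for i
      unfolding h2_def by simp
    show ?thesis
    proof (cases "h2 \<in> S")
      case True
      then show ?thesis using h(2)[of h2] F2 by simp
    next
      case False
      then have "\<not> (\<forall>i. h2 i \<le> H)"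
        using h2_nonneg unfolding S_def by blast
      then obtain i where i: "h2 i > H"
        by (auto simp: not_le)
      then have iI: "i \<in> I" using H0 by (auto simp: h2_def split: if_splits)
      have "(LINT p:K|lborel. -R) \<le> (LINT p:K|lborel. u h2 p)"
      proof (intro set_integral_mono u_int cont_int continuous_intros)
        fix p assume "p \<in> K"
        then show "- R \<le> u h2 p"
          using R[of p k] u_ge[of k p h2] k by (auto simp: h2_def)
      qed
      then have 1: "- (R * measure lborel K) \<le> (LINT p:K|lborel. u h2 p)"
        by (simp add: const mult.commute)
      have "(\<bar>F (\<lambda>_. 0)\<bar> + R * measure lborel K) / g i \<le> H"
        unfolding H_def using I iI R0 g
        by (intro member_le_sum divide_nonneg_nonneg) (auto intro: less_imp_le)
      then have "\<bar>F (\<lambda>_. 0)\<bar> + R * measure lborel K \<le> g i * h2 i"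
        using i g[OF iI] pos_divide_le_eq[OF g[OF iI], of "\<bar>F (\<lambda>_. 0)\<bar> + R * measure lborel K" "h2 i"]
        by (simp add: mult.commute)
      also have "\<dots> \<le> (\<Sum>i\<in>I. g i * h2 i)"
      proof (rule member_le_sum[OF iI _ I(1)])
        fix j assume "j \<in> I - {i}"
        then show "0 \<le> g j * h2 j" using g[of j] h2_nonneg[of j] by simp
      qed
      finally have "F (\<lambda>_. 0) \<le> F h2"
        using 1 by (simp add: F_def)
      moreover have "F h \<le> F (\<lambda>_. 0)"
        using h(2) H0 by (auto simp: S_def)
      ultimately show ?thesis using F2 by simp
    qed
  qed
  \<comment> \<open>The cell of \<open>i\<close> with slack \<open>s\<close>. Lowering
    \<open>h i\<close> by \<open>s\<close> raises \<open>u\<close> by at most \<open>s\<close> there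
    and does not raise it elsewhere, while the linear term falls by \<open>s * g i\<close>;
    minimality then bounds the measure of the cell below by \<open>g i\<close>. The slack goes to 0
    by continuity of the measure along decreasing sets.\<close>
  define W where "W s i = {p\<in>K. \<forall>j\<in>I. p \<bullet> x j - h j \<le> p \<bullet> x i - h i + s}" for s i
  have W_compact: "compact (W s i)" for s i
  proof -
    have "W s i = K \<inter> (\<Inter>j\<in>I. {p. p \<bullet> x j - h j \<le> p \<bullet> x i - h i + s})"
      by (auto simp: W_def)
    moreover have "closed (\<Inter>j\<in>I. {p. p \<bullet> x j - h j \<le> p \<bullet> x i - h i + s})"
      by (intro closed_INT ballI closed_Collect_le continuous_intros)
    ultimately show ?thesis using K by (simp add: compact_Int_closed)
  qed
  have W_sets: "W s i \<in> sets lborel" "emeasure lborel (W s i) \<noteq> \<infinity>" for s i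
    using W_compact[of s i] emeasure_compact_finite[of "W s i"] by (auto simp: compact_imp_closed borel_closed)
  have W_ge: "g i \<le> measure lborel (W s i)" if i: "i \<in> I" and s: "0 < s" for i s
  proof -
    let ?h = "h(i := h i - s)"
    have int_ind: "set_integrable lborel K (\<lambda>p. s * indicator (W s i) p)"
      unfolding set_integrable_def using Ks W_sets
      by (intro integrable_scaleR_right integrable_mult_right integrable_mult_indicator)
         (auto simp: integrable_indicator_iff less_top)
    have "u ?h p \<le> u h p + s * indicator (W s i) p" if p: "p \<in> K" for p
    proof (rule u_le)
      fix j assume j: "j \<in> I"
      show "p \<bullet> x j - ?h j \<le> u h p + s * indicator (W s i) p"
      proof (cases "j = i")
        case True
        show ?thesis
        proof (cases "p \<in> W s i")
          case False
          then obtain k where "k \<in> I" "p \<bullet> x k - h k > p \<bullet> x i - h i + s"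
            using p by (force simp: W_def)
          then show ?thesis using True False u_ge[of k p h] by simp
        qed (use True u_ge[OF i, of p h] in simp)
      next
        case False
        have "0 \<le> s * indicator (W s i) p" using s by simp
        then show ?thesis using u_ge[OF j, of p h] False unfolding fun_upd_apply by auto
      qed
    qed
    then have "(LINT p:K|lborel. u ?h p) \<le> (LINT p:K|lborel. u h p + s * indicator (W s i) p)"
      using u_int int_ind by (intro set_integral_mono set_integral_add) auto
    also have "\<dots> = (LINT p:K|lborel. u h p) + (LINT p:K|lborel. s * indicator (W s i) p)"
      using u_int int_ind by (rule set_integral_add)
    also have "(LINT p:K|lborel. s * indicator (W s i) p) = s * measure lborel (W s i)"
    proof -
      have "(\<lambda>p. indicat_real K p *\<^sub>R (s * indicator (W s i) p)) = (\<lambda>p. s * indicator (W s i) p)"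
        by (rule ext) (auto simp: W_def split: split_indicator)
      then show ?thesis unfolding set_lebesgue_integral_def by simp
    qed
    finally have 1: "(LINT p:K|lborel. u ?h p) \<le> (LINT p:K|lborel. u h p) + s * measure lborel (W s i)" .
    have "(\<Sum>j\<in>I. g j * ?h j) = (\<Sum>j\<in>I. g j * h j) - s * g i"
      using sum.remove[OF I(1) i, of "\<lambda>j. g j * ?h j"] sum.remove[OF I(1) i, of "\<lambda>j. g j * h j"]
      by (simp add: algebra_simps)
    with 1 min[of ?h] have "s * g i \<le> s * measure lborel (W s i)"
      unfolding F_def by linarith
    then show ?thesis using s by simp
  qed
  have "g i \<le> measure lborel (W 0 i)" if i: "i \<in> I" for i
  proof -
    have "(\<lambda>n. measure lborel (W (inverse (real (Suc n))) i)) \<longlonglongrightarrow> measure lborel (\<Inter>n. W (inverse (real (Suc n))) i)"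
    proof (rule Lim_measure_decseq)
      show "range (\<lambda>n. W (inverse (real (Suc n))) i) \<subseteq> sets lborel"
        using W_sets(1) by blast
      show "emeasure lborel (W (inverse (real (Suc n))) i) \<noteq> \<infinity>" for n
        by (rule W_sets(2))
      show "decseq (\<lambda>n. W (inverse (real (Suc n))) i)"
      proof (rule decseq_SucI, rule subsetI)
        fix n p assume p: "p \<in> W (inverse (real (Suc (Suc n)))) i"
        have le: "inverse (real (Suc (Suc n))) \<le> inverse (real (Suc n))"
          by (simp add: field_simps)
        have "p \<bullet> x j - h j \<le> p \<bullet> x i - h i + inverse (real (Suc n))" if "j \<in> I" for j
        proof -
          have "p \<bullet> x j - h j \<le> p \<bullet> x i - h i + inverse (real (Suc (Suc n)))"
            using p that unfolding W_def by blast
          with le show ?thesis by linarith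
        qed
        then show "p \<in> W (inverse (real (Suc n))) i"
          using p unfolding W_def by blast
      qed
    qed
    also have "(\<Inter>n. W (inverse (real (Suc n))) i) = W 0 i"
    proof (intro equalityI subsetI)
      fix p assume p: "p \<in> (\<Inter>n. W (inverse (real (Suc n))) i)"
      have "p \<bullet> x j - h j \<le> p \<bullet> x i - h i" if "j \<in> I" for j
      proof (rule field_le_epsilon)
        fix e :: real assume "0 < e"
        then obtain n where "inverse (real (Suc n)) < e" using reals_Archimedean by blast
        moreover have "p \<bullet> x j - h j \<le> p \<bullet> x i - h i + inverse (real (Suc n))"
          using p that unfolding W_def by blast
        ultimately show "p \<bullet> x j - h j \<le> p \<bullet> x i - h i + e" by linarith
      qed
      then show "p \<in> W 0 i" using p by (auto simp: W_def)
    next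
      fix p assume p: "p \<in> W 0 i"
      have "p \<bullet> x j - h j \<le> p \<bullet> x i - h i + inverse (real (Suc n))" if "j \<in> I" for j n
      proof -
        have "p \<bullet> x j - h j \<le> p \<bullet> x i - h i + 0"
          using p that unfolding W_def by blast
        moreover have "0 \<le> inverse (real (Suc n))" by simp
        ultimately show ?thesis by linarith
      qed
      moreover have "p \<in> K" using p unfolding W_def by blast
      ultimately show "p \<in> (\<Inter>n. W (inverse (real (Suc n))) i)"
        unfolding W_def by blast
    qed
    finally show ?thesis
      by (rule LIMSEQ_le_const) (rule exI[of _ 0], intro allI impI W_ge[OF i], simp)
  qed
  then have "\<And>i. i \<in> I \<Longrightarrow> g i \<le> measure lborel {p\<in>K. \<forall>j\<in>I. p \<bullet> x j - h j \<le> p \<bullet> x i - h i}"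
    unfolding W_def add_0_right .
  then show thesis
    by (rule that)
qed

section \<open>Smooth cutoff functions\<close>

text \<open>The derivatives of \<open>exp (- 1 / s)\<close> are combinations of the functions \<open>flat k\<close>, so the class
  \<open>smooth_funs\<close> generated by them is closed under directional derivatives.\<close>

definition flat :: "nat \<Rightarrow> real \<Rightarrow> real" where
  "flat k s = (if s \<le> 0 then 0 else exp (- inverse s) * inverse s ^ k)"

lemma flat_nonneg: "0 \<le> flat k s"
  by (simp add: flat_def)

text \<open>One term of the exponential series, taken at 1/s, dominates the power. A bound quadratic
  in \<open>s\<close> is what makes \<open>flat k\<close> differentiable at 0 with derivative
  0.\<close>

lemma flat_le_square: "flat k s \<le> fact (k + 2) * s\<^sup>2"
proof (cases "s \<le> 0")
  case False
  define y where "y = inverse s"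
  have y: "0 < y" using False by (simp add: y_def)
  have "y ^ (k + 2) / fact (k + 2) \<le> exp y"
  proof -
    have "(\<Sum>n\<in>{k+2}. y ^ n /\<^sub>R fact n) \<le> (\<Sum>n. y ^ n /\<^sub>R fact n)"
      using y summable_exp_generic[of y] by (intro sum_le_suminf) auto
    then show ?thesis by (simp add: exp_def divide_inverse mult.commute)
  qed
  then have "y ^ (k + 2) \<le> exp y * fact (k + 2)"
    by (simp only: pos_divide_le_eq fact_gt_zero)
  then have "exp (- y) * y ^ (k + 2) \<le> exp (- y) * (exp y * fact (k + 2))"
    by (intro mult_left_mono) auto
  also have "\<dots> = fact (k + 2)"
    by (simp only: mult.assoc[symmetric] exp_add[symmetric]) simp
  finally have "exp (- y) * y ^ k * y\<^sup>2 \<le> fact (k + 2)"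
    by (simp only: power_add mult.assoc)
  then have "exp (- y) * y ^ k \<le> fact (k + 2) / y\<^sup>2"
    using y by (simp add: pos_le_divide_eq)
  also have "\<dots> = fact (k + 2) * s\<^sup>2"
    by (simp add: y_def power_inverse divide_inverse)
  finally show ?thesis using False by (simp add: flat_def y_def)
qed (simp add: flat_def)

lemma DERIV_flat: "(flat k has_real_derivative (flat (k + 2) s - real k * flat (k + 1) s)) (at s)"
proof -
  consider "s < 0" | "s = 0" | "0 < s" by linarith
  then show ?thesis
  proof cases
    case 1
    have ev: "\<forall>\<^sub>F x in nhds s. flat k x = 0"
      using eventually_nhds_in_open[of "{..<0}" s] 1 by (auto elim!: eventually_mono simp: flat_def)
    have "(flat k has_real_derivative 0) (at s) = ((\<lambda>_. 0) has_real_derivative 0) (at s)"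
      by (rule DERIV_cong_ev[OF refl ev refl])
    then show ?thesis using 1 by (simp add: flat_def)
  next
    case 2
    have "((\<lambda>h. (flat k (0 + h) - flat k 0) / h) \<longlongrightarrow> 0) (at 0)"
    proof (rule Lim_null_comparison)
      show "\<forall>\<^sub>F h in at 0. norm ((flat k (0 + h) - flat k 0) / h) \<le> fact (k + 2) * \<bar>h\<bar>"
      proof (rule eventually_at_filter[THEN iffD2], rule always_eventually, intro allI impI)
        fix h :: real assume "h \<noteq> 0"
        have "norm ((flat k (0 + h) - flat k 0) / h) = flat k h / \<bar>h\<bar>"
          using flat_nonneg[of k h] by (simp add: flat_def[of k 0])
        also have "\<dots> \<le> fact (k + 2) * h\<^sup>2 / \<bar>h\<bar>"
          by (intro divide_right_mono flat_le_square) simp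
        also have "\<dots> = fact (k + 2) * \<bar>h\<bar>"
          using \<open>h \<noteq> 0\<close> by (simp add: power2_eq_square abs_if)
        finally show "norm ((flat k (0 + h) - flat k 0) / h) \<le> fact (k + 2) * \<bar>h\<bar>" .
      qed
      show "((\<lambda>h. fact (k + 2) * \<bar>h\<bar>) \<longlongrightarrow> 0) (at (0::real))"
        by (rule tendsto_eq_intros refl | simp)+
    qed
    then show ?thesis using 2 by (simp add: DERIV_def flat_def)
  next
    case 3
    have ev: "\<forall>\<^sub>F x in nhds s. flat k x = exp (- inverse x) * inverse x ^ k"
      using eventually_nhds_in_open[of "{0<..}" s] 3 by (auto elim!: eventually_mono simp: flat_def)
    have inv: "(inverse has_real_derivative - ((inverse s)\<^sup>2)) (at s)"
      using 3 by (auto intro!: derivative_eq_intros simp: power2_eq_square)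
    have "((\<lambda>x. exp (- inverse x) * inverse x ^ k) has_real_derivative
       exp (- inverse s) * (real k * (inverse s ^ (k - Suc 0) * - ((inverse s)\<^sup>2)))
         + (exp (- inverse s) * (inverse s)\<^sup>2) * inverse s ^ k) (at s)"
      by (rule DERIV_cong, rule DERIV_mult', rule DERIV_chain2[OF DERIV_exp DERIV_minus[OF inv]],
          rule DERIV_power[OF inv]) simp
    moreover have "exp (- inverse s) * (real k * (inverse s ^ (k - Suc 0) * - ((inverse s)\<^sup>2)))
         + (exp (- inverse s) * (inverse s)\<^sup>2) * inverse s ^ k = flat (k + 2) s - real k * flat (k + 1) s"
      using 3 by (cases k) (simp_all add: flat_def power2_eq_square algebra_simps)
    ultimately have "((\<lambda>x. exp (- inverse x) * inverse x ^ k) has_real_derivative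
       (flat (k + 2) s - real k * flat (k + 1) s)) (at s)"
      by (simp only:)
    then show ?thesis
      using DERIV_cong_ev[OF refl ev refl] by blast
  qed
qed

section \<open>Functions closed under directional derivatives\<close>

inductive_set smooth_funs :: "('a::real_normed_vector \<Rightarrow> real) set" where
  const: "(\<lambda>_. c) \<in> smooth_funs"
| linear: "bounded_linear l \<Longrightarrow> l \<in> smooth_funs"
| add: "f \<in> smooth_funs \<Longrightarrow> g \<in> smooth_funs \<Longrightarrow> (\<lambda>x. f x + g x) \<in> smooth_funs"
| mult: "f \<in> smooth_funs \<Longrightarrow> g \<in> smooth_funs \<Longrightarrow> (\<lambda>x. f x * g x) \<in> smooth_funs"
| exp: "f \<in> smooth_funs \<Longrightarrow> (\<lambda>x. exp (f x)) \<in> smooth_funs"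
| inverse: "f \<in> smooth_funs \<Longrightarrow> (\<forall>x. f x \<noteq> 0) \<Longrightarrow> (\<lambda>x. inverse (f x)) \<in> smooth_funs"
| flat: "f \<in> smooth_funs \<Longrightarrow> (\<lambda>x. flat k (f x)) \<in> smooth_funs"

lemma smooth_funs_diff: "f \<in> smooth_funs \<Longrightarrow> g \<in> smooth_funs \<Longrightarrow> (\<lambda>x. f x - g x) \<in> smooth_funs"
  using smooth_funs.add[OF _ smooth_funs.mult[OF smooth_funs.const[of "-1"]], of f g] by simp

lemma smooth_funs_divide:
  "f \<in> smooth_funs \<Longrightarrow> g \<in> smooth_funs \<Longrightarrow> (\<forall>x. g x \<noteq> 0) \<Longrightarrow> (\<lambda>x. f x / g x) \<in> smooth_funs"
  using smooth_funs.mult[OF _ smooth_funs.inverse, of f g] by (simp add: divide_inverse)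

lemma smooth_funs_sum: "(\<And>i. i \<in> I \<Longrightarrow> f i \<in> smooth_funs) \<Longrightarrow> (\<lambda>x. \<Sum>i\<in>I. f i x) \<in> smooth_funs"
  by (induction I rule: infinite_finite_induct) (auto intro: smooth_funs.intros)

lemma smooth_funs_has_derivative:
  assumes "f \<in> smooth_funs"
  obtains D where "\<And>x. (f has_derivative D x) (at x)" "\<And>u. (\<lambda>x. D x u) \<in> smooth_funs"
proof -
  have "\<exists>D. (\<forall>x. (f has_derivative D x) (at x)) \<and> (\<forall>u. (\<lambda>x. D x u) \<in> smooth_funs)"
    using assms
  proof induction
    case (const c)
    show ?case by (intro exI[of _ "\<lambda>_ _. 0"]) (auto intro: smooth_funs.const)
  next
    case (linear l)
    then show ?case
      by (intro exI[of _ "\<lambda>_. l"]) (auto intro: smooth_funs.const bounded_linear_imp_has_derivative)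
  next
    case (add f g)
    then obtain Df Dg where D: "\<And>x. (f has_derivative Df x) (at x)" "\<And>u. (\<lambda>x. Df x u) \<in> smooth_funs"
      "\<And>x. (g has_derivative Dg x) (at x)" "\<And>u. (\<lambda>x. Dg x u) \<in> smooth_funs" by blast
    show ?case
      by (intro exI[of _ "\<lambda>x u. Df x u + Dg x u"] conjI allI has_derivative_add D smooth_funs.add)
  next
    case (mult f g)
    then obtain Df Dg where D: "\<And>x. (f has_derivative Df x) (at x)" "\<And>u. (\<lambda>x. Df x u) \<in> smooth_funs"
      "\<And>x. (g has_derivative Dg x) (at x)" "\<And>u. (\<lambda>x. Dg x u) \<in> smooth_funs" by blast
    show ?case
      by (intro exI[of _ "\<lambda>x u. f x * Dg x u + Df x u * g x"] conjI allI has_derivative_mult D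
          smooth_funs.add smooth_funs.mult mult.hyps)
  next
    case (exp f)
    then obtain Df where D: "\<And>x. (f has_derivative Df x) (at x)" "\<And>u. (\<lambda>x. Df x u) \<in> smooth_funs" by blast
    have "((\<lambda>x. exp (f x)) has_derivative (\<lambda>u. exp (f x) * Df x u)) (at x)" for x
      using D(1) by (auto intro!: derivative_eq_intros)
    then show ?case
      by (intro exI[of _ "\<lambda>x u. exp (f x) * Df x u"] conjI allI smooth_funs.exp smooth_funs.mult exp.hyps D)
  next
    case (inverse f)
    then obtain Df where D: "\<And>x. (f has_derivative Df x) (at x)" "\<And>u. (\<lambda>x. Df x u) \<in> smooth_funs" by blast
    have "((\<lambda>x. inverse (f x)) has_derivative (\<lambda>u. - (inverse (f x) * Df x u * inverse (f x)))) (at x)" for x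
      using D(1) inverse.hyps by (intro Deriv.has_derivative_inverse) auto
    moreover have "(\<lambda>x. - (inverse (f x) * Df x u * inverse (f x))) \<in> smooth_funs" for u
    proof -
      have "(\<lambda>x. (-1) * ((inverse (f x) * Df x u) * inverse (f x))) \<in> smooth_funs"
        by (intro smooth_funs.const smooth_funs.mult smooth_funs.inverse inverse.hyps D)
      then show ?thesis by simp
    qed
    ultimately show ?case
      by (intro exI[of _ "\<lambda>x u. - (inverse (f x) * Df x u * inverse (f x))"]) auto
  next
    case (flat f k)
    then obtain Df where D: "\<And>x. (f has_derivative Df x) (at x)" "\<And>u. (\<lambda>x. Df x u) \<in> smooth_funs" by blast
    have "((\<lambda>x. flat k (f x)) has_derivative (\<lambda>u. Df x u * (flat (k + 2) (f x) - real k * flat (k + 1) (f x)))) (at x)" for x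
      by (rule has_derivative_compose[OF D(1) DERIV_flat[unfolded has_field_derivative_def], THEN has_derivative_eq_rhs])
         (simp add: mult.commute)
    moreover have "(\<lambda>x. Df x u * (flat (k + 2) (f x) - real k * flat (k + 1) (f x))) \<in> smooth_funs" for u
      by (intro smooth_funs.mult smooth_funs_diff smooth_funs.const smooth_funs.flat flat.hyps D)
    ultimately show ?case
      by (intro exI[of _ "\<lambda>x u. Df x u * (flat (k + 2) (f x) - real k * flat (k + 1) (f x))"]) auto
  qed
  then show ?thesis using that by blast
qed

lemma smooth_funs_frechet:
  assumes "f \<in> smooth_funs"
  shows "(f has_derivative frechet_derivative f (at x)) (at x)"
    and "(\<lambda>x. frechet_derivative f (at x) u) \<in> smooth_funs"
proof -
  obtain D where D: "\<And>x. (f has_derivative D x) (at x)" "\<And>u. (\<lambda>x. D x u) \<in> smooth_funs"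
    using smooth_funs_has_derivative[OF assms] by blast
  then have "frechet_derivative f (at x) = D x" for x
    using frechet_derivative_at[OF D(1)] by simp
  with D show "(f has_derivative frechet_derivative f (at x)) (at x)"
    "(\<lambda>x. frechet_derivative f (at x) u) \<in> smooth_funs" by simp_all
qed

lemma smooth_funs_continuous_on: "f \<in> smooth_funs \<Longrightarrow> continuous_on S f"
  by (meson continuous_at_imp_continuous_on has_derivative_continuous smooth_funs_frechet(1))

lemma smooth_funs_C_infinity:
  assumes "f \<in> smooth_funs"
  shows "C_infinity f"
proof -
  have "iter_dderiv f us \<in> smooth_funs" for us
    by (induction us) (use assms smooth_funs_frechet(2) in auto)
  then show ?thesis
    unfolding C_infinity_def by (meson differentiableI smooth_funs_frechet(1))
qed

section \<open>The smooth step and its derivative as an approximate identity\<close>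

definition smooth_step :: "real \<Rightarrow> real" where
  "smooth_step s = flat 0 s / (flat 0 s + flat 0 (1 - s))"

lemma flat_0_pos: "0 < s \<Longrightarrow> 0 < flat 0 s"
  by (simp add: flat_def)

lemma flat_0_mono: "s \<le> s' \<Longrightarrow> flat 0 s \<le> flat 0 s'"
  by (auto simp: flat_def)

lemma smooth_step_denom: "0 < flat 0 s + flat 0 (1 - s)"
proof (cases "0 < s")
  case True
  then show ?thesis using flat_0_pos[of s] flat_nonneg[of 0 "1 - s"] by linarith
next
  case False
  then show ?thesis using flat_0_pos[of "1 - s"] flat_nonneg[of 0 s] by linarith
qed

lemma smooth_step_smooth:
  assumes "f \<in> smooth_funs"
  shows "(\<lambda>x. smooth_step (f x)) \<in> smooth_funs"
  unfolding smooth_step_def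
  by (intro smooth_funs_divide smooth_funs.add smooth_funs.flat smooth_funs_diff smooth_funs.const assms)
     (use smooth_step_denom in \<open>auto simp: less_imp_neq[symmetric]\<close>)

lemma smooth_step_id: "smooth_step \<in> smooth_funs"
  using smooth_step_smooth[OF smooth_funs.linear[OF bounded_linear_ident]] by simp

lemma smooth_step_eq_0: "s \<le> 0 \<Longrightarrow> smooth_step s = 0"
  by (simp add: smooth_step_def flat_def)

lemma smooth_step_eq_1: "1 \<le> s \<Longrightarrow> smooth_step s = 1"
  using smooth_step_denom[of s] by (simp add: smooth_step_def flat_def[of _ "1 - s"])

lemma smooth_step_range: "0 \<le> smooth_step s" "smooth_step s \<le> 1"
  using smooth_step_denom[of s] flat_nonneg[of 0 s] flat_nonneg[of 0 "1 - s"]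
  by (simp_all add: smooth_step_def)

lemma smooth_step_mono: "s \<le> s' \<Longrightarrow> smooth_step s \<le> smooth_step s'"
proof -
  assume "s \<le> s'"
  then have *: "flat 0 s \<le> flat 0 s'" "flat 0 (1 - s') \<le> flat 0 (1 - s)"
    by (auto intro: flat_0_mono)
  have "flat 0 s * flat 0 (1 - s') \<le> flat 0 s' * flat 0 (1 - s)"
    using * by (intro mult_mono flat_nonneg)
  then show ?thesis
    using smooth_step_denom[of s] smooth_step_denom[of s']
    by (simp add: smooth_step_def field_simps)
qed

definition smooth_step' :: "real \<Rightarrow> real" where
  "smooth_step' s = frechet_derivative smooth_step (at s) 1"

lemma DERIV_smooth_step: "(smooth_step has_real_derivative smooth_step' s) (at s)"
proof -
  have d: "(smooth_step has_derivative frechet_derivative smooth_step (at s)) (at s)"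
    by (rule smooth_funs_frechet(1)[OF smooth_step_id])
  then interpret bounded_linear "frechet_derivative smooth_step (at s)"
    by (rule has_derivative_bounded_linear)
  have "frechet_derivative smooth_step (at s) = (*) (smooth_step' s)"
  proof
    fix x :: real
    show "frechet_derivative smooth_step (at s) x = smooth_step' s * x"
      using scaleR[of x 1] by (simp add: smooth_step'_def)
  qed
  with d show ?thesis by (simp add: has_field_derivative_def)
qed

lemma smooth_step'_cont: "continuous_on S smooth_step'"
  unfolding smooth_step'_def
  by (rule smooth_funs_continuous_on[OF smooth_funs_frechet(2)[OF smooth_step_id]])

lemma smooth_step'_nonneg: "0 \<le> smooth_step' s"
proof -
  have "mono_on UNIV smooth_step" by (auto simp: mono_on_def smooth_step_mono)
  then show ?thesis
    using mono_on_imp_deriv_nonneg[OF _ DERIV_smooth_step, of UNIV] by simp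
qed

lemma smooth_step'_eq_0:
  assumes "s \<notin> {0..1}"
  shows "smooth_step' s = 0"
proof -
  have "\<exists>c. \<forall>\<^sub>F x in nhds s. smooth_step x = c"
  proof (cases "s < 0")
    case True
    then have "\<forall>\<^sub>F x in nhds s. smooth_step x = 0"
      using eventually_nhds_in_open[of "{..<0}" s] by (auto elim!: eventually_mono simp: smooth_step_eq_0)
    then show ?thesis by blast
  next
    case False
    then have "\<forall>\<^sub>F x in nhds s. smooth_step x = 1"
      using assms eventually_nhds_in_open[of "{1<..}" s] by (auto elim!: eventually_mono simp: smooth_step_eq_1)
    then show ?thesis by blast
  qed
  then obtain c where ev: "\<forall>\<^sub>F x in nhds s. smooth_step x = c" by blast
  have "(smooth_step has_real_derivative 0) (at s)"
    using DERIV_cong_ev[OF refl ev refl, of 0] by simp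
  then show ?thesis using DERIV_smooth_step DERIV_unique by blast
qed

lemma smooth_step'_bounded: obtains C where "0 < C" "\<And>s. smooth_step' s \<le> C"
proof -
  have "bounded (smooth_step' ` {0..1})"
    by (intro compact_imp_bounded compact_continuous_image smooth_step'_cont) auto
  then obtain B where "\<forall>z\<in>smooth_step' ` {0..1}. norm z \<le> B"
    unfolding bounded_iff by blast
  then have B: "\<And>s. s \<in> {0..1} \<Longrightarrow> norm (smooth_step' s) \<le> B"
    by blast
  have "smooth_step' s \<le> \<bar>B\<bar> + 1" for s
    using B[of s] smooth_step'_eq_0[of s] by (cases "s \<in> {0..1}") auto
  then show ?thesis by (intro that[of "\<bar>B\<bar> + 1"]) auto
qed

lemma smooth_step'_measurable [measurable]: "smooth_step' \<in> borel_measurable borel"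
  by (rule borel_measurable_continuous_onI[OF smooth_step'_cont])

lemma DERIV_smooth_step_affine:
  "((\<lambda>t. smooth_step ((t - s) / d)) has_real_derivative smooth_step' ((t - s) / d) / d) (at t)"
  "((\<lambda>t. smooth_step ((s - t) / d)) has_real_derivative - (smooth_step' ((s - t) / d) / d)) (at t)"
proof -
  have "((\<lambda>t. (t - s) / d) has_real_derivative 1 / d) (at t)"
    by (auto intro!: derivative_eq_intros simp: divide_inverse)
  from DERIV_chain2[OF DERIV_smooth_step this]
  show "((\<lambda>t. smooth_step ((t - s) / d)) has_real_derivative smooth_step' ((t - s) / d) / d) (at t)"
    by simp
  have "((\<lambda>t. (s - t) / d) has_real_derivative - (1 / d)) (at t)"
    by (auto intro!: derivative_eq_intros simp: divide_inverse)
  from DERIV_chain2[OF DERIV_smooth_step this]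
  show "((\<lambda>t. smooth_step ((s - t) / d)) has_real_derivative - (smooth_step' ((s - t) / d) / d)) (at t)"
    by simp
qed

text \<open>The rescaled derivatives are probability densities of width \<open>d\<close>, supported
  to the right of \<open>s\<close> in the first case and to the left in the second. The total mass
  does not depend on \<open>d\<close>, so time cutoffs of any steepness cost the same.\<close>

lemma nn_integral_smooth_step':
  assumes "0 < d"
  shows "(\<integral>\<^sup>+ t. ennreal (smooth_step' ((t - s) / d) / d) \<partial>lborel) = 1"
    and "(\<integral>\<^sup>+ t. ennreal (smooth_step' ((s - t) / d) / d) \<partial>lborel) = 1"
proof -
  have nonneg: "0 \<le> smooth_step' r / d" for r
    using assms smooth_step'_nonneg by simp
  have supp: "smooth_step' ((t - s) / d) = 0" if "t \<notin> {s..s+d}" for t s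
    using that assms by (intro smooth_step'_eq_0) (auto simp: pos_divide_le_eq zero_le_divide_iff)
  have "(\<integral>\<^sup>+ t. ennreal (smooth_step' ((t - s) / d) / d) \<partial>lborel)
    = (\<integral>\<^sup>+ t. ennreal (smooth_step' ((t - s) / d) / d) * indicator {s..s+d} t \<partial>lborel)"
    by (intro nn_integral_cong) (use supp[of _ s] in \<open>simp split: split_indicator\<close>)
  also have "\<dots> = ennreal (smooth_step ((s + d - s) / d) - smooth_step ((s - s) / d))"
    using assms by (intro nn_integral_FTC_Icc DERIV_smooth_step_affine nonneg) auto
  finally show "(\<integral>\<^sup>+ t. ennreal (smooth_step' ((t - s) / d) / d) \<partial>lborel) = 1"
    using assms by (simp add: smooth_step_eq_0 smooth_step_eq_1)
  have supp: "smooth_step' ((s - t) / d) = 0" if "t \<notin> {s-d..s}" for t s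
    using that assms by (intro smooth_step'_eq_0) (auto simp: pos_divide_le_eq zero_le_divide_iff)
  have "(\<integral>\<^sup>+ t. ennreal (smooth_step' ((s - t) / d) / d) \<partial>lborel)
    = (\<integral>\<^sup>+ t. ennreal (smooth_step' ((s - t) / d) / d) * indicator {s-d..s} t \<partial>lborel)"
    by (intro nn_integral_cong) (use supp[of _ s] in \<open>simp split: split_indicator\<close>)
  also have "\<dots> = ennreal ((- smooth_step ((s - s) / d)) - (- smooth_step ((s - (s - d)) / d)))"
    using assms DERIV_minus[OF DERIV_smooth_step_affine(2)[of s d]]
    by (intro nn_integral_FTC_Icc nonneg) auto
  finally show "(\<integral>\<^sup>+ t. ennreal (smooth_step' ((s - t) / d) / d) \<partial>lborel) = 1"
    using assms by (simp add: smooth_step_eq_0 smooth_step_eq_1)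
qed

section \<open>Smoothed maxima of affine functions\<close>

text \<open>Softmax weights at temperature \<open>e\<close> of the affine functions p . x -
  \<open>c p\<close>. Each affine function is named by its slope, so \<open>P\<close> is a set of
  slopes and \<open>c\<close> assigns the offsets.\<close>

definition lse_weight :: "'a::euclidean_space set \<Rightarrow> ('a \<Rightarrow> real) \<Rightarrow> real \<Rightarrow> 'a \<Rightarrow> 'a \<Rightarrow> real" where
  "lse_weight P c e x p = exp ((p \<bullet> x - c p) / e) / (\<Sum>q\<in>P. exp ((q \<bullet> x - c q) / e))"

definition lse_grad :: "'a::euclidean_space set \<Rightarrow> ('a \<Rightarrow> real) \<Rightarrow> real \<Rightarrow> 'a \<Rightarrow> 'a" where
  "lse_grad P c e x = (\<Sum>p\<in>P. lse_weight P c e x p *\<^sub>R p)"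

definition lse :: "'a::euclidean_space set \<Rightarrow> ('a \<Rightarrow> real) \<Rightarrow> real \<Rightarrow> 'a \<Rightarrow> real" where
  "lse P c e x = e * ln (\<Sum>p\<in>P. exp ((p \<bullet> x - c p) / e))"

text \<open>When \<open>Q\<close> is the quadratic form of a matrix A, this is tr (A D^2 lse): the
  variance of the slopes measured by A, divided by the temperature. Keeping \<open>Q\<close> as an
  argument serves squares along single frame vectors and full quadratic forms alike.\<close>

definition lse_hess :: "'a::euclidean_space set \<Rightarrow> ('a \<Rightarrow> real) \<Rightarrow> real \<Rightarrow> 'a \<Rightarrow> ('a \<Rightarrow> real) \<Rightarrow> real" where
  "lse_hess P c e x Q = (\<Sum>p\<in>P. lse_weight P c e x p * Q (p - lse_grad P c e x)) / e"

context
  fixes P :: "'a::euclidean_space set" and c :: "'a \<Rightarrow> real" and e :: real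
  assumes P: "finite P" "P \<noteq> {}" and e: "0 < e"
begin

lemma lse_sum_pos: "0 < (\<Sum>p\<in>P. exp ((p \<bullet> x - c p) / e))"
  using P by (intro sum_pos) auto

lemma lse_weight_pos: "0 < lse_weight P c e x p"
  unfolding lse_weight_def using lse_sum_pos by simp

lemma sum_lse_weight: "(\<Sum>p\<in>P. lse_weight P c e x p) = 1"
  unfolding lse_weight_def using lse_sum_pos[of x] by (simp add: sum_divide_distrib[symmetric])

lemma lse_grad_in_convex: "P \<subseteq> K \<Longrightarrow> convex K \<Longrightarrow> lse_grad P c e x \<in> K"
  unfolding lse_grad_def using P
  by (intro convex_sum) (auto simp: sum_lse_weight less_imp_le[OF lse_weight_pos])

lemma inner_lse_grad:
  "lse_grad P c e x \<bullet> u = (\<Sum>p\<in>P. exp ((p \<bullet> x - c p) / e) * (p \<bullet> u)) / (\<Sum>q\<in>P. exp ((q \<bullet> x - c q) / e))"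
  by (simp add: lse_grad_def lse_weight_def inner_sum_left sum_divide_distrib)

lemma has_derivative_exp_affine:
  "((\<lambda>x. exp ((p \<bullet> x - c p) / e)) has_derivative (\<lambda>u. exp ((p \<bullet> x - c p) / e) * (p \<bullet> u) / e)) (at x)"
  using e by (auto intro!: derivative_eq_intros)

lemma has_derivative_sum_exp:
  "((\<lambda>x. \<Sum>p\<in>P. exp ((p \<bullet> x - c p) / e)) has_derivative
     (\<lambda>u. (\<Sum>p\<in>P. exp ((p \<bullet> x - c p) / e)) * (lse_grad P c e x \<bullet> u) / e)) (at x)"
proof -
  have "((\<lambda>x. \<Sum>p\<in>P. exp ((p \<bullet> x - c p) / e)) has_derivative
     (\<lambda>u. \<Sum>p\<in>P. exp ((p \<bullet> x - c p) / e) * (p \<bullet> u) / e)) (at x)"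
    by (intro has_derivative_sum has_derivative_exp_affine)
  moreover have "(\<Sum>p\<in>P. exp ((p \<bullet> x - c p) / e) * (p \<bullet> u) / e) =
      (\<Sum>p\<in>P. exp ((p \<bullet> x - c p) / e)) * (lse_grad P c e x \<bullet> u) / e" for u
    using lse_sum_pos[of x] by (simp add: inner_lse_grad sum_divide_distrib[symmetric])
  ultimately show ?thesis by simp
qed

lemma has_derivative_lse_weight:
  "((\<lambda>x. lse_weight P c e x p) has_derivative
     (\<lambda>u. lse_weight P c e x p * ((p - lse_grad P c e x) \<bullet> u) / e)) (at x)"
proof -
  let ?S = "\<Sum>q\<in>P. exp ((q \<bullet> x - c q) / e)"
  have S: "?S \<noteq> 0" using lse_sum_pos[of x] by simp
  have "((\<lambda>x. lse_weight P c e x p) has_derivative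
     (\<lambda>u. ((exp ((p \<bullet> x - c p) / e) * (p \<bullet> u) / e) * ?S -
          exp ((p \<bullet> x - c p) / e) * (?S * (lse_grad P c e x \<bullet> u) / e)) / (?S * ?S))) (at x)"
    unfolding lse_weight_def
    by (rule has_derivative_divide'[OF has_derivative_exp_affine has_derivative_sum_exp S])
  moreover have "((a * b / e) * S - a * (S * d / e)) / (S * S) = a / S * (b - d) / e" if "S \<noteq> 0" for a b d S
    using that e by (simp add: field_simps)
  ultimately show ?thesis
    using S by (simp add: lse_weight_def inner_diff_left)
qed

text \<open>The Hessian of log-sum-exp is the covariance of the slopes divided by \<open>e\<close>.
  Differentiating the weights leaves one factor p . l uncentred; it may be centred because the
  deviations from the weighted mean average to zero.\<close>

lemma has_derivative_lse_grad:
  "((\<lambda>x. lse_grad P c e x \<bullet> l) has_derivative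
     (\<lambda>u. (\<Sum>p\<in>P. lse_weight P c e x p * (((p - lse_grad P c e x) \<bullet> l) * ((p - lse_grad P c e x) \<bullet> u))) / e)) (at x)"
proof -
  let ?g = "lse_grad P c e x" and ?w = "lse_weight P c e x"
  have "((\<lambda>x. \<Sum>p\<in>P. lse_weight P c e x p * (p \<bullet> l)) has_derivative
     (\<lambda>u. \<Sum>p\<in>P. (?w p * ((p - ?g) \<bullet> u) / e) * (p \<bullet> l))) (at x)"
    by (intro has_derivative_sum has_derivative_mult_left has_derivative_lse_weight)
  moreover have "(\<Sum>p\<in>P. (?w p * ((p - ?g) \<bullet> u) / e) * (p \<bullet> l))
    = (\<Sum>p\<in>P. ?w p * (((p - ?g) \<bullet> l) * ((p - ?g) \<bullet> u))) / e" for u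
  proof -
    have "(\<Sum>p\<in>P. ?w p * ((p - ?g) \<bullet> u)) = (\<Sum>p\<in>P. ?w p * (p \<bullet> u)) - (\<Sum>p\<in>P. ?w p) * (?g \<bullet> u)"
      by (simp add: inner_diff_left right_diff_distrib sum_subtractf sum_distrib_right)
    also have "\<dots> = 0"
      by (simp add: sum_lse_weight) (simp add: lse_grad_def inner_sum_left)
    finally have z: "(\<Sum>p\<in>P. ?w p * ((p - ?g) \<bullet> u)) = 0" .
    have "(?w p * ((p - ?g) \<bullet> u) / e) * (p \<bullet> l) =
        ?w p * (((p - ?g) \<bullet> l) * ((p - ?g) \<bullet> u)) / e + (?w p * ((p - ?g) \<bullet> u)) * ((?g \<bullet> l) / e)" for p
      by (simp add: inner_diff_left[of p ?g l] algebra_simps diff_divide_distrib add_divide_distrib)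
    then have "(\<Sum>p\<in>P. (?w p * ((p - ?g) \<bullet> u) / e) * (p \<bullet> l))
      = (\<Sum>p\<in>P. ?w p * (((p - ?g) \<bullet> l) * ((p - ?g) \<bullet> u)) / e) + (\<Sum>p\<in>P. (?w p * ((p - ?g) \<bullet> u))) * ((?g \<bullet> l) / e)"
      by (simp add: sum.distrib sum_distrib_right sum_divide_distrib)
    then show ?thesis using z by (simp add: sum_divide_distrib)
  qed
  ultimately show ?thesis
    by (simp add: lse_grad_def inner_sum_left)
qed

text \<open>Convexity through Jensen's inequality for exp: the tangent of exp at the weighted mean
  \<open>m\<close> lies below exp, and averaging the tangent over the weights returns exp m.\<close>

lemma lse_tangent: "lse P c e x + lse_grad P c e x \<bullet> (y - x) \<le> lse P c e y"
proof -
  let ?S = "\<lambda>x. \<Sum>q\<in>P. exp ((q \<bullet> x - c q) / e)"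
  define m where "m = lse_grad P c e x \<bullet> (y - x) / e"
  have "exp m = (\<Sum>p\<in>P. lse_weight P c e x p * (exp m * (1 + (p \<bullet> (y - x) / e - m))))"
  proof -
    have "(\<Sum>p\<in>P. lse_weight P c e x p * (1 + (p \<bullet> (y - x) / e - m)))
      = (\<Sum>p\<in>P. lse_weight P c e x p) * (1 - m) + (\<Sum>p\<in>P. lse_weight P c e x p * (p \<bullet> (y - x)) / e)"
      by (simp add: algebra_simps sum.distrib sum_subtractf sum_distrib_left sum_distrib_right)
    also have "(\<Sum>p\<in>P. lse_weight P c e x p * (p \<bullet> (y - x)) / e) = m"
      by (simp add: m_def lse_grad_def inner_sum_left sum_divide_distrib)
    finally have "(\<Sum>p\<in>P. lse_weight P c e x p * (1 + (p \<bullet> (y - x) / e - m))) = 1"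
      by (simp add: sum_lse_weight)
    then show ?thesis
      by (simp add: mult.left_commute[of _ "exp m"] sum_distrib_left[symmetric])
  qed
  also have "\<dots> \<le> (\<Sum>p\<in>P. lse_weight P c e x p * exp (p \<bullet> (y - x) / e))"
  proof (intro sum_mono mult_left_mono)
    fix p
    have "exp m * (1 + (p \<bullet> (y - x) / e - m)) \<le> exp m * exp (p \<bullet> (y - x) / e - m)"
      by (intro mult_left_mono exp_ge_add_one_self) simp
    then show "exp m * (1 + (p \<bullet> (y - x) / e - m)) \<le> exp (p \<bullet> (y - x) / e)"
      by (simp add: exp_add[symmetric])
  qed (simp add: less_imp_le[OF lse_weight_pos])
  also have "\<dots> = ?S y / ?S x"
  proof -
    have "exp ((p \<bullet> x - c p) / e) * exp (p \<bullet> (y - x) / e) = exp ((p \<bullet> y - c p) / e)" for p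
      by (simp add: exp_add[symmetric] inner_diff_right diff_divide_distrib)
    then show ?thesis
      by (simp add: lse_weight_def sum_divide_distrib)
  qed
  finally have "exp m * ?S x \<le> ?S y"
    using lse_sum_pos[of x] by (simp add: pos_le_divide_eq)
  then have "ln (exp m * ?S x) \<le> ln (?S y)"
    using lse_sum_pos[of x] lse_sum_pos[of y] by (subst ln_le_cancel_iff) auto
  then have "m + ln (?S x) \<le> ln (?S y)"
    using lse_sum_pos[of x] by (simp add: ln_mult)
  then have "e * (m + ln (?S x)) \<le> e * ln (?S y)"
    using e by (intro mult_left_mono) auto
  moreover have "e * m = lse_grad P c e x \<bullet> (y - x)"
    using e by (simp add: m_def)
  ultimately show ?thesis by (simp add: lse_def distrib_left add.commute)
qed

lemma lse_ge: "p \<in> P \<Longrightarrow> p \<bullet> x - c p \<le> lse P c e x"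
proof -
  assume p: "p \<in> P"
  have "exp ((p \<bullet> x - c p) / e) \<le> (\<Sum>q\<in>P. exp ((q \<bullet> x - c q) / e))"
    using P p by (intro member_le_sum) auto
  then have "(p \<bullet> x - c p) / e \<le> ln (\<Sum>q\<in>P. exp ((q \<bullet> x - c q) / e))"
    using lse_sum_pos by (simp add: ln_ge_iff)
  then show ?thesis using e by (simp add: lse_def pos_divide_le_eq mult.commute)
qed

text \<open>With \<open>lse_ge\<close>, log-sum-exp lies above the maximum of the affine functions
  by at most \<open>e\<close> times ln of their number, an error that goes to 0 with
  \<open>e\<close> for a fixed set of slopes.\<close>

lemma lse_le:
  assumes "\<And>p. p \<in> P \<Longrightarrow> p \<bullet> x - c p \<le> h"
  shows "lse P c e x \<le> h + e * ln (card P)"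
proof -
  have "(\<Sum>q\<in>P. exp ((q \<bullet> x - c q) / e)) \<le> (\<Sum>q\<in>P. exp (h / e))"
    using assms e by (intro sum_mono) (simp add: divide_right_mono)
  also have "\<dots> = card P * exp (h / e)" by simp
  finally have "ln (\<Sum>q\<in>P. exp ((q \<bullet> x - c q) / e)) \<le> ln (card P * exp (h / e))"
    using lse_sum_pos[of x] by (intro ln_mono) auto
  also have "\<dots> = ln (card P) + h / e"
    using P by (subst ln_mult) (auto simp: card_gt_0_iff)
  finally have "e * ln (\<Sum>q\<in>P. exp ((q \<bullet> x - c q) / e)) \<le> e * (ln (card P) + h / e)"
    using e by (intro mult_left_mono) auto
  then show ?thesis using e by (simp add: lse_def algebra_simps)
qed

lemma continuous_on_lse_weight: "continuous_on S (\<lambda>x. lse_weight P c e x p)"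
  by (intro continuous_at_imp_continuous_on ballI has_derivative_continuous[OF has_derivative_lse_weight])

lemma continuous_on_lse_grad: "continuous_on S (\<lambda>x. lse_grad P c e x)"
  unfolding lse_grad_def by (intro continuous_intros continuous_on_lse_weight)

lemma lse_hess_mono:
  assumes "\<And>x. Q x \<le> Q' x"
  shows "lse_hess P c e x Q \<le> lse_hess P c e x Q'"
  unfolding lse_hess_def using e
  by (intro divide_right_mono sum_mono mult_left_mono assms less_imp_le[OF lse_weight_pos]) auto

lemma lse_hess_nonneg: "(\<And>x. 0 \<le> Q x) \<Longrightarrow> 0 \<le> lse_hess P c e x Q"
  unfolding lse_hess_def using e
  by (intro divide_nonneg_pos sum_nonneg mult_nonneg_nonneg less_imp_le[OF lse_weight_pos]) auto

end

section \<open>The Hessian of a smoothed maximum on an ellipsoid\<close>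

text \<open>By translation invariance each difference quotient along \<open>l\<close> has integral
  zero; the mean value theorem bounds the quotients uniformly and dominated convergence passes to
  the limit. A derivative in a single direction is assumed, which suits the product of a C^1 bump
  and a smooth gradient.\<close>

lemma integral_directional_derivative_eq_0:
  fixes F F' :: "'a::euclidean_space \<Rightarrow> real"
  assumes deriv: "\<And>x. ((\<lambda>s. F (x + s *\<^sub>R l)) has_real_derivative F' x) (at 0)"
    and cont: "continuous_on UNIV F'" "continuous_on UNIV F"
    and supp: "\<And>x. R < norm x \<Longrightarrow> F x = 0" "\<And>x. R < norm x \<Longrightarrow> F' x = 0"
  shows "(\<integral>x. F' x \<partial>lborel) = 0"
proof -
  \<comment> \<open>The steps 1/(n+1) are at most 1, so shifting the support by them stays within
    this radius.\<close>
  define R' where "R' = \<bar>R\<bar> + norm l"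
  define q where "q n x = real (Suc n) * (F (x + inverse (real (Suc n)) *\<^sub>R l) - F x)" for n x
  obtain B where B: "0 \<le> B" "\<And>x. \<bar>F' x\<bar> \<le> B"
  proof -
    have "bounded (F' ` cball 0 R)"
      by (intro compact_imp_bounded compact_continuous_image continuous_on_subset[OF cont(1)]) auto
    then obtain B where "\<forall>z\<in>F' ` cball 0 R. norm z \<le> B"
      unfolding bounded_iff by blast
    then have B: "\<bar>F' x\<bar> \<le> B" if "norm x \<le> R" for x
      using that by auto
    have "\<bar>F' x\<bar> \<le> \<bar>B\<bar>" for x
      using supp(2)[of x] B[of x] by (cases "norm x \<le> R") auto
    then show ?thesis using that[of "\<bar>B\<bar>"] by simp
  qed
  have line: "((\<lambda>s. F (x + s *\<^sub>R l)) has_real_derivative F' (x + s *\<^sub>R l)) (at s)" for x s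
  proof -
    have eq: "(x + s *\<^sub>R l) + r *\<^sub>R l = x + (r + s) *\<^sub>R l" for r
      by (simp add: scaleR_add_left)
    have "((\<lambda>r. F (x + (r + s) *\<^sub>R l)) has_real_derivative F' (x + s *\<^sub>R l)) (at 0)"
      using deriv[of "x + s *\<^sub>R l"] by (simp only: eq)
    then show ?thesis
      using DERIV_shift[of "\<lambda>r. F (x + r *\<^sub>R l)" "F' (x + s *\<^sub>R l)" 0 s] by simp
  qed
  have q_bound: "\<bar>q n x\<bar> \<le> B * indicator (cball 0 R') x" for n x
  proof (cases "norm x \<le> R'")
    case True
    let ?h = "inverse (real (Suc n))"
    have "\<exists>z. 0 < z \<and> z < ?h \<and> F (x + ?h *\<^sub>R l) - F (x + 0 *\<^sub>R l) = (?h - 0) * F' (x + z *\<^sub>R l)"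
      by (intro MVT2 line) auto
    then obtain z where "F (x + ?h *\<^sub>R l) - F x = ?h * F' (x + z *\<^sub>R l)" by auto
    then have "q n x = F' (x + z *\<^sub>R l)" by (simp add: q_def del: of_nat_Suc)
    then show ?thesis using B(2) True by simp
  next
    case False
    have "norm x \<le> norm (x + inverse (real (Suc n)) *\<^sub>R l) + norm (inverse (real (Suc n)) *\<^sub>R l)"
      using norm_triangle_ineq4[of "x + inverse (real (Suc n)) *\<^sub>R l" "inverse (real (Suc n)) *\<^sub>R l"] by simp
    moreover have "norm (inverse (real (Suc n)) *\<^sub>R l) \<le> norm l"
      by (simp add: field_simps)
    ultimately have "R < norm (x + inverse (real (Suc n)) *\<^sub>R l)"
      using False by (simp add: R'_def del: of_nat_Suc norm_scaleR)
    moreover have "R < norm x" using False norm_ge_zero[of l] unfolding R'_def by linarith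
    ultimately show ?thesis using supp(1) False by (simp add: q_def del: of_nat_Suc)
  qed
  have F_int: "integrable lborel F"
  proof -
    have "integrable lborel (\<lambda>x. indicator (cball 0 \<bar>R\<bar>) x *\<^sub>R F x)"
      by (intro borel_integrable_compact continuous_on_subset[OF cont(2)]) auto
    moreover have "(\<lambda>x. indicator (cball 0 \<bar>R\<bar>) x *\<^sub>R F x) = F"
      using supp(1) by (auto simp: fun_eq_iff split: split_indicator)
    ultimately show ?thesis by simp
  qed
  have shift: "integrable lborel (\<lambda>x. F (x + a))" "(\<integral>x. F (x + a) \<partial>lborel) = (\<integral>x. F x \<partial>lborel)" for a
  proof -
    have *: "lborel = distr lborel borel (\<lambda>x::'a. a + x)"
      using lborel_distr_plus[of a] by simp
    have [measurable]: "F \<in> borel_measurable borel"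
      by (rule borel_measurable_continuous_onI[OF cont(2)])
    have "integrable (distr lborel borel (\<lambda>x. a + x)) F"
      using F_int * by simp
    then show "integrable lborel (\<lambda>x. F (x + a))"
      by (subst (asm) integrable_distr_eq) (auto simp: add.commute)
    have "(\<integral>x. F x \<partial>distr lborel borel (\<lambda>x. a + x)) = (\<integral>x. F (a + x) \<partial>lborel)"
      by (intro integral_distr) auto
    then show "(\<integral>x. F (x + a) \<partial>lborel) = (\<integral>x. F x \<partial>lborel)"
      using * by (simp add: add.commute)
  qed
  have "(\<lambda>n. \<integral>x. q n x \<partial>lborel) \<longlonglongrightarrow> (\<integral>x. F' x \<partial>lborel)"
  proof (rule integral_dominated_convergence)
    show "F' \<in> borel_measurable lborel"
      using borel_measurable_continuous_onI[OF cont(1)] by simp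
    show "q n \<in> borel_measurable lborel" for n
      unfolding q_def using F_int shift(1) by (auto intro!: borel_measurable_times borel_measurable_diff)
    show "integrable lborel (\<lambda>x. B * indicator (cball 0 R' :: 'a set) x)"
      using emeasure_bounded_finite[of "cball 0 R' :: 'a set"]
      by (intro integrable_mult_right integrable_real_indicator) auto
    show "AE x in lborel. norm (q n x) \<le> B * indicator (cball 0 R') x" for n
      using q_bound by simp
    show "AE x in lborel. (\<lambda>n. q n x) \<longlonglongrightarrow> F' x"
    proof (rule AE_I2)
      fix x
      have "((\<lambda>s. (F (x + s *\<^sub>R l) - F x) / s) \<longlongrightarrow> F' x) (at 0)"
        using deriv[of x] by (simp add: has_field_derivative_iff)
      moreover have "filterlim (\<lambda>n. inverse (real (Suc n))) (at 0) sequentially"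
        unfolding filterlim_at using LIMSEQ_inverse_real_of_nat by auto
      ultimately have "(\<lambda>n. (F (x + inverse (real (Suc n)) *\<^sub>R l) - F x) / inverse (real (Suc n))) \<longlonglongrightarrow> F' x"
        by (rule filterlim_compose)
      then show "(\<lambda>n. q n x) \<longlonglongrightarrow> F' x"
        by (simp add: q_def divide_inverse mult.commute del: of_nat_Suc)
    qed
  qed
  moreover have "(\<integral>x. q n x \<partial>lborel) = 0" for n
    unfolding q_def using F_int shift by simp
  ultimately show ?thesis
    by (simp add: LIMSEQ_const_iff)
qed

lemma has_derivative_imp_directional:
  assumes "(f has_derivative D) (at x)"
  shows "((\<lambda>s. f (x + s *\<^sub>R l)) has_real_derivative D l) (at 0)"
proof -
  have "((\<lambda>s. x + s *\<^sub>R l) has_derivative (\<lambda>s. s *\<^sub>R l)) (at 0)"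
    by (auto intro!: derivative_eq_intros)
  then have "((\<lambda>s. f (x + s *\<^sub>R l)) has_derivative (\<lambda>s. D (s *\<^sub>R l))) (at 0)"
    by (rule has_derivative_compose) (use assms in simp)
  moreover have "D (s *\<^sub>R l) = D l * s" for s
    using linear_scale[OF has_derivative_linear[OF assms]] by simp
  ultimately show ?thesis by (simp add: has_field_derivative_def)
qed

text \<open>Truncation at 0 is not differentiable but its square is C^1, so the squared bump is an
  admissible weight for integration by parts.\<close>

lemma DERIV_max_0_square: "((\<lambda>u. (max 0 u)\<^sup>2) has_real_derivative 2 * max 0 u) (at (u::real))"
proof -
  consider "u < 0" | "u = 0" | "0 < u" by linarith
  then show ?thesis
  proof cases
    case 1
    have "\<forall>\<^sub>F x in nhds u. (max 0 x)\<^sup>2 = 0"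
      using eventually_nhds_in_open[of "{..<0}" u] 1 by (auto elim!: eventually_mono)
    from DERIV_cong_ev[OF refl this refl, of 0] show ?thesis using 1 by simp
  next
    case 2
    have "((\<lambda>h. ((max 0 (0 + h))\<^sup>2 - (max 0 0)\<^sup>2) / h) \<longlongrightarrow> 0) (at (0::real))"
    proof (rule Lim_null_comparison)
      show "\<forall>\<^sub>F h in at 0. norm (((max 0 (0 + h))\<^sup>2 - (max 0 0)\<^sup>2) / h) \<le> \<bar>h::real\<bar>"
        by (rule always_eventually) (auto simp: max_def power2_eq_square)
      show "((\<lambda>h. \<bar>h\<bar>) \<longlongrightarrow> 0) (at (0::real))"
        by (rule tendsto_eq_intros refl | simp)+
    qed
    then show ?thesis using 2 by (simp add: DERIV_def)
  next
    case 3
    have ev: "\<forall>\<^sub>F x in nhds u. (max 0 x)\<^sup>2 = x\<^sup>2"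
      using eventually_nhds_in_open[of "{0<..}" u] 3 by (auto elim!: eventually_mono)
    have "((\<lambda>x. x\<^sup>2) has_real_derivative 2 * u) (at u)"
      by (auto intro!: derivative_eq_intros)
    with DERIV_cong_ev[OF refl ev refl, of "2 * u"] show ?thesis using 3 by simp
  qed
qed

lemma integrable_continuous_support:
  fixes f :: "'a::euclidean_space \<Rightarrow> real"
  assumes "continuous_on UNIV f" "\<And>x. R < norm x \<Longrightarrow> f x = 0"
  shows "integrable lborel f"
proof -
  have "integrable lborel (\<lambda>x. indicator (cball 0 R) x *\<^sub>R f x)"
    by (intro borel_integrable_compact continuous_on_subset[OF assms(1)]) auto
  moreover have "(\<lambda>x. indicator (cball 0 R) x *\<^sub>R f x) = f"
    using assms(2) by (auto simp: fun_eq_iff split: split_indicator)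
  ultimately show ?thesis by simp
qed

text \<open>Biorthogonal bases. They encode the positive definite matrix A = sum_j l_j l_j^T without
  a square root of A: sum_j (l_j . \<xi>)^2 is the form of A on slopes, sum_j (v_j . x)^2 is the
  form of its inverse on positions, and tr (A D^2 \<phi>) is the sum of the second derivatives of
  \<phi> along the l_j.\<close>

locale dual_frame =
  fixes J :: "'j set" and v l :: "'j \<Rightarrow> 'a::euclidean_space"
  assumes finite_J: "finite J"
    and expand: "\<And>x. x = (\<Sum>j\<in>J. (v j \<bullet> x) *\<^sub>R l j)"
    and dual: "\<And>i j. i \<in> J \<Longrightarrow> j \<in> J \<Longrightarrow> v i \<bullet> l j = (if i = j then 1 else 0)"
begin

definition gauge_norm :: "'a \<Rightarrow> real" where
  "gauge_norm x = L2_set (\<lambda>j. v j \<bullet> x) J"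

definition ellipsoid :: "'a \<Rightarrow> real \<Rightarrow> 'a set" where
  "ellipsoid x0 s = {x. gauge_norm (x - x0) < s}"

lemma gauge_norm_nonneg: "0 \<le> gauge_norm x"
  by (simp add: gauge_norm_def)

lemma gauge_norm_sq: "(gauge_norm x)\<^sup>2 = (\<Sum>j\<in>J. (v j \<bullet> x)\<^sup>2)"
  by (simp add: gauge_norm_def L2_set_def sum_nonneg)

lemma continuous_on_gauge_norm [continuous_intros]:
  "continuous_on S f \<Longrightarrow> continuous_on S (\<lambda>x. gauge_norm (f x))"
  unfolding gauge_norm_def L2_set_def by (intro continuous_intros)

lemma norm_le_gauge_norm: "norm x \<le> gauge_norm x * (\<Sum>j\<in>J. norm (l j))"
proof -
  have "norm x = norm (\<Sum>j\<in>J. (v j \<bullet> x) *\<^sub>R l j)"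
    using expand[of x] by simp
  also have "\<dots> \<le> (\<Sum>j\<in>J. \<bar>v j \<bullet> x\<bar> * norm (l j))"
    by (rule order_trans[OF norm_sum]) simp
  also have "\<dots> \<le> (\<Sum>j\<in>J. gauge_norm x * norm (l j))"
  proof (intro sum_mono mult_right_mono)
    fix j assume "j \<in> J"
    then have "\<bar>v j \<bullet> x\<bar> \<le> L2_set (\<lambda>j. \<bar>v j \<bullet> x\<bar>) J"
      using finite_J by (intro member_le_L2_set) auto
    then show "\<bar>v j \<bullet> x\<bar> \<le> gauge_norm x"
      by (simp add: gauge_norm_def L2_set_def)
  qed auto
  finally show ?thesis by (simp add: sum_distrib_left)
qed

lemma open_ellipsoid: "open (ellipsoid x0 s)"
  unfolding ellipsoid_def by (intro open_Collect_less continuous_intros)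

lemma bounded_ellipsoid: "bounded (ellipsoid x0 s)"
proof -
  have "ellipsoid x0 s \<subseteq> cball x0 (s * (\<Sum>j\<in>J. norm (l j)))"
  proof
    fix x assume "x \<in> ellipsoid x0 s"
    then have "gauge_norm (x - x0) * (\<Sum>j\<in>J. norm (l j)) \<le> s * (\<Sum>j\<in>J. norm (l j))"
      by (intro mult_right_mono sum_nonneg) (auto simp: ellipsoid_def)
    then show "x \<in> cball x0 (s * (\<Sum>j\<in>J. norm (l j)))"
      using norm_le_gauge_norm[of "x - x0"] by (simp add: dist_norm norm_minus_commute)
  qed
  then show ?thesis by (rule bounded_subset[OF bounded_cball])
qed

lemma ellipsoid_sets [measurable]: "ellipsoid x0 s \<in> sets borel"
  using open_ellipsoid by simp

lemma emeasure_ellipsoid: "emeasure lborel (ellipsoid x0 s) = ennreal (measure lborel (ellipsoid x0 s))"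
  using emeasure_bounded_finite[OF bounded_ellipsoid, of x0 s]
  by (intro emeasure_eq_ennreal_measure) auto

lemma ellipsoid_affine_image:
  assumes "0 < m"
  shows "(\<lambda>x. m *\<^sub>R x + d) ` ellipsoid x0 s = ellipsoid (m *\<^sub>R x0 + d) (m * s)"
proof -
  have g: "gauge_norm (m *\<^sub>R x) = m * gauge_norm x" for x
    unfolding gauge_norm_def using assms by (simp add: L2_set_left_distrib L2_set_right_distrib)
  show ?thesis
  proof (intro equalityI subsetI)
    fix y assume "y \<in> (\<lambda>x. m *\<^sub>R x + d) ` ellipsoid x0 s"
    then obtain x where x: "gauge_norm (x - x0) < s" "y = m *\<^sub>R x + d" by (auto simp: ellipsoid_def)
    have "y - (m *\<^sub>R x0 + d) = m *\<^sub>R (x - x0)" using x by (simp add: algebra_simps)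
    then show "y \<in> ellipsoid (m *\<^sub>R x0 + d) (m * s)"
      using x assms by (simp add: ellipsoid_def g)
  next
    fix y assume y: "y \<in> ellipsoid (m *\<^sub>R x0 + d) (m * s)"
    define x where "x = (1 / m) *\<^sub>R (y - d)"
    have yx: "y = m *\<^sub>R x + d" using assms by (simp add: x_def)
    then have "y - (m *\<^sub>R x0 + d) = m *\<^sub>R (x - x0)" by (simp add: algebra_simps)
    then have "m * gauge_norm (x - x0) < m * s" using y by (simp add: ellipsoid_def g)
    then have "x \<in> ellipsoid x0 s" using assms by (simp add: ellipsoid_def)
    then show "y \<in> (\<lambda>x. m *\<^sub>R x + d) ` ellipsoid x0 s" using yx by blast
  qed
qed

lemma measure_ellipsoid:
  assumes "0 < s"
  shows "measure lborel (ellipsoid x0 s) = s ^ DIM('a) * measure lborel (ellipsoid 0 1)"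
proof -
  have "ellipsoid x0 s = (\<lambda>x. s *\<^sub>R x + x0) ` ellipsoid 0 1"
    using ellipsoid_affine_image[of s x0 0 1] assms by simp
  then have "measure lebesgue (ellipsoid x0 s) = \<bar>s\<bar> ^ DIM('a) * measure lebesgue (ellipsoid 0 1)"
    by (simp add: measure_lebesgue_affine)
  then show ?thesis using assms by simp
qed

text \<open>Along each frame direction \<open>l j\<close> the derivative of b^2 (grad - q) . l_j
  integrates to zero. The factor 4 / s^2 is that of the derivative of b^2, and summing over the
  frame reassembles x - x0 from its coordinates. The constant \<open>q\<close> does not affect the
  Hessian; it makes the right side comparable with log-sum-exp minus an affine minorant of slope
  \<open>q\<close>.\<close>

lemma lse_integration_by_parts:
  fixes P :: "'a set" and q x0 :: 'a
  assumes P: "finite P" "P \<noteq> {}" and e: "0 < e" and s: "0 < s"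
  defines "b \<equiv> \<lambda>x. max 0 (1 - (gauge_norm (x - x0))\<^sup>2 / s\<^sup>2)"
  shows "integrable lborel (\<lambda>x. (b x)\<^sup>2 * (\<Sum>j\<in>J. lse_hess P c e x (\<lambda>\<xi>. (l j \<bullet> \<xi>)\<^sup>2)))"
    and "integrable lborel (\<lambda>x. 4 / s\<^sup>2 * b x * ((lse_grad P c e x - q) \<bullet> (x - x0)))"
    and "(\<integral>x. (b x)\<^sup>2 * (\<Sum>j\<in>J. lse_hess P c e x (\<lambda>\<xi>. (l j \<bullet> \<xi>)\<^sup>2)) \<partial>lborel)
      = (\<integral>x. 4 / s\<^sup>2 * b x * ((lse_grad P c e x - q) \<bullet> (x - x0)) \<partial>lborel)"
proof -
  let ?g = "lse_grad P c e"
  let ?h = "\<lambda>j x. lse_hess P c e x (\<lambda>\<xi>. (l j \<bullet> \<xi>)\<^sup>2)"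
  define R where "R = norm x0 + s * (\<Sum>j\<in>J. norm (l j))"
  have b_supp: "b x = 0" if "R < norm x" for x
  proof -
    have "s * (\<Sum>j\<in>J. norm (l j)) < norm (x - x0)"
      using that norm_triangle_ineq2[of x x0] unfolding R_def by linarith
    also have "\<dots> \<le> gauge_norm (x - x0) * (\<Sum>j\<in>J. norm (l j))" by (rule norm_le_gauge_norm)
    finally have lt: "s * (\<Sum>j\<in>J. norm (l j)) < gauge_norm (x - x0) * (\<Sum>j\<in>J. norm (l j))" .
    have "s < gauge_norm (x - x0)"
    proof (rule ccontr)
      assume "\<not> s < gauge_norm (x - x0)"
      then have "gauge_norm (x - x0) * (\<Sum>j\<in>J. norm (l j)) \<le> s * (\<Sum>j\<in>J. norm (l j))"
        by (intro mult_right_mono sum_nonneg) auto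
      with lt show False by linarith
    qed
    then have "s\<^sup>2 \<le> (gauge_norm (x - x0))\<^sup>2" using s by (intro power_mono) auto
    then show ?thesis using s by (simp add: b_def)
  qed
  have b_cont: "continuous_on UNIV b"
    unfolding b_def using s by (intro continuous_intros) auto
  have h_cont: "continuous_on UNIV (\<lambda>x. ?h j x)" for j
    unfolding lse_hess_def using e
    by (intro continuous_intros continuous_on_lse_weight continuous_on_lse_grad P e) auto
  have g_cont: "continuous_on UNIV ?g" by (rule continuous_on_lse_grad[OF P e])
  define F where "F j x = (b x)\<^sup>2 * ((?g x - q) \<bullet> l j)" for j x
  define F' where "F' j x = (b x)\<^sup>2 * ?h j x - 4 / s\<^sup>2 * b x * (v j \<bullet> (x - x0)) * ((?g x - q) \<bullet> l j)" for j x
  have F'_cont: "continuous_on UNIV (F' j)" for j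
    unfolding F'_def using s by (intro continuous_intros b_cont h_cont g_cont) auto
  have F'_int: "integrable lborel (F' j)" for j
    by (rule integrable_continuous_support[OF F'_cont, of R]) (simp add: F'_def b_supp)
  have F'_0: "(\<integral>x. F' j x \<partial>lborel) = 0" if j: "j \<in> J" for j
  proof (rule integral_directional_derivative_eq_0[where F = "F j" and l = "l j" and R = R])
    fix x
    have "((\<lambda>t. gauge_norm (x + t *\<^sub>R l j - x0) ^ 2) has_real_derivative 2 * (v j \<bullet> (x - x0))) (at 0)" (is "(?G has_real_derivative ?G') _")
    proof -
      have "((\<lambda>t. \<Sum>i\<in>J. (v i \<bullet> (x + t *\<^sub>R l j - x0))\<^sup>2) has_real_derivative
          (\<Sum>i\<in>J. 2 * (v i \<bullet> (x - x0)) * (v i \<bullet> l j))) (at 0)"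
        by (auto intro!: derivative_eq_intros sum.cong simp: inner_diff_right inner_add_right)
      moreover have "(\<Sum>i\<in>J. 2 * (v i \<bullet> (x - x0)) * (v i \<bullet> l j)) = (\<Sum>i\<in>J. if i = j then 2 * (v j \<bullet> (x - x0)) else 0)"
        using dual j by (intro sum.cong) auto
      ultimately show ?thesis
        using j finite_J by (simp add: gauge_norm_sq)
    qed
    then have "((\<lambda>t. 1 - gauge_norm (x + t *\<^sub>R l j - x0) ^ 2 / s\<^sup>2) has_real_derivative - (2 * (v j \<bullet> (x - x0)) / s\<^sup>2)) (at 0)"
      using DERIV_diff[OF DERIV_const[of 1] DERIV_cdivide[of ?G ?G' 0 UNIV "s\<^sup>2"]] by simp
    then have "((\<lambda>t. (b (x + t *\<^sub>R l j))\<^sup>2) has_real_derivative 2 * b x * - (2 * (v j \<bullet> (x - x0)) / s\<^sup>2)) (at 0)"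
      unfolding b_def using DERIV_chain2[OF DERIV_max_0_square] by fastforce
    moreover have "((\<lambda>t. (?g (x + t *\<^sub>R l j) - q) \<bullet> l j) has_real_derivative ?h j x) (at 0)"
    proof -
      have "((\<lambda>t. ?g (x + t *\<^sub>R l j) \<bullet> l j) has_real_derivative ?h j x) (at 0)"
        using has_derivative_imp_directional[OF has_derivative_lse_grad[OF P e, where l = "l j" and x = x and c = c], of "l j"]
        by (simp add: lse_hess_def power2_eq_square inner_commute)
      then show ?thesis
        by (auto intro!: derivative_eq_intros simp: inner_diff_left)
    qed
    ultimately show "((\<lambda>t. F j (x + t *\<^sub>R l j)) has_real_derivative F' j x) (at 0)"
      unfolding F_def by (rule DERIV_cong[OF DERIV_mult]) (simp add: F'_def algebra_simps)
  qed (use F'_cont in \<open>auto simp: F_def F'_def b_supp intro!: continuous_intros b_cont g_cont\<close>)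
  show int1: "integrable lborel (\<lambda>x. (b x)\<^sup>2 * (\<Sum>j\<in>J. ?h j x))"
    by (rule integrable_continuous_support[where R = R]) (auto intro!: continuous_intros b_cont h_cont simp: b_supp)
  show int2: "integrable lborel (\<lambda>x. 4 / s\<^sup>2 * b x * ((?g x - q) \<bullet> (x - x0)))"
    using s by (intro integrable_continuous_support[where R = R]) (auto intro!: continuous_intros b_cont g_cont simp: b_supp)
  have "(\<Sum>j\<in>J. F' j x) = (b x)\<^sup>2 * (\<Sum>j\<in>J. ?h j x) - 4 / s\<^sup>2 * b x * ((?g x - q) \<bullet> (x - x0))" for x
  proof -
    have "(?g x - q) \<bullet> (x - x0) = (?g x - q) \<bullet> (\<Sum>j\<in>J. (v j \<bullet> (x - x0)) *\<^sub>R l j)"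
      using expand[of "x - x0"] by simp
    also have "\<dots> = (\<Sum>j\<in>J. (v j \<bullet> (x - x0)) * ((?g x - q) \<bullet> l j))"
      by (simp add: inner_sum_right)
    finally show ?thesis
      by (simp add: F'_def sum_subtractf sum_distrib_left mult.assoc)
  qed
  then have "(\<integral>x. (b x)\<^sup>2 * (\<Sum>j\<in>J. ?h j x) - 4 / s\<^sup>2 * b x * ((?g x - q) \<bullet> (x - x0)) \<partial>lborel) = (\<integral>x. (\<Sum>j\<in>J. F' j x) \<partial>lborel)"
    by simp
  also have "\<dots> = 0"
    using F'_int F'_0 by simp
  finally show "(\<integral>x. (b x)\<^sup>2 * (\<Sum>j\<in>J. ?h j x) \<partial>lborel)
      = (\<integral>x. 4 / s\<^sup>2 * b x * ((?g x - q) \<bullet> (x - x0)) \<partial>lborel)"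
    using int1 int2 by simp
qed

text \<open>Integration by parts turns the Hessian integral into one of \<open>(lse_grad - q) \<bullet> (x - x0)\<close>, which
  by convexity dominates \<open>lse\<close> minus its affine minorant of slope \<open>q\<close>; the minorant of slope \<open>p\<close> makes
  this large on part of the ellipsoid, up to the smoothing error \<open>e * ln (card P)\<close>.\<close>

lemma lse_local_estimate:
  fixes P :: "'a set" and p q x0 :: 'a
  assumes P: "finite P" "P \<noteq> {}" and e: "0 < e" and s: "0 < s"
    and at_x0: "lse P c e x0 \<le> h + e * ln (card P)"
    and supp_p: "\<And>x. h + p \<bullet> (x - x0) \<le> lse P c e x"
    and supp_q: "\<And>x. h + q \<bullet> (x - x0) \<le> lse P c e x"
  defines "w \<equiv> L2_set (\<lambda>j. l j \<bullet> (p - q)) J"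
  shows "ennreal ((7 / 16 * (w / s) * (1 / 4) ^ DIM('a) - 4 / s\<^sup>2 * (e * ln (card P))) * measure lborel (ellipsoid x0 s))
    \<le> (\<integral>\<^sup>+x\<in>ellipsoid x0 s. ennreal (\<Sum>j\<in>J. lse_hess P c e x (\<lambda>\<xi>. (l j \<bullet> \<xi>)\<^sup>2)) \<partial>lborel)"
proof -
  let ?g = "lse_grad P c e"
  let ?h = "\<lambda>x. \<Sum>j\<in>J. lse_hess P c e x (\<lambda>\<xi>. (l j \<bullet> \<xi>)\<^sup>2)"
  let ?E = "ellipsoid x0 s"
  define b where "b x = max 0 (1 - (gauge_norm (x - x0))\<^sup>2 / s\<^sup>2)" for x
  have parts: "integrable lborel (\<lambda>x. (b x)\<^sup>2 * ?h x)"
    "integrable lborel (\<lambda>x. 4 / s\<^sup>2 * b x * ((?g x - q) \<bullet> (x - x0)))"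
    "(\<integral>x. (b x)\<^sup>2 * ?h x \<partial>lborel) = (\<integral>x. 4 / s\<^sup>2 * b x * ((?g x - q) \<bullet> (x - x0)) \<partial>lborel)"
    unfolding b_def by (rule lse_integration_by_parts[OF P e s])+
  define \<epsilon> where "\<epsilon> = e * ln (card P)"
  have \<epsilon>0: "0 \<le> \<epsilon>"
    using P e by (simp add: \<epsilon>_def card_gt_0_iff Suc_leI)
  \<comment> \<open>The unit vector, in frame coordinates, along which (p - q) . x grows fastest.
    The point \<open>x1\<close> lies at gauge distance s/2 from \<open>x0\<close> in that direction,
    so on the ellipsoid of radius s/4 about \<open>x1\<close> the gauge distance to
    \<open>x0\<close> is at most 3s/4, whence b >= 1 - 9/16, and (p - q) . (x - x0) >= w (s/2 -
    s/4). If \<open>w\<close> is 0, so is the gain claimed.\<close>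
  define wh where "wh j = (l j \<bullet> (p - q)) / w" for j
  define x1 where "x1 = x0 + (s / 2) *\<^sub>R (\<Sum>j\<in>J. wh j *\<^sub>R l j)"
  define E' where "E' = ellipsoid x1 (s / 4)"
  have E'_meas: "measure lborel E' = (1 / 4) ^ DIM('a) * measure lborel ?E"
    unfolding E'_def using s measure_ellipsoid[of "s / 4" x1] measure_ellipsoid[of s x0] by (simp add: power_divide)
  have w0: "0 \<le> w" by (simp add: w_def)
  have v_x1: "v j \<bullet> (x1 - x0) = s / 2 * wh j" if "j \<in> J" for j
  proof -
    have "v j \<bullet> (\<Sum>i\<in>J. wh i *\<^sub>R l i) = (\<Sum>i\<in>J. if i = j then wh j else 0)"
      unfolding inner_sum_right using dual that by (intro sum.cong) auto
    then show ?thesis using that finite_J by (simp add: x1_def)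
  qed
  have b01: "0 \<le> b x" "b x \<le> 1" for x
    by (simp_all add: b_def)
  have b_off: "b x = 0" if "x \<notin> ?E" for x
  proof -
    have "s\<^sup>2 \<le> (gauge_norm (x - x0))\<^sup>2" using that s by (intro power_mono) (auto simp: ellipsoid_def)
    then show ?thesis using s by (simp add: b_def)
  qed
  \<comment> \<open>The tangent at x, evaluated at \<open>x0\<close>, bounds grad . (x - x0) below
    by lse x - lse x0. The two minorants have the common height \<open>h\<close> at
    \<open>x0\<close>, and \<open>\<epsilon>\<close> is the amount by which lse x0 may exceed
    it.\<close>
  have conv: "max 0 ((p - q) \<bullet> (x - x0)) - \<epsilon> \<le> (?g x - q) \<bullet> (x - x0)" for x
  proof -
    have "lse P c e x - ?g x \<bullet> (x - x0) \<le> h + \<epsilon>"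
      using lse_tangent[OF P e, of c x x0] at_x0 by (simp add: \<epsilon>_def inner_diff_right)
    then show ?thesis
      using supp_p[of x] supp_q[of x] by (simp add: inner_diff_left)
  qed
  have on_E': "b x \<ge> 7 / 16" "w * s / 4 \<le> (p - q) \<bullet> (x - x0)" if x: "x \<in> E'" and w: "w \<noteq> 0" for x
  proof -
    let ?z = "\<lambda>j. v j \<bullet> (x - x0)"
    have L2_wh: "L2_set wh J = 1"
    proof -
      have "L2_set wh J = L2_set (\<lambda>j. l j \<bullet> (p - q)) J * (1 / w)"
        unfolding wh_def using w0 by (subst L2_set_left_distrib) (auto simp: divide_inverse)
      then show ?thesis using w by (simp add: w_def)
    qed
    have d: "L2_set (\<lambda>j. ?z j - s / 2 * wh j) J < s / 4"
    proof -
      have "v j \<bullet> (x - x1) = ?z j - s / 2 * wh j" if "j \<in> J" for j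
        using v_x1[OF that] by (simp add: inner_diff_right)
      then have "L2_set (\<lambda>j. ?z j - s / 2 * wh j) J = gauge_norm (x - x1)"
        unfolding gauge_norm_def by (intro L2_set_cong) auto
      then show ?thesis using x by (simp add: E'_def ellipsoid_def)
    qed
    have "gauge_norm (x - x0) = L2_set (\<lambda>j. (?z j - s / 2 * wh j) + s / 2 * wh j) J"
      by (simp add: gauge_norm_def)
    also have "\<dots> \<le> L2_set (\<lambda>j. ?z j - s / 2 * wh j) J + L2_set (\<lambda>j. s / 2 * wh j) J"
      by (rule L2_set_triangle_ineq)
    also have "L2_set (\<lambda>j. s / 2 * wh j) J = s / 2"
      using L2_set_right_distrib[of "s / 2" wh J] s L2_wh by simp
    finally have "gauge_norm (x - x0) \<le> 3 / 4 * s" using d by simp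
    then have "(gauge_norm (x - x0))\<^sup>2 \<le> (3 / 4 * s)\<^sup>2"
      using gauge_norm_nonneg by (intro power_mono) auto
    then have "(gauge_norm (x - x0))\<^sup>2 / s\<^sup>2 \<le> 9 / 16"
      using s by (simp add: pos_divide_le_eq power_mult_distrib power_divide)
    then have "7 / 16 \<le> 1 - (gauge_norm (x - x0))\<^sup>2 / s\<^sup>2" by linarith
    then show "b x \<ge> 7 / 16" unfolding b_def by (rule max.coboundedI2)
    have "(\<Sum>j\<in>J. (?z j - s / 2 * wh j) * wh j) \<ge> - (\<Sum>j\<in>J. \<bar>?z j - s / 2 * wh j\<bar> * \<bar>wh j\<bar>)"
      unfolding sum_negf[symmetric] abs_mult[symmetric] by (intro sum_mono) (metis abs_ge_minus_self minus_le_iff)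
    moreover have "(\<Sum>j\<in>J. \<bar>?z j - s / 2 * wh j\<bar> * \<bar>wh j\<bar>) \<le> L2_set (\<lambda>j. ?z j - s / 2 * wh j) J * L2_set wh J"
      by (rule L2_set_mult_ineq)
    ultimately have "- (s / 4) \<le> (\<Sum>j\<in>J. (?z j - s / 2 * wh j) * wh j)"
      using d L2_wh by simp
    also have "\<dots> = (\<Sum>j\<in>J. ?z j * wh j) - s / 2 * (\<Sum>j\<in>J. (wh j)\<^sup>2)"
      by (simp add: left_diff_distrib sum_subtractf sum_distrib_left power2_eq_square mult.assoc)
    also have "(\<Sum>j\<in>J. (wh j)\<^sup>2) = 1"
      using L2_wh by (simp add: L2_set_def)
    finally have z: "s / 4 \<le> (\<Sum>j\<in>J. ?z j * wh j)" by simp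
    have "(p - q) \<bullet> (x - x0) = (p - q) \<bullet> (\<Sum>j\<in>J. ?z j *\<^sub>R l j)"
      using expand[of "x - x0"] by simp
    also have "\<dots> = (\<Sum>j\<in>J. ?z j * (w * wh j))"
      using w by (simp add: inner_sum_right wh_def inner_commute)
    also have "\<dots> = w * (\<Sum>j\<in>J. ?z j * wh j)"
      by (simp add: sum_distrib_left mult.left_commute)
    finally show "w * s / 4 \<le> (p - q) \<bullet> (x - x0)"
      using z w0 mult_left_mono[of "s / 4" "\<Sum>j\<in>J. ?z j * wh j" w] by simp
  qed
  \<comment> \<open>On \<open>E'\<close> the factors 4/s^2, 7/16 and w s/4 multiply to 7/16 * (w /
    s); elsewhere the gain is only known to be nonnegative. The smoothing error is paid on the whole
    ellipsoid.\<close>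
  have pointwise: "7 / 16 * (w / s) * indicator E' x - 4 / s\<^sup>2 * \<epsilon> * indicator ?E x
      \<le> 4 / s\<^sup>2 * b x * ((?g x - q) \<bullet> (x - x0))" for x
  proof -
    let ?m = "max 0 ((p - q) \<bullet> (x - x0))"
    have "4 / s\<^sup>2 * b x * (?m - \<epsilon>) \<le> 4 / s\<^sup>2 * b x * ((?g x - q) \<bullet> (x - x0))"
      using b01 by (intro mult_left_mono conv) auto
    moreover have "4 / s\<^sup>2 * b x * \<epsilon> \<le> 4 / s\<^sup>2 * \<epsilon> * indicator ?E x"
    proof (cases "x \<in> ?E")
      case True
      have "4 / s\<^sup>2 * \<epsilon> * b x \<le> 4 / s\<^sup>2 * \<epsilon> * 1"
        using b01[of x] \<epsilon>0 by (intro mult_left_mono) auto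
      then show ?thesis using True by (simp add: ac_simps)
    qed (simp add: b_off)
    moreover have "7 / 16 * (w / s) * indicator E' x \<le> 4 / s\<^sup>2 * b x * ?m"
    proof (cases "x \<in> E' \<and> w \<noteq> 0")
      case True
      have "7 / 16 * (w / s) = 4 / s\<^sup>2 * (7 / 16) * (w * s / 4)"
        using s by (simp add: power2_eq_square)
      also have "\<dots> \<le> 4 / s\<^sup>2 * b x * ?m"
        using on_E'[of x] True w0 s b01 by (intro mult_mono) auto
      finally show ?thesis using True by simp
    next
      case False
      then show ?thesis using b01[of x] by auto
    qed
    ultimately show ?thesis by (simp add: right_diff_distrib)
  qed
  have ind: "integrable lborel (indicat_real (ellipsoid y r))" for y r
    using emeasure_ellipsoid[of y r] by (intro integrable_real_indicator) auto
  have "(7 / 16 * (w / s) * (1 / 4) ^ DIM('a) - 4 / s\<^sup>2 * \<epsilon>) * measure lborel ?E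
    = (\<integral>x. 7 / 16 * (w / s) * indicator E' x - 4 / s\<^sup>2 * \<epsilon> * indicator ?E x \<partial>lborel)"
    using ind[of x1 "s / 4"] ind[of x0 s] E'_meas unfolding E'_def
    by (simp add: left_diff_distrib)
  also have "\<dots> \<le> (\<integral>x. 4 / s\<^sup>2 * b x * ((?g x - q) \<bullet> (x - x0)) \<partial>lborel)"
    using ind[of x1 "s / 4"] ind[of x0 s] unfolding E'_def[symmetric]
    by (intro integral_mono parts(2) pointwise Bochner_Integration.integrable_diff integrable_mult_right)
  also have "\<dots> = (\<integral>x. (b x)\<^sup>2 * ?h x \<partial>lborel)"
    by (rule parts(3)[symmetric])
  finally have "ennreal ((7 / 16 * (w / s) * (1 / 4) ^ DIM('a) - 4 / s\<^sup>2 * \<epsilon>) * measure lborel ?E)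
    \<le> ennreal (\<integral>x. (b x)\<^sup>2 * ?h x \<partial>lborel)"
    by (rule ennreal_leI)
  also have "\<dots> = (\<integral>\<^sup>+x. ennreal ((b x)\<^sup>2 * ?h x) \<partial>lborel)"
    using parts(1) by (intro nn_integral_eq_integral[symmetric])
      (auto intro!: mult_nonneg_nonneg sum_nonneg lse_hess_nonneg[OF P e])
  also have "\<dots> \<le> (\<integral>\<^sup>+x\<in>?E. ennreal (?h x) \<partial>lborel)"
  proof (intro nn_integral_mono)
    fix x
    have h0: "0 \<le> ?h x" by (intro sum_nonneg lse_hess_nonneg[OF P e]) simp
    show "ennreal ((b x)\<^sup>2 * ?h x) \<le> ennreal (?h x) * indicator ?E x"
    proof (cases "x \<in> ?E")
      case True
      have "(b x)\<^sup>2 \<le> 1" using b01[of x] by (simp add: power_le_one)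
      then have "(b x)\<^sup>2 * ?h x \<le> 1 * ?h x" using h0 by (intro mult_right_mono)
      then show ?thesis using True by (simp add: ennreal_leI)
    qed (simp add: b_off)
  qed
  finally show ?thesis unfolding \<epsilon>_def .
qed

end

text \<open>Exchanging the two bases replaces the matrix by its inverse. The ellipsoids of the
  swapped frame measure slopes instead of positions.\<close>

lemma (in dual_frame) dual_frame_swap: "dual_frame J l v"
proof
  show "finite J" by (rule finite_J)
  show "x = (\<Sum>j\<in>J. (l j \<bullet> x) *\<^sub>R v j)" for x
  proof -
    have "(x - (\<Sum>j\<in>J. (l j \<bullet> x) *\<^sub>R v j)) \<bullet> y = 0" for y
    proof -
      have "x \<bullet> y = x \<bullet> (\<Sum>j\<in>J. (v j \<bullet> y) *\<^sub>R l j)"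
        using expand[of y] by simp
      also have "\<dots> = (\<Sum>j\<in>J. (l j \<bullet> x) *\<^sub>R v j) \<bullet> y"
        by (simp add: inner_sum_left inner_sum_right inner_commute mult.commute)
      finally show ?thesis by (simp add: inner_diff_left)
    qed
    then show ?thesis by (metis eq_iff_diff_eq_0 inner_eq_zero_iff)
  qed
  show "l i \<bullet> v j = (if i = j then 1 else 0)" if "i \<in> J" "j \<in> J" for i j
    using dual[OF that(2,1)] by (simp add: inner_commute)
qed

section \<open>Positive matrices and packings by ellipsoids\<close>

text \<open>If y . A x were nonzero, the form at y - t x would be affine in t and hence negative for
  some t; the chosen \<open>t\<close> makes it -1.\<close>

lemma psd_Cauchy_Schwarz:
  fixes A :: "real^'m^'m"
  assumes sym: "\<And>x y. x \<bullet> (A *v y) = y \<bullet> (A *v x)" and psd: "\<And>x. 0 \<le> x \<bullet> (A *v x)"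
    and x: "x \<bullet> (A *v x) = 0"
  shows "y \<bullet> (A *v x) = 0"
proof (rule ccontr)
  define a b where "a = y \<bullet> (A *v x)" and "b = y \<bullet> (A *v y)"
  assume "y \<bullet> (A *v x) \<noteq> 0"
  then have a: "a \<noteq> 0" by (simp add: a_def)
  define t where "t = (b + 1) / (2 * a)"
  have "0 \<le> (y - t *\<^sub>R x) \<bullet> (A *v (y - t *\<^sub>R x))" by (rule psd)
  also have "\<dots> = b - 2 * t * a"
    using x sym[of x y]
    by (simp add: matrix_vector_mult_diff_distrib matrix_vector_mult_scaleR inner_diff_left inner_diff_right
        a_def b_def algebra_simps)
  also have "\<dots> = -1" using a by (simp add: t_def field_simps)
  finally show False by simp
qed

lemma psd_det_nonzero_imp_pd:
  fixes A :: "real^'m^'m"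
  assumes sym: "\<And>x y. x \<bullet> (A *v y) = y \<bullet> (A *v x)" and psd: "\<And>x. 0 \<le> x \<bullet> (A *v x)"
    and det: "det A \<noteq> 0" and x: "x \<noteq> 0"
  shows "0 < x \<bullet> (A *v x)"
proof (rule ccontr)
  assume "\<not> ?thesis"
  then have "x \<bullet> (A *v x) = 0" using psd[of x] by linarith
  then have "(A *v x) \<bullet> (A *v x) = 0"
    using psd_Cauchy_Schwarz[OF sym psd] by blast
  then have "A *v x = 0" by simp
  moreover have "invertible A" using det by (simp add: invertible_det_nz)
  ultimately show False using x
    by (metis matrix_left_invertible_ker invertible_def)
qed

text \<open>Gram-Schmidt for the inner product with matrix \<open>A\<close>, adding one index at a
  time.\<close>

lemma pd_orthonormal_family:
  fixes A :: "real^'m^'m"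
  assumes sym: "\<And>x y. x \<bullet> (A *v y) = y \<bullet> (A *v x)" and pd: "\<And>x. x \<noteq> 0 \<Longrightarrow> 0 < x \<bullet> (A *v x)"
  obtains v :: "'m \<Rightarrow> real^'m" where "\<And>i j. v i \<bullet> (A *v v j) = (if i = j then 1 else 0)"
proof -
  have "\<exists>v :: 'm \<Rightarrow> real^'m. \<forall>i\<in>S. \<forall>j\<in>S. v i \<bullet> (A *v v j) = (if i = j then 1 else 0)" for S :: "'m set"
  proof (induction S rule: finite_induct[OF finite])
    case 1
    show ?case by simp
  next
    case (2 k S)
    then obtain v :: "'m \<Rightarrow> real^'m" where v: "\<And>i j. i \<in> S \<Longrightarrow> j \<in> S \<Longrightarrow> v i \<bullet> (A *v v j) = (if i = j then 1 else 0)"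
      by blast
    have "span (v ` S) \<noteq> UNIV"
    proof
      assume "span (v ` S) = UNIV"
      then have "dim (UNIV :: (real^'m) set) \<le> card (v ` S)"
        by (metis dim_le_card' dim_span finite finite_imageI)
      also have "\<dots> \<le> card S" by (rule card_image_le) simp
      also have "\<dots> < CARD('m)" using 2 by (intro psubset_card_mono) auto
      finally show False by simp
    qed
    then obtain x where x: "x \<notin> span (v ` S)" by blast
    define y where "y = x - (\<Sum>i\<in>S. (v i \<bullet> (A *v x)) *\<^sub>R v i)"
    have "(\<Sum>i\<in>S. (v i \<bullet> (A *v x)) *\<^sub>R v i) \<in> span (v ` S)"
      by (intro span_sum span_scale span_base) auto
    then have "y \<noteq> 0" using x by (auto simp: y_def)
    then have ypos: "0 < y \<bullet> (A *v y)" by (rule pd)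
    have orth: "v j \<bullet> (A *v y) = 0" if "j \<in> S" for j
    proof -
      have "v j \<bullet> (A *v y) = v j \<bullet> (A *v x) - (\<Sum>i\<in>S. (v i \<bullet> (A *v x)) * (v j \<bullet> (A *v v i)))"
        by (simp add: y_def matrix_vector_mult_diff_distrib linear_sum[OF matrix_vector_mul_linear]
            matrix_vector_mult_scaleR inner_diff_right inner_sum_right)
      also have "(\<Sum>i\<in>S. (v i \<bullet> (A *v x)) * (v j \<bullet> (A *v v i))) = (\<Sum>i\<in>S. if i = j then v j \<bullet> (A *v x) else 0)"
        using v that by (intro sum.cong) auto
      finally show ?thesis using that by simp
    qed
    define v' where "v' = v(k := (1 / sqrt (y \<bullet> (A *v y))) *\<^sub>R y)"
    have "v' i \<bullet> (A *v v' j) = (if i = j then 1 else 0)" if ij: "i \<in> insert k S" "j \<in> insert k S" for i j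
    proof -
      have kS: "k \<notin> S" using 2 by simp
      consider "i = k" "j = k" | "i = k" "j \<in> S" | "i \<in> S" "j = k" | "i \<in> S" "j \<in> S"
        using ij by blast
      then show ?thesis
      proof cases
        case 1
        have "sqrt (y \<bullet> (A *v y)) * sqrt (y \<bullet> (A *v y)) = y \<bullet> (A *v y)" using ypos by simp
        then show ?thesis using 1 ypos by (simp add: v'_def matrix_vector_mult_scaleR)
      next
        case 2
        then have "y \<bullet> (A *v v j) = 0" using orth sym[of y "v j"] by simp
        then show ?thesis using 2 kS by (auto simp: v'_def)
      next
        case 3
        then show ?thesis using orth kS by (auto simp: v'_def matrix_vector_mult_scaleR)
      next
        case 4
        then show ?thesis using v kS by (auto simp: v'_def)
      qed
    qed
    then show ?case by blast
  qed
  from this[of UNIV] show ?thesis using that by auto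
qed

text \<open>With the \<open>A\<close>-orthonormal vectors as rows of \<open>V\<close> and l_j = A
  v_j, orthonormality reads V A V^T = 1. Since a one-sided inverse is two-sided, A V^T V = 1 as
  well, which is the expansion; taking determinants gives det A (det V)^2 = 1 and so the
  sign.\<close>

lemma pd_dual_frame:
  fixes A :: "real^'m^'m"
  assumes sym: "\<And>x y. x \<bullet> (A *v y) = y \<bullet> (A *v x)" and pd: "\<And>x. x \<noteq> 0 \<Longrightarrow> 0 < x \<bullet> (A *v x)"
  obtains v l :: "'m \<Rightarrow> real^'m" where "dual_frame UNIV v l"
    "\<And>x. A *v x = (\<Sum>j\<in>UNIV. (l j \<bullet> x) *\<^sub>R l j)" "0 < det A"
proof -
  obtain v :: "'m \<Rightarrow> real^'m" where v: "\<And>i j. v i \<bullet> (A *v v j) = (if i = j then 1 else 0)"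
    using pd_orthonormal_family[OF sym pd] by blast
  define V :: "real^'m^'m" where "V = (\<chi> i. v i)"
  define l where "l j = A *v v j" for j
  have col: "column j (A ** transpose V) = A *v v j" for j
    by (simp add: V_def column_def matrix_matrix_mult_def matrix_vector_mult_def transpose_def vec_eq_iff)
  have 1: "V ** (A ** transpose V) = mat 1"
  proof -
    have "(V ** (A ** transpose V)) $ i $ j = row i V \<bullet> column j (A ** transpose V)" for i j
      by (simp add: matrix_matrix_mult_def row_def column_def inner_vec_def)
    moreover have "row i V = v i" for i by (simp add: row_def V_def vec_eq_iff)
    ultimately show ?thesis by (simp add: vec_eq_iff col v mat_def)
  qed
  then have 2: "(A ** transpose V) ** V = mat 1"
    using matrix_left_right_inverse by blast
  have expand: "x = (\<Sum>j\<in>UNIV. (v j \<bullet> x) *\<^sub>R l j)" for x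
  proof -
    have "x = (A ** transpose V) *v (V *v x)"
      using 2 by (simp add: matrix_vector_mul_assoc)
    also have "\<dots> = (\<Sum>j\<in>UNIV. (V *v x) $ j *s column j (A ** transpose V))"
      by (rule matrix_mult_sum)
    also have "\<dots> = (\<Sum>j\<in>UNIV. (v j \<bullet> x) *\<^sub>R l j)"
    proof -
      have "(V *v x) $ j = v j \<bullet> x" for j by (simp add: matrix_vector_mul_component V_def)
      then show ?thesis by (simp add: col l_def scalar_mult_eq_scaleR)
    qed
    finally show ?thesis .
  qed
  have fr: "dual_frame UNIV v l"
    by unfold_locales (use expand v in \<open>auto simp: l_def\<close>)
  have lx: "l j \<bullet> x = v j \<bullet> (A *v x)" for j x
    using sym[of x "v j"] by (simp add: l_def inner_commute)
  have "det V * (det A * det V) = 1"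
    using arg_cong[OF 1, of det] by (simp add: det_mul)
  then have "det A * (det V)\<^sup>2 = 1" by (simp add: power2_eq_square ac_simps)
  then have "0 < det A"
    by (metis mult_nonneg_nonpos2 not_le not_one_le_zero zero_le_power2 mult.commute)
  then show ?thesis
    using that[OF fr] expand[of "A *v _"] lx by simp
qed

text \<open>The matrix \<open>A\<close> itself maps the unit ellipsoid of slopes onto the unit
  ellipsoid of positions, because v_i . A x = l_i . x.\<close>

lemma measure_dual_ellipsoids:
  fixes A :: "real^'m::{finite,wellorder}^'m::{finite,wellorder}"
    and v l :: "'m::{finite,wellorder} \<Rightarrow> real^'m::{finite,wellorder}"
  assumes fr: "dual_frame UNIV v l" and A: "\<And>x. A *v x = (\<Sum>j\<in>UNIV. (l j \<bullet> x) *\<^sub>R l j)"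
  shows "measure lborel (dual_frame.ellipsoid UNIV v 0 1) = \<bar>det A\<bar> * measure lborel (dual_frame.ellipsoid UNIV l 0 1)"
proof -
  interpret dual_frame UNIV v l by (rule fr)
  interpret sw: dual_frame UNIV l v by (rule dual_frame_swap)
  have vA: "v i \<bullet> (A *v x) = l i \<bullet> x" for i x
    unfolding A using dual by (simp add: inner_sum_right if_distrib[of "\<lambda>z. _ * z"] cong: if_cong)
  have "ellipsoid 0 1 = (\<lambda>x. A *v x) ` sw.ellipsoid 0 1"
  proof (intro equalityI subsetI)
    fix y assume y: "y \<in> ellipsoid 0 1"
    define x where "x = (\<Sum>j\<in>UNIV. (v j \<bullet> y) *\<^sub>R v j)"
    have lx: "l i \<bullet> x = v i \<bullet> y" for i
      unfolding x_def using sw.dual by (simp add: inner_sum_right if_distrib[of "\<lambda>z. _ * z"] cong: if_cong)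
    have "A *v x = y" unfolding A lx using expand[of y] by simp
    moreover have "x \<in> sw.ellipsoid 0 1"
      using y by (simp add: ellipsoid_def sw.ellipsoid_def gauge_norm_def sw.gauge_norm_def lx)
    ultimately show "y \<in> (\<lambda>x. A *v x) ` sw.ellipsoid 0 1" by blast
  next
    fix y assume "y \<in> (\<lambda>x. A *v x) ` sw.ellipsoid 0 1"
    then show "y \<in> ellipsoid 0 1"
      by (auto simp: ellipsoid_def sw.ellipsoid_def gauge_norm_def sw.gauge_norm_def vA)
  qed
  moreover have lm: "sw.ellipsoid 0 1 \<in> lmeasurable"
    using sw.bounded_ellipsoid sw.open_ellipsoid by (rule lmeasurable_open)
  ultimately have "measure lebesgue (ellipsoid 0 1) = \<bar>det (matrix (\<lambda>x. A *v x))\<bar> * measure lebesgue (sw.ellipsoid 0 1)"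
    using measure_linear_image[OF matrix_vector_mul_linear[of A] lm] by (simp only:)
  then show ?thesis by simp
qed

text \<open>In frame coordinates the ellipsoids are round balls, and Vitali's theorem fills the open
  set by disjoint ones up to a null set. Finitely many of them already carry half the measure; all
  volumes change by the same determinant on the way back.\<close>

lemma ellipsoid_packing:
  fixes v l :: "'m::{finite,wellorder} \<Rightarrow> real^'m::{finite,wellorder}"
  assumes fr: "dual_frame UNIV v l" and U: "open U" "bounded U"
  obtains C where "finite C" "\<And>x0 s. (x0, s) \<in> C \<Longrightarrow> 0 < s \<and> dual_frame.ellipsoid UNIV v x0 s \<subseteq> U"
    "pairwise (\<lambda>i j. disjnt (dual_frame.ellipsoid UNIV v (fst i) (snd i)) (dual_frame.ellipsoid UNIV v (fst j) (snd j))) C"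
    "measure lborel U \<le> 2 * (\<Sum>(x0, s)\<in>C. measure lborel (dual_frame.ellipsoid UNIV v x0 s))"
proof (cases "measure lborel U = 0")
  case True
  show ?thesis by (rule that[of "{}"]) (use True in auto)
next
  case False
  interpret dual_frame UNIV v l by (rule fr)
  define T :: "real^'m::{finite,wellorder} \<Rightarrow> real^'m::{finite,wellorder}" where "T x = (\<chi> j. v j \<bullet> x)" for x
  define S :: "real^'m::{finite,wellorder} \<Rightarrow> real^'m::{finite,wellorder}" where "S z = (\<Sum>j\<in>UNIV. z $ j *\<^sub>R l j)" for z
  have ST: "S (T x) = x" for x
    unfolding S_def T_def using expand[of x] by simp
  have TS: "T (S z) = z" for z
    unfolding S_def T_def using dual
    by (simp add: vec_eq_iff inner_sum_right if_distrib[of "\<lambda>z. _ * z"] cong: if_cong)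
  have linS: "linear S"
    unfolding S_def by (intro linearI) (simp_all add: scaleR_add_left sum.distrib scaleR_sum_right)
  have linT: "linear T"
    unfolding T_def by (intro linearI) (simp_all add: inner_add_right vec_eq_iff)
  have normT: "norm (T x) = gauge_norm x" for x
    by (simp add: norm_vec_def T_def gauge_norm_def L2_set_def)
  have S_ball: "S ` ball a r = ellipsoid (S a) r" for a r
  proof (intro equalityI subsetI)
    fix x assume "x \<in> S ` ball a r"
    then obtain z where z: "x = S z" "dist a z < r" by auto
    have "gauge_norm (x - S a) = norm (z - a)"
      using z normT[of "x - S a"] by (simp add: linear_diff[OF linT] TS)
    then show "x \<in> ellipsoid (S a) r" using z by (simp add: ellipsoid_def dist_norm norm_minus_commute)
  next
    fix x assume "x \<in> ellipsoid (S a) r"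
    then have "norm (T x - a) < r"
      using normT[of "x - S a"] by (simp add: ellipsoid_def linear_diff[OF linT] TS)
    then have "T x \<in> ball a r" by (simp add: dist_norm norm_minus_commute)
    then show "x \<in> S ` ball a r" using ST[of x] by (metis image_eqI)
  qed
  define U' where "U' = T ` U"
  have SU': "S ` U' = U" unfolding U'_def by (auto simp: image_image ST)
  have "U' = S -` U" unfolding U'_def by (auto simp: ST) (metis TS image_eqI)
  then have openU': "open U'"
    using U(1) by (simp add: linS linear_continuous_at open_vimage linear_linear linear_continuous_on)
  have bddU': "bounded U'"
    unfolding U'_def using U(2) linT by (simp add: bounded_linear_image linear_linear)
  define KK where "KK = {(a, r). 0 < r \<and> ball a r \<subseteq> U'}"
  have "\<exists>i. i \<in> KK \<and> x \<in> ball (fst i) (snd i) \<and> snd i < d" if "x \<in> U'" "0 < d" for x d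
  proof -
    obtain e where e: "0 < e" "ball x e \<subseteq> U'" using openU' \<open>x \<in> U'\<close> open_contains_ball by blast
    have "(x, min e (d / 2)) \<in> KK" using e that by (auto simp: KK_def)
    then show ?thesis using e that by (intro exI[of _ "(x, min e (d / 2))"]) auto
  qed
  then obtain C where C: "countable C" "C \<subseteq> KK"
     "pairwise (\<lambda>i j. disjnt (ball (fst i) (snd i)) (ball (fst j) (snd j))) C"
     "negligible (U' - (\<Union>i\<in>C. ball (fst i) (snd i)))"
    by (rule Vitali_covering_theorem_balls[where a = fst and r = snd and K = KK and S = U'])
  have sub: "(\<Union>i\<in>C. ball (fst i) (snd i)) \<subseteq> U'"
    using C(2) by (force simp: KK_def)
  have U'_lm: "U' \<in> lmeasurable" using openU' bddU' by (simp add: lmeasurable_open)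
  have U_lm: "measure lebesgue U = \<bar>det (matrix S)\<bar> * measure lebesgue U'"
    using measure_linear_image[OF linS U'_lm] SU' by simp
  have "measure lebesgue U \<noteq> 0" using False U(1) by simp
  then have "measure lebesgue U' \<noteq> 0" using U_lm by auto
  then have U'_pos: "0 < measure lebesgue U'" by (simp add: zero_less_measure_iff)
  have injS: "inj S" by (rule inj_on_inverseI[of _ T]) (rule TS)
  have Cne: "C \<noteq> {}"
  proof
    assume "C = {}"
    then have "negligible U'" using C(4) by simp
    then show False using U'_pos by (simp add: negligible_iff_measure0 U'_lm)
  qed
  define B where "B n = (\<Union>i\<in>from_nat_into C ` {..n::nat}. ball (fst i) (snd i))" for n
  have UB: "(\<Union>n. B n) = (\<Union>i\<in>C. ball (fst i) (snd i))"
  proof -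
    have "(\<Union>n. from_nat_into C ` {..n}) = C"
      by (simp only: image_UN[symmetric] UN_atMost_UNIV range_from_nat_into[OF Cne C(1)])
    moreover have "(\<Union>n. B n) = (\<Union>i\<in>(\<Union>n. from_nat_into C ` {..n}). ball (fst i) (snd i))"
      unfolding B_def by blast
    ultimately show ?thesis by simp
  qed
  have B_sub: "B n \<subseteq> U'" for n
  proof -
    have "B n \<subseteq> (\<Union>n. B n)" by (rule UN_upper) simp
    then show ?thesis unfolding UB using sub by (rule order_trans)
  qed
  have B_open: "open (B n)" for n unfolding B_def by auto
  have "(\<lambda>n. measure lebesgue (B n)) \<longlonglongrightarrow> measure lebesgue (\<Union>n. B n)"
  proof (rule Lim_measure_incseq)
    show "range B \<subseteq> sets lebesgue" using B_open by auto
    show "incseq B" unfolding B_def incseq_def by (intro allI impI UN_mono image_mono) auto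
    have "(\<Union>n. B n) \<in> lmeasurable"
      using sub UB B_open bounded_subset[OF bddU'] by (intro lmeasurable_open) auto
    then show "emeasure lebesgue (\<Union>n. B n) \<noteq> \<infinity>"
      unfolding infinity_ennreal_def by (rule fmeasurableD2)
  qed
  moreover have "measure lebesgue (\<Union>n. B n) = measure lebesgue U'"
  proof -
    have "negligible ((\<Union>n. B n) - U' \<union> (U' - (\<Union>n. B n)))"
      using C(4) sub UB by (simp add: Diff_eq_empty_iff[THEN iffD2])
    then show ?thesis
      using U'_lm measure_negligible_symdiff[of U' "\<Union>n. B n"] by (simp add: Un_commute)
  qed
  ultimately have "\<forall>\<^sub>F n in sequentially. measure lebesgue U' / 2 < measure lebesgue (B n)"
    using U'_pos by (intro order_tendstoD(1)) auto
  then obtain n where n: "measure lebesgue U' / 2 < measure lebesgue (B n)"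
    by (auto simp: eventually_sequentially)
  define X where "X = from_nat_into C ` {..n}"
  have B_X: "B n = (\<Union>i\<in>X. ball (fst i) (snd i))" and finX: "finite X"
    by (simp_all add: B_def X_def)
  define C' where "C' = (\<lambda>i. (S (fst i), snd i)) ` X"
  have C'_C: "X \<subseteq> C" unfolding X_def using from_nat_into[OF Cne] by blast
  have inj: "inj_on (\<lambda>i. (S (fst i), snd i)) X"
    by (rule inj_onI) (metis TS prod.collapse prod.inject)
  show ?thesis
  proof (rule that[of C'])
    show "finite C'" by (simp add: C'_def finX)
    show "0 < s \<and> ellipsoid x0 s \<subseteq> U" if mem: "(x0, s) \<in> C'" for x0 s
    proof -
      obtain i where "i \<in> X" "(x0, s) = (S (fst i), snd i)"
        using mem unfolding C'_def by blast
      then have i: "i \<in> C" "x0 = S (fst i)" "s = snd i" using C'_C by auto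
      then have "i \<in> KK" using C(2) by blast
      then have "0 < s" "ball (fst i) s \<subseteq> U'" using i by (auto simp: KK_def case_prod_beta)
      then have "S ` ball (fst i) s \<subseteq> U" using SU' by blast
      then show ?thesis using \<open>0 < s\<close> S_ball i by simp
    qed
    show "pairwise (\<lambda>i j. disjnt (ellipsoid (fst i) (snd i)) (ellipsoid (fst j) (snd j))) C'"
    proof (rule pairwiseI)
      fix x y assume "x \<in> C'" "y \<in> C'" "x \<noteq> y"
      then obtain i j where ij: "i \<in> C" "j \<in> C" "x = (S (fst i), snd i)" "y = (S (fst j), snd j)"
        using C'_C unfolding C'_def by blast
      then have "disjnt (ball (fst i) (snd i)) (ball (fst j) (snd j))"
        using C(3) \<open>x \<noteq> y\<close> by (auto simp: pairwise_def)
      then have "disjnt (S ` ball (fst i) (snd i)) (S ` ball (fst j) (snd j))"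
        unfolding disjnt_def by (simp add: image_Int[OF injS, symmetric])
      then show "disjnt (ellipsoid (fst x) (snd x)) (ellipsoid (fst y) (snd y))"
        using ij S_ball by simp
    qed
    have "measure lebesgue (B n) = (\<Sum>i\<in>X. measure lebesgue (ball (fst i) (snd i)))"
      unfolding B_X
    proof (rule measure_UNION')
      show "pairwise (\<lambda>i j. disjnt (ball (fst i) (snd i)) (ball (fst j) (snd j))) (X)"
        by (rule pairwise_subset[OF C(3) C'_C])
    qed (use finX in auto)
    moreover have "measure lebesgue (S ` ball a r) = \<bar>det (matrix S)\<bar> * measure lebesgue (ball a r)" for a r
      by (rule measure_linear_image[OF linS]) simp
    ultimately have "\<bar>det (matrix S)\<bar> * measure lebesgue (B n) = (\<Sum>i\<in>X. measure lebesgue (S ` ball (fst i) (snd i)))"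
      by (simp add: sum_distrib_left)
    also have "\<dots> = (\<Sum>(x0, s)\<in>C'. measure lebesgue (ellipsoid x0 s))"
      unfolding C'_def by (subst sum.reindex[OF inj]) (simp add: S_ball)
    finally have eq: "\<bar>det (matrix S)\<bar> * measure lebesgue (B n) = (\<Sum>(x0, s)\<in>C'. measure lebesgue (ellipsoid x0 s))" .
    have "\<bar>det (matrix S)\<bar> * measure lebesgue U' \<le> \<bar>det (matrix S)\<bar> * (2 * measure lebesgue (B n))"
      using n by (intro mult_left_mono abs_ge_zero) linarith
    then have "measure lebesgue U \<le> 2 * (\<Sum>(x0, s)\<in>C'. measure lebesgue (ellipsoid x0 s))"
      unfolding U_lm eq[symmetric] by (simp only: mult.left_commute)
    then show "measure lborel U \<le> 2 * (\<Sum>(x0, s)\<in>C'. measure lborel (ellipsoid x0 s))"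
      using U(1) by (simp add: case_prod_beta)
  qed
qed

section \<open>Determinants and transport\<close>

text \<open>An inequality, since \<open>ennreal\<close> truncates negative terms to 0; the local
  estimates can be negative when the smoothing error dominates.\<close>

lemma ennreal_sum_le: "ennreal (\<Sum>i\<in>I. f i) \<le> (\<Sum>i\<in>I. ennreal (f i))"
proof -
  have "ennreal (\<Sum>i\<in>I. f i) \<le> ennreal (\<Sum>i\<in>I. max 0 (f i))"
    by (intro ennreal_leI sum_mono) simp
  also have "\<dots> = (\<Sum>i\<in>I. ennreal (max 0 (f i)))"
    by (rule sum_ennreal[symmetric]) simp
  also have "\<dots> = (\<Sum>i\<in>I. ennreal (f i))"
    by (intro sum.cong refl) (simp add: max_def ennreal_neg)
  finally show ?thesis .
qed

text \<open>The transport cell \<open>W i\<close> is too large to fit into the dual ellipsoid of radius \<open>D i\<close>, so it contains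
  slopes \<open>p i\<close>, \<open>q i\<close> at dual distance at least \<open>D i\<close>; the exponent \<open>1 / (d - 1)\<close> is the one for which
  \<open>D i / s i\<close> is proportional to the mass density \<open>g i\<close>, since then \<open>g i ^ d = g i * det (A i)\<close>.\<close>

lemma det_transport_discrete:
  fixes A :: "'i \<Rightarrow> real^'m::{finite,wellorder}^'m::{finite,wellorder}"
    and v l :: "'i \<Rightarrow> 'm::{finite,wellorder} \<Rightarrow> real^'m::{finite,wellorder}"
    and K :: "(real^'m::{finite,wellorder}) set"
  assumes I: "finite I" and m: "2 \<le> CARD('m)"
    and fr: "\<And>i. i \<in> I \<Longrightarrow> dual_frame UNIV (v i) (l i)"
    and A: "\<And>i x. i \<in> I \<Longrightarrow> A i *v x = (\<Sum>j\<in>UNIV. (l i j \<bullet> x) *\<^sub>R l i j)"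
    and det: "\<And>i. i \<in> I \<Longrightarrow> 0 < det (A i)"
    and s: "\<And>i. i \<in> I \<Longrightarrow> 0 < s i"
    and K: "compact K" "0 < measure lborel K"
    and K_le: "measure lborel K \<le> (\<Sum>i\<in>I. det (A i) powr (1 / real (CARD('m) - 1)) *
        measure lborel (dual_frame.ellipsoid UNIV (v i) (x0 i) (s i)))"
    and B: "0 \<le> B"
    and bound: "\<And>P c e. finite P \<Longrightarrow> P \<noteq> {} \<Longrightarrow> P \<subseteq> K \<Longrightarrow> 0 < e \<Longrightarrow>
       (\<Sum>i\<in>I. \<integral>\<^sup>+x\<in>dual_frame.ellipsoid UNIV (v i) (x0 i) (s i).
          ennreal (\<Sum>j\<in>UNIV. lse_hess P c e x (\<lambda>\<xi>. (l i j \<bullet> \<xi>)\<^sup>2)) \<partial>lborel) \<le> ennreal B"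
  shows "measure lborel K \<le> (32 / 7 * 4 ^ CARD('m)) * B"
proof -
  define d where "d = CARD('m)"
  have d2: "2 \<le> d" using m by (simp add: d_def)
  define g where "g i = det (A i) powr (1 / real (d - 1))" for i
  define E where "E i = dual_frame.ellipsoid UNIV (v i) (x0 i) (s i)" for i
  define G where "G = (\<Sum>i\<in>I. g i * measure lborel (E i))"
  have g_pos: "0 < g i" if "i \<in> I" for i
    using det[OF that] by (simp add: g_def)
  have g_pow: "g i ^ d = g i * det (A i)" if "i \<in> I" for i
  proof -
    have "g i ^ (d - 1) = det (A i)"
      using det[OF that] d2 by (simp add: g_def powr_realpow[symmetric] powr_powr)
    moreover have "g i ^ d = g i * g i ^ (d - 1)"
      using d2 power_Suc[of "g i" "d - 1"] by simp
    ultimately show ?thesis by simp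
  qed
  have KG: "measure lborel K \<le> G"
    using K_le by (simp add: G_def g_def E_def d_def)
  \<comment> \<open>Rescales the masses so that they add up to the measure of \<open>K\<close>. That
    \<open>lam\<close> is at most 1 pays off at the end, where lam/2 is bounded by its d-th
    root.\<close>
  define lam where "lam = measure lborel K / G"
  have G_pos: "0 < G" using KG K by linarith
  have lam: "0 < lam" "lam \<le> 1" using KG K G_pos by (simp_all add: lam_def)
  have E_pos: "0 < measure lborel (E i)" if "i \<in> I" for i
  proof -
    interpret dual_frame UNIV "v i" "l i" by (rule fr[OF that])
    have "x0 i \<in> E i" using s[OF that] by (simp add: E_def ellipsoid_def gauge_norm_def L2_set_def)
    moreover have "open (E i)" unfolding E_def by (rule open_ellipsoid)
    ultimately have "\<not> negligible (E i)" using open_not_negligible by blast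
    moreover have "E i \<in> lmeasurable" unfolding E_def by (rule lmeasurable_open[OF bounded_ellipsoid open_ellipsoid])
    ultimately have "measure lebesgue (E i) \<noteq> 0" by (simp add: negligible_iff_measure)
    then have "measure lborel (E i) \<noteq> 0" unfolding E_def by simp
    then show ?thesis by (simp add: zero_less_measure_iff)
  qed
  define \<mu> where "\<mu> i = lam * (g i * measure lborel (E i))" for i
  have \<mu>_pos: "0 < \<mu> i" if "i \<in> I" for i
    using lam g_pos[OF that] E_pos[OF that] by (simp add: \<mu>_def)
  have "(\<Sum>i\<in>I. \<mu> i) = lam * G"
    by (simp add: \<mu>_def G_def sum_distrib_left)
  also have "\<dots> = measure lborel K" using G_pos by (simp add: lam_def)
  finally have \<mu>_sum: "(\<Sum>i\<in>I. \<mu> i) = measure lborel K" .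
  have I_ne: "I \<noteq> {}" using G_pos by (auto simp: G_def)
  obtain h where h: "\<And>i. i \<in> I \<Longrightarrow> \<mu> i \<le> measure lborel {p\<in>K. \<forall>j\<in>I. p \<bullet> x0 j - h j \<le> p \<bullet> x0 i - h i}"
    using semidiscrete_transport[OF K(1) I I_ne \<mu>_pos \<mu>_sum, of x0] by blast
  define W where "W i = {p\<in>K. \<forall>j\<in>I. p \<bullet> x0 j - h j \<le> p \<bullet> x0 i - h i}" for i
  \<comment> \<open>The dual ellipsoid of this radius has measure \<open>\<mu> i / 2\<close>: its
    volume is D^d times that of the dual unit ellipsoid, D^d contains g^d = g det A, and det A
    converts the dual unit volume into the primal one. A cell of measure at least
    \<open>\<mu> i\<close> cannot fit inside.\<close>
  define D where "D i = s i * (lam / 2) powr (1 / d) * g i" for i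
  have ex: "\<exists>p q. p \<in> W i \<and> q \<in> W i \<and> D i \<le> L2_set (\<lambda>j. l i j \<bullet> (p - q)) UNIV" if i: "i \<in> I" for i
  proof (rule ccontr)
    assume contra: "\<not> ?thesis"
    interpret dual_frame UNIV "v i" "l i" by (rule fr[OF i])
    interpret sw: dual_frame UNIV "l i" "v i" by (rule dual_frame_swap)
    have D_pos: "0 < D i" using s[OF i] lam g_pos[OF i] by (simp add: D_def)
    have "0 < measure lborel (W i)" using h[OF i] \<mu>_pos[OF i] unfolding W_def by linarith
    then have "W i \<noteq> {}" by auto
    then obtain p where p: "p \<in> W i" by blast
    have "W i \<subseteq> sw.ellipsoid p (D i)"
    proof
      fix q assume "q \<in> W i"
      then have "L2_set (\<lambda>j. l i j \<bullet> (q - p)) UNIV < D i"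
        using contra p by (meson not_le)
      then show "q \<in> sw.ellipsoid p (D i)" by (simp add: sw.ellipsoid_def sw.gauge_norm_def)
    qed
    then have "emeasure lborel (W i) \<le> emeasure lborel (sw.ellipsoid p (D i))"
      by (intro emeasure_mono) auto
    then have "measure lborel (W i) \<le> measure lborel (sw.ellipsoid p (D i))"
      unfolding measure_def
      by (rule enn2real_mono) (simp add: sw.emeasure_ellipsoid)
    also have "\<dots> = D i ^ d * measure lborel (sw.ellipsoid 0 1)"
      unfolding d_def sw.measure_ellipsoid[OF D_pos, of p] by (simp only: DIM_cart DIM_real mult_1_right)
    also have "D i ^ d = s i ^ d * (lam / 2) * (g i * det (A i))"
    proof -
      have "((lam / 2) powr (1 / d)) ^ d = lam / 2"
        using lam d2 by (simp add: powr_realpow[symmetric] powr_powr)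
      then show ?thesis by (simp add: D_def power_mult_distrib g_pow[OF i])
    qed
    also have "s i ^ d * (lam / 2) * (g i * det (A i)) * measure lborel (sw.ellipsoid 0 1)
      = \<mu> i / 2"
    proof -
      have "measure lborel (ellipsoid 0 1) = det (A i) * measure lborel (sw.ellipsoid 0 1)"
        using measure_dual_ellipsoids[OF fr[OF i] A[OF i]] det[OF i] by simp
      moreover have "measure lborel (E i) = s i ^ d * measure lborel (ellipsoid 0 1)"
        unfolding E_def d_def measure_ellipsoid[OF s[OF i], of "x0 i"] by (simp only: DIM_cart DIM_real mult_1_right)
      ultimately show ?thesis by (simp add: \<mu>_def)
    qed
    finally show False using h[OF i] \<mu>_pos[OF i] by (simp add: W_def)
  qed
  have "\<forall>i\<in>I. \<exists>z. fst z \<in> W i \<and> snd z \<in> W i \<and> D i \<le> L2_set (\<lambda>j. l i j \<bullet> (fst z - snd z)) UNIV"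
  proof
    fix i assume "i \<in> I"
    from ex[OF this] obtain p q where "p \<in> W i" "q \<in> W i" "D i \<le> L2_set (\<lambda>j. l i j \<bullet> (p - q)) UNIV"
      by blast
    then show "\<exists>z. fst z \<in> W i \<and> snd z \<in> W i \<and> D i \<le> L2_set (\<lambda>j. l i j \<bullet> (fst z - snd z)) UNIV"
      by (intro exI[of _ "(p, q)"]) simp
  qed
  from bchoice[OF this] obtain z where z: "\<forall>i\<in>I. fst (z i) \<in> W i \<and> snd (z i) \<in> W i \<and>
      D i \<le> L2_set (\<lambda>j. l i j \<bullet> (fst (z i) - snd (z i))) UNIV"
    by blast
  define p q where "p i = fst (z i)" and "q i = snd (z i)" for i
  have pq: "p i \<in> W i" "q i \<in> W i" "D i \<le> L2_set (\<lambda>j. l i j \<bullet> (p i - q i)) UNIV" if "i \<in> I" for i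
    using z that unfolding p_def q_def by blast+
  define P where "P = p ` I \<union> q ` I"
  \<comment> \<open>The discrete Legendre transform of the weights \<open>h\<close>. With these
    offsets every affine function lies at or below \<open>h i\<close> at \<open>x0 i\<close>, with
    equality exactly when its slope belongs to the cell of \<open>i\<close>, for slopes in
    \<open>K\<close>; so \<open>p i\<close> and \<open>q i\<close> give two minorants of the same
    height there.\<close>
  define c where "c \<xi> = Max ((\<lambda>i. \<xi> \<bullet> x0 i - h i) ` I)" for \<xi>
  have P: "finite P" "P \<noteq> {}" "P \<subseteq> K"
    using I I_ne pq(1,2) by (auto simp: P_def W_def)
  have c_ge: "\<xi> \<bullet> x0 i - h i \<le> c \<xi>" if "i \<in> I" for \<xi> i
    unfolding c_def using I that by (intro Max_ge) auto
  have c_W: "c \<xi> \<le> \<xi> \<bullet> x0 i - h i" if "\<xi> \<in> W i" for \<xi> i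
    unfolding c_def using I I_ne that by (intro Max.boundedI) (auto simp: W_def)
  \<comment> \<open>The total smoothing error per unit of \<open>e\<close>. It involves neither
    \<open>e\<close> nor the potential beyond the number of slopes, so letting \<open>e\<close> tend
    to 0 removes it.\<close>
  define S where "S = (\<Sum>i\<in>I. 4 / (s i)\<^sup>2 * ln (card P) * measure lborel (E i))"
  define \<kappa> :: real where "\<kappa> = 7 / 16 * (1 / 4) ^ d"
  have est: "\<kappa> * (\<Sum>i\<in>I. (D i / s i) * measure lborel (E i)) - e * S \<le> B" if e: "0 < e" for e
  proof -
    have "ennreal (\<kappa> * (\<Sum>i\<in>I. (D i / s i) * measure lborel (E i)) - e * S)
      = ennreal (\<Sum>i\<in>I. (\<kappa> * (D i / s i) - 4 / (s i)\<^sup>2 * (e * ln (card P))) * measure lborel (E i))"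
      by (simp add: S_def sum_distrib_left sum_subtractf left_diff_distrib mult.assoc mult.left_commute)
    also have "\<dots> \<le> (\<Sum>i\<in>I. ennreal ((\<kappa> * (D i / s i) - 4 / (s i)\<^sup>2 * (e * ln (card P))) * measure lborel (E i)))"
      by (rule ennreal_sum_le)
    also have "\<dots> \<le> (\<Sum>i\<in>I. \<integral>\<^sup>+x\<in>E i. ennreal (\<Sum>j\<in>UNIV. lse_hess P c e x (\<lambda>\<xi>. (l i j \<bullet> \<xi>)\<^sup>2)) \<partial>lborel)"
    proof (rule sum_mono)
      fix i assume i: "i \<in> I"
      interpret dual_frame UNIV "v i" "l i" by (rule fr[OF i])
      let ?w = "L2_set (\<lambda>j. l i j \<bullet> (p i - q i)) UNIV"
      have supp: "h i + \<xi> \<bullet> (x - x0 i) \<le> lse P c e x" if "\<xi> \<in> P" "\<xi> \<in> W i" for \<xi> x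
        using lse_ge[OF P(1,2) e that(1), of x c] c_W[OF that(2)] by (simp add: inner_diff_right)
      have "lse P c e (x0 i) \<le> h i + e * ln (card P)"
        by (rule lse_le[OF P(1,2) e]) (use c_ge[OF i] in \<open>simp add: algebra_simps\<close>)
      then have "ennreal ((7 / 16 * (?w / s i) * (1 / 4) ^ DIM(real^'m::{finite,wellorder}) - 4 / (s i)\<^sup>2 * (e * ln (card P))) * measure lborel (ellipsoid (x0 i) (s i)))
        \<le> (\<integral>\<^sup>+x\<in>ellipsoid (x0 i) (s i). ennreal (\<Sum>j\<in>UNIV. lse_hess P c e x (\<lambda>\<xi>. (l i j \<bullet> \<xi>)\<^sup>2)) \<partial>lborel)"
        using i pq(1,2)[OF i] by (intro lse_local_estimate[OF P(1,2) e s[OF i], where h = "h i"] supp) (auto simp: P_def)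
      moreover have "(\<kappa> * (D i / s i) - 4 / (s i)\<^sup>2 * (e * ln (card P))) * measure lborel (E i)
        \<le> (7 / 16 * (?w / s i) * (1 / 4) ^ d - 4 / (s i)\<^sup>2 * (e * ln (card P))) * measure lborel (E i)"
      proof (intro mult_right_mono diff_right_mono)
        have "7 / 16 * (1 / 4) ^ d * (D i / s i) \<le> 7 / 16 * (1 / 4) ^ d * (?w / s i)"
          using pq(3)[OF i] s[OF i] by (intro mult_left_mono divide_right_mono) auto
        then show "\<kappa> * (D i / s i) \<le> 7 / 16 * (?w / s i) * (1 / 4) ^ d"
          by (simp add: \<kappa>_def mult.commute mult.left_commute)
      qed simp
      ultimately show "ennreal ((\<kappa> * (D i / s i) - 4 / (s i)\<^sup>2 * (e * ln (card P))) * measure lborel (E i))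
        \<le> (\<integral>\<^sup>+x\<in>E i. ennreal (\<Sum>j\<in>UNIV. lse_hess P c e x (\<lambda>\<xi>. (l i j \<bullet> \<xi>)\<^sup>2)) \<partial>lborel)"
        unfolding E_def d_def by (simp add: order_trans[OF ennreal_leI])
    qed
    also have "\<dots> \<le> ennreal B"
      unfolding E_def by (rule bound[OF P e])
    finally have "ennreal (\<kappa> * (\<Sum>i\<in>I. (D i / s i) * measure lborel (E i)) - e * S) \<le> ennreal B" .
    then show ?thesis using B by (simp add: ennreal_le_iff)
  qed
  have "\<kappa> * (lam / 2) * G \<le> B"
  proof -
    have "\<kappa> * (\<Sum>i\<in>I. (D i / s i) * measure lborel (E i)) \<le> B"
    proof (rule field_le_epsilon)
      fix z :: real assume z: "0 < z"
      have "z / (\<bar>S\<bar> + 1) * S \<le> z"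
      proof -
        have "z / (\<bar>S\<bar> + 1) * S \<le> z / (\<bar>S\<bar> + 1) * (\<bar>S\<bar> + 1)"
          using z by (intro mult_left_mono) auto
        then show ?thesis by simp
      qed
      moreover have "0 < z / (\<bar>S\<bar> + 1)" using z by (intro divide_pos_pos) auto
      ultimately show "\<kappa> * (\<Sum>i\<in>I. (D i / s i) * measure lborel (E i)) \<le> B + z"
        using est[of "z / (\<bar>S\<bar> + 1)"] by linarith
    qed
    moreover have "\<kappa> * ((lam / 2) * G) \<le> \<kappa> * (\<Sum>i\<in>I. (D i / s i) * measure lborel (E i))"
    proof (intro mult_left_mono)
      have "lam / 2 \<le> (lam / 2) powr (1 / d)"
        using lam d2 powr_mono'[of "1 / d" 1 "lam / 2"] by simp
      then have "(lam / 2) * (g i * measure lborel (E i)) \<le> (D i / s i) * measure lborel (E i)" if "i \<in> I" for i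
        using mult_right_mono[of "lam / 2" "(lam / 2) powr (1 / d)" "g i * measure lborel (E i)"]
          g_pos[OF that] E_pos[OF that] s[OF that] by (simp add: D_def mult.assoc)
      then show "(lam / 2) * G \<le> (\<Sum>i\<in>I. (D i / s i) * measure lborel (E i))"
        unfolding G_def sum_distrib_left by (intro sum_mono)
    qed (simp add: \<kappa>_def)
    ultimately show ?thesis by (simp add: mult.assoc)
  qed
  moreover have "\<kappa> * (lam / 2) * G = 7 / 32 * (1 / 4) ^ d * measure lborel K"
    using G_pos by (simp add: \<kappa>_def lam_def)
  ultimately have "7 / 32 * (1 / 4) ^ d * measure lborel K \<le> B" by linarith
  then have "(32 / 7 * 4 ^ d) * (7 / 32 * (1 / 4) ^ d * measure lborel K) \<le> (32 / 7 * 4 ^ d) * B"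
    by (intro mult_left_mono) auto
  moreover have "(32 / 7 * 4 ^ d) * (7 / 32 * (1 / 4) ^ d * measure lborel K) = measure lborel K"
    by (simp add: power_divide)
  ultimately show ?thesis unfolding d_def[symmetric] by linarith
qed

section \<open>From frozen matrices to continuous matrix fields\<close>

lemma norm_matrix_vector_mult_le: "norm (M *v x) \<le> norm M * norm (x :: real^'m)" for M :: "real^'m^'k"
proof -
  have "norm (M *v x) = L2_set (\<lambda>i. \<bar>(M $ i) \<bullet> x\<bar>) UNIV"
    by (simp add: norm_vec_def matrix_vector_mul_component L2_set_def)
  also have "\<dots> \<le> L2_set (\<lambda>i. norm (M $ i) * norm x) UNIV"
    by (intro L2_set_mono Cauchy_Schwarz_ineq2) auto
  also have "\<dots> = norm M * norm x"
    by (simp add: norm_vec_def[of M] L2_set_left_distrib)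
  finally show ?thesis .
qed

lemma psd_det_nonneg:
  fixes A :: "real^'m^'m"
  assumes sym: "\<And>x y. x \<bullet> (A *v y) = y \<bullet> (A *v x)" and psd: "\<And>x. 0 \<le> x \<bullet> (A *v x)"
  shows "0 \<le> det A"
proof (cases "det A = 0")
  case False
  then show ?thesis
    using pd_dual_frame[OF sym psd_det_nonzero_imp_pd[OF sym psd False]] by (metis less_imp_le)
qed simp

text \<open>The form of \<open>A x\<close> is at least |\<xi>|^2 / Z^2, so a perturbation of norm
  below 1 / (2 Z^2) changes it by at most half of itself, uniformly in \<xi>. This allows freezing
  the matrix at the tag of a small box.\<close>

lemma pd_locally_comparable:
  fixes A :: "'a::metric_space \<Rightarrow> real^'m^'m"
  assumes sym: "\<And>y z. y \<bullet> (A x *v z) = z \<bullet> (A x *v y)" and pd: "\<And>y. y \<noteq> 0 \<Longrightarrow> 0 < y \<bullet> (A x *v y)"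
    and cont: "continuous (at x within S) A"
  shows "\<forall>\<^sub>F y in at x within S. \<forall>\<xi>. \<xi> \<bullet> (A x *v \<xi>) \<le> 2 * (\<xi> \<bullet> (A y *v \<xi>))"
proof -
  obtain v l :: "'m \<Rightarrow> real^'m" where fr: "dual_frame UNIV v l"
    and A: "\<And>\<xi>. A x *v \<xi> = (\<Sum>j\<in>UNIV. (l j \<bullet> \<xi>) *\<^sub>R l j)"
    using pd_dual_frame[OF sym pd] by metis
  interpret dual_frame UNIV v l by (rule fr)
  interpret sw: dual_frame UNIV l v by (rule dual_frame_swap)
  define Z where "Z = (\<Sum>j\<in>UNIV. norm (v j)) + 1"
  have Z: "0 < Z" unfolding Z_def by (intro add_nonneg_pos sum_nonneg) auto
  have lower: "(norm \<xi>)\<^sup>2 \<le> Z\<^sup>2 * (\<xi> \<bullet> (A x *v \<xi>))" for \<xi>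
  proof -
    have "norm \<xi> \<le> sw.gauge_norm \<xi> * (\<Sum>j\<in>UNIV. norm (v j))"
      by (rule sw.norm_le_gauge_norm)
    also have "\<dots> \<le> sw.gauge_norm \<xi> * Z"
      by (intro mult_left_mono sw.gauge_norm_nonneg) (simp add: Z_def)
    finally have "(norm \<xi>)\<^sup>2 \<le> (sw.gauge_norm \<xi> * Z)\<^sup>2" by (intro power_mono) auto
    also have "\<dots> = Z\<^sup>2 * (\<xi> \<bullet> (A x *v \<xi>))"
      unfolding power_mult_distrib sw.gauge_norm_sq A
      by (simp add: inner_sum_right power2_eq_square inner_commute mult.commute)
    finally show ?thesis .
  qed
  have "\<forall>\<^sub>F y in at x within S. dist (A y) (A x) < 1 / (2 * Z\<^sup>2)"
    using cont Z unfolding continuous_within by (intro tendstoD) auto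
  then show ?thesis
  proof (eventually_elim, intro allI)
    fix y \<xi> assume y: "dist (A y) (A x) < 1 / (2 * Z\<^sup>2)"
    have "\<bar>\<xi> \<bullet> ((A x - A y) *v \<xi>)\<bar> \<le> norm \<xi> * (norm (A x - A y) * norm \<xi>)"
      by (rule order_trans[OF Cauchy_Schwarz_ineq2 mult_left_mono[OF norm_matrix_vector_mult_le]]) simp
    also have "\<dots> = norm (A x - A y) * (norm \<xi>)\<^sup>2" by (simp add: power2_eq_square)
    also have "\<dots> \<le> 1 / (2 * Z\<^sup>2) * (Z\<^sup>2 * (\<xi> \<bullet> (A x *v \<xi>)))"
      using y lower[of \<xi>] Z by (intro mult_mono) (auto simp: dist_norm norm_minus_commute)
    also have "\<dots> = (\<xi> \<bullet> (A x *v \<xi>)) / 2" using Z by simp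
    finally have "\<bar>\<xi> \<bullet> ((A x - A y) *v \<xi>)\<bar> \<le> (\<xi> \<bullet> (A x *v \<xi>)) / 2" .
    moreover have "\<xi> \<bullet> ((A x - A y) *v \<xi>) = \<xi> \<bullet> (A x *v \<xi>) - \<xi> \<bullet> (A y *v \<xi>)"
      by (simp add: matrix_vector_mult_diff_rdistrib inner_diff_right)
    ultimately show "\<xi> \<bullet> (A x *v \<xi>) \<le> 2 * (\<xi> \<bullet> (A y *v \<xi>))"
      by linarith
  qed
qed

lemma sum_lse_hess: "(\<Sum>j\<in>J. lse_hess P c e x (\<lambda>\<xi>. Q j \<xi>)) = lse_hess P c e x (\<lambda>\<xi>. \<Sum>j\<in>J. Q j \<xi>)"
  unfolding lse_hess_def sum_divide_distrib[symmetric] sum_distrib_left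
  by (subst sum.swap) simp

lemma lse_hess_scale: "lse_hess P c e x (\<lambda>\<xi>. k * Q \<xi>) = k * lse_hess P c e x Q"
  by (simp add: lse_hess_def sum_distrib_left mult.left_commute)

text \<open>A gauge-fine tagged division makes the density at nearby points at most its tag value
  plus \<open>z\<close>, and the form at the tag at most twice the nearby form. Each box with
  positive definite tag is packed by ellipsoids of its own frame. The factor 4 in
  \<open>K_le\<close> pays twice for a half: once for the error \<open>z\<close>, once for the
  packing. Doubling the form turns 32/7 into 64/7.\<close>

lemma det_transport_continuous:
  fixes A :: "real^'m::{finite,wellorder} \<Rightarrow> real^'m::{finite,wellorder}^'m::{finite,wellorder}"
  assumes m: "2 \<le> CARD('m)"
    and cont: "continuous_on (cbox a b) A"
    and sym: "\<And>x y z. x \<in> cbox a b \<Longrightarrow> y \<bullet> (A x *v z) = z \<bullet> (A x *v y)"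
    and psd: "\<And>x y. x \<in> cbox a b \<Longrightarrow> 0 \<le> y \<bullet> (A x *v y)"
    and K: "compact K" "0 < measure lborel K"
    and K_le: "4 * measure lborel K \<le> integral (cbox a b) (\<lambda>x. det (A x) powr (1 / real (CARD('m) - 1)))"
    and B: "0 \<le> B"
    and bound: "\<And>P c e. finite P \<Longrightarrow> P \<noteq> {} \<Longrightarrow> P \<subseteq> K \<Longrightarrow> 0 < e \<Longrightarrow>
       (\<integral>\<^sup>+x\<in>cbox a b. ennreal (lse_hess P c e x (\<lambda>\<xi>. \<xi> \<bullet> (A x *v \<xi>))) \<partial>lborel) \<le> ennreal B"
  shows "measure lborel K \<le> (64 / 7 * 4 ^ CARD('m)) * B"
proof -
  define g where "g x = det (A x) powr (1 / real (CARD('m) - 1))" for x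
  define J where "J = integral (cbox a b) g"
  have KJ: "4 * measure lborel K \<le> J" using K_le unfolding J_def g_def .
  then have J: "0 < J" using K by linarith
  have g_cont: "continuous_on (cbox a b) g"
    unfolding g_def
  proof (rule continuous_on_powr')
    show "continuous_on (cbox a b) (\<lambda>x. det (A x))"
      unfolding det_def using cont by (intro continuous_intros) auto
    show "\<forall>x\<in>cbox a b. 0 \<le> det (A x) \<and> (det (A x) = 0 \<longrightarrow> 0 < 1 / real (CARD('m) - 1))"
      using m psd_det_nonneg[OF sym psd] by auto
  qed (rule continuous_on_const)
  \<comment> \<open>The error summed over the whole box is then at most J / 2; the added 1 guards
    against a box of measure zero.\<close>
  define z where "z = J / (2 * (measure lborel (cbox a b) + 1))"
  have c0: "0 \<le> measure lborel (cbox a b)" by simp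
  have z0: "0 < z" using J c0 by (simp add: z_def add_nonneg_pos)
  have "z * (measure lborel (cbox a b) + 1) = J / 2"
    using c0 by (simp add: z_def field_simps add_nonneg_eq_0_iff)
  moreover have "z * measure lborel (cbox a b) \<le> z * (measure lborel (cbox a b) + 1)"
    using z0 by (intro mult_left_mono) auto
  ultimately have z: "0 < z" "z * measure lborel (cbox a b) \<le> J / 2"
    using z0 by linarith+
  have "\<exists>\<delta>>0. \<forall>y\<in>cbox a b. dist y x < \<delta> \<longrightarrow>
      g y \<le> g x + z \<and> (0 < det (A x) \<longrightarrow> (\<forall>\<xi>. \<xi> \<bullet> (A x *v \<xi>) \<le> 2 * (\<xi> \<bullet> (A y *v \<xi>))))" if x: "x \<in> cbox a b" for x
  proof -
    have "\<forall>\<^sub>F y in at x within cbox a b. g y \<le> g x + z"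
    proof -
      have "(g \<longlongrightarrow> g x) (at x within cbox a b)" using g_cont x by (auto simp: continuous_on_def)
      then have "\<forall>\<^sub>F y in at x within cbox a b. g y < g x + z"
        using z by (intro order_tendstoD(2)) auto
      then show ?thesis by (rule eventually_mono) simp
    qed
    moreover have "\<forall>\<^sub>F y in at x within cbox a b. (0 < det (A x) \<longrightarrow> (\<forall>\<xi>. \<xi> \<bullet> (A x *v \<xi>) \<le> 2 * (\<xi> \<bullet> (A y *v \<xi>))))"
    proof (cases "0 < det (A x)")
      case True
      have "\<forall>\<^sub>F y in at x within cbox a b. \<forall>\<xi>. \<xi> \<bullet> (A x *v \<xi>) \<le> 2 * (\<xi> \<bullet> (A y *v \<xi>))"
      proof (rule pd_locally_comparable[where A = A and x = x])
        show "y \<bullet> (A x *v z) = z \<bullet> (A x *v y)" for y z by (rule sym[OF x])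
        show "0 < y \<bullet> (A x *v y)" if "y \<noteq> 0" for y
          using True by (intro psd_det_nonzero_imp_pd[OF sym[OF x] psd[OF x] _ that]) simp
        show "continuous (at x within cbox a b) A"
          using cont x by (simp add: continuous_on_eq_continuous_within)
      qed
      then show ?thesis by (rule eventually_mono) simp
    qed simp
    ultimately have "\<forall>\<^sub>F y in at x within cbox a b. g y \<le> g x + z \<and> (0 < det (A x) \<longrightarrow> (\<forall>\<xi>. \<xi> \<bullet> (A x *v \<xi>) \<le> 2 * (\<xi> \<bullet> (A y *v \<xi>))))"
      by (rule eventually_conj)
    then obtain \<delta> where \<delta>: "0 < \<delta>" "\<And>y. y \<in> cbox a b \<Longrightarrow> y \<noteq> x \<Longrightarrow> dist y x < \<delta> \<Longrightarrow>
       g y \<le> g x + z \<and> (0 < det (A x) \<longrightarrow> (\<forall>\<xi>. \<xi> \<bullet> (A x *v \<xi>) \<le> 2 * (\<xi> \<bullet> (A y *v \<xi>))))"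
      unfolding eventually_at by blast
    show ?thesis
    proof (intro exI[of _ \<delta>] conjI ballI impI \<delta>(1))
      fix y assume y: "y \<in> cbox a b" "dist y x < \<delta>"
      show "g y \<le> g x + z" using \<delta>(2)[OF y(1) _ y(2)] z by (cases "y = x") auto
      fix \<xi> assume "0 < det (A x)"
      then show "\<forall>\<xi>. \<xi> \<bullet> (A x *v \<xi>) \<le> 2 * (\<xi> \<bullet> (A y *v \<xi>))"
        using \<delta>(2)[OF y(1) _ y(2)] psd[OF x] by (cases "y = x") auto
    qed
  qed
  then have "\<forall>x\<in>cbox a b. \<exists>\<delta>. 0 < \<delta> \<and> (\<forall>y\<in>cbox a b. dist y x < \<delta> \<longrightarrow>
      g y \<le> g x + z \<and> (0 < det (A x) \<longrightarrow> (\<forall>\<xi>. \<xi> \<bullet> (A x *v \<xi>) \<le> 2 * (\<xi> \<bullet> (A y *v \<xi>)))))"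
    by blast
  from bchoice[OF this] obtain \<delta> where \<delta>: "\<forall>x\<in>cbox a b. 0 < \<delta> x \<and> (\<forall>y\<in>cbox a b. dist y x < \<delta> x \<longrightarrow>
      g y \<le> g x + z \<and> (0 < det (A x) \<longrightarrow> (\<forall>\<xi>. \<xi> \<bullet> (A x *v \<xi>) \<le> 2 * (\<xi> \<bullet> (A y *v \<xi>)))))"
    by blast
  define \<gamma> where "\<gamma> x = ball x (if x \<in> cbox a b then \<delta> x else 1)" for x
  have "gauge \<gamma>" unfolding gauge_def \<gamma>_def using \<delta> by auto
  then obtain p where p: "p tagged_division_of (cbox a b)" "\<gamma> fine p"
    using fine_division_exists by blast
  have fin_p: "finite p" using p(1) by (rule tagged_division_of_finite)
  have tag: "x \<in> k" "k \<subseteq> cbox a b" "\<exists>u w. k = cbox u w" "k \<subseteq> ball x (\<delta> x)" "x \<in> cbox a b" if "(x, k) \<in> p" for x k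
  proof -
    show 1: "x \<in> k" "k \<subseteq> cbox a b" "\<exists>u w. k = cbox u w"
      using tagged_division_ofD(2-4)[OF p(1) that] by blast+
    then show "x \<in> cbox a b" by blast
    then show "k \<subseteq> ball x (\<delta> x)" using fineD[OF p(2) that] by (simp add: \<gamma>_def)
  qed
  have near: "g y \<le> g x + z" "0 < det (A x) \<Longrightarrow> \<xi> \<bullet> (A x *v \<xi>) \<le> 2 * (\<xi> \<bullet> (A y *v \<xi>))"
    if "(x, k) \<in> p" "y \<in> k" for x k y \<xi>
  proof -
    have "dist y x < \<delta> x" "y \<in> cbox a b" "x \<in> cbox a b"
      using tag[OF that(1)] that(2) by (auto simp: dist_commute)
    then show "g y \<le> g x + z" "0 < det (A x) \<Longrightarrow> \<xi> \<bullet> (A x *v \<xi>) \<le> 2 * (\<xi> \<bullet> (A y *v \<xi>))"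
      using \<delta> by blast+
  qed
  have g_int: "g integrable_on cbox a b" using g_cont by (rule integrable_continuous)
  have "J = (\<Sum>(x, k)\<in>p. integral k g)"
    unfolding J_def by (rule integral_combine_tagged_division_topdown[OF g_int p(1)])
  also have "\<dots> \<le> (\<Sum>(x, k)\<in>p. (g x + z) * measure lborel k)"
  proof (intro sum_mono, clarify)
    fix x k assume xk: "(x, k) \<in> p"
    obtain u w where k: "k = cbox u w" using tag(3)[OF xk] by blast
    have "integral k g \<le> integral k (\<lambda>_. g x + z)"
      using near(1)[OF xk] tag(2)[OF xk] unfolding k
      by (intro integral_le integrable_const integrable_on_subcbox[OF g_int]) auto
    then show "integral k g \<le> (g x + z) * measure lborel k" by (simp add: k mult.commute)
  qed
  also have "\<dots> = (\<Sum>(x, k)\<in>p. g x * measure lborel k) + z * (\<Sum>(x, k)\<in>p. measure lborel k)"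
    by (simp add: distrib_right sum.distrib sum_distrib_left case_prod_beta)
  also have "(\<Sum>(x, k)\<in>p. measure lborel k) = measure lborel (cbox a b)"
    by (rule additive_content_tagged_division[OF p(1)])
  finally have sum_g: "J / 2 \<le> (\<Sum>(x, k)\<in>p. g x * measure lborel k)" using z by linarith
  define p' where "p' = {xk\<in>p. 0 < det (A (fst xk))}"
  have fin_p': "finite p'" using fin_p by (simp add: p'_def)
  have "(\<Sum>(x, k)\<in>p. g x * measure lborel k) = (\<Sum>(x, k)\<in>p'. g x * measure lborel k)"
  proof (rule sum.mono_neutral_right[OF fin_p])
    show "\<forall>i\<in>p - p'. (case i of (x, k) \<Rightarrow> g x * measure lborel k) = 0"
    proof (clarify)
      fix x k assume "(x, k) \<in> p" "(x, k) \<notin> p'"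
      then have "det (A x) = 0"
        using psd_det_nonneg[OF sym psd, OF tag(5) tag(5)] by (force simp: p'_def)
      then show "g x * measure lborel k = 0" by (simp add: g_def)
    qed
  qed (auto simp: p'_def)
  with sum_g have sum_g': "J / 2 \<le> (\<Sum>(x, k)\<in>p'. g x * measure lborel k)" by simp
  define packs where "packs xk v l C \<longleftrightarrow> dual_frame UNIV v l \<and>
      (\<forall>\<xi>. A (fst xk) *v \<xi> = (\<Sum>j\<in>UNIV. (l j \<bullet> \<xi>) *\<^sub>R l j)) \<and> finite C \<and>
      (\<forall>x0 s. (x0, s) \<in> C \<longrightarrow> 0 < s \<and> dual_frame.ellipsoid UNIV v x0 s \<subseteq> interior (snd xk)) \<and>
      pairwise (\<lambda>i j. disjnt (dual_frame.ellipsoid UNIV v (fst i) (snd i)) (dual_frame.ellipsoid UNIV v (fst j) (snd j))) C \<and>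
      measure lborel (snd xk) \<le> 2 * (\<Sum>(x0, s)\<in>C. measure lborel (dual_frame.ellipsoid UNIV v x0 s))"
    for xk :: "(real^'m::{finite,wellorder}) \<times> (real^'m::{finite,wellorder}) set"
      and v l :: "'m::{finite,wellorder} \<Rightarrow> real^'m::{finite,wellorder}"
      and C :: "((real^'m::{finite,wellorder}) \<times> real) set"
  have "\<exists>w. packs xk (fst w) (fst (snd w)) (snd (snd w))" if xk: "xk \<in> p'" for xk
  proof -
    have xp: "(fst xk, snd xk) \<in> p" and det: "0 < det (A (fst xk))" using xk by (auto simp: p'_def)
    have x: "fst xk \<in> cbox a b" by (rule tag(5)[OF xp])
    have pd: "0 < y \<bullet> (A (fst xk) *v y)" if "y \<noteq> 0" for y
      using det by (intro psd_det_nonzero_imp_pd[OF sym[OF x] psd[OF x] _ that]) simp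
    obtain v l :: "'m::{finite,wellorder} \<Rightarrow> real^'m::{finite,wellorder}" where fr: "dual_frame UNIV v l"
      and Al: "\<And>\<xi>. A (fst xk) *v \<xi> = (\<Sum>j\<in>UNIV. (l j \<bullet> \<xi>) *\<^sub>R l j)"
      using pd_dual_frame[OF sym[OF x] pd] by metis
    obtain u w where k: "snd xk = cbox u w" using tag(3)[OF xp] by blast
    have "open (interior (snd xk))" "bounded (interior (snd xk))"
      using k by (auto simp: interior_cbox)
    from ellipsoid_packing[OF fr this] obtain C where C: "finite C"
      "\<And>x0 s. (x0, s) \<in> C \<Longrightarrow> 0 < s \<and> dual_frame.ellipsoid UNIV v x0 s \<subseteq> interior (snd xk)"
      "pairwise (\<lambda>i j. disjnt (dual_frame.ellipsoid UNIV v (fst i) (snd i)) (dual_frame.ellipsoid UNIV v (fst j) (snd j))) C"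
      "measure lborel (interior (snd xk)) \<le> 2 * (\<Sum>(x0, s)\<in>C. measure lborel (dual_frame.ellipsoid UNIV v x0 s))"
      by blast
    have "measure lborel (interior (snd xk)) = measure lborel (snd xk)"
      unfolding k interior_cbox by (simp add: measure_lborel_box_eq measure_lborel_cbox_eq)
    with C have "packs xk v l C" unfolding packs_def using fr Al by simp
    then show ?thesis by (intro exI[of _ "(v, l, C)"]) simp
  qed
  then have "\<forall>xk\<in>p'. \<exists>w. packs xk (fst w) (fst (snd w)) (snd (snd w))" by blast
  from bchoice[OF this] obtain w where w: "\<forall>xk\<in>p'. packs xk (fst (w xk)) (fst (snd (w xk))) (snd (snd (w xk)))"
    by blast
  define v l C where "v xk = fst (w xk)" and "l xk = fst (snd (w xk))" and "C xk = snd (snd (w xk))" for xk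
  have packs: "packs xk (v xk) (l xk) (C xk)" if "xk \<in> p'" for xk
    using w that unfolding v_def l_def C_def by blast
  have fr: "dual_frame UNIV (v xk) (l xk)" and Al: "A (fst xk) *v \<xi> = (\<Sum>j\<in>UNIV. (l xk j \<bullet> \<xi>) *\<^sub>R l xk j)"
    and fin_C: "finite (C xk)"
    and C_disj: "pairwise (\<lambda>i j. disjnt (dual_frame.ellipsoid UNIV (v xk) (fst i) (snd i)) (dual_frame.ellipsoid UNIV (v xk) (fst j) (snd j))) (C xk)"
    and C_vol: "measure lborel (snd xk) \<le> 2 * (\<Sum>(x0, s)\<in>C xk. measure lborel (dual_frame.ellipsoid UNIV (v xk) x0 s))"
    if "xk \<in> p'" for xk \<xi>
    using packs[OF that] unfolding packs_def by auto
  have C_in: "0 < snd i" "dual_frame.ellipsoid UNIV (v xk) (fst i) (snd i) \<subseteq> interior (snd xk)"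
    if "xk \<in> p'" "i \<in> C xk" for xk i
    using packs[OF that(1)] that(2) unfolding packs_def by (metis prod.collapse)+
  define I where "I = Sigma p' C"
  define E where "E i = dual_frame.ellipsoid UNIV (v (fst i)) (fst (snd i)) (snd (snd i))" for i
  have fin_I: "finite I" unfolding I_def using fin_p' fin_C by auto
  have E_in: "E i \<subseteq> interior (snd (fst i))" "E i \<subseteq> snd (fst i)" if "i \<in> I" for i
  proof -
    have "fst i \<in> p'" "snd i \<in> C (fst i)" using that by (auto simp: I_def)
    then show "E i \<subseteq> interior (snd (fst i))" unfolding E_def by (rule C_in(2))
    then show "E i \<subseteq> snd (fst i)" using interior_subset by blast
  qed
  have disj: "disjoint_family_on E I"
    unfolding disjoint_family_on_def
  proof (intro ballI impI)
    fix i j assume ij: "i \<in> I" "j \<in> I" "i \<noteq> j"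
    show "E i \<inter> E j = {}"
    proof (cases "fst i = fst j")
      case True
      then have "snd i \<noteq> snd j" using ij by (simp add: prod_eq_iff)
      then show ?thesis
      proof -
        have mem: "fst i \<in> p'" "snd i \<in> C (fst i)" "snd j \<in> C (fst i)"
          using ij True by (auto simp: I_def)
        from pairwiseD[OF C_disj[OF mem(1)] mem(2,3) \<open>snd i \<noteq> snd j\<close>] show ?thesis
          using True by (simp add: E_def disjnt_def)
      qed
    next
      case False
      have "interior (snd (fst i)) \<inter> interior (snd (fst j)) = {}"
        using ij False tagged_division_ofD(5)[OF p(1), of "fst (fst i)" "snd (fst i)" "fst (fst j)" "snd (fst j)"]
        by (auto simp: I_def p'_def)
      then show ?thesis using E_in(1) ij by blast
    qed
  qed
  have E_meas: "E i \<in> sets borel" if "i \<in> I" for i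
    unfolding E_def using that by (auto simp: I_def intro!: borel_open dual_frame.open_ellipsoid[OF fr])
  show ?thesis
  proof -
    have "measure lborel K \<le> (32 / 7 * 4 ^ CARD('m)) * (2 * B)"
    proof (rule det_transport_discrete[where I = I and A = "\<lambda>i. A (fst (fst i))" and v = "\<lambda>i. v (fst i)"
          and l = "\<lambda>i. l (fst i)" and ?x0.0 = "\<lambda>i. fst (snd i)" and s = "\<lambda>i. snd (snd i)"])
      show "measure lborel K \<le> (\<Sum>i\<in>I. det (A (fst (fst i))) powr (1 / real (CARD('m) - 1)) *
          measure lborel (dual_frame.ellipsoid UNIV (v (fst i)) (fst (snd i)) (snd (snd i))))"
      proof -
        have "J / 2 \<le> (\<Sum>(x, k)\<in>p'. g x * measure lborel k)" by (rule sum_g')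
        also have "\<dots> \<le> (\<Sum>xk\<in>p'. g (fst xk) * (2 * (\<Sum>i\<in>C xk. measure lborel (E (xk, i)))))"
        proof (rule sum_mono)
          fix xk assume "xk \<in> p'"
          from C_vol[OF this] have "g (fst xk) * measure lborel (snd xk) \<le> g (fst xk) * (2 * (\<Sum>i\<in>C xk. measure lborel (E (xk, i))))"
            by (intro mult_left_mono) (simp_all add: g_def E_def case_prod_beta)
          then show "(case xk of (x, k) \<Rightarrow> g x * measure lborel k) \<le> g (fst xk) * (2 * (\<Sum>i\<in>C xk. measure lborel (E (xk, i))))"
            by (simp add: case_prod_beta)
        qed
        also have "\<dots> = 2 * (\<Sum>xk\<in>p'. \<Sum>i\<in>C xk. g (fst xk) * measure lborel (E (xk, i)))"
          by (simp add: sum_distrib_left mult.left_commute)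
        also have "(\<Sum>xk\<in>p'. \<Sum>i\<in>C xk. g (fst xk) * measure lborel (E (xk, i))) = (\<Sum>i\<in>I. g (fst (fst i)) * measure lborel (E i))"
          unfolding I_def using fin_p' fin_C by (subst sum.Sigma) (auto simp: case_prod_beta)
        finally show ?thesis using KJ unfolding g_def E_def by linarith
      qed
      fix P :: "(real^'m::{finite,wellorder}) set" and c and e :: real
      assume P: "finite P" "P \<noteq> {}" "P \<subseteq> K" and e: "0 < e"
      define H where "H x = lse_hess P c e x (\<lambda>\<xi>. \<xi> \<bullet> (A x *v \<xi>))" for x
      have H_cont: "continuous_on (cbox a b) H"
        unfolding H_def lse_hess_def matrix_vector_mult_def using e
        by (intro continuous_intros continuous_on_lse_weight continuous_on_lse_grad P e cont) auto
      define HH where "HH x = ennreal (indicator (cbox a b) x *\<^sub>R H x)" for x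
      have [measurable]: "HH \<in> borel_measurable borel"
        unfolding HH_def
        by (intro measurable_compose[OF borel_measurable_continuous_on_indicator[OF _ H_cont] measurable_ennreal]) simp
      have H_nonneg: "0 \<le> H x" if "x \<in> cbox a b" for x
        unfolding H_def using psd[OF that] by (rule lse_hess_nonneg[OF P(1,2) e])
      have "(\<Sum>i\<in>I. \<integral>\<^sup>+x\<in>E i. ennreal (\<Sum>j\<in>UNIV. lse_hess P c e x (\<lambda>\<xi>. (l (fst i) j \<bullet> \<xi>)\<^sup>2)) \<partial>lborel)
        \<le> (\<Sum>i\<in>I. \<integral>\<^sup>+x. 2 * HH x * indicator (E i) x \<partial>lborel)"
      proof (intro sum_mono nn_integral_mono)
        fix i x assume i: "i \<in> I"
        show "ennreal (\<Sum>j\<in>UNIV. lse_hess P c e x (\<lambda>\<xi>. (l (fst i) j \<bullet> \<xi>)\<^sup>2)) * indicator (E i) x \<le> 2 * HH x * indicator (E i) x"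
        proof (cases "x \<in> E i")
          case True
          have fi: "fst i \<in> p'" "(fst (fst i), snd (fst i)) \<in> p" "0 < det (A (fst (fst i)))"
            using i by (auto simp: I_def p'_def)
          have xk: "x \<in> snd (fst i)" using E_in(2)[OF i] True by blast
          then have xc: "x \<in> cbox a b" using tag(2)[OF fi(2)] by blast
          have "(\<Sum>j\<in>UNIV. lse_hess P c e x (\<lambda>\<xi>. (l (fst i) j \<bullet> \<xi>)\<^sup>2)) = lse_hess P c e x (\<lambda>\<xi>. \<xi> \<bullet> (A (fst (fst i)) *v \<xi>))"
            unfolding sum_lse_hess Al[OF fi(1)] by (simp add: inner_sum_right power2_eq_square inner_commute)
          also have "\<dots> \<le> lse_hess P c e x (\<lambda>\<xi>. 2 * (\<xi> \<bullet> (A x *v \<xi>)))"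
            by (rule lse_hess_mono[OF P(1,2) e near(2)[OF fi(2) xk fi(3)]])
          also have "\<dots> = 2 * H x" by (simp add: lse_hess_scale H_def)
          finally have "ennreal (\<Sum>j\<in>UNIV. lse_hess P c e x (\<lambda>\<xi>. (l (fst i) j \<bullet> \<xi>)\<^sup>2)) \<le> ennreal (2 * H x)"
            by (rule ennreal_leI)
          also have "\<dots> = 2 * HH x" using xc H_nonneg[OF xc] by (simp add: HH_def ennreal_mult)
          finally show ?thesis using True by simp
        qed simp
      qed
      also have "\<dots> = (\<integral>\<^sup>+x. (\<Sum>i\<in>I. 2 * HH x * indicator (E i) x) \<partial>lborel)"
        using E_meas by (intro nn_integral_sum[symmetric]) auto
      also have "\<dots> \<le> (\<integral>\<^sup>+x. 2 * HH x \<partial>lborel)"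
      proof (intro nn_integral_mono)
        fix x
        have "(\<Sum>i\<in>I. indicator (E i) x) = (indicator (\<Union>i\<in>I. E i) x :: ennreal)"
          using fin_I disj by (simp add: indicator_UN_disjoint)
        also have "\<dots> \<le> 1" by (simp add: indicator_def)
        finally have "2 * HH x * (\<Sum>i\<in>I. indicator (E i) x) \<le> 2 * HH x * 1"
          by (rule mult_left_mono) simp
        then show "(\<Sum>i\<in>I. 2 * HH x * indicator (E i) x) \<le> 2 * HH x"
          by (simp add: sum_distrib_left)
      qed
      also have "\<dots> = 2 * (\<integral>\<^sup>+x. HH x \<partial>lborel)" by (intro nn_integral_cmult) simp
      also have "(\<integral>\<^sup>+x. HH x \<partial>lborel) = (\<integral>\<^sup>+x\<in>cbox a b. ennreal (H x) \<partial>lborel)"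
        by (intro nn_integral_cong) (simp add: HH_def split: split_indicator)
      also have "2 * \<dots> \<le> 2 * ennreal B"
        unfolding H_def by (intro mult_left_mono bound P e) auto
      also have "\<dots> = ennreal (2 * B)" using B by (simp add: ennreal_mult)
      finally show "(\<Sum>i\<in>I. \<integral>\<^sup>+x\<in>dual_frame.ellipsoid UNIV (v (fst i)) (fst (snd i)) (snd (snd i)).
          ennreal (\<Sum>j\<in>UNIV. lse_hess P c e x (\<lambda>\<xi>. (l (fst i) j \<bullet> \<xi>)\<^sup>2)) \<partial>lborel) \<le> ennreal (2 * B)"
        unfolding E_def .
    qed (use fin_I m fr Al C_in K B in \<open>auto simp: I_def p'_def\<close>)
    then show ?thesis by simp
  qed
qed

section \<open>Matrix fields indexed by time and space\<close>

text \<open>A well-ordered copy of a finite type: the library has the change of variables formula for linear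
  maps only over index types of class \<open>wellorder\<close>.\<close>

typedef 'a wo = "UNIV :: 'a set" morphisms unwo towo ..

lemma towo_unwo [simp]: "towo (unwo x) = x" and unwo_towo [simp]: "unwo (towo y) = y"
  by (simp_all add: unwo_inverse towo_inverse)

lemma bij_unwo: "bij unwo"
  by (rule bij_betw_byWitness[where f' = towo]) auto

instance wo :: (finite) finite
proof
  have "(UNIV :: 'a wo set) = towo ` UNIV"
    by (metis UNIV_eq_I rangeI towo_unwo)
  then show "finite (UNIV :: 'a wo set)" by (metis finite finite_imageI)
qed

instantiation wo :: (finite) wellorder
begin

definition less_eq_wo :: "'a wo \<Rightarrow> 'a wo \<Rightarrow> bool" where
  "x \<le> y \<longleftrightarrow> to_nat (unwo x) \<le> to_nat (unwo y)"

definition less_wo :: "'a wo \<Rightarrow> 'a wo \<Rightarrow> bool" where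
  "x < y \<longleftrightarrow> to_nat (unwo x) < to_nat (unwo y)"

instance
proof
  fix P :: "'a wo \<Rightarrow> bool" and a
  assume step: "\<And>x. (\<And>y. y < x \<Longrightarrow> P y) \<Longrightarrow> P x"
  show "P a"
    by (induction a rule: measure_induct_rule[where f = "\<lambda>x. to_nat (unwo x)"])
      (rule step, simp add: less_wo_def)
qed (auto simp: less_eq_wo_def less_wo_def unwo_inject)

end

lemma CARD_wo: "CARD('a::finite wo) = CARD('a)"
  using bij_betw_same_card[OF bij_unwo] by simp

text \<open>Induction over transpositions: conjugation by \<open>b\<close> carries the transposition
  of x and y to that of b x and b y. The two index types may differ.\<close>

lemma sign_conjugate:
  fixes b :: "'k::finite \<Rightarrow> 'l::finite"
  assumes b: "bij b" and p: "p permutes UNIV"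
  shows "sign (b \<circ> p \<circ> inv b) = sign p"
  using p finite
proof (induction p rule: permutes_induct)
  case id
  have "b \<circ> id \<circ> inv b = id"
    using bij_is_surj[OF b] unfolding surj_iff by simp
  then show ?case by (simp add: sign_id)
next
  case (swap x y p)
  have inv: "inv b (b z) = z" "b (inv b z') = z'" for z z'
    using b by (simp_all add: bij_is_inj bij_is_surj surj_f_inv_f)
  have bb: "b s = b t \<longleftrightarrow> s = t" for s t
    using b by (auto simp: bij_def inj_on_def)
  have eq: "b \<circ> (Transposition.transpose x y \<circ> p) \<circ> inv b = Transposition.transpose (b x) (b y) \<circ> (b \<circ> p \<circ> inv b)"
    by (rule ext) (auto simp: Transposition.transpose_def inv bb)
  have "bij p" using swap.hyps by (simp add: permutes_bij)
  then have "bij (b \<circ> p \<circ> inv b)"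
    using b by (intro bij_comp bij_imp_bij_inv)
  then have "permutation (b \<circ> p \<circ> inv b)" "permutation p"
    using \<open>bij p\<close> by (simp_all add: permutation)
  note sign_eqs = sign_compose[OF permutation_swap_id this(1)] sign_compose[OF permutation_swap_id this(2)]
  moreover have IH: "sign (b \<circ> p \<circ> inv b) = sign p" and "b x \<noteq> b y" "x \<noteq> y"
    using swap bb[of x y] by blast+
  ultimately show ?case
    unfolding eq sign_eqs sign_swap_id IH by simp
qed

text \<open>Conjugation by \<open>b\<close> is a sign-preserving bijection between the two
  permutation groups, so it reindexes the Leibniz sum.\<close>

lemma det_reindex:
  fixes b :: "'k::finite \<Rightarrow> 'l::finite" and B :: "'l \<Rightarrow> 'l \<Rightarrow> 'a::comm_ring_1"
  assumes b: "bij b"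
  shows "det (\<chi> i j. B (b i) (b j)) = det (\<chi> i j. B i j)"
proof -
  have inv: "inv b (b z) = z" "b (inv b z') = z'" for z z'
    using b by (simp_all add: bij_is_inj bij_is_surj surj_f_inv_f)
  define C where "C p = b \<circ> p \<circ> inv b" for p
  have perm: "p permutes (UNIV :: 'c set) \<longleftrightarrow> bij p" for p :: "'c::finite \<Rightarrow> 'c"
    using bij_imp_permutes[of p UNIV] permutes_bij[of p UNIV] by blast
  have "bij_betw C {p. p permutes UNIV} {p. p permutes UNIV}"
  proof (rule bij_betw_byWitness[where f' = "\<lambda>q. inv b \<circ> q \<circ> b"])
    show "C ` {p. p permutes UNIV} \<subseteq> {p. p permutes UNIV}"
      using b unfolding perm C_def by (auto intro!: bij_comp bij_imp_bij_inv)
    show "(\<lambda>q. inv b \<circ> q \<circ> b) ` {p. p permutes UNIV} \<subseteq> {p. p permutes UNIV}"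
      using b unfolding perm by (auto intro!: bij_comp bij_imp_bij_inv)
  qed (auto simp: C_def fun_eq_iff inv)
  then have "det (\<chi> i j. B i j) = (\<Sum>p\<in>{p. p permutes UNIV}. of_int (sign (C p)) * (\<Prod>i\<in>UNIV. B i (C p i)))"
    unfolding det_def by (subst sum.reindex_bij_betw[symmetric, of C]) auto
  also have "\<dots> = (\<Sum>p\<in>{p. p permutes UNIV}. of_int (sign p) * (\<Prod>i\<in>UNIV. B (b i) (b (p i))))"
  proof (intro sum.cong refl)
    fix p :: "'k \<Rightarrow> 'k" assume "p \<in> {p. p permutes UNIV}"
    then have "sign (C p) = sign p" unfolding C_def using sign_conjugate[OF b] by simp
    moreover have "(\<Prod>i\<in>UNIV. B i (C p i)) = (\<Prod>i\<in>UNIV. B (b i) (C p (b i)))"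
      using b by (intro prod.reindex_bij_betw[symmetric]) simp
    ultimately show "of_int (sign (C p)) * (\<Prod>i\<in>UNIV. B i (C p i)) = of_int (sign p) * (\<Prod>i\<in>UNIV. B (b i) (b (p i)))"
      by (simp add: C_def inv)
  qed
  also have "\<dots> = det (\<chi> i j. B (b i) (b j))"
    unfolding det_def by simp
  finally show ?thesis by simp
qed

section \<open>Time-space as a coordinate space indexed by None (time) and Some j (space)\<close>

definition coord :: "'n::finite option \<Rightarrow> real \<times> (real^'n) \<Rightarrow> real" where
  "coord i x = (case i of None \<Rightarrow> fst x | Some j \<Rightarrow> snd x $ j)"

definition unit :: "'n::finite option \<Rightarrow> real \<times> (real^'n)" where
  "unit i = (case i of None \<Rightarrow> (1, 0) | Some j \<Rightarrow> (0, axis j 1))"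

lemma sum_option: "(\<Sum>i\<in>UNIV. h i) = h None + (\<Sum>j\<in>UNIV. h (Some j))" for h :: "'n::finite option \<Rightarrow> 'a::comm_monoid_add"
  unfolding UNIV_option_conv by (simp add: sum.reindex)

lemma inner_coord: "x \<bullet> y = (\<Sum>i\<in>UNIV. coord i x * coord i y)"
  by (simp add: sum_option coord_def inner_prod_def inner_vec_def)

lemma unit_expand: "x = (\<Sum>i\<in>UNIV. coord i x *\<^sub>R unit i)"
proof -
  have "snd x = (\<Sum>j\<in>UNIV. (snd x $ j) *\<^sub>R axis j 1)"
    using basis_expansion[of "snd x"] by (simp add: scalar_mult_eq_scaleR)
  then show ?thesis
    by (simp add: sum_option coord_def unit_def prod_eq_iff fst_sum snd_sum)
qed

lemma linear_coord: "linear (coord i)"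
  by (rule linearI) (auto simp: coord_def split: option.splits)

definition to_vec :: "real \<times> (real^'n) \<Rightarrow> real^('n::finite option wo)" where
  "to_vec x = (\<chi> i. coord (unwo i) x)"

definition of_vec :: "real^('n::finite option wo) \<Rightarrow> real \<times> (real^'n)" where
  "of_vec z = (z $ towo None, \<chi> j. z $ towo (Some j))"

lemma coord_of_vec [simp]: "coord i (of_vec z) = z $ towo i"
  by (cases i) (simp_all add: coord_def of_vec_def)

lemma to_vec_of_vec [simp]: "to_vec (of_vec z) = z"
  by (simp add: to_vec_def vec_eq_iff)

lemma of_vec_to_vec [simp]: "of_vec (to_vec x) = x"
  by (simp add: to_vec_def of_vec_def coord_def prod_eq_iff vec_eq_iff)

lemma linear_of_vec: "linear of_vec"
  by (rule linearI) (auto simp: of_vec_def vec_eq_iff)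

lemma linear_to_vec: "linear to_vec"
  by (intro linearI) (simp_all add: to_vec_def vec_eq_iff linear_add[OF linear_coord] linear_scale[OF linear_coord])

lemma sum_wo: "(\<Sum>i\<in>UNIV. h (unwo i)) = (\<Sum>i\<in>UNIV. h i)" for h :: "'a::finite \<Rightarrow> 'b::comm_monoid_add"
  using bij_unwo by (rule sum.reindex_bij_betw)

lemma prod_wo: "(\<Prod>i\<in>UNIV. h (unwo i)) = (\<Prod>i\<in>UNIV. h i)" for h :: "'a::finite \<Rightarrow> 'b::comm_monoid_mult"
  using bij_unwo by (rule prod.reindex_bij_betw)

lemma inner_to_vec: "to_vec x \<bullet> to_vec y = x \<bullet> y"
  using sum_wo[of "\<lambda>i. coord i x * coord i y"] by (simp add: inner_vec_def to_vec_def inner_coord)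

lemma inner_of_vec: "of_vec x \<bullet> of_vec y = x \<bullet> y"
  using inner_to_vec[of "of_vec x" "of_vec y"] by simp

lemma continuous_on_of_vec: "continuous_on S of_vec"
  by (rule linear_continuous_on[OF linear_conv_bounded_linear[THEN iffD1, OF linear_of_vec]])

lemma continuous_on_to_vec: "continuous_on S to_vec"
  by (rule linear_continuous_on[OF linear_conv_bounded_linear[THEN iffD1, OF linear_to_vec]])

lemma prod_option: "(\<Prod>i\<in>UNIV. h i) = h None * (\<Prod>j\<in>UNIV. h (Some j))" for h :: "'n::finite option \<Rightarrow> 'a::comm_monoid_mult"
  unfolding UNIV_option_conv by (simp add: prod.reindex)

lemma all_option: "(\<forall>i. Q i) \<longleftrightarrow> Q None \<and> (\<forall>j. Q (Some j))"
  by (metis not_None_eq)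

lemma mem_box_coord:
  "x \<in> cbox a b \<longleftrightarrow> (\<forall>i. coord i a \<le> coord i x \<and> coord i x \<le> coord i b)"
  "x \<in> box a b \<longleftrightarrow> (\<forall>i. coord i a < coord i x \<and> coord i x < coord i b)"
  by (cases x; cases a; cases b; auto simp: all_option coord_def cbox_Pair_eq box_def Basis_prod_def mem_box_cart
      Basis_vec_def inner_axis cbox_def)+

lemma all_wo: "(\<forall>i. Q (unwo i)) \<longleftrightarrow> (\<forall>i. Q i)"
  by (metis unwo_towo)

lemma vimage_of_vec_box:
  fixes a b :: "real \<times> (real^'n::finite)"
  shows "of_vec -` cbox a b = cbox (to_vec a) (to_vec b)" "of_vec -` box a b = box (to_vec a) (to_vec b)"
proof -
  have "z \<in> of_vec -` cbox a b \<longleftrightarrow> z \<in> cbox (to_vec a) (to_vec b)"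
    "z \<in> of_vec -` box a b \<longleftrightarrow> z \<in> box (to_vec a) (to_vec b)" for z
    using all_wo[of "\<lambda>i. coord i a \<le> z $ towo i \<and> z $ towo i \<le> coord i b"]
      all_wo[of "\<lambda>i. coord i a < z $ towo i \<and> z $ towo i < coord i b"]
    by (simp_all add: mem_box_coord mem_box_cart to_vec_def)
  then show "of_vec -` cbox a b = cbox (to_vec a) (to_vec b)" "of_vec -` box a b = box (to_vec a) (to_vec b)"
    by blast+
qed

lemma prod_Basis_coord: "(\<Prod>b\<in>Basis. x \<bullet> b) = (\<Prod>i\<in>UNIV. coord i x)"
proof -
  have "(\<Prod>b\<in>Basis. x \<bullet> b) = fst x * (\<Prod>b\<in>Basis. snd x \<bullet> b)"
    unfolding Basis_prod_def
    by (subst prod.union_disjoint) (auto simp: prod.reindex inj_on_def inner_prod_def)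
  also have "(\<Prod>b\<in>Basis. snd x \<bullet> b) = (\<Prod>j\<in>UNIV. snd x $ j)"
    unfolding Basis_vec_def
    by (subst prod.UNION_disjoint) (auto simp: inner_axis axis_eq_axis)
  finally show ?thesis by (simp add: prod_option coord_def)
qed

text \<open>The preimage of a box is the box with the same side lengths in another order, and
  Lebesgue measure is determined by its values on boxes.\<close>

lemma lborel_of_vec: "lborel = distr lborel borel (of_vec :: real^('n::finite option wo) \<Rightarrow> _)"
proof (rule lborel_eqI)
  have [measurable]: "(of_vec :: real^('n::finite option wo) \<Rightarrow> _) \<in> borel_measurable borel"
    by (intro borel_measurable_continuous_onI continuous_on_of_vec)
  fix l u :: "real \<times> (real^'n)" assume le: "\<And>b. b \<in> Basis \<Longrightarrow> l \<bullet> b \<le> u \<bullet> b"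
  have ci: "coord i l \<le> coord i u" for i
  proof (cases i)
    case None
    then show ?thesis using le[of "(1, 0)"] by (simp add: coord_def Basis_prod_def inner_prod_def)
  next
    case (Some j)
    then show ?thesis using le[of "(0, axis j 1)"]
      by (auto simp: coord_def Basis_prod_def inner_prod_def Basis_vec_def inner_axis image_iff)
  qed
  have "emeasure (distr lborel borel of_vec) (box l u) = emeasure lborel (of_vec -` box l u :: (real^('n option wo)) set)"
    by (subst emeasure_distr) auto
  also have "\<dots> = emeasure lborel (box (to_vec l) (to_vec u))"
    by (simp add: vimage_of_vec_box)
  also have "\<dots> = (\<Prod>b\<in>Basis. (to_vec u - to_vec l) \<bullet> b)"
    by (rule emeasure_lborel_box) (use ci in \<open>auto simp: Basis_vec_def inner_axis to_vec_def\<close>)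
  also have "(\<Prod>b\<in>Basis. (to_vec u - to_vec l) \<bullet> b) = (\<Prod>i\<in>UNIV. (to_vec u - to_vec l) $ i)"
    unfolding Basis_vec_def
    by (subst prod.UNION_disjoint) (auto simp: inner_axis axis_eq_axis)
  also have "\<dots> = (\<Prod>i\<in>UNIV. coord i (u - l))"
  proof -
    have "(to_vec u - to_vec l) $ i = coord (unwo i) (u - l)" for i
      by (simp add: to_vec_def linear_diff[OF linear_coord])
    from prod_wo[of "\<lambda>i. coord i (u - l)"] this show ?thesis by (simp only:)
  qed
  finally show "emeasure (distr lborel borel (of_vec :: real^('n option wo) \<Rightarrow> _)) (box l u) = ennreal (\<Prod>b\<in>Basis. (u - l) \<bullet> b)"
    by (simp add: prod_Basis_coord)
qed simp

definition lift :: "real^'n \<Rightarrow> 'n::finite option \<Rightarrow> real" where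
  "lift v i = (case i of None \<Rightarrow> 1 | Some j \<Rightarrow> v $ j)"

text \<open>Expanding both determinants by Leibniz, Fubini turns the term of \<sigma> and \<tau>
  into the product of the entries A(\<sigma> i, \<tau> i). For fixed \<sigma> the signed sum over
  \<tau> is the determinant of A with rows permuted by \<sigma>; the two signs of \<sigma> cancel
  and each of the (n+1)! permutations contributes det A.\<close>

lemma det_integral_Andreief:
  fixes g :: "real^'n::finite \<Rightarrow> real"
  assumes g: "\<And>v. 0 \<le> g v"
    and int: "\<And>i j. integrable lborel (\<lambda>v. g v * lift v i * lift v j)"
  shows "(\<integral>\<^sup>+ V. ennreal ((\<Prod>i\<in>UNIV. g (V i)) * (Delta V)\<^sup>2) \<partial>(PiM UNIV (\<lambda>_::'n option. lborel)))
    = ennreal (fact (CARD('n) + 1) * det (\<chi> i j. (\<integral>v. g v * lift v i * lift v j \<partial>lborel) :: real^('n option)^('n option)))"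
proof -
  interpret product_sigma_finite "\<lambda>_::'n option. lborel :: (real^'n) measure" ..
  let ?M = "PiM UNIV (\<lambda>_::'n option. lborel :: (real^'n) measure)"
  let ?S = "{p. p permutes (UNIV :: 'n option set)}"
  define A :: "real^('n option)^('n option)" where "A = (\<chi> i j. (\<integral>v. g v * lift v i * lift v j \<partial>lborel))"
  define h where "h \<sigma> \<tau> i v = g v * lift v (\<sigma> i) * lift v (\<tau> i)" for \<sigma> \<tau> :: "'n option \<Rightarrow> 'n option" and i v
  have Delta_eq: "Delta V = (\<Sum>\<sigma>\<in>?S. of_int (sign \<sigma>) * (\<Prod>i\<in>UNIV. lift (V i) (\<sigma> i)))" for V
    unfolding Delta_def by (subst det_transpose[symmetric]) (simp add: det_def transpose_def lift_def)
  have expand: "(\<Prod>i\<in>UNIV. g (V i)) * (Delta V)\<^sup>2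
    = (\<Sum>\<sigma>\<in>?S. \<Sum>\<tau>\<in>?S. of_int (sign \<sigma>) * of_int (sign \<tau>) * (\<Prod>i\<in>UNIV. h \<sigma> \<tau> i (V i)))" for V
  proof -
    have "(\<Prod>i\<in>UNIV. g (V i)) * (Delta V)\<^sup>2
      = (\<Sum>\<sigma>\<in>?S. \<Sum>\<tau>\<in>?S. (\<Prod>i\<in>UNIV. g (V i)) * ((of_int (sign \<sigma>) * (\<Prod>i\<in>UNIV. lift (V i) (\<sigma> i))) *
          (of_int (sign \<tau>) * (\<Prod>i\<in>UNIV. lift (V i) (\<tau> i)))))"
      unfolding power2_eq_square Delta_eq sum_product by (simp add: sum_distrib_left)
    then show ?thesis
      by (simp add: h_def prod.distrib ac_simps)
  qed
  have hint: "integrable lborel (h \<sigma> \<tau> i)" for \<sigma> \<tau> i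
    unfolding h_def by (rule int)
  have pint: "integrable ?M (\<lambda>V. \<Prod>i\<in>UNIV. h \<sigma> \<tau> i (V i))"
    and pval: "(\<integral>V. (\<Prod>i\<in>UNIV. h \<sigma> \<tau> i (V i)) \<partial>?M) = (\<Prod>i\<in>UNIV. A $ \<sigma> i $ \<tau> i)" for \<sigma> \<tau>
  proof -
    show "integrable ?M (\<lambda>V. \<Prod>i\<in>UNIV. h \<sigma> \<tau> i (V i))"
      using hint by (intro product_integrable_prod) auto
    have "(\<integral>V. (\<Prod>i\<in>UNIV. h \<sigma> \<tau> i (V i)) \<partial>?M) = (\<Prod>i\<in>UNIV. \<integral>v. h \<sigma> \<tau> i v \<partial>lborel)"
      using hint by (intro product_integral_prod) auto
    then show "(\<integral>V. (\<Prod>i\<in>UNIV. h \<sigma> \<tau> i (V i)) \<partial>?M) = (\<Prod>i\<in>UNIV. A $ \<sigma> i $ \<tau> i)"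
      by (simp only: A_def h_def vec_lambda_beta)
  qed
  have "(\<integral>V. (\<Prod>i\<in>UNIV. g (V i)) * (Delta V)\<^sup>2 \<partial>?M)
    = (\<Sum>\<sigma>\<in>?S. of_int (sign \<sigma>) * (\<Sum>\<tau>\<in>?S. of_int (sign \<tau>) * (\<Prod>i\<in>UNIV. A $ \<sigma> i $ \<tau> i)))"
    unfolding expand using pint pval by (simp add: sum_distrib_left mult.assoc)
  also have "\<dots> = (\<Sum>\<sigma>\<in>?S. of_int (sign \<sigma>) * (of_int (sign \<sigma>) * det A))"
  proof (intro sum.cong refl)
    fix \<sigma> assume "\<sigma> \<in> ?S"
    then have "det (\<chi> i. A $ \<sigma> i) = of_int (sign \<sigma>) * det A"
      by (intro det_permute_rows) simp
    then show "of_int (sign \<sigma>) * (\<Sum>\<tau>\<in>?S. of_int (sign \<tau>) * (\<Prod>i\<in>UNIV. A $ \<sigma> i $ \<tau> i)) =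
        of_int (sign \<sigma>) * (of_int (sign \<sigma>) * det A)"
      by (simp add: det_def)
  qed
  also have "\<dots> = (\<Sum>\<sigma>\<in>?S. det A)"
    by (intro sum.cong refl) (simp add: sign_def)
  also have "\<dots> = fact (CARD('n) + 1) * det A"
    by (simp add: card_permutations[OF refl] card_option algebra_simps)
  finally have val: "(\<integral>V. (\<Prod>i\<in>UNIV. g (V i)) * (Delta V)\<^sup>2 \<partial>?M) = fact (CARD('n) + 1) * det A" .
  have "integrable ?M (\<lambda>V. (\<Prod>i\<in>UNIV. g (V i)) * (Delta V)\<^sup>2)"
    unfolding expand using pint by simp
  then have "(\<integral>\<^sup>+ V. ennreal ((\<Prod>i\<in>UNIV. g (V i)) * (Delta V)\<^sup>2) \<partial>?M)
     = ennreal (\<integral>V. (\<Prod>i\<in>UNIV. g (V i)) * (Delta V)\<^sup>2 \<partial>?M)"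
    using g by (intro nn_integral_eq_integral) (auto intro!: prod_nonneg mult_nonneg_nonneg)
  then show ?thesis using val by (simp add: A_def)
qed

lemma nn_integral_cbox_continuous:
  fixes f :: "'a::euclidean_space \<Rightarrow> real"
  assumes "continuous_on (cbox a b) f" "\<And>x. x \<in> cbox a b \<Longrightarrow> 0 \<le> f x"
  shows "(\<integral>\<^sup>+x\<in>cbox a b. ennreal (f x) \<partial>lborel) = ennreal (integral (cbox a b) f)"
proof -
  have int: "integrable lborel (\<lambda>x. indicator (cbox a b) x *\<^sub>R f x)"
    using assms(1) by (intro borel_integrable_compact) auto
  have "(\<integral>\<^sup>+x\<in>cbox a b. ennreal (f x) \<partial>lborel) = (\<integral>\<^sup>+x. ennreal (indicator (cbox a b) x *\<^sub>R f x) \<partial>lborel)"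
    by (intro nn_integral_cong) (simp split: split_indicator)
  also have "\<dots> = ennreal (\<integral>x. indicator (cbox a b) x *\<^sub>R f x \<partial>lborel)"
    using int assms(2) by (intro nn_integral_eq_integral) (auto split: split_indicator)
  also have "(\<integral>x. indicator (cbox a b) x *\<^sub>R f x \<partial>lborel) = integral (cbox a b) f"
    using set_borel_integral_eq_integral(2)[of "cbox a b" f] int
    by (simp add: set_integrable_def set_lebesgue_integral_def)
  finally show ?thesis .
qed

lemma lse_hess_of_vec:
  "lse_hess P c e z Q = lse_hess (of_vec ` P) (c \<circ> to_vec) e (of_vec z) (Q \<circ> to_vec)"
proof -
  have inj: "inj_on of_vec S" for S
    by (rule inj_on_inverseI[of _ to_vec]) simp
  have w: "lse_weight (of_vec ` P) (c \<circ> to_vec) e (of_vec z) (of_vec p) = lse_weight P c e z p" for p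
    by (simp add: lse_weight_def sum.reindex[OF inj] inner_of_vec)
  have g: "lse_grad (of_vec ` P) (c \<circ> to_vec) e (of_vec z) = of_vec (lse_grad P c e z)"
    by (simp add: lse_grad_def sum.reindex[OF inj] w linear_sum[OF linear_of_vec] linear_scale[OF linear_of_vec])
  show ?thesis
    by (simp add: lse_hess_def sum.reindex[OF inj] w g linear_diff[OF linear_of_vec, symmetric])
qed

lemma nn_integral_of_vec:
  assumes "h \<in> borel_measurable borel"
  shows "(\<integral>\<^sup>+z. h (of_vec z) \<partial>lborel) = (\<integral>\<^sup>+x. h x \<partial>lborel)"
proof -
  have [measurable]: "(of_vec :: real^('n::finite option wo) \<Rightarrow> _) \<in> borel_measurable borel"
    by (intro borel_measurable_continuous_onI continuous_on_of_vec)
  have "(\<integral>\<^sup>+x. h x \<partial>lborel) = (\<integral>\<^sup>+x. h x \<partial>(distr lborel borel of_vec))"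
    by (subst lborel_of_vec) simp
  also have "\<dots> = (\<integral>\<^sup>+z. h (of_vec z) \<partial>lborel)"
    using assms by (intro nn_integral_distr) auto
  finally show ?thesis by simp
qed

definition qform :: "('n::finite option \<Rightarrow> 'n option \<Rightarrow> real) \<Rightarrow> real \<times> (real^'n) \<Rightarrow> real" where
  "qform A y = (\<Sum>i\<in>UNIV. \<Sum>j\<in>UNIV. coord i y * coord j y * A i j)"

lemma continuous_on_coord [continuous_intros]:
  "continuous_on S f \<Longrightarrow> continuous_on S (\<lambda>x. coord i (f x))"
  by (cases i) (auto simp: coord_def intro!: continuous_intros)

text \<open>Carries the inequality through the isometry \<open>of_vec\<close>, under which measure,
  inner products, log-sum-exp and determinants are all preserved.\<close>

lemma det_transport:
  fixes A :: "real \<times> (real^'n::finite) \<Rightarrow> 'n option \<Rightarrow> 'n option \<Rightarrow> real"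
  assumes cont: "\<And>i j. continuous_on (cbox a b) (\<lambda>x. A x i j)"
    and sym: "\<And>x i j. x \<in> cbox a b \<Longrightarrow> A x i j = A x j i"
    and psd: "\<And>x y. x \<in> cbox a b \<Longrightarrow> 0 \<le> qform (A x) y"
    and K: "compact K" "0 < measure lborel K"
    and K_le: "ennreal (4 * measure lborel K) \<le>
       (\<integral>\<^sup>+x\<in>cbox a b. ennreal (det (\<chi> i j. A x i j) powr (1 / CARD('n))) \<partial>lborel)"
    and B: "0 \<le> B"
    and bound: "\<And>P c e. finite P \<Longrightarrow> P \<noteq> {} \<Longrightarrow> P \<subseteq> K \<Longrightarrow> 0 < e \<Longrightarrow>
       (\<integral>\<^sup>+x\<in>cbox a b. ennreal (lse_hess P c e x (qform (A x))) \<partial>lborel) \<le> ennreal B"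
  shows "measure lborel K \<le> (64 / 7 * 4 ^ (CARD('n) + 1)) * B"
proof -
  have [measurable]: "(of_vec :: real^('n option wo) \<Rightarrow> _) \<in> borel_measurable borel"
    by (intro borel_measurable_continuous_onI continuous_on_of_vec)
  let ?a = "to_vec a" and ?b = "to_vec b"
  define A' :: "real^('n option wo) \<Rightarrow> real^('n option wo)^('n option wo)" where
    "A' z = (\<chi> i j. A (of_vec z) (unwo i) (unwo j))" for z
  have mem: "z \<in> cbox ?a ?b \<longleftrightarrow> of_vec z \<in> cbox a b" for z :: "real^('n option wo)"
    using vimage_of_vec_box(1)[of a b] by blast
  have img: "of_vec ` cbox ?a ?b \<subseteq> cbox a b" using mem by blast
  have card: "CARD('n option wo) = CARD('n) + 1" by (simp add: CARD_wo card_option)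
  have det': "det (A' z) = det (\<chi> i j. A (of_vec z) i j)" for z
    unfolding A'_def by (rule det_reindex[OF bij_unwo])
  have bil: "y \<bullet> (A' z *v w) = (\<Sum>i\<in>UNIV. \<Sum>j\<in>UNIV. coord i (of_vec y) * coord j (of_vec w) * A (of_vec z) i j)" for y z w
  proof -
    have "y \<bullet> (A' z *v w) = (\<Sum>i\<in>UNIV. \<Sum>j\<in>UNIV. coord (unwo i) (of_vec y) * coord (unwo j) (of_vec w) * A (of_vec z) (unwo i) (unwo j))"
      by (simp add: inner_vec_def matrix_vector_mult_def A'_def sum_distrib_left ac_simps)
    also have "\<dots> = (\<Sum>i\<in>UNIV. \<Sum>j\<in>UNIV. coord (unwo i) (of_vec y) * coord j (of_vec w) * A (of_vec z) (unwo i) j)"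
      by (intro sum.cong refl sum_wo)
    also have "\<dots> = (\<Sum>i\<in>UNIV. \<Sum>j\<in>UNIV. coord i (of_vec y) * coord j (of_vec w) * A (of_vec z) i j)"
      by (rule sum_wo)
    finally show ?thesis .
  qed
  have quad: "y \<bullet> (A' z *v y) = qform (A (of_vec z)) (of_vec y)" for y z
    by (simp add: bil qform_def)
  have cont': "continuous_on (cbox ?a ?b) (\<lambda>z. A (of_vec z) i j)" for i j
    by (rule continuous_on_compose2[OF cont continuous_on_of_vec img])
  have contA': "continuous_on (cbox ?a ?b) A'"
    unfolding A'_def using cont' by (intro continuous_on_vec_lambda)
  have sym': "y \<bullet> (A' z *v w) = w \<bullet> (A' z *v y)" if "z \<in> cbox ?a ?b" for y z w
  proof -
    have s: "A (of_vec z) i j = A (of_vec z) j i" for i j using sym mem that by blast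
    have "y \<bullet> (A' z *v w) = (\<Sum>j\<in>UNIV. \<Sum>i\<in>UNIV. coord i (of_vec y) * coord j (of_vec w) * A (of_vec z) i j)"
      unfolding bil by (rule sum.swap)
    then show ?thesis
      unfolding bil[of w] by (simp add: s mult.commute mult.left_commute)
  qed
  have psd': "0 \<le> y \<bullet> (A' z *v y)" if "z \<in> cbox ?a ?b" for y z
    unfolding quad using psd mem that by blast
  define K' where "K' = of_vec -` K"
  have K'_img: "K' = to_vec ` K"
    unfolding K'_def by (auto simp: image_iff) (metis to_vec_of_vec)
  have Kb: "K \<in> sets borel" using K(1) by (simp add: compact_imp_closed borel_closed)
  have "emeasure lborel K = emeasure (distr lborel borel of_vec) K" by (subst lborel_of_vec) simp
  also have "\<dots> = emeasure lborel K'"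
    using Kb by (subst emeasure_distr) (auto simp: K'_def)
  finally have mK: "measure lborel K = measure lborel K'" by (simp add: measure_def)
  define g where "g x = det (\<chi> i j. A x i j) powr (1 / CARD('n))" for x
  have det_nonneg: "0 \<le> det (\<chi> i j. A x i j)" if "x \<in> cbox a b" for x
  proof -
    have "to_vec x \<in> cbox ?a ?b" using that mem by simp
    then show ?thesis using psd_det_nonneg[of "A' (to_vec x)", OF sym' psd'] det'[of "to_vec x"] by simp
  qed
  have g_cont: "continuous_on (cbox a b) g"
    unfolding g_def
  proof (rule continuous_on_powr')
    show "continuous_on (cbox a b) (\<lambda>x. det (\<chi> i j. A x i j))"
      unfolding det_def using cont by (intro continuous_intros) auto
  qed (use det_nonneg in \<open>auto intro: continuous_on_const\<close>)
  have g'_cont: "continuous_on (cbox ?a ?b) (\<lambda>z. g (of_vec z))"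
    by (rule continuous_on_compose2[OF g_cont continuous_on_of_vec img])
  have "ennreal (4 * measure lborel K') \<le> (\<integral>\<^sup>+x. ennreal (indicator (cbox a b) x *\<^sub>R g x) \<partial>lborel)"
    using K_le unfolding mK g_def[symmetric]
    by (rule order_trans) (intro nn_integral_mono, simp split: split_indicator)
  also have "\<dots> = (\<integral>\<^sup>+z. ennreal (indicator (cbox a b) (of_vec z) *\<^sub>R g (of_vec z)) \<partial>lborel)"
    by (rule nn_integral_of_vec[symmetric])
      (intro measurable_compose[OF borel_measurable_continuous_on_indicator[OF _ g_cont] measurable_ennreal], simp)
  also have "\<dots> = (\<integral>\<^sup>+z\<in>cbox ?a ?b. ennreal (g (of_vec z)) \<partial>lborel)"
    by (intro nn_integral_cong) (auto simp: mem split: split_indicator)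
  also have "\<dots> = ennreal (integral (cbox ?a ?b) (\<lambda>z. g (of_vec z)))"
    by (rule nn_integral_cbox_continuous[OF g'_cont]) (simp add: g_def)
  finally have le: "ennreal (4 * measure lborel K') \<le> ennreal (integral (cbox ?a ?b) (\<lambda>z. g (of_vec z)))" .
  have K'_le: "4 * measure lborel K' \<le> integral (cbox ?a ?b) (\<lambda>z. g (of_vec z))"
  proof -
    have "0 \<le> integral (cbox ?a ?b) (\<lambda>z. g (of_vec z))"
      by (intro integral_nonneg integrable_continuous g'_cont) (simp add: g_def)
    then show ?thesis using le by (simp add: ennreal_le_iff)
  qed
  have "measure lborel K' \<le> (64 / 7 * 4 ^ CARD('n option wo)) * B"
  proof (rule det_transport_continuous[where A = A' and a = ?a and b = ?b])
    show "2 \<le> CARD('n option wo)" unfolding card using zero_less_card_finite[where 'a='n] by linarith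
    show "compact K'" unfolding K'_img by (intro compact_continuous_image continuous_on_to_vec K)
    show "0 < measure lborel K'" using K(2) mK by simp
    show "4 * measure lborel K' \<le> integral (cbox ?a ?b) (\<lambda>x. det (A' x) powr (1 / real (CARD('n option wo) - 1)))"
      using K'_le unfolding card det' g_def by simp
    fix P :: "(real^('n option wo)) set" and c e
    assume P: "finite P" "P \<noteq> {}" "P \<subseteq> K'" and e: "(0::real) < e"
    have P': "finite (of_vec ` P)" "of_vec ` P \<noteq> {}" "of_vec ` P \<subseteq> K"
      using P by (auto simp: K'_def)
    define H where "H x = lse_hess (of_vec ` P) (c \<circ> to_vec) e x (qform (A x))" for x
    have H_cont: "continuous_on (cbox a b) H"
      unfolding H_def lse_hess_def qform_def using e
      by (intro continuous_intros continuous_on_lse_weight continuous_on_lse_grad P' e cont) auto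
    have eq: "lse_hess P c e z (\<lambda>\<xi>. \<xi> \<bullet> (A' z *v \<xi>)) = H (of_vec z)" for z
      unfolding H_def quad by (subst lse_hess_of_vec) (simp add: comp_def)
    have "(\<integral>\<^sup>+z\<in>cbox ?a ?b. ennreal (lse_hess P c e z (\<lambda>\<xi>. \<xi> \<bullet> (A' z *v \<xi>))) \<partial>lborel)
      = (\<integral>\<^sup>+z. ennreal (indicator (cbox a b) (of_vec z) *\<^sub>R H (of_vec z)) \<partial>lborel)"
      unfolding eq by (intro nn_integral_cong) (auto simp: mem split: split_indicator)
    also have "\<dots> = (\<integral>\<^sup>+x. ennreal (indicator (cbox a b) x *\<^sub>R H x) \<partial>lborel)"
      by (rule nn_integral_of_vec)
        (intro measurable_compose[OF borel_measurable_continuous_on_indicator[OF _ H_cont] measurable_ennreal], simp)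
    also have "\<dots> = (\<integral>\<^sup>+x\<in>cbox a b. ennreal (H x) \<partial>lborel)"
      by (intro nn_integral_cong) (simp split: split_indicator)
    also have "\<dots> \<le> ennreal B"
      unfolding H_def by (rule bound[OF P' e])
    finally show "(\<integral>\<^sup>+z\<in>cbox ?a ?b. ennreal (lse_hess P c e z (\<lambda>\<xi>. \<xi> \<bullet> (A' z *v \<xi>))) \<partial>lborel) \<le> ennreal B" .
  qed (use contA' sym' psd' B in auto)
  then show ?thesis by (simp add: mK card)
qed

section \<open>The flux of a kinetic density\<close>

lemma smooth_funs_translate:
  assumes "f \<in> smooth_funs"
  shows "(\<lambda>x. f (x - z)) \<in> smooth_funs"
  using assms
proof induction
  case (linear l)
  have "(\<lambda>x. l (x - z)) = (\<lambda>x. l x - l z)"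
    using linear by (simp add: bounded_linear.linear linear_diff)
  then show ?case using linear by (auto intro: smooth_funs_diff smooth_funs.linear smooth_funs.const)
qed (auto intro: smooth_funs.intros)

lemma smooth_funs_inner: "(\<lambda>x. p \<bullet> x) \<in> smooth_funs"
  by (intro smooth_funs.linear bounded_linear_inner_right)

lemma smooth_funs_lse_grad:
  assumes P: "finite P" "P \<noteq> {}" and e: "0 < e"
  shows "(\<lambda>x. lse_grad P c e x \<bullet> l) \<in> smooth_funs"
proof -
  have exp: "(\<lambda>x. exp ((p \<bullet> x - c p) / e)) \<in> smooth_funs" for p
    by (intro smooth_funs.exp smooth_funs_divide smooth_funs_diff smooth_funs_inner smooth_funs.const) (use e in auto)
  show ?thesis
    unfolding inner_lse_grad[OF P e]
    by (intro smooth_funs_divide smooth_funs_sum smooth_funs.mult exp smooth_funs.const)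
      (use lse_sum_pos[OF P e] in \<open>simp add: less_imp_neq[symmetric]\<close>)
qed

text \<open>Rises on [\<tau>, 2 \<tau>] and falls on [T - 2 \<tau>, T - \<tau>]. The margin \<tau>
  at the end leaves room to shift the bump forward in time by less than \<tau> inside (0,
  T).\<close>

definition time_bump :: "real \<Rightarrow> real \<Rightarrow> real \<Rightarrow> real" where
  "time_bump T \<tau> t = smooth_step ((t - \<tau>) / \<tau>) * smooth_step ((T - \<tau> - t) / \<tau>)"

text \<open>A majorant of the absolute derivative of \<open>time_bump\<close>, in which each step
  factor is bounded by 1. Its integral is 2 for every \<tau>: this is the factor 2 of the flux
  bound.\<close>

definition time_bump_rate :: "real \<Rightarrow> real \<Rightarrow> real \<Rightarrow> real" where
  "time_bump_rate T \<tau> t = smooth_step' ((t - \<tau>) / \<tau>) / \<tau> + smooth_step' ((T - \<tau> - t) / \<tau>) / \<tau>"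

text \<open>Built on the square of the norm so as to be smooth at the origin; it is 1 for |y| <= R
  and 0 once |y|^2 >= 2 R^2.\<close>

definition space_bump :: "real \<Rightarrow> real^'n \<Rightarrow> real" where
  "space_bump R y = smooth_step (2 - (y \<bullet> y) / R\<^sup>2)"

lemma time_bump_props:
  assumes "0 < \<tau>"
  shows "0 \<le> time_bump T \<tau> t" "time_bump T \<tau> t \<le> 1"
    and "2 * \<tau> \<le> t \<Longrightarrow> t \<le> T - 2 * \<tau> \<Longrightarrow> time_bump T \<tau> t = 1"
    and "t \<notin> {\<tau>..T - \<tau>} \<Longrightarrow> time_bump T \<tau> t = 0"
    and "\<exists>r. (time_bump T \<tau> has_real_derivative r) (at t) \<and> \<bar>r\<bar> \<le> time_bump_rate T \<tau> t"
proof -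
  show "0 \<le> time_bump T \<tau> t" "time_bump T \<tau> t \<le> 1"
    unfolding time_bump_def using smooth_step_range by (auto intro: mult_le_one)
  show "2 * \<tau> \<le> t \<Longrightarrow> t \<le> T - 2 * \<tau> \<Longrightarrow> time_bump T \<tau> t = 1"
    unfolding time_bump_def using assms by (simp add: smooth_step_eq_1 pos_le_divide_eq)
  show "time_bump T \<tau> t = 0" if t: "t \<notin> {\<tau>..T - \<tau>}"
  proof -
    consider "t < \<tau>" | "T - \<tau> < t" using t by force
    then show ?thesis
    proof cases
      case 1
      then have "smooth_step ((t - \<tau>) / \<tau>) = 0"
        using assms by (intro smooth_step_eq_0) (simp add: divide_le_0_iff)
      then show ?thesis by (simp add: time_bump_def)
    next
      case 2
      then have "smooth_step ((T - \<tau> - t) / \<tau>) = 0"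
        using assms by (intro smooth_step_eq_0) (simp add: divide_le_0_iff)
      then show ?thesis by (simp add: time_bump_def)
    qed
  qed
  let ?s1 = "smooth_step ((t - \<tau>) / \<tau>)" and ?s2 = "smooth_step ((T - \<tau> - t) / \<tau>)"
  let ?d1 = "smooth_step' ((t - \<tau>) / \<tau>) / \<tau>" and ?d2 = "smooth_step' ((T - \<tau> - t) / \<tau>) / \<tau>"
  have "(time_bump T \<tau> has_real_derivative (?d1 * ?s2 + - ?d2 * ?s1)) (at t)"
    unfolding time_bump_def by (rule DERIV_mult[OF DERIV_smooth_step_affine(1) DERIV_smooth_step_affine(2)])
  moreover have "\<bar>?d1 * ?s2 + - ?d2 * ?s1\<bar> \<le> ?d1 + ?d2"
  proof -
    have "0 \<le> ?d1" "0 \<le> ?d2" using assms smooth_step'_nonneg by simp_all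
    moreover have "0 \<le> a * s \<and> a * s \<le> a" if "0 \<le> a" "0 \<le> s" "s \<le> 1" for a s :: real
      using mult_left_le[of s a] that by simp
    ultimately have "0 \<le> ?d1 * ?s2 \<and> ?d1 * ?s2 \<le> ?d1" "0 \<le> ?d2 * ?s1 \<and> ?d2 * ?s1 \<le> ?d2"
      using smooth_step_range by blast+
    then show ?thesis by linarith
  qed
  ultimately show "\<exists>r. (time_bump T \<tau> has_real_derivative r) (at t) \<and> \<bar>r\<bar> \<le> time_bump_rate T \<tau> t"
    unfolding time_bump_rate_def by blast
qed

lemma time_bump_rate_nonneg: "0 < \<tau> \<Longrightarrow> 0 \<le> time_bump_rate T \<tau> t"
  using smooth_step'_nonneg by (simp add: time_bump_rate_def)

lemma time_bump_rate_measurable [measurable]: "time_bump_rate T \<tau> \<in> borel_measurable borel"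
  unfolding time_bump_rate_def by measurable

lemma nn_integral_time_bump_rate:
  assumes "0 < \<tau>"
  shows "(\<integral>\<^sup>+t. ennreal (time_bump_rate T \<tau> (t - s)) \<partial>lborel) = 2"
proof -
  have "(\<integral>\<^sup>+t. ennreal (time_bump_rate T \<tau> (t - s)) \<partial>lborel)
    = (\<integral>\<^sup>+t. ennreal (smooth_step' ((t - (s + \<tau>)) / \<tau>) / \<tau>) + ennreal (smooth_step' ((T - \<tau> + s - t) / \<tau>) / \<tau>) \<partial>lborel)"
  proof (rule nn_integral_cong)
    fix t
    have "t - s - \<tau> = t - (s + \<tau>)" "T - \<tau> - (t - s) = T - \<tau> + s - t" by simp_all
    then have "time_bump_rate T \<tau> (t - s) = smooth_step' ((t - (s + \<tau>)) / \<tau>) / \<tau> + smooth_step' ((T - \<tau> + s - t) / \<tau>) / \<tau>"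
      by (simp only: time_bump_rate_def)
    moreover have "0 \<le> smooth_step' r / \<tau>" for r using assms smooth_step'_nonneg by simp
    ultimately show "ennreal (time_bump_rate T \<tau> (t - s)) =
        ennreal (smooth_step' ((t - (s + \<tau>)) / \<tau>) / \<tau>) + ennreal (smooth_step' ((T - \<tau> + s - t) / \<tau>) / \<tau>)"
      by (simp only: ennreal_plus)
  qed
  also have "\<dots> = (\<integral>\<^sup>+t. ennreal (smooth_step' ((t - (s + \<tau>)) / \<tau>) / \<tau>) \<partial>lborel)
      + (\<integral>\<^sup>+t. ennreal (smooth_step' ((T - \<tau> + s - t) / \<tau>) / \<tau>) \<partial>lborel)"
    by (intro nn_integral_add) measurable
  also have "\<dots> = 2"
    unfolding nn_integral_smooth_step'[OF assms] by simp
  finally show ?thesis .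
qed

lemma space_bump_props:
  assumes "0 < R"
  shows "0 \<le> space_bump R y" "space_bump R y \<le> 1"
    and "norm y \<le> R \<Longrightarrow> space_bump R y = 1"
    and "2 * R < norm y \<Longrightarrow> space_bump R y = 0"
    and "(space_bump R has_derivative (\<lambda>v. - (2 * smooth_step' (2 - (y \<bullet> y) / R\<^sup>2) * (y \<bullet> v) / R\<^sup>2))) (at y)"
proof -
  show "0 \<le> space_bump R y" "space_bump R y \<le> 1"
    unfolding space_bump_def using smooth_step_range by auto
  show "space_bump R y = 1" if "norm y \<le> R"
  proof -
    have "y \<bullet> y \<le> R\<^sup>2" using that by (simp add: dot_square_norm power_mono)
    then show ?thesis unfolding space_bump_def using assms by (intro smooth_step_eq_1) (simp add: pos_divide_le_eq)
  qed
  show "space_bump R y = 0" if "2 * R < norm y"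
  proof -
    have "(2 * R)\<^sup>2 \<le> (norm y)\<^sup>2" using that assms by (intro power_mono) auto
    then have "4 * R\<^sup>2 \<le> y \<bullet> y" by (simp add: dot_square_norm power_mult_distrib)
    then have "2 * R\<^sup>2 \<le> y \<bullet> y" using zero_le_power2[of R] by linarith
    then show ?thesis unfolding space_bump_def using assms by (intro smooth_step_eq_0) (simp add: pos_le_divide_eq)
  qed
  have "((\<lambda>y. 2 - (y \<bullet> y) / R\<^sup>2) has_derivative (\<lambda>v. - (2 * (y \<bullet> v) / R\<^sup>2))) (at y)"
    using assms by (auto intro!: derivative_eq_intros simp: inner_commute divide_inverse)
  from has_derivative_compose[OF this DERIV_smooth_step[unfolded has_field_derivative_def]]
  show "(space_bump R has_derivative (\<lambda>v. - (2 * smooth_step' (2 - (y \<bullet> y) / R\<^sup>2) * (y \<bullet> v) / R\<^sup>2))) (at y)"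
    unfolding space_bump_def by (simp add: ac_simps)
qed

definition cutoff :: "real \<Rightarrow> real \<Rightarrow> real \<Rightarrow> real \<times> (real^'n) \<Rightarrow> real" where
  "cutoff T \<tau> R x = time_bump T \<tau> (fst x) * space_bump R (snd x)"

lemma smooth_funs_time_bump: "0 < \<tau> \<Longrightarrow> (\<lambda>x. time_bump T \<tau> (fst x)) \<in> smooth_funs"
  unfolding time_bump_def
  by (intro smooth_funs.mult smooth_step_smooth smooth_funs_divide smooth_funs_diff smooth_funs.const
      smooth_funs.linear bounded_linear_fst) auto

lemma smooth_funs_space_bump:
  assumes "0 < R"
  shows "(\<lambda>x. space_bump R (snd x :: real^'n)) \<in> smooth_funs"
proof -
  have "(\<lambda>x :: 'a \<times> (real^'n). snd x \<bullet> snd x) = (\<lambda>x. \<Sum>j\<in>UNIV. (snd x $ j) * (snd x $ j))"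
    by (simp add: inner_vec_def)
  moreover have "(\<lambda>x :: 'a \<times> (real^'n). snd x $ j) \<in> smooth_funs" for j
    by (intro smooth_funs.linear bounded_linear_compose[OF bounded_linear_vec_nth bounded_linear_snd])
  ultimately have "(\<lambda>x :: 'a \<times> (real^'n). snd x \<bullet> snd x) \<in> smooth_funs"
    by (simp only:) (intro smooth_funs_sum smooth_funs.mult)
  then show ?thesis
    unfolding space_bump_def using assms
    by (intro smooth_step_smooth smooth_funs_divide smooth_funs_diff smooth_funs.const) auto
qed

lemma smooth_funs_cutoff: "0 < \<tau> \<Longrightarrow> 0 < R \<Longrightarrow> cutoff T \<tau> R \<in> smooth_funs"
  unfolding cutoff_def by (intro smooth_funs.mult smooth_funs_time_bump smooth_funs_space_bump)

lemma cutoff_props: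
  assumes "0 < \<tau>" "0 < R"
  shows "0 \<le> cutoff T \<tau> R x" "cutoff T \<tau> R x \<le> 1"
    and "2 * \<tau> \<le> fst x \<Longrightarrow> fst x \<le> T - 2 * \<tau> \<Longrightarrow> norm (snd x) \<le> R \<Longrightarrow> cutoff T \<tau> R x = 1"
    and "x \<notin> {\<tau>..T - \<tau>} \<times> cball 0 (2 * R) \<Longrightarrow> cutoff T \<tau> R x = 0"
proof -
  note tb = time_bump_props(1-4)[OF assms(1), where T = T and t = "fst x"]
  note sb = space_bump_props(1-4)[OF assms(2), of "snd x"]
  show "0 \<le> cutoff T \<tau> R x" unfolding cutoff_def using tb(1) sb(1) by (rule mult_nonneg_nonneg)
  show "cutoff T \<tau> R x \<le> 1" unfolding cutoff_def using tb(2) sb(1,2) by (rule mult_le_one)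
  show "cutoff T \<tau> R x = 1" if "2 * \<tau> \<le> fst x" "fst x \<le> T - 2 * \<tau>" "norm (snd x) \<le> R"
    unfolding cutoff_def using tb(3)[OF that(1,2)] sb(3)[OF that(3)] by simp
  show "cutoff T \<tau> R x = 0" if x: "x \<notin> {\<tau>..T - \<tau>} \<times> cball 0 (2 * R)"
  proof (cases "fst x \<in> {\<tau>..T - \<tau>}")
    case True
    then have "2 * R < norm (snd x)" using x by (auto simp: mem_Times_iff)
    then show ?thesis using sb(4) by (simp add: cutoff_def)
  qed (use tb(4) in \<open>simp add: cutoff_def\<close>)
qed

text \<open>Where the slope does not vanish, |y| is at most 2 R, against R^2 in the denominator. The
  spatial cutoff error is thus of order 1/R and disappears in the limit.\<close>

lemma space_bump_slope_bound:
  assumes R: "0 < R" and C: "\<And>s. smooth_step' s \<le> C"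
  shows "\<bar>2 * smooth_step' (2 - (y \<bullet> y) / R\<^sup>2) * (y \<bullet> v) / R\<^sup>2\<bar> \<le> 4 * C / R * norm v"
proof -
  have C0: "0 \<le> C" using C[of 0] smooth_step'_nonneg[of 0] by linarith
  show ?thesis
  proof (cases "norm y \<le> 2 * R")
    case True
    have "\<bar>2 * smooth_step' (2 - (y \<bullet> y) / R\<^sup>2) * (y \<bullet> v) / R\<^sup>2\<bar> = 2 * smooth_step' (2 - (y \<bullet> y) / R\<^sup>2) * \<bar>y \<bullet> v\<bar> / R\<^sup>2"
      using smooth_step'_nonneg by (simp add: abs_mult)
    also have "\<dots> \<le> 2 * C * (2 * R * norm v) / R\<^sup>2"
    proof (intro divide_right_mono mult_mono)
      show "\<bar>y \<bullet> v\<bar> \<le> 2 * R * norm v"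
        using True by (intro order_trans[OF Cauchy_Schwarz_ineq2] mult_right_mono) auto
    qed (use C C0 R smooth_step'_nonneg in auto)
    also have "\<dots> = 4 * C / R * norm v" using R by (simp add: power2_eq_square)
    finally show ?thesis .
  next
    case False
    then have "(2 * R)\<^sup>2 \<le> (norm y)\<^sup>2" using R by (intro power_mono) auto
    then have "4 * R\<^sup>2 \<le> y \<bullet> y" by (simp add: dot_square_norm power_mult_distrib)
    then have "4 \<le> (y \<bullet> y) / R\<^sup>2" using R by (simp add: pos_le_divide_eq)
    then have "smooth_step' (2 - (y \<bullet> y) / R\<^sup>2) = 0"
      by (intro smooth_step'_eq_0) auto
    then show ?thesis using C0 R by (simp)
  qed
qed

text \<open>The direction (1, v) is that of free transport. Its time part is controlled by a rate of
  fixed total mass, its space part by a term of order |v| / R.\<close>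

lemma cutoff_derivative_bound:
  fixes x :: "real \<times> (real^'n)"
  assumes \<tau>: "0 < \<tau>" and R: "0 < R" and C: "\<And>s. smooth_step' s \<le> C"
  shows "\<bar>frechet_derivative (cutoff T \<tau> R) (at x) (1, v)\<bar> \<le> time_bump_rate T \<tau> (fst x) + 4 * C / R * norm v"
proof -
  obtain r where r: "(time_bump T \<tau> has_real_derivative r) (at (fst x))" "\<bar>r\<bar> \<le> time_bump_rate T \<tau> (fst x)"
    using time_bump_props(5)[OF \<tau>] by blast
  let ?y = "snd x"
  define q where "q v = - (2 * smooth_step' (2 - (?y \<bullet> ?y) / R\<^sup>2) * (?y \<bullet> v) / R\<^sup>2)" for v
  have "((\<lambda>x. time_bump T \<tau> (fst x)) has_derivative (\<lambda>u. r * fst u)) (at x)"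
    by (rule has_derivative_compose[OF has_derivative_fst[OF has_derivative_ident] r(1)[unfolded has_field_derivative_def]])
  moreover have "((\<lambda>x. space_bump R (snd x)) has_derivative (\<lambda>u. q (snd u))) (at x)"
    unfolding q_def by (rule has_derivative_compose[OF has_derivative_snd[OF has_derivative_ident] space_bump_props(5)[OF R]])
  ultimately have "(cutoff T \<tau> R has_derivative
      (\<lambda>u. time_bump T \<tau> (fst x) * q (snd u) + r * fst u * space_bump R ?y)) (at x)"
    unfolding cutoff_def by (rule has_derivative_mult)
  then have eq: "frechet_derivative (cutoff T \<tau> R) (at x) (1, v) = time_bump T \<tau> (fst x) * q v + r * space_bump R ?y"
    by (simp add: frechet_derivative_at[symmetric])
  have "\<bar>q v\<bar> \<le> 4 * C / R * norm v"
    unfolding q_def abs_minus_cancel by (rule space_bump_slope_bound[OF R C])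
  moreover have "\<bar>time_bump T \<tau> (fst x) * q v\<bar> \<le> \<bar>q v\<bar>"
    using mult_left_le_one_le[of "\<bar>q v\<bar>" "time_bump T \<tau> (fst x)"] time_bump_props(1,2)[OF \<tau>, where T = T and t = "fst x"]
    by (simp add: abs_mult)
  moreover have "\<bar>r * space_bump R ?y\<bar> \<le> \<bar>r\<bar>"
    using mult_left_le[of "space_bump R ?y" "\<bar>r\<bar>"] space_bump_props(1,2)[OF R, of ?y] by (simp add: abs_mult)
  ultimately show ?thesis unfolding eq using r(2) by linarith
qed

text \<open>Slopes \<open>\<xi>\<close> for which \<open>\<xi> \<bullet> (1, v)\<close> is small for velocities \<open>v\<close> close to \<open>u\<close>.\<close>

definition slope_box :: "real^'n \<Rightarrow> real \<Rightarrow> real \<Rightarrow> (real \<times> (real^'n)) set" where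
  "slope_box u \<alpha> \<beta> = {\<xi>. \<bar>fst \<xi> + u \<bullet> snd \<xi>\<bar> \<le> \<alpha> \<and> (\<forall>k. \<bar>snd \<xi> $ k\<bar> \<le> \<beta>)}"

lemma convex_slope_box: "convex (slope_box u \<alpha> \<beta>)"
proof -
  have 1: "convex {\<xi> :: real \<times> (real^'n). \<bar>f \<xi>\<bar> \<le> a}" if "linear f" for f :: "real \<times> (real^'n) \<Rightarrow> real" and a
  proof -
    have "{\<xi>. \<bar>f \<xi>\<bar> \<le> a} = f -` {-a..a}" by auto
    then show ?thesis using convex_linear_vimage[OF that, of "{-a..a}"] by simp
  qed
  have "slope_box u \<alpha> \<beta> = {\<xi>. \<bar>fst \<xi> + u \<bullet> snd \<xi>\<bar> \<le> \<alpha>} \<inter> (\<Inter>k. {\<xi>. \<bar>snd \<xi> $ k\<bar> \<le> \<beta>})"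
    by (auto simp: slope_box_def)
  also have "convex \<dots>"
    by (intro convex_Int convex_INT 1 linearI) (auto simp: inner_add_right algebra_simps)
  finally show ?thesis .
qed

text \<open>Splitting v into u and v - u isolates \<xi>_0 + u . \<xi>', the quantity that the box
  restricts by \<alpha>.\<close>

lemma slope_box_bound:
  assumes "\<xi> \<in> slope_box u \<alpha> \<beta>"
  shows "\<bar>\<xi> \<bullet> (1, v)\<bar> \<le> \<alpha> + \<beta> * (\<Sum>k\<in>UNIV. \<bar>v $ k - u $ k\<bar>)"
proof -
  have "\<xi> \<bullet> (1, v) = (fst \<xi> + u \<bullet> snd \<xi>) + (\<Sum>k\<in>UNIV. snd \<xi> $ k * (v $ k - u $ k))"
    by (simp add: inner_prod_def inner_vec_def right_diff_distrib sum_subtractf mult.commute)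
  moreover have "\<bar>\<Sum>k\<in>UNIV. snd \<xi> $ k * (v $ k - u $ k)\<bar> \<le> (\<Sum>k\<in>UNIV. \<beta> * \<bar>v $ k - u $ k\<bar>)"
    using assms by (intro order_trans[OF sum_abs] sum_mono) (auto simp: abs_mult slope_box_def intro!: mult_right_mono)
  moreover have "\<bar>fst \<xi> + u \<bullet> snd \<xi>\<bar> \<le> \<alpha>" using assms by (simp add: slope_box_def)
  ultimately show ?thesis
    unfolding sum_distrib_left by linarith
qed

section \<open>Kinetic densities and the conservation laws tested by a convex potential\<close>

lemma sum_lift_unit: "(\<Sum>i\<in>UNIV. lift v i *\<^sub>R unit i) = (1, v)"
  using unit_expand[of "(1, v)"] by (simp add: lift_def coord_def sum_option)

lemma inner_lift: "\<xi> \<bullet> (1, v) = (\<Sum>i\<in>UNIV. coord i \<xi> * lift v i)"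
  by (simp add: inner_coord[of \<xi>] lift_def coord_def sum_option)

lemma abs_lift_le: "\<bar>lift v i\<bar> \<le> 1 + norm v"
  by (cases i) (auto simp: lift_def intro: order_trans[OF component_le_norm_cart])

lemma lift_mult_le: "\<bar>lift v i * lift v j\<bar> \<le> 2 * (1 + (norm v)\<^sup>2)"
proof -
  have "\<bar>lift v i * lift v j\<bar> \<le> (1 + norm v) * (1 + norm v)"
    unfolding abs_mult by (intro mult_mono abs_lift_le) auto
  also have "\<dots> \<le> 2 * (1 + (norm v)\<^sup>2)"
    using zero_le_power2[of "1 - norm v"] by (simp add: power2_eq_square algebra_simps)
  finally show ?thesis .
qed

lemma lift_measurable [measurable]: "(\<lambda>v. lift v i) \<in> borel_measurable borel"
  by (cases i) (auto simp: lift_def)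

lemma one_plus_norm_square_le: "(1 + norm v) * (1 + norm v) \<le> 2 * (1 + (norm v)\<^sup>2)"
  using zero_le_power2[of "1 - norm v"] by (simp add: power2_eq_square algebra_simps)

lemma borel_measurable_fst_prod [measurable]: "fst \<in> borel_measurable (borel :: ('a::{second_countable_topology} \<times> 'b::{second_countable_topology}) measure)"
  by (intro borel_measurable_continuous_onI continuous_intros)

lemma borel_measurable_snd_prod [measurable]: "snd \<in> borel_measurable (borel :: ('a::{second_countable_topology} \<times> 'b::{second_countable_topology}) measure)"
  by (intro borel_measurable_continuous_onI continuous_intros)

text \<open>The first argument of \<open>F\<close> is the pair (t, y). Extension by 0 outside (0, T)
  lets all integrals run over the whole of time-space, and the finite weighted integral makes every
  second velocity moment integrable.\<close>

locale kinetic_density =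
  fixes T :: real and F :: "real \<times> (real^'n::finite) \<Rightarrow> real^'n \<Rightarrow> real"
  assumes F_measurable [measurable]: "(\<lambda>z. F (fst z) (snd z)) \<in> borel_measurable borel"
    and F_nonneg: "\<And>x v. 0 \<le> F x v"
    and F_supp: "\<And>x v. fst x \<notin> {0<..<T} \<Longrightarrow> F x v = 0"
    and F_finite: "(\<integral>\<^sup>+z. ennreal (F (fst z) (snd z) * (1 + (norm (snd z))\<^sup>2)) \<partial>lborel) < \<infinity>"
begin

lemma F_weight_integrable: "integrable lborel (\<lambda>z. F (fst z) (snd z) * (1 + (norm (snd z))\<^sup>2))"
proof (rule integrableI_nonneg)
  show "(\<lambda>z. F (fst z) (snd z) * (1 + (norm (snd z))\<^sup>2)) \<in> borel_measurable lborel"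
    using F_measurable by measurable
qed (use F_finite F_nonneg in auto)

lemma F_integrable:
  assumes [measurable]: "H \<in> borel_measurable borel"
    and "\<And>z. \<bar>H z\<bar> \<le> k * (1 + (norm (snd z))\<^sup>2)"
  shows "integrable lborel (\<lambda>z. F (fst z) (snd z) * H z)"
proof (rule Bochner_Integration.integrable_bound)
  show "integrable lborel (\<lambda>z. k * (F (fst z) (snd z) * (1 + (norm (snd z))\<^sup>2)))"
    using F_weight_integrable by (rule integrable_mult_right)
  show "AE z in lborel. norm (F (fst z) (snd z) * H z) \<le> norm (k * (F (fst z) (snd z) * (1 + (norm (snd z))\<^sup>2)))"
  proof (rule AE_I2)
    fix z
    have "norm (F (fst z) (snd z) * H z) = F (fst z) (snd z) * \<bar>H z\<bar>"
      using F_nonneg by (simp add: abs_mult)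
    also have "\<dots> \<le> F (fst z) (snd z) * (k * (1 + (norm (snd z))\<^sup>2))"
      using F_nonneg assms(2) by (intro mult_left_mono) auto
    also have "\<dots> \<le> norm (k * (F (fst z) (snd z) * (1 + (norm (snd z))\<^sup>2)))"
      by (simp add: mult.left_commute)
    finally show "norm (F (fst z) (snd z) * H z) \<le> norm (k * (F (fst z) (snd z) * (1 + (norm (snd z))\<^sup>2)))" .
  qed
qed (use F_measurable in measurable)

end

text \<open>The derivative in direction (1, v) is (d/dt + v . grad) \<phi>. For each index
  \<open>i\<close> the assumption says that row \<open>i\<close> of the flux matrix is divergence
  free: None is mass, Some k is momentum.\<close>

locale kinetic_flow = kinetic_density T F
  for T :: real and F :: "real \<times> (real^'n::finite) \<Rightarrow> real^'n \<Rightarrow> real" +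
  assumes F_transport: "\<And>\<phi> i. test_fun ({0<..<T} \<times> UNIV) \<phi> \<Longrightarrow>
       (\<integral>z. F (fst z) (snd z) * lift (snd z) i * frechet_derivative \<phi> (at (fst z)) (1, snd z) \<partial>lborel) = 0"
begin

lemma test_fun_cutoff_lse_grad:
  fixes P :: "(real \<times> (real^'n)) set" and c :: "real \<times> (real^'n) \<Rightarrow> real"
  assumes P: "finite P" "P \<noteq> {}" and e: "0 < e" and \<tau>: "0 < \<tau>" and R: "0 < R"
    and z: "0 \<le> fst z" "fst z < \<tau>"
  shows "(\<lambda>x. cutoff T \<tau> R (x - z) * (lse_grad P c e (x - z) \<bullet> l)) \<in> smooth_funs"
    and "test_fun ({0<..<T} \<times> UNIV) (\<lambda>x. cutoff T \<tau> R (x - z) * (lse_grad P c e (x - z) \<bullet> l))"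
proof -
  show sm: "(\<lambda>x. cutoff T \<tau> R (x - z) * (lse_grad P c e (x - z) \<bullet> l)) \<in> smooth_funs"
    by (intro smooth_funs.mult smooth_funs_translate[OF smooth_funs_cutoff[OF \<tau> R]]
        smooth_funs_translate[OF smooth_funs_lse_grad[OF P e]])
  define K where "K = {\<tau> + fst z..T - \<tau> + fst z} \<times> cball (snd z) (2 * R)"
  have "compact K" unfolding K_def by (intro compact_Times) auto
  moreover have "K \<subseteq> {0<..<T} \<times> UNIV" unfolding K_def using z \<tau> by auto
  moreover have "cutoff T \<tau> R (x - z) = 0" if "x \<notin> K" for x
  proof (rule cutoff_props(4)[OF \<tau> R])
    show "x - z \<notin> {\<tau>..T - \<tau>} \<times> cball 0 (2 * R)"
      using that by (auto simp: K_def mem_Times_iff dist_norm norm_minus_commute)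
  qed
  ultimately show "test_fun ({0<..<T} \<times> UNIV) (\<lambda>x. cutoff T \<tau> R (x - z) * (lse_grad P c e (x - z) \<bullet> l))"
    unfolding test_fun_def using smooth_funs_C_infinity[OF sm] by (intro conjI exI[of _ K]) auto
qed

text \<open>Row \<open>i\<close> is tested with the cutoff times the i-th component of the gradient,
  and the rows are summed. By the product rule the derivative of the cutoff produces
  \<open>J1\<close>, and that of the gradient produces the cutoff times w . D^2 lse w, which is
  \<open>J2\<close>. The translation by \<open>z\<close> prepares the averaging over cubes.\<close>

lemma flux_identity:
  fixes P :: "(real \<times> (real^'n)) set" and c :: "real \<times> (real^'n) \<Rightarrow> real"
  assumes P: "finite P" "P \<noteq> {}" and e: "0 < e" and \<tau>: "0 < \<tau>" and R: "0 < R"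
    and z: "0 \<le> fst z" "fst z < \<tau>"
  defines "J1 \<equiv> \<lambda>w. frechet_derivative (cutoff T \<tau> R) (at (fst w - z)) (1, snd w) * (lse_grad P c e (fst w - z) \<bullet> (1, snd w))"
    and "J2 \<equiv> \<lambda>w. cutoff T \<tau> R (fst w - z) * lse_hess P c e (fst w - z) (\<lambda>\<xi>. (\<xi> \<bullet> (1, snd w))\<^sup>2)"
  shows "integrable lborel (\<lambda>w. F (fst w) (snd w) * J1 w)" "integrable lborel (\<lambda>w. F (fst w) (snd w) * J2 w)"
    and "(\<integral>w. F (fst w) (snd w) * J2 w \<partial>lborel) = - (\<integral>w. F (fst w) (snd w) * J1 w \<partial>lborel)"
proof -
  let ?\<chi> = "cutoff T \<tau> R :: real \<times> (real^'n) \<Rightarrow> real" and ?G = "lse_grad P c e"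
  define D\<chi> where "D\<chi> i x = frechet_derivative ?\<chi> (at x) (unit i)" for i x
  define \<phi> where "\<phi> i x = ?\<chi> (x - z) * (?G (x - z) \<bullet> unit i)" for i x
  have sm\<chi>: "?\<chi> \<in> smooth_funs" by (rule smooth_funs_cutoff[OF \<tau> R])
  have D\<chi>_der: "(?\<chi> has_derivative frechet_derivative ?\<chi> (at x)) (at x)" for x
    by (rule smooth_funs_frechet(1)[OF sm\<chi>])
  have D\<chi>_exp: "frechet_derivative ?\<chi> (at x) (1, v) = (\<Sum>i\<in>UNIV. lift v i * D\<chi> i x)" for x v
    unfolding D\<chi>_def sum_lift_unit[symmetric]
    by (simp add: linear_sum[OF has_derivative_linear[OF D\<chi>_der]] linear_scale[OF has_derivative_linear[OF D\<chi>_der]])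
  have D\<chi>_cont: "continuous_on S (D\<chi> i)" for S i
    unfolding D\<chi>_def by (rule smooth_funs_continuous_on[OF smooth_funs_frechet(2)[OF sm\<chi>]])
  have shift: "continuous_on UNIV (\<lambda>w :: (real \<times> (real^'n)) \<times> (real^'n). fst w - z)"
    by (intro continuous_intros)
  have cont: "continuous_on UNIV (\<lambda>w :: (real \<times> (real^'n)) \<times> (real^'n). D\<chi> i (fst w - z))"
      "continuous_on UNIV (\<lambda>w :: (real \<times> (real^'n)) \<times> (real^'n). ?\<chi> (fst w - z))"
      "continuous_on UNIV (\<lambda>w :: (real \<times> (real^'n)) \<times> (real^'n). ?G (fst w - z))"
      "continuous_on UNIV (\<lambda>w :: (real \<times> (real^'n)) \<times> (real^'n). lse_weight P c e (fst w - z) p)"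
      "continuous_on UNIV (\<lambda>w :: (real \<times> (real^'n)) \<times> (real^'n). lift (snd w) i)" for i p
  proof -
    show "continuous_on UNIV (\<lambda>w :: (real \<times> (real^'n)) \<times> (real^'n). D\<chi> i (fst w - z))"
      by (rule continuous_on_compose2[OF D\<chi>_cont[of UNIV] shift]) simp
    show "continuous_on UNIV (\<lambda>w :: (real \<times> (real^'n)) \<times> (real^'n). ?\<chi> (fst w - z))"
      by (rule continuous_on_compose2[OF smooth_funs_continuous_on[OF sm\<chi>, of UNIV] shift]) simp
    show "continuous_on UNIV (\<lambda>w :: (real \<times> (real^'n)) \<times> (real^'n). ?G (fst w - z))"
      by (rule continuous_on_compose2[OF continuous_on_lse_grad[OF P e, of UNIV] shift]) simp
    show "continuous_on UNIV (\<lambda>w :: (real \<times> (real^'n)) \<times> (real^'n). lse_weight P c e (fst w - z) p)"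
      by (rule continuous_on_compose2[OF continuous_on_lse_weight[OF P e, of UNIV] shift]) simp
    show "continuous_on UNIV (\<lambda>w :: (real \<times> (real^'n)) \<times> (real^'n). lift (snd w) i)"
      by (cases i) (auto simp: lift_def intro!: continuous_intros)
  qed
  obtain GB where GBp: "\<And>p. p \<in> P \<Longrightarrow> norm p \<le> GB" and GB: "\<And>x. norm (?G x) \<le> GB" and GB0: "0 \<le> GB"
  proof -
    obtain GB where GBp: "\<And>p. p \<in> P \<Longrightarrow> norm p \<le> GB"
      using finite_imp_bounded[OF P(1)] by (auto simp: bounded_iff)
    then have "P \<subseteq> cball 0 GB" by auto
    then have G: "?G x \<in> cball 0 GB" for x by (rule lse_grad_in_convex[OF P e _ convex_cball])
    then have "norm (?G x) \<le> GB" for x by simp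
    moreover from this[of 0] have "0 \<le> GB" using norm_ge_zero order_trans by blast
    ultimately show ?thesis using that[OF GBp] by blast
  qed
  have norm1v: "norm (1 :: real, v) \<le> 1 + norm v" for v :: "real^'n"
    by (rule order_trans[OF norm_Pair_le]) simp
  obtain C where C: "0 < C" "\<And>s. smooth_step' s \<le> C" using smooth_step'_bounded by blast
  define k where "k = 2 * C / \<tau> + 4 * C / R"
  have k0: "0 \<le> k" using C \<tau> R by (simp add: k_def)
  have D\<chi>_bound: "\<bar>frechet_derivative ?\<chi> (at x) (1, v)\<bar> \<le> k * (1 + norm v)" for x :: "real \<times> (real^'n)" and v
  proof -
    have "time_bump_rate T \<tau> (fst x) \<le> C / \<tau> + C / \<tau>"
      unfolding time_bump_rate_def using C \<tau> by (intro add_mono divide_right_mono) auto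
    moreover have "0 \<le> C / \<tau> * norm v" "0 \<le> C / R" using C \<tau> R by simp_all
    moreover have "k * (1 + norm v) = C / \<tau> + C / \<tau> + 4 * (C / R) + 2 * (C / \<tau> * norm v) + 4 * C / R * norm v"
      by (simp add: k_def distrib_left distrib_right)
    ultimately show ?thesis
      using cutoff_derivative_bound[OF \<tau> R C(2), of T x v] by linarith
  qed
  have G1v: "\<bar>?G x \<bullet> (1, v)\<bar> \<le> GB * (1 + norm v)" for x v
    by (rule order_trans[OF Cauchy_Schwarz_ineq2 mult_mono[OF GB norm1v GB0]]) simp
  have pG: "norm (p - ?G x) \<le> 2 * GB" if "p \<in> P" for p x
    using norm_triangle_ineq4[of p "?G x"] GBp[OF that] GB[of x] by linarith
  have pG1v: "\<bar>(p - ?G x) \<bullet> (1, v)\<bar> \<le> 2 * GB * (1 + norm v)" if "p \<in> P" for p x v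
    by (rule order_trans[OF Cauchy_Schwarz_ineq2 mult_mono[OF pG[OF that] norm1v]]) (use GB0 in auto)
  have wsum: "\<bar>\<Sum>p\<in>P. lse_weight P c e x p * a p\<bar> \<le> b" if "\<And>p. p \<in> P \<Longrightarrow> \<bar>a p\<bar> \<le> b" for x a b
  proof -
    have "\<bar>\<Sum>p\<in>P. lse_weight P c e x p * a p\<bar> \<le> (\<Sum>p\<in>P. lse_weight P c e x p * b)"
    proof (intro order_trans[OF sum_abs] sum_mono)
      fix p assume "p \<in> P"
      have w0: "0 \<le> lse_weight P c e x p" by (rule less_imp_le[OF lse_weight_pos[OF P e]])
      then have "\<bar>lse_weight P c e x p * a p\<bar> = lse_weight P c e x p * \<bar>a p\<bar>" by (simp add: abs_mult)
      also have "\<dots> \<le> lse_weight P c e x p * b" by (rule mult_left_mono[OF that[OF \<open>p \<in> P\<close>] w0])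
      finally show "\<bar>lse_weight P c e x p * a p\<bar> \<le> lse_weight P c e x p * b" .
    qed
    then show ?thesis by (simp add: sum_distrib_right[symmetric] sum_lse_weight[OF P e])
  qed
  have unit1: "norm (unit i :: real \<times> (real^'n)) = 1" for i
    by (cases i) (auto simp: unit_def norm_Pair)
  have q: "a * (1 + norm v) * (b * (1 + norm v)) \<le> (2 * a * b) * (1 + (norm v)\<^sup>2)" if "0 \<le> a" "0 \<le> b" for a b and v :: "real^'n"
    using mult_left_mono[OF one_plus_norm_square_le[of v], of "a * b"] that by (simp add: ac_simps)
  show int1: "integrable lborel (\<lambda>w. F (fst w) (snd w) * J1 w)"
  proof (rule F_integrable)
    show "J1 \<in> borel_measurable borel"
      unfolding J1_def D\<chi>_exp by (intro borel_measurable_continuous_onI continuous_intros cont)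
    fix w :: "(real \<times> (real^'n)) \<times> (real^'n)"
    have "\<bar>J1 w\<bar> \<le> k * (1 + norm (snd w)) * (GB * (1 + norm (snd w)))"
      unfolding J1_def abs_mult by (intro mult_mono D\<chi>_bound G1v mult_nonneg_nonneg k0) auto
    then show "\<bar>J1 w\<bar> \<le> (2 * k * GB) * (1 + (norm (snd w))\<^sup>2)"
      using q[OF k0 GB0, of "snd w"] by linarith
  qed
  show int2: "integrable lborel (\<lambda>w. F (fst w) (snd w) * J2 w)"
  proof (rule F_integrable)
    show "J2 \<in> borel_measurable borel"
      unfolding J2_def lse_hess_def
      by (intro borel_measurable_continuous_onI continuous_intros cont) (use e in auto)
    fix w :: "(real \<times> (real^'n)) \<times> (real^'n)"
    let ?x = "fst w - z"
    have "\<bar>\<Sum>p\<in>P. lse_weight P c e ?x p * ((p - ?G ?x) \<bullet> (1, snd w))\<^sup>2\<bar>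
      \<le> 2 * GB * (1 + norm (snd w)) * (2 * GB * (1 + norm (snd w)))"
    proof (rule wsum)
      fix p assume p: "p \<in> P"
      show "\<bar>((p - ?G ?x) \<bullet> (1, snd w))\<^sup>2\<bar> \<le> 2 * GB * (1 + norm (snd w)) * (2 * GB * (1 + norm (snd w)))"
        unfolding power2_eq_square abs_mult using GB0 by (intro mult_mono pG1v[OF p]) auto
    qed
    also have "\<dots> \<le> (2 * (2 * GB) * (2 * GB)) * (1 + (norm (snd w))\<^sup>2)"
      using GB0 by (intro q) auto
    finally have "\<bar>lse_hess P c e ?x (\<lambda>\<xi>. (\<xi> \<bullet> (1, snd w))\<^sup>2)\<bar> \<le> (2 * (2 * GB) * (2 * GB) / e) * (1 + (norm (snd w))\<^sup>2)"
      unfolding lse_hess_def using e by (simp add: divide_right_mono)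
    moreover have "\<bar>J2 w\<bar> \<le> 1 * \<bar>lse_hess P c e ?x (\<lambda>\<xi>. (\<xi> \<bullet> (1, snd w))\<^sup>2)\<bar>"
      unfolding J2_def abs_mult using cutoff_props(1,2)[OF \<tau> R, where T = T and x = ?x] by (intro mult_right_mono) auto
    ultimately show "\<bar>J2 w\<bar> \<le> (2 * (2 * GB) * (2 * GB) / e) * (1 + (norm (snd w))\<^sup>2)"
      by linarith
  qed
  have D\<phi>: "frechet_derivative (\<phi> i) (at x) u = frechet_derivative ?\<chi> (at (x - z)) u * (?G (x - z) \<bullet> unit i)
     + ?\<chi> (x - z) * ((\<Sum>p\<in>P. lse_weight P c e (x - z) p * (((p - ?G (x - z)) \<bullet> unit i) * ((p - ?G (x - z)) \<bullet> u))) / e)" for i x u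
  proof -
    have sh: "((\<lambda>x. x - z) has_derivative (\<lambda>u. u)) (at x)" by (auto intro!: derivative_eq_intros)
    have "((\<lambda>x. ?\<chi> (x - z)) has_derivative frechet_derivative ?\<chi> (at (x - z))) (at x)"
      using has_derivative_compose[OF sh D\<chi>_der] by simp
    moreover have "((\<lambda>x. ?G (x - z) \<bullet> unit i) has_derivative
       (\<lambda>u. (\<Sum>p\<in>P. lse_weight P c e (x - z) p * (((p - ?G (x - z)) \<bullet> unit i) * ((p - ?G (x - z)) \<bullet> u))) / e)) (at x)"
      using has_derivative_compose[OF sh has_derivative_lse_grad[OF P e]] by simp
    ultimately have "(\<phi> i has_derivative (\<lambda>u. ?\<chi> (x - z) * ((\<Sum>p\<in>P. lse_weight P c e (x - z) p * (((p - ?G (x - z)) \<bullet> unit i) * ((p - ?G (x - z)) \<bullet> u))) / e)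
        + frechet_derivative ?\<chi> (at (x - z)) u * (?G (x - z) \<bullet> unit i))) (at x)"
      unfolding \<phi>_def by (rule has_derivative_mult)
    from frechet_derivative_at[OF this, symmetric] show ?thesis by simp
  qed
  have sum_eq: "(\<Sum>i\<in>UNIV. lift (snd w) i * frechet_derivative (\<phi> i) (at (fst w)) (1, snd w)) = J1 w + J2 w" for w
  proof -
    let ?x = "fst w - z" and ?v = "snd w"
    have inn: "(\<Sum>i\<in>UNIV. lift ?v i * (\<zeta> \<bullet> unit i)) = \<zeta> \<bullet> (1, ?v)" for \<zeta> :: "real \<times> (real^'n)"
      unfolding sum_lift_unit[symmetric] by (simp add: inner_sum_right)
    have "(\<Sum>i\<in>UNIV. lift ?v i * (frechet_derivative ?\<chi> (at ?x) (1, ?v) * (?G ?x \<bullet> unit i))) = J1 w"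
      unfolding J1_def inn[symmetric] by (simp add: sum_distrib_left mult.left_commute)
    moreover have "(\<Sum>i\<in>UNIV. lift ?v i * (?\<chi> ?x * ((\<Sum>p\<in>P. lse_weight P c e ?x p * (((p - ?G ?x) \<bullet> unit i) * ((p - ?G ?x) \<bullet> (1, ?v)))) / e))) = J2 w"
    proof -
      have "(\<Sum>i\<in>UNIV. lift ?v i * (?\<chi> ?x * ((\<Sum>p\<in>P. lse_weight P c e ?x p * (((p - ?G ?x) \<bullet> unit i) * ((p - ?G ?x) \<bullet> (1, ?v)))) / e)))
        = ?\<chi> ?x * ((\<Sum>i\<in>UNIV. \<Sum>p\<in>P. lse_weight P c e ?x p * ((p - ?G ?x) \<bullet> (1, ?v)) * (lift ?v i * ((p - ?G ?x) \<bullet> unit i))) / e)"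
        by (simp add: sum_distrib_left sum_divide_distrib ac_simps)
      also have "\<dots> = ?\<chi> ?x * ((\<Sum>p\<in>P. \<Sum>i\<in>UNIV. lse_weight P c e ?x p * ((p - ?G ?x) \<bullet> (1, ?v)) * (lift ?v i * ((p - ?G ?x) \<bullet> unit i))) / e)"
        by (subst sum.swap) simp
      also have "\<dots> = J2 w"
        unfolding J2_def lse_hess_def by (simp only: sum_distrib_left[symmetric] inn power2_eq_square mult.assoc)
      finally show ?thesis .
    qed
    ultimately show ?thesis unfolding D\<phi> distrib_left sum.distrib by simp
  qed
  have \<phi>_int: "integrable lborel (\<lambda>w. F (fst w) (snd w) * lift (snd w) i * frechet_derivative (\<phi> i) (at (fst w)) (1, snd w))" for i
    unfolding mult.assoc
  proof (rule F_integrable)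
    show "(\<lambda>w. lift (snd w) i * frechet_derivative (\<phi> i) (at (fst w)) (1, snd w)) \<in> borel_measurable borel"
      unfolding D\<phi> D\<chi>_exp
      by (intro borel_measurable_continuous_onI continuous_intros cont) (use e in auto)
    fix w :: "(real \<times> (real^'n)) \<times> (real^'n)"
    let ?x = "fst w - z" and ?v = "snd w"
    have "\<bar>(\<Sum>p\<in>P. lse_weight P c e ?x p * (((p - ?G ?x) \<bullet> unit i) * ((p - ?G ?x) \<bullet> (1, ?v))))\<bar>
       \<le> 2 * GB * (2 * GB * (1 + norm ?v))"
    proof (rule wsum)
      fix p assume p: "p \<in> P"
      have "\<bar>(p - ?G ?x) \<bullet> unit i\<bar> \<le> 2 * GB"
        using Cauchy_Schwarz_ineq2[of "p - ?G ?x" "unit i"] pG[OF p, of ?x] by (simp add: unit1)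
      then show "\<bar>((p - ?G ?x) \<bullet> unit i) * ((p - ?G ?x) \<bullet> (1, ?v))\<bar> \<le> 2 * GB * (2 * GB * (1 + norm ?v))"
        unfolding abs_mult using pG1v[OF p] GB0 by (intro mult_mono) auto
    qed
    then have "\<bar>(\<Sum>p\<in>P. lse_weight P c e ?x p * (((p - ?G ?x) \<bullet> unit i) * ((p - ?G ?x) \<bullet> (1, ?v)))) / e\<bar>
       \<le> 2 * GB * (2 * GB * (1 + norm ?v)) / e"
      using e by (simp add: divide_right_mono)
    then have b2: "\<bar>?\<chi> ?x * ((\<Sum>p\<in>P. lse_weight P c e ?x p * (((p - ?G ?x) \<bullet> unit i) * ((p - ?G ?x) \<bullet> (1, ?v)))) / e)\<bar>
       \<le> 1 * (2 * GB * (2 * GB * (1 + norm ?v)) / e)"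
      unfolding abs_mult[of "?\<chi> ?x"] using cutoff_props(1,2)[OF \<tau> R, where T = T and x = ?x] by (intro mult_mono) auto
    have b1: "\<bar>frechet_derivative ?\<chi> (at ?x) (1, ?v) * (?G ?x \<bullet> unit i)\<bar> \<le> k * (1 + norm ?v) * GB"
      unfolding abs_mult using Cauchy_Schwarz_ineq2[of "?G ?x" "unit i"] GB[of ?x] k0
      by (intro mult_mono D\<chi>_bound) (auto simp: unit1)
    have tri: "\<bar>A\<bar> \<le> a \<Longrightarrow> \<bar>B\<bar> \<le> b \<Longrightarrow> \<bar>B + A\<bar> \<le> b + a" for A B a b :: real by linarith
    have "\<bar>frechet_derivative (\<phi> i) (at (fst w)) (1, ?v)\<bar> \<le> (k * GB + 2 * GB * (2 * GB) / e) * (1 + norm ?v)"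
    proof -
      have eq: "(k * GB + 2 * GB * (2 * GB) / e) * (1 + norm ?v) = k * (1 + norm ?v) * GB + 1 * (2 * GB * (2 * GB * (1 + norm ?v)) / e)"
        using e by (simp add: field_simps)
      show ?thesis unfolding D\<phi> eq by (rule tri[OF b2 b1])
    qed
    then have "\<bar>lift ?v i * frechet_derivative (\<phi> i) (at (fst w)) (1, ?v)\<bar>
       \<le> 1 * (1 + norm ?v) * ((k * GB + 2 * GB * (2 * GB) / e) * (1 + norm ?v))"
      unfolding abs_mult using abs_lift_le[of ?v i] by (intro mult_mono) auto
    also have "\<dots> \<le> (2 * 1 * (k * GB + 2 * GB * (2 * GB) / e)) * (1 + (norm ?v)\<^sup>2)"
      using k0 GB0 e by (intro q) auto
    finally show "\<bar>lift ?v i * frechet_derivative (\<phi> i) (at (fst w)) (1, ?v)\<bar>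
       \<le> (2 * 1 * (k * GB + 2 * GB * (2 * GB) / e)) * (1 + (norm ?v)\<^sup>2)" .
  qed
  have "(\<integral>w. F (fst w) (snd w) * J1 w + F (fst w) (snd w) * J2 w \<partial>lborel)
    = (\<integral>w. (\<Sum>i\<in>UNIV. F (fst w) (snd w) * lift (snd w) i * frechet_derivative (\<phi> i) (at (fst w)) (1, snd w)) \<partial>lborel)"
    by (intro Bochner_Integration.integral_cong refl)
      (simp only: distrib_left[symmetric] sum_eq[symmetric] sum_distrib_left mult.assoc)
  also have "\<dots> = (\<Sum>i\<in>UNIV. \<integral>w. F (fst w) (snd w) * lift (snd w) i * frechet_derivative (\<phi> i) (at (fst w)) (1, snd w) \<partial>lborel)"
    using \<phi>_int by (intro Bochner_Integration.integral_sum) auto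
  also have "\<dots> = 0"
    unfolding \<phi>_def using F_transport[OF test_fun_cutoff_lse_grad(2)[OF P e \<tau> R z]] by simp
  finally show "(\<integral>w. F (fst w) (snd w) * J2 w \<partial>lborel) = - (\<integral>w. F (fst w) (snd w) * J1 w \<partial>lborel)"
    using int1 int2 by simp
qed

end

section \<open>Fubini, translations and moving cubes\<close>

lemma nn_integral_lborel_translate:
  fixes a :: "'a::euclidean_space"
  assumes "f \<in> borel_measurable borel"
  shows "(\<integral>\<^sup>+x. f (x + a) \<partial>lborel) = (\<integral>\<^sup>+x. f x \<partial>lborel)"
proof -
  have "(\<integral>\<^sup>+x. f x \<partial>lborel) = (\<integral>\<^sup>+x. f x \<partial>distr lborel borel ((+) a))"
    by (simp add: lborel_distr_plus)
  also have "\<dots> = (\<integral>\<^sup>+x. f (a + x) \<partial>lborel)"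
    using assms by (intro nn_integral_distr) auto
  finally show ?thesis by (simp add: add.commute)
qed

lemma nn_integral_lborel_iterated:
  fixes f :: "'a::euclidean_space \<times> 'b::euclidean_space \<Rightarrow> ennreal"
  assumes "f \<in> borel_measurable borel"
  shows "(\<integral>\<^sup>+w. f w \<partial>lborel) = (\<integral>\<^sup>+x. \<integral>\<^sup>+v. f (x, v) \<partial>lborel \<partial>lborel)"
    and "(\<lambda>x. \<integral>\<^sup>+v. f (x, v) \<partial>lborel) \<in> borel_measurable borel"
proof -
  have f: "f \<in> borel_measurable (lborel \<Otimes>\<^sub>M lborel)" using assms by (simp add: lborel_prod)
  show "(\<integral>\<^sup>+w. f w \<partial>lborel) = (\<integral>\<^sup>+x. \<integral>\<^sup>+v. f (x, v) \<partial>lborel \<partial>lborel)"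
    using lborel.nn_integral_fst[OF f] by (simp add: lborel_prod)
  show "(\<lambda>x. \<integral>\<^sup>+v. f (x, v) \<partial>lborel) \<in> borel_measurable borel"
    using lborel.borel_measurable_nn_integral_fst[OF f] by simp
qed

lemma nn_integral_lborel_swap:
  fixes f :: "'a::euclidean_space \<times> 'b::euclidean_space \<Rightarrow> ennreal"
  assumes "f \<in> borel_measurable borel"
  shows "(\<integral>\<^sup>+x. \<integral>\<^sup>+y. f (x, y) \<partial>lborel \<partial>lborel) = (\<integral>\<^sup>+y. \<integral>\<^sup>+x. f (x, y) \<partial>lborel \<partial>lborel)"
proof -
  have f: "f \<in> borel_measurable (lborel \<Otimes>\<^sub>M lborel)" using assms by (simp add: lborel_prod)
  then show ?thesis using lborel_pair.Fubini'[of "\<lambda>x y. f (x, y)"] by simp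
qed

text \<open>Dominated convergence: for a fixed point the indicator of the moving cube is itself the
  indicator of a cube in the corner variable, so it converges unless the point lies on the frontier
  of the limit cube, which is a null set.\<close>

lemma continuous_on_window_integral:
  fixes g :: "'a::euclidean_space \<Rightarrow> real"
  assumes g: "integrable lborel g"
  shows "continuous_on UNIV (\<lambda>x. \<integral>y. indicator (cbox x (x + h *\<^sub>R One)) y * g y \<partial>lborel)"
  unfolding continuous_on_sequentially
proof (intro allI ballI impI)
  fix x :: "nat \<Rightarrow> 'a" and a assume x: "(\<forall>n. x n \<in> UNIV) \<and> x \<longlonglongrightarrow> a"
  have mem: "y \<in> cbox x (x + h *\<^sub>R One) \<longleftrightarrow> x \<in> cbox (y - h *\<^sub>R One) y" 
    "y \<in> box x (x + h *\<^sub>R One) \<longleftrightarrow> x \<in> box (y - h *\<^sub>R One) y" for x y :: 'a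
    by (auto simp: mem_box inner_simps algebra_simps)
  have "(\<lambda>n. \<integral>y. indicator (cbox (x n) (x n + h *\<^sub>R One)) y * g y \<partial>lborel)
    \<longlonglongrightarrow> (\<integral>y. indicator (cbox a (a + h *\<^sub>R One)) y * g y \<partial>lborel)"
  proof (rule integral_dominated_convergence)
    show "integrable lborel (\<lambda>y. \<bar>g y\<bar>)" using g by (rule integrable_abs)
    have "frontier (cbox a (a + h *\<^sub>R One)) \<in> null_sets lborel"
      using negligible_frontier_interval[of a "a + h *\<^sub>R One"]
      by (simp add: negligible_iff_null_sets null_sets_completion_iff frontier_cbox)
    then have "AE y in lborel. y \<notin> frontier (cbox a (a + h *\<^sub>R One))" by (rule AE_not_in)
    then show "AE y in lborel. (\<lambda>n. indicator (cbox (x n) (x n + h *\<^sub>R One)) y * g y) \<longlonglongrightarrow> indicator (cbox a (a + h *\<^sub>R One)) y * g y"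
    proof (rule AE_mp[OF _ AE_I2], intro impI)
      fix y assume "y \<notin> frontier (cbox a (a + h *\<^sub>R One))"
      then have "a \<notin> frontier (cbox (y - h *\<^sub>R One) y)"
        using mem by (simp add: frontier_cbox)
      then have "isCont (indicat_real (cbox (y - h *\<^sub>R One) y)) a" by (simp add: isCont_indicator)
      then have "(\<lambda>n. indicat_real (cbox (y - h *\<^sub>R One) y) (x n)) \<longlonglongrightarrow> indicat_real (cbox (y - h *\<^sub>R One) y) a"
        using x isCont_tendsto_compose by blast
      moreover have "indicat_real (cbox (y - h *\<^sub>R One) y) z = indicat_real (cbox z (z + h *\<^sub>R One)) y" for z
        using mem(1)[of y z] by (simp add: indicator_def)
      ultimately show "(\<lambda>n. indicator (cbox (x n) (x n + h *\<^sub>R One)) y * g y) \<longlonglongrightarrow> indicator (cbox a (a + h *\<^sub>R One)) y * g y"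
        by (intro tendsto_mult) simp_all
    qed
    show "AE y in lborel. norm (indicator (cbox (x n) (x n + h *\<^sub>R One)) y * g y) \<le> \<bar>g y\<bar>" for n
      by (rule AE_I2) (simp split: split_indicator)
  qed (use g in auto)
  then show "((\<lambda>x. \<integral>y. indicator (cbox x (x + h *\<^sub>R One)) y * g y \<partial>lborel) \<circ> x)
    \<longlonglongrightarrow> (\<integral>y. indicator (cbox a (a + h *\<^sub>R One)) y * g y \<partial>lborel)"
    by (simp add: comp_def)
qed

context kinetic_flow
begin

lemma F_times_measurable:
  assumes "H \<in> borel_measurable borel"
  shows "(\<lambda>w. ennreal (F (fst w) (snd w) * H w)) \<in> borel_measurable borel"
  by (intro measurable_compose[OF borel_measurable_times[OF F_measurable assms] measurable_ennreal])

text \<open>At each fixed time the integral over y and v is at most \<open>M\<close>; what remains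
  is the total mass 2 of the rate.\<close>

lemma nn_integral_time_weight:
  assumes H: "H \<in> borel_measurable borel" "\<And>v. 0 \<le> H v"
    and M: "0 \<le> M" "\<And>t. t \<in> {0<..<T} \<Longrightarrow> (\<integral>\<^sup>+y. \<integral>\<^sup>+v. ennreal (F (t, y) v * H v) \<partial>lborel \<partial>lborel) \<le> ennreal M"
    and \<tau>: "0 < \<tau>"
  shows "(\<integral>\<^sup>+w. ennreal (F (fst w) (snd w) * (time_bump_rate T \<tau> (fst (fst w) - s) * H (snd w))) \<partial>lborel) \<le> ennreal (2 * M)"
proof -
  have mH: "(\<lambda>w :: (real \<times> (real^'n)) \<times> (real^'n). H (snd w)) \<in> borel_measurable borel"
    by (intro measurable_compose[OF _ H(1)] borel_measurable_continuous_onI continuous_intros)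
  have mr: "(\<lambda>w :: (real \<times> (real^'n)) \<times> (real^'n). time_bump_rate T \<tau> (fst (fst w) - s)) \<in> borel_measurable borel"
    by (intro measurable_compose[OF _ time_bump_rate_measurable] borel_measurable_continuous_onI continuous_intros)
  have m1: "(\<lambda>w. ennreal (F (fst w) (snd w) * (time_bump_rate T \<tau> (fst (fst w) - s) * H (snd w)))) \<in> borel_measurable borel"
    by (intro F_times_measurable borel_measurable_times mr mH)
  have m2: "(\<lambda>w. ennreal (F (fst w) (snd w) * H (snd w))) \<in> borel_measurable borel"
    by (intro F_times_measurable mH)
  have m3: "(\<lambda>v. ennreal (F x v * H v)) \<in> borel_measurable borel" for x
    using measurable_compose[OF _ m2, of "\<lambda>v. (x, v)" borel]
    by (simp add: borel_measurable_continuous_onI continuous_on_Pair)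
  define a where "a x = (\<integral>\<^sup>+v. ennreal (F x v * H v) \<partial>lborel)" for x
  have ma: "a \<in> borel_measurable borel"
    unfolding a_def using nn_integral_lborel_iterated(2)[OF m2] by simp
  have ma': "(\<lambda>y. a (t, y)) \<in> borel_measurable borel" for t
    by (intro measurable_compose[OF _ ma] borel_measurable_continuous_onI continuous_intros)
  have "(\<integral>\<^sup>+w. ennreal (F (fst w) (snd w) * (time_bump_rate T \<tau> (fst (fst w) - s) * H (snd w))) \<partial>lborel)
    = (\<integral>\<^sup>+x. \<integral>\<^sup>+v. ennreal (time_bump_rate T \<tau> (fst x - s)) * ennreal (F x v * H v) \<partial>lborel \<partial>lborel)"
    using time_bump_rate_nonneg[OF \<tau>] F_nonneg H(2)
    by (subst nn_integral_lborel_iterated(1)[OF m1]) (simp add: ennreal_mult[symmetric] mult.left_commute)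
  also have "\<dots> = (\<integral>\<^sup>+x. ennreal (time_bump_rate T \<tau> (fst x - s)) * a x \<partial>lborel)"
    unfolding a_def using m3 by (intro nn_integral_cong nn_integral_cmult) simp
  also have "\<dots> = (\<integral>\<^sup>+t. \<integral>\<^sup>+y. ennreal (time_bump_rate T \<tau> (t - s)) * a (t, y) \<partial>lborel \<partial>lborel)"
  proof (subst nn_integral_lborel_iterated(1))
    have "(\<lambda>x :: real \<times> (real^'n). time_bump_rate T \<tau> (fst x - s)) \<in> borel_measurable borel"
      by (intro measurable_compose[OF _ time_bump_rate_measurable] borel_measurable_continuous_onI continuous_intros)
    then show "(\<lambda>x. ennreal (time_bump_rate T \<tau> (fst x - s)) * a x) \<in> borel_measurable borel"
      using ma by (intro borel_measurable_times_ennreal measurable_compose[OF _ measurable_ennreal])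
  qed simp
  also have "\<dots> = (\<integral>\<^sup>+t. ennreal (time_bump_rate T \<tau> (t - s)) * (\<integral>\<^sup>+y. a (t, y) \<partial>lborel) \<partial>lborel)"
    using ma' by (intro nn_integral_cong nn_integral_cmult) simp
  also have "\<dots> \<le> (\<integral>\<^sup>+t. ennreal (time_bump_rate T \<tau> (t - s)) * ennreal M \<partial>lborel)"
  proof (intro nn_integral_mono mult_left_mono)
    fix t
    show "(\<integral>\<^sup>+y. a (t, y) \<partial>lborel) \<le> ennreal M"
    proof (cases "t \<in> {0<..<T}")
      case True
      then show ?thesis unfolding a_def by (rule M(2))
    next
      case False
      then have "a (t, y) = 0" for y unfolding a_def using F_supp[of "(t, y)"] by simp
      then show ?thesis by simp
    qed
  qed simp
  also have "\<dots> = (\<integral>\<^sup>+t. ennreal (time_bump_rate T \<tau> (t - s)) \<partial>lborel) * ennreal M"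
    by (intro nn_integral_multc) measurable
  also have "\<dots> = ennreal (2 * M)"
    using M(1) by (simp add: nn_integral_time_bump_rate[OF \<tau>] ennreal_mult)
  finally show ?thesis .
qed

text \<open>By convexity the gradients stay in the slope box, so grad . (1, v) is at most \<alpha>
  plus \<beta> times the l1 distance of v to u. Multiplying by the two parts of the cutoff
  derivative gives four terms: the time parts yield 2 M and 2 N, the space parts carry
  \<open>j1\<close> and \<open>j2\<close> with a factor of order 1/R.\<close>

lemma flux_bound:
  fixes P :: "(real \<times> (real^'n)) set" and c :: "real \<times> (real^'n) \<Rightarrow> real"
  assumes P: "finite P" "P \<noteq> {}" and e: "0 < e" and \<tau>: "0 < \<tau>" and R: "0 < R"
    and z: "0 \<le> fst z" "fst z < \<tau>"
    and PK: "P \<subseteq> slope_box u \<alpha> \<beta>" and \<alpha>: "0 \<le> \<alpha>" and \<beta>: "0 \<le> \<beta>"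
    and C: "\<And>s. smooth_step' s \<le> C"
    and M: "0 \<le> M" "\<And>t. t \<in> {0<..<T} \<Longrightarrow> (\<integral>\<^sup>+y. \<integral>\<^sup>+v. ennreal (F (t, y) v) \<partial>lborel \<partial>lborel) \<le> ennreal M"
    and N: "0 \<le> N" "\<And>t. t \<in> {0<..<T} \<Longrightarrow>
       (\<integral>\<^sup>+y. \<integral>\<^sup>+v. ennreal (F (t, y) v * (\<Sum>k\<in>UNIV. \<bar>v $ k - u $ k\<bar>)) \<partial>lborel \<partial>lborel) \<le> ennreal N"
    and j1: "0 \<le> j1" "(\<integral>\<^sup>+w. ennreal (F (fst w) (snd w) * norm (snd w)) \<partial>lborel) \<le> ennreal j1"
    and j2: "0 \<le> j2" "(\<integral>\<^sup>+w. ennreal (F (fst w) (snd w) * (norm (snd w) * (\<Sum>k\<in>UNIV. \<bar>snd w $ k - u $ k\<bar>))) \<partial>lborel) \<le> ennreal j2"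
  shows "(\<integral>\<^sup>+w. ennreal (F (fst w) (snd w) * (cutoff T \<tau> R (fst w - z) * lse_hess P c e (fst w - z) (\<lambda>\<xi>. (\<xi> \<bullet> (1, snd w))\<^sup>2))) \<partial>lborel)
    \<le> ennreal (\<alpha> * (2 * M + 4 * C / R * j1) + \<beta> * (2 * N + 4 * C / R * j2))"
proof -
  define J1 where "J1 w = frechet_derivative (cutoff T \<tau> R) (at (fst w - z)) (1, snd w) * (lse_grad P c e (fst w - z) \<bullet> (1, snd w))"
    for w :: "(real \<times> (real^'n)) \<times> (real^'n)"
  define J2 where "J2 w = cutoff T \<tau> R (fst w - z) * lse_hess P c e (fst w - z) (\<lambda>\<xi>. (\<xi> \<bullet> (1, snd w))\<^sup>2)"
    for w :: "(real \<times> (real^'n)) \<times> (real^'n)"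
  note id = flux_identity[OF P e \<tau> R z, of c, folded J1_def J2_def]
  have J2_nonneg: "0 \<le> J2 w" for w
    unfolding J2_def by (intro mult_nonneg_nonneg cutoff_props[OF \<tau> R] lse_hess_nonneg[OF P e]) simp
  let ?l = "\<lambda>v. \<Sum>k\<in>UNIV. \<bar>v $ k - u $ k\<bar>"
  let ?r = "\<lambda>w :: (real \<times> (real^'n)) \<times> (real^'n). time_bump_rate T \<tau> (fst (fst w) - fst z)"
  have C0: "0 \<le> C" using C[of 0] smooth_step'_nonneg[of 0] by linarith
  define k where "k = 4 * C / R"
  have k0: "0 \<le> k" using C0 R by (simp add: k_def)
  have l0: "0 \<le> ?l v" for v by (intro sum_nonneg) auto
  have ml: "?l \<in> borel_measurable borel"
    by (intro borel_measurable_continuous_onI continuous_intros)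
  have "(\<integral>\<^sup>+w. ennreal (F (fst w) (snd w) * J2 w) \<partial>lborel) = ennreal (\<integral>w. F (fst w) (snd w) * J2 w \<partial>lborel)"
    using id(2) F_nonneg J2_nonneg by (intro nn_integral_eq_integral) auto
  also have "\<dots> \<le> ennreal (\<integral>w. \<bar>F (fst w) (snd w) * J1 w\<bar> \<partial>lborel)"
    unfolding id(3) by (intro ennreal_leI order_trans[OF _ integral_abs_bound]) simp
  also have "\<dots> = (\<integral>\<^sup>+w. ennreal \<bar>F (fst w) (snd w) * J1 w\<bar> \<partial>lborel)"
    using id(1) by (intro nn_integral_eq_integral[symmetric] integrable_abs) auto
  also have "\<dots> \<le> (\<integral>\<^sup>+w. (ennreal \<alpha> * ennreal (F (fst w) (snd w) * (?r w * 1)) + ennreal \<beta> * ennreal (F (fst w) (snd w) * (?r w * ?l (snd w))))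
      + (ennreal (\<alpha> * k) * ennreal (F (fst w) (snd w) * norm (snd w)) + ennreal (\<beta> * k) * ennreal (F (fst w) (snd w) * (norm (snd w) * ?l (snd w)))) \<partial>lborel)"
  proof (rule nn_integral_mono)
    fix w :: "(real \<times> (real^'n)) \<times> (real^'n)"
    let ?f = "F (fst w) (snd w)" and ?L = "?l (snd w)" and ?V = "norm (snd w)"
    have f0: "0 \<le> ?f" by (rule F_nonneg)
    have r0: "0 \<le> ?r w" by (rule time_bump_rate_nonneg[OF \<tau>])
    have L0: "0 \<le> ?L" by (rule l0)
    have "lse_grad P c e (fst w - z) \<in> slope_box u \<alpha> \<beta>"
      by (rule lse_grad_in_convex[OF P e PK convex_slope_box])
    then have g: "\<bar>lse_grad P c e (fst w - z) \<bullet> (1, snd w)\<bar> \<le> \<alpha> + \<beta> * ?L"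
      by (rule slope_box_bound)
    have "\<bar>J1 w\<bar> \<le> (?r w + k * ?V) * (\<alpha> + \<beta> * ?L)"
      unfolding J1_def abs_mult k_def
      using cutoff_derivative_bound[OF \<tau> R C, of T "fst w - z" "snd w"] g r0 k0[unfolded k_def]
      by (intro mult_mono) auto
    then have "\<bar>?f * J1 w\<bar> \<le> ?f * ((?r w + k * ?V) * (\<alpha> + \<beta> * ?L))"
      using f0 by (simp add: abs_mult mult_left_mono)
    also have "\<dots> = (\<alpha> * (?f * (?r w * 1)) + \<beta> * (?f * (?r w * ?L))) + (\<alpha> * k * (?f * ?V) + \<beta> * k * (?f * (?V * ?L)))"
      by (simp add: algebra_simps)
    finally have "ennreal \<bar>?f * J1 w\<bar> \<le> ennreal ((\<alpha> * (?f * (?r w * 1)) + \<beta> * (?f * (?r w * ?L))) + (\<alpha> * k * (?f * ?V) + \<beta> * k * (?f * (?V * ?L))))"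
      by (rule ennreal_leI)
    also have "\<dots> = (ennreal \<alpha> * ennreal (?f * (?r w * 1)) + ennreal \<beta> * ennreal (?f * (?r w * ?L)))
      + (ennreal (\<alpha> * k) * ennreal (?f * ?V) + ennreal (\<beta> * k) * ennreal (?f * (?V * ?L)))"
    proof -
      have "0 \<le> ?f * (?r w * 1)" "0 \<le> ?f * (?r w * ?L)" "0 \<le> ?f * ?V" "0 \<le> ?f * (?V * ?L)" "0 \<le> \<alpha> * k" "0 \<le> \<beta> * k"
        using f0 r0 L0 \<alpha> \<beta> k0 by simp_all
      then show ?thesis
        using \<alpha> \<beta> by (simp only: ennreal_plus ennreal_mult add_nonneg_nonneg mult_nonneg_nonneg)
    qed
    finally show "ennreal \<bar>?f * J1 w\<bar> \<le> (ennreal \<alpha> * ennreal (?f * (?r w * 1)) + ennreal \<beta> * ennreal (?f * (?r w * ?L)))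
      + (ennreal (\<alpha> * k) * ennreal (?f * ?V) + ennreal (\<beta> * k) * ennreal (?f * (?V * ?L)))" .
  qed
  also have "\<dots> = (ennreal \<alpha> * (\<integral>\<^sup>+w. ennreal (F (fst w) (snd w) * (?r w * 1)) \<partial>lborel)
      + ennreal \<beta> * (\<integral>\<^sup>+w. ennreal (F (fst w) (snd w) * (?r w * ?l (snd w))) \<partial>lborel))
      + (ennreal (\<alpha> * k) * (\<integral>\<^sup>+w. ennreal (F (fst w) (snd w) * norm (snd w)) \<partial>lborel)
      + ennreal (\<beta> * k) * (\<integral>\<^sup>+w. ennreal (F (fst w) (snd w) * (norm (snd w) * ?l (snd w))) \<partial>lborel))"
  proof -
    have mr: "?r \<in> borel_measurable borel"
      by (intro measurable_compose[OF _ time_bump_rate_measurable] borel_measurable_continuous_onI continuous_intros)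
    have mlw: "(\<lambda>w :: (real \<times> (real^'n)) \<times> (real^'n). ?l (snd w)) \<in> borel_measurable borel"
      "(\<lambda>w :: (real \<times> (real^'n)) \<times> (real^'n). norm (snd w)) \<in> borel_measurable borel"
      by (intro borel_measurable_continuous_onI continuous_intros)+
    have m1: "(\<lambda>w. ennreal (F (fst w) (snd w) * (?r w * 1))) \<in> borel_measurable borel"
      by (rule F_times_measurable) (intro borel_measurable_times mr borel_measurable_const)
    have m2: "(\<lambda>w. ennreal (F (fst w) (snd w) * (?r w * ?l (snd w)))) \<in> borel_measurable borel"
      by (rule F_times_measurable) (intro borel_measurable_times mr mlw)
    have m3: "(\<lambda>w. ennreal (F (fst w) (snd w) * norm (snd w))) \<in> borel_measurable borel"
      by (rule F_times_measurable) (rule mlw)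
    have m4: "(\<lambda>w. ennreal (F (fst w) (snd w) * (norm (snd w) * ?l (snd w)))) \<in> borel_measurable borel"
      by (rule F_times_measurable) (intro borel_measurable_times mlw)
    have split: "(\<integral>\<^sup>+w. (x1 * a1 w + x2 * a2 w) + (x3 * a3 w + x4 * a4 w) \<partial>lborel)
      = (x1 * (\<integral>\<^sup>+w. a1 w \<partial>lborel) + x2 * (\<integral>\<^sup>+w. a2 w \<partial>lborel)) + (x3 * (\<integral>\<^sup>+w. a3 w \<partial>lborel) + x4 * (\<integral>\<^sup>+w. a4 w \<partial>lborel))"
      if "a1 \<in> borel_measurable borel" "a2 \<in> borel_measurable borel" "a3 \<in> borel_measurable borel" "a4 \<in> borel_measurable borel"
      for x1 x2 x3 x4 :: ennreal and a1 a2 a3 a4 :: "(real \<times> (real^'n)) \<times> (real^'n) \<Rightarrow> ennreal"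
      using that by (simp add: nn_integral_add nn_integral_cmult)
    show ?thesis by (rule split[OF m1 m2 m3 m4])
  qed
  also have "\<dots> \<le> (ennreal \<alpha> * ennreal (2 * M) + ennreal \<beta> * ennreal (2 * N)) + (ennreal (\<alpha> * k) * ennreal j1 + ennreal (\<beta> * k) * ennreal j2)"
  proof (intro add_mono mult_left_mono j1 j2)
    show "(\<integral>\<^sup>+w. ennreal (F (fst w) (snd w) * (?r w * 1)) \<partial>lborel) \<le> ennreal (2 * M)"
      by (rule nn_integral_time_weight[OF _ _ M(1) _ \<tau>]) (use M(2) in auto)
    show "(\<integral>\<^sup>+w. ennreal (F (fst w) (snd w) * (?r w * ?l (snd w))) \<partial>lborel) \<le> ennreal (2 * N)"
      by (rule nn_integral_time_weight[OF ml l0 N(1) _ \<tau>]) (rule N(2))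
  qed auto
  also have "\<dots> = ennreal (\<alpha> * (2 * M + 4 * C / R * j1) + \<beta> * (2 * N + 4 * C / R * j2))"
    using \<alpha> \<beta> k0 M(1) N(1) j1(1) j2(1) unfolding k_def[symmetric]
    by (simp add: ennreal_mult[symmetric] ennreal_plus[symmetric] algebra_simps del: ennreal_plus)
  finally show ?thesis unfolding J2_def .
qed

end

section \<open>Compactness and volume of the slope box\<close>

lemma slope_box_bounded: "bounded (slope_box (u :: real^'n::finite) \<alpha> \<beta>)"
proof -
  have "norm \<xi> \<le> (\<bar>\<alpha>\<bar> + norm u * (CARD('n) * \<bar>\<beta>\<bar>)) + CARD('n) * \<bar>\<beta>\<bar>" if "\<xi> \<in> slope_box u \<alpha> \<beta>" for \<xi>
  proof -
    have "norm (snd \<xi>) \<le> (\<Sum>k\<in>UNIV. \<bar>snd \<xi> $ k\<bar>)" by (rule norm_le_l1_cart)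
    also have "\<dots> \<le> (\<Sum>k\<in>(UNIV :: 'n set). \<bar>\<beta>\<bar>)"
      using that by (intro sum_mono) (auto simp: slope_box_def intro: order_trans[OF _ abs_ge_self])
    finally have s: "norm (snd \<xi>) \<le> CARD('n) * \<bar>\<beta>\<bar>" by simp
    have "\<bar>u \<bullet> snd \<xi>\<bar> \<le> norm u * (CARD('n) * \<bar>\<beta>\<bar>)"
      by (rule order_trans[OF Cauchy_Schwarz_ineq2 mult_left_mono[OF s]]) simp
    moreover have "\<bar>fst \<xi> + u \<bullet> snd \<xi>\<bar> \<le> \<bar>\<alpha>\<bar>" using that by (auto simp: slope_box_def)
    ultimately have "\<bar>fst \<xi>\<bar> \<le> \<bar>\<alpha>\<bar> + norm u * (CARD('n) * \<bar>\<beta>\<bar>)" by linarith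
    moreover have "norm \<xi> \<le> \<bar>fst \<xi>\<bar> + norm (snd \<xi>)"
      using norm_Pair_le[of "fst \<xi>" "snd \<xi>"] by simp
    ultimately show ?thesis using s by linarith
  qed
  then show ?thesis unfolding bounded_iff by blast
qed

lemma slope_box_compact: "compact (slope_box (u :: real^'n::finite) \<alpha> \<beta>)"
proof -
  have "slope_box u \<alpha> \<beta> = {\<xi>. \<bar>fst \<xi> + u \<bullet> snd \<xi>\<bar> \<le> \<alpha>} \<inter> (\<Inter>k. {\<xi>. \<bar>snd \<xi> $ k\<bar> \<le> \<beta>})"
    by (auto simp: slope_box_def)
  moreover have "closed \<dots>"
    by (intro closed_Int closed_INT ballI closed_Collect_le continuous_intros)
  ultimately show ?thesis using slope_box_bounded compact_eq_bounded_closed by metis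
qed

text \<open>For fixed \<xi>' the slice is an interval of length 2 \<alpha>; the vector
  \<open>u\<close> only shifts it, so the box is a shear of a rectangular one.\<close>

lemma measure_slope_box:
  assumes "0 \<le> \<alpha>" "0 \<le> \<beta>"
  shows "measure lborel (slope_box (u :: real^'n::finite) \<alpha> \<beta>) = 2 * \<alpha> * (2 * \<beta>) ^ CARD('n)"
proof -
  let ?Q = "cbox (\<chi> k. - \<beta>) (\<chi> k. \<beta>) :: (real^'n) set"
  have sets: "slope_box u \<alpha> \<beta> \<in> sets (lborel \<Otimes>\<^sub>M lborel)"
    unfolding lborel_prod using slope_box_compact[of u \<alpha> \<beta>] by (simp add: compact_imp_closed borel_closed)
  have "emeasure lborel (slope_box u \<alpha> \<beta>) = emeasure (lborel \<Otimes>\<^sub>M lborel) (slope_box u \<alpha> \<beta>)"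
    by (simp add: lborel_prod)
  also have "\<dots> = (\<integral>\<^sup>+y. emeasure lborel ((\<lambda>t. (t, y)) -` slope_box u \<alpha> \<beta>) \<partial>lborel)"
    by (rule lborel_pair.emeasure_pair_measure_alt2[OF sets])
  also have "\<dots> = (\<integral>\<^sup>+y. ennreal (2 * \<alpha>) * indicator ?Q y \<partial>lborel)"
  proof (rule nn_integral_cong)
    fix y :: "real^'n"
    have Q: "y \<in> ?Q \<longleftrightarrow> (\<forall>k. \<bar>y $ k\<bar> \<le> \<beta>)"
      by (auto simp: mem_box_cart abs_le_iff minus_le_iff)
    show "emeasure lborel ((\<lambda>t. (t, y)) -` slope_box u \<alpha> \<beta>) = ennreal (2 * \<alpha>) * indicator ?Q y"
    proof (cases "y \<in> ?Q")
      case True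
      then have "(\<lambda>t. (t, y)) -` slope_box u \<alpha> \<beta> = {- \<alpha> - u \<bullet> y .. \<alpha> - u \<bullet> y}"
        using Q by (auto simp: slope_box_def)
      then show ?thesis using True assms by simp
    next
      case False
      then have "(\<lambda>t. (t, y)) -` slope_box u \<alpha> \<beta> = {}"
        using Q by (auto simp: slope_box_def)
      then show ?thesis using False by simp
    qed
  qed
  also have "\<dots> = ennreal (2 * \<alpha>) * emeasure lborel ?Q"
    by (rule nn_integral_cmult_indicator) simp
  also have "emeasure lborel ?Q = ennreal ((2 * \<beta>) ^ CARD('n))"
  proof -
    have "?Q \<noteq> {}" using assms by (simp add: interval_ne_empty_cart)
    then have "measure lborel ?Q = (2 * \<beta>) ^ CARD('n)"
      by (simp add: content_cbox_cart)
    moreover have "emeasure lborel ?Q = ennreal (measure lborel ?Q)"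
    proof -
      have fin: "emeasure lborel ?Q < \<infinity>" by (rule emeasure_compact_finite) simp
      then show ?thesis by (intro emeasure_eq_ennreal_measure) auto
    qed
    ultimately show ?thesis by simp
  qed
  finally have "emeasure lborel (slope_box u \<alpha> \<beta>) = ennreal (2 * \<alpha> * (2 * \<beta>) ^ CARD('n))"
    using assms by (simp add: ennreal_mult)
  then show ?thesis using assms by (simp add: measure_def)
qed

section \<open>Averages of the flux matrix over small cubes\<close>

context kinetic_flow
begin

text \<open>The transport inequality needs continuous matrix fields, so it is applied to averages of the flux
  matrix over small cubes, which converge to it almost everywhere.\<close>

definition window_avg :: "real \<Rightarrow> real \<times> (real^'n) \<Rightarrow> (real^'n \<Rightarrow> real) \<Rightarrow> real" where
  "window_avg h x q = (1 / h ^ DIM(real \<times> (real^'n))) *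
     (\<integral>w. indicator (cbox x (x + h *\<^sub>R One)) (fst w) * (F (fst w) (snd w) * q (snd w)) \<partial>lborel)"

definition flux_matrix :: "real \<times> (real^'n) \<Rightarrow> 'n option \<Rightarrow> 'n option \<Rightarrow> real" where
  "flux_matrix x i j = (\<integral>v. F x v * (lift v i * lift v j) \<partial>lborel)"

definition avg_matrix :: "real \<Rightarrow> real \<times> (real^'n) \<Rightarrow> 'n option \<Rightarrow> 'n option \<Rightarrow> real" where
  "avg_matrix h x i j = window_avg h x (\<lambda>v. lift v i * lift v j)"

lemma F_q_integrable:
  assumes "q \<in> borel_measurable borel" "\<And>v. \<bar>q v\<bar> \<le> k * (1 + (norm v)\<^sup>2)"
  shows "integrable lborel (\<lambda>w. F (fst w) (snd w) * q (snd w))"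
  by (rule F_integrable[where k = k])
    (use assms in \<open>auto intro!: measurable_compose[OF _ assms(1)] borel_measurable_continuous_onI continuous_intros\<close>)

lemma window_integrable:
  assumes "q \<in> borel_measurable borel" "\<And>v. \<bar>q v\<bar> \<le> k * (1 + (norm v)\<^sup>2)"
  shows "integrable lborel (\<lambda>w. indicator (cbox x (x + h *\<^sub>R One)) (fst w) * (F (fst w) (snd w) * q (snd w)))"
proof -
  have "cbox x (x + h *\<^sub>R One) \<times> UNIV \<in> sets (borel :: ((real \<times> (real^'n)) \<times> (real^'n)) measure)"
    by (intro borel_closed closed_Times) auto
  then have "integrable lborel (\<lambda>w. indicator (cbox x (x + h *\<^sub>R One) \<times> UNIV) w *\<^sub>R (F (fst w) (snd w) * q (snd w)))"
    using F_q_integrable[OF assms] by (intro integrable_mult_indicator) auto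
  moreover have "indicat_real (cbox x (x + h *\<^sub>R One) \<times> UNIV) w = indicator (cbox x (x + h *\<^sub>R One)) (fst w)"
    for w :: "(real \<times> (real^'n)) \<times> (real^'n)"
    by (cases w) (simp add: indicator_def)
  ultimately show ?thesis by simp
qed

lemma lift_mult_measurable: "(\<lambda>v. lift v i * lift v j) \<in> borel_measurable borel"
  by (intro borel_measurable_times lift_measurable)

lemma window_avg_sum:
  assumes "finite I" "\<And>i. i \<in> I \<Longrightarrow> q i \<in> borel_measurable borel"
    and "\<And>i v. i \<in> I \<Longrightarrow> \<bar>q i v\<bar> \<le> k i * (1 + (norm v)\<^sup>2)"
  shows "window_avg h x (\<lambda>v. \<Sum>i\<in>I. c i * q i v) = (\<Sum>i\<in>I. c i * window_avg h x (q i))"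
proof -
  have "(\<integral>w. indicator (cbox x (x + h *\<^sub>R One)) (fst w) * (F (fst w) (snd w) * (\<Sum>i\<in>I. c i * q i (snd w))) \<partial>lborel)
    = (\<integral>w. (\<Sum>i\<in>I. c i * (indicator (cbox x (x + h *\<^sub>R One)) (fst w) * (F (fst w) (snd w) * q i (snd w)))) \<partial>lborel)"
    by (simp add: sum_distrib_left ac_simps)
  also have "\<dots> = (\<Sum>i\<in>I. c i * (\<integral>w. indicator (cbox x (x + h *\<^sub>R One)) (fst w) * (F (fst w) (snd w) * q i (snd w)) \<partial>lborel))"
    using window_integrable[OF assms(2,3)] by (subst Bochner_Integration.integral_sum) auto
  finally show ?thesis
    by (simp add: window_avg_def sum_distrib_left ac_simps)
qed

lemma qform_avg_matrix: "qform (avg_matrix h x) y = window_avg h x (\<lambda>v. (y \<bullet> (1, v))\<^sup>2)"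
proof -
  have "qform (avg_matrix h x) y = (\<Sum>p\<in>UNIV. (coord (fst p) y * coord (snd p) y) * window_avg h x (\<lambda>v. lift v (fst p) * lift v (snd p)))"
    unfolding qform_def avg_matrix_def by (simp add: sum.cartesian_product UNIV_Times_UNIV case_prod_beta)
  also have "\<dots> = window_avg h x (\<lambda>v. \<Sum>p\<in>UNIV. (coord (fst p) y * coord (snd p) y) * (lift v (fst p) * lift v (snd p)))"
    by (rule window_avg_sum[where k = "\<lambda>_. 2", symmetric]) (use lift_mult_measurable lift_mult_le in auto)
  also have "(\<lambda>v. \<Sum>p\<in>UNIV. (coord (fst p) y * coord (snd p) y) * (lift v (fst p) * lift v (snd p))) = (\<lambda>v. (y \<bullet> (1, v))\<^sup>2)"
  proof
    fix v
    have "(y \<bullet> (1, v))\<^sup>2 = (\<Sum>i\<in>UNIV. \<Sum>j\<in>UNIV. (coord i y * lift v i) * (coord j y * lift v j))"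
      unfolding inner_lift power2_eq_square by (rule sum_product)
    then show "(\<Sum>p\<in>UNIV. (coord (fst p) y * coord (snd p) y) * (lift v (fst p) * lift v (snd p))) = (y \<bullet> (1, v))\<^sup>2"
      by (simp add: sum.cartesian_product UNIV_Times_UNIV case_prod_beta ac_simps)
  qed
  finally show ?thesis .
qed

lemma inner_lift_square_le: "\<bar>((y :: real \<times> (real^'n)) \<bullet> (1, v))\<^sup>2\<bar> \<le> 2 * (norm y)\<^sup>2 * (1 + (norm v)\<^sup>2)"
proof -
  have "\<bar>y \<bullet> (1, v)\<bar> \<le> norm y * (1 + norm v)"
    by (rule order_trans[OF Cauchy_Schwarz_ineq2 mult_left_mono[OF order_trans[OF norm_Pair_le]]]) simp_all
  then have "(y \<bullet> (1, v))\<^sup>2 \<le> (norm y * (1 + norm v))\<^sup>2"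
    by (simp add: abs_le_square_iff[symmetric])
  also have "\<dots> = (norm y)\<^sup>2 * ((1 + norm v) * (1 + norm v))"
    by (simp add: power2_eq_square ac_simps)
  also have "\<dots> \<le> (norm y)\<^sup>2 * (2 * (1 + (norm v)\<^sup>2))"
    by (intro mult_left_mono one_plus_norm_square_le) simp
  finally show ?thesis by (simp add: algebra_simps)
qed

lemma inner_lift_square_measurable: "(\<lambda>v. ((y :: real \<times> (real^'n)) \<bullet> (1, v))\<^sup>2) \<in> borel_measurable borel"
  by (intro borel_measurable_continuous_onI continuous_intros)

lemma window_avg_nonneg: "0 < h \<Longrightarrow> (\<And>v. 0 \<le> q v) \<Longrightarrow> 0 \<le> window_avg h x q"
  unfolding window_avg_def using F_nonneg by (intro mult_nonneg_nonneg integral_nonneg) auto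

text \<open>The Hessian is taken at the corner \<open>x\<close> while the density is averaged over
  the cube at \<open>x\<close>; by linearity in the quadratic form the two operations
  commute.\<close>

lemma lse_hess_avg_matrix:
  fixes P :: "(real \<times> (real^'n)) set"
  assumes "finite P"
  shows "lse_hess P c e x (qform (avg_matrix h x)) = window_avg h x (\<lambda>v. lse_hess P c e x (\<lambda>\<xi>. (\<xi> \<bullet> (1, v))\<^sup>2))"
proof -
  let ?G = "lse_grad P c e x"
  have "lse_hess P c e x (qform (avg_matrix h x)) = (\<Sum>p\<in>P. (lse_weight P c e x p / e) * window_avg h x (\<lambda>v. ((p - ?G) \<bullet> (1, v))\<^sup>2))"
    by (simp add: lse_hess_def qform_avg_matrix sum_divide_distrib)
  also have "\<dots> = window_avg h x (\<lambda>v. \<Sum>p\<in>P. (lse_weight P c e x p / e) * ((p - ?G) \<bullet> (1, v))\<^sup>2)"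
    by (rule window_avg_sum[OF assms inner_lift_square_measurable inner_lift_square_le, symmetric])
  also have "\<dots> = window_avg h x (\<lambda>v. lse_hess P c e x (\<lambda>\<xi>. (\<xi> \<bullet> (1, v))\<^sup>2))"
    by (simp add: lse_hess_def sum_divide_distrib)
  finally show ?thesis .
qed

lemma flux_matrix_integrable: "integrable lborel (\<lambda>x. flux_matrix x i j)"
  and window_avg_fubini: "avg_matrix h x i j =
    (1 / h ^ DIM(real \<times> (real^'n))) * (\<integral>y. indicator (cbox x (x + h *\<^sub>R One)) y * flux_matrix y i j \<partial>lborel)"
proof -
  note int = F_q_integrable[OF lift_mult_measurable lift_mult_le]
  show "integrable lborel (\<lambda>x. flux_matrix x i j)"
    unfolding flux_matrix_def
    using lborel_pair.integrable_fst'[of "\<lambda>w. F (fst w) (snd w) * (lift (snd w) i * lift (snd w) j)"] int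
    by (simp add: lborel_prod)
  note wint = window_integrable[OF lift_mult_measurable lift_mult_le]
  have "(\<integral>w. indicator (cbox x (x + h *\<^sub>R One)) (fst w) * (F (fst w) (snd w) * (lift (snd w) i * lift (snd w) j)) \<partial>lborel)
    = (\<integral>y. \<integral>v. indicator (cbox x (x + h *\<^sub>R One)) y * (F y v * (lift v i * lift v j)) \<partial>lborel \<partial>lborel)"
    using lborel_pair.integral_fst'[of "\<lambda>w. indicator (cbox x (x + h *\<^sub>R One)) (fst w) * (F (fst w) (snd w) * (lift (snd w) i * lift (snd w) j))"]
      wint[of x h i j] by (simp add: lborel_prod)
  then show "avg_matrix h x i j =
    (1 / h ^ DIM(real \<times> (real^'n))) * (\<integral>y. indicator (cbox x (x + h *\<^sub>R One)) y * flux_matrix y i j \<partial>lborel)"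
    by (simp add: avg_matrix_def window_avg_def flux_matrix_def)
qed

lemma avg_matrix_continuous: "continuous_on S (\<lambda>x. avg_matrix h x i j)"
  unfolding window_avg_fubini
  by (intro continuous_on_mult_left continuous_on_subset[OF continuous_on_window_integral[OF flux_matrix_integrable]]) auto

text \<open>Lebesgue differentiation for cubes with corner x. There are finitely many index pairs,
  so one null set serves them all.\<close>

lemma avg_matrix_tendsto:
  "AE x in lborel. \<forall>i j. (\<lambda>n. avg_matrix (inverse (real (Suc n))) x i j) \<longlonglongrightarrow> flux_matrix x i j"
proof -
  have "AE x in lborel. (\<lambda>n. avg_matrix (inverse (real (Suc n))) x i j) \<longlonglongrightarrow> flux_matrix x i j" for i j
  proof -
    let ?f = "\<lambda>x. flux_matrix x i j"
    have si: "set_integrable lborel (cbox a b) ?f" for a b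
      unfolding set_integrable_def using flux_matrix_integrable by (intro integrable_mult_indicator) auto
    have hk: "?f integrable_on cbox a b" for a b
      using set_borel_integral_eq_integral(1)[OF si] .
    obtain N where N: "negligible N" "\<And>x e. \<lbrakk>x \<notin> N; 0 < e\<rbrakk> \<Longrightarrow>
        \<exists>d>0. \<forall>h. 0 < h \<and> h < d \<longrightarrow> norm (integral (cbox x (x + h *\<^sub>R One)) ?f /\<^sub>R h ^ DIM(real \<times> (real^'n)) - ?f x) < e"
      using integrable_ccontinuous_explicit[of ?f, OF hk] by metis
    have conv: "(\<lambda>n. avg_matrix (inverse (real (Suc n))) x i j) \<longlonglongrightarrow> flux_matrix x i j" if x: "x \<notin> N" for x
    proof (rule LIMSEQ_I)
      fix r :: real assume "0 < r"
      from N(2)[OF x this] obtain d where d: "0 < d"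
        "\<And>h. 0 < h \<Longrightarrow> h < d \<Longrightarrow> norm (integral (cbox x (x + h *\<^sub>R One)) ?f /\<^sub>R h ^ DIM(real \<times> (real^'n)) - ?f x) < r"
        by blast
      have avg: "avg_matrix h x i j = integral (cbox x (x + h *\<^sub>R One)) ?f /\<^sub>R h ^ DIM(real \<times> (real^'n))" for h
        using set_borel_integral_eq_integral(2)[OF si, of x "x + h *\<^sub>R One"]
        by (simp add: window_avg_fubini set_lebesgue_integral_def divide_inverse)
      obtain n0 where n0: "inverse (real (Suc n0)) < d" using reals_Archimedean[OF d(1)] by blast
      have "norm (avg_matrix (inverse (real (Suc n))) x i j - flux_matrix x i j) < r" if "n0 \<le> n" for n
      proof -
        have "inverse (real (Suc n)) \<le> inverse (real (Suc n0))" using that by (intro le_imp_inverse_le) auto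
        then have "inverse (real (Suc n)) < d" using n0 by linarith
        then show ?thesis unfolding avg by (intro d(2)) auto
      qed
      then show "\<exists>no. \<forall>n\<ge>no. norm (avg_matrix (inverse (real (Suc n))) x i j - flux_matrix x i j) < r" by blast
    qed
    obtain N' where "N \<subseteq> N'" "N' \<in> null_sets lborel"
      using N(1) unfolding negligible_iff_null_sets null_sets_completion_iff2 by blast
    then show ?thesis using conv by (intro AE_I'[of N']) auto
  qed
  then have "AE x in lborel. \<forall>p. (\<lambda>n. avg_matrix (inverse (real (Suc n))) x (fst p) (snd p)) \<longlonglongrightarrow> flux_matrix x (fst p) (snd p)"
    by (subst AE_all_countable) (auto intro: countableI_type)
  then show ?thesis by eventually_elim simp
qed

end

context kinetic_flow
begin

text \<open>Averaging the matrix over a cube is traded for translating the potential: with y = x +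
  z, the Hessian at x meeting the density at x + z becomes the Hessian at y - z meeting the density
  at y. For each displacement \<open>z\<close> in the cube the flux bound applies, and the volume of
  the cube cancels the normalisation.\<close>

lemma averaged_flux_bound:
  fixes P :: "(real \<times> (real^'n)) set" and c :: "real \<times> (real^'n) \<Rightarrow> real"
  assumes P: "finite P" "P \<noteq> {}" and e: "0 < e" and h: "0 < h" and \<tau>: "0 < \<tau>" and R: "0 < R"
    and box: "\<And>x. x \<in> cbox a b \<Longrightarrow> cutoff T \<tau> R x = 1"
    and flux: "\<And>z. z \<in> cbox 0 (h *\<^sub>R One) \<Longrightarrow>
      (\<integral>\<^sup>+w. ennreal (F (fst w) (snd w) * (cutoff T \<tau> R (fst w - z) * lse_hess P c e (fst w - z) (\<lambda>\<xi>. (\<xi> \<bullet> (1, snd w))\<^sup>2))) \<partial>lborel) \<le> ennreal B"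
  shows "(\<integral>\<^sup>+x\<in>cbox a b. ennreal (lse_hess P c e x (qform (avg_matrix h x))) \<partial>lborel) \<le> ennreal B"
proof -
  define hs where "hs x v = lse_hess P c e x (\<lambda>\<xi>. (\<xi> \<bullet> (1, v))\<^sup>2)" for x :: "real \<times> (real^'n)" and v :: "real^'n"
  define hd where "hd = h ^ DIM(real \<times> (real^'n))"
  have hd: "0 < hd" using h by (simp add: hd_def)
  have hs0: "0 \<le> hs x v" for x v unfolding hs_def by (rule lse_hess_nonneg[OF P e]) simp
  have hs_cont: "continuous_on UNIV (\<lambda>w. hs (fst w) (snd w))"
  proof -
    have f: "continuous_on UNIV (\<lambda>w :: (real \<times> (real^'n)) \<times> (real^'n). fst w)" by (intro continuous_intros)
    have g: "continuous_on UNIV (\<lambda>w :: (real \<times> (real^'n)) \<times> (real^'n). lse_grad P c e (fst w))"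
      by (rule continuous_on_compose2[OF continuous_on_lse_grad[OF P e, of UNIV] f]) simp
    have w: "continuous_on UNIV (\<lambda>w :: (real \<times> (real^'n)) \<times> (real^'n). lse_weight P c e (fst w) p)" for p
      by (rule continuous_on_compose2[OF continuous_on_lse_weight[OF P e, of UNIV] f]) simp
    show ?thesis
      unfolding hs_def lse_hess_def using e by (intro continuous_intros g w) auto
  qed
  define \<kappa> where "\<kappa> xy = (\<integral>\<^sup>+v. ennreal (F (snd xy) v * hs (fst xy) v) \<partial>lborel)" for xy
  define f where "f u = ennreal (F (snd (fst u)) (snd u) * hs (fst (fst u)) (snd u))"
    for u :: "((real \<times> (real^'n)) \<times> (real \<times> (real^'n))) \<times> (real^'n)"
  have f_meas: "f \<in> borel_measurable borel"
  proof -
    have 1: "(\<lambda>u :: ((real \<times> (real^'n)) \<times> (real \<times> (real^'n))) \<times> (real^'n). F (snd (fst u)) (snd u)) \<in> borel_measurable borel"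
      using measurable_compose[OF _ F_measurable, of "\<lambda>u :: ((real \<times> (real^'n)) \<times> (real \<times> (real^'n))) \<times> (real^'n). (snd (fst u), snd u)" borel]
      by (simp add: borel_measurable_continuous_onI continuous_intros)
    have 2: "(\<lambda>u :: ((real \<times> (real^'n)) \<times> (real \<times> (real^'n))) \<times> (real^'n). hs (fst (fst u)) (snd u)) \<in> borel_measurable borel"
      using continuous_on_compose2[OF hs_cont, of UNIV "\<lambda>u :: ((real \<times> (real^'n)) \<times> (real \<times> (real^'n))) \<times> (real^'n). (fst (fst u), snd u)"]
      by (intro borel_measurable_continuous_onI) (simp add: continuous_intros)
    show ?thesis unfolding f_def
      by (intro measurable_compose[OF borel_measurable_times[OF 1 2] measurable_ennreal])
  qed
  have \<kappa>_meas: "\<kappa> \<in> borel_measurable borel"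
  proof -
    have "\<kappa> = (\<lambda>xy. \<integral>\<^sup>+v. f (xy, v) \<partial>lborel)" by (rule ext) (simp add: \<kappa>_def f_def)
    then show ?thesis using nn_integral_lborel_iterated(2)[OF f_meas] by simp
  qed
  define G where "G xy = ennreal (1 / hd) * (indicator (cbox a b) (fst xy) * \<kappa> xy)" for xy
  have fst_m: "fst \<in> borel_measurable (borel :: ((real \<times> (real^'n)) \<times> (real \<times> (real^'n))) measure)"
    by (intro borel_measurable_continuous_onI continuous_intros)
  have G_meas: "G \<in> borel_measurable borel"
    unfolding G_def
    by (intro borel_measurable_times_ennreal borel_measurable_const \<kappa>_meas measurable_compose[OF fst_m borel_measurable_indicator]) simp
  have memz: "y \<in> cbox x (x + h *\<^sub>R One) \<longleftrightarrow> y - x \<in> cbox 0 (h *\<^sub>R One)" for x y :: "real \<times> (real^'n)"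
    by (auto simp: mem_box inner_simps algebra_simps)
  have "(\<integral>\<^sup>+x\<in>cbox a b. ennreal (lse_hess P c e x (qform (avg_matrix h x))) \<partial>lborel)
    = (\<integral>\<^sup>+x. \<integral>\<^sup>+y. indicator (cbox 0 (h *\<^sub>R One)) (y - x) * G (x, y) \<partial>lborel \<partial>lborel)"
  proof (rule nn_integral_cong)
    fix x :: "real \<times> (real^'n)"
    have m: "(\<lambda>v. hs x v) \<in> borel_measurable borel"
      using continuous_on_compose2[OF hs_cont, of UNIV "\<lambda>v. (x, v)"]
      by (intro borel_measurable_continuous_onI) (simp add: continuous_intros)
    define GB where "GB = (\<Sum>p\<in>P. lse_weight P c e x p * (2 * (norm (p - lse_grad P c e x))\<^sup>2)) / e"
    have hs_bound: "\<bar>hs x v\<bar> \<le> GB * (1 + (norm v)\<^sup>2)" for v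
    proof -
      have "hs x v \<le> (\<Sum>p\<in>P. lse_weight P c e x p * (2 * (norm (p - lse_grad P c e x))\<^sup>2 * (1 + (norm v)\<^sup>2))) / e"
        unfolding hs_def lse_hess_def using e
      proof (intro divide_right_mono sum_mono mult_left_mono)
        fix p
        show "((p - lse_grad P c e x) \<bullet> (1, v))\<^sup>2 \<le> 2 * (norm (p - lse_grad P c e x))\<^sup>2 * (1 + (norm v)\<^sup>2)"
          using inner_lift_square_le[of "p - lse_grad P c e x" v] by linarith
      qed (use less_imp_le[OF lse_weight_pos[OF P e]] in auto)
      also have "\<dots> = GB * (1 + (norm v)\<^sup>2)"
        by (simp add: GB_def sum_distrib_right mult.assoc)
      finally show ?thesis using hs0[of x v] by simp
    qed
    note wint = window_integrable[OF m hs_bound, of x h]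
    have wm: "(\<lambda>w. ennreal (indicator (cbox x (x + h *\<^sub>R One)) (fst w) * (F (fst w) (snd w) * hs x (snd w)))) \<in> borel_measurable borel"
      using borel_measurable_integrable[OF wint] by (intro measurable_compose[OF _ measurable_ennreal]) simp
    have fm: "(\<lambda>v. ennreal (F y v * hs x v)) \<in> borel_measurable borel" for y
      using measurable_compose[OF _ f_meas, of "\<lambda>v. ((x, y), v)" borel]
      by (simp add: f_def borel_measurable_continuous_onI continuous_intros)
    have "ennreal (lse_hess P c e x (qform (avg_matrix h x))) = ennreal (window_avg h x (\<lambda>v. hs x v))"
      unfolding lse_hess_avg_matrix[OF P(1)] hs_def ..
    also have "\<dots> = ennreal (1 / hd) * ennreal (\<integral>w. indicator (cbox x (x + h *\<^sub>R One)) (fst w) * (F (fst w) (snd w) * hs x (snd w)) \<partial>lborel)"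
      unfolding window_avg_def hd_def[symmetric] using hd F_nonneg hs0
      by (intro ennreal_mult integral_nonneg) auto
    also have "ennreal (\<integral>w. indicator (cbox x (x + h *\<^sub>R One)) (fst w) * (F (fst w) (snd w) * hs x (snd w)) \<partial>lborel)
      = (\<integral>\<^sup>+w. ennreal (indicator (cbox x (x + h *\<^sub>R One)) (fst w) * (F (fst w) (snd w) * hs x (snd w))) \<partial>lborel)"
      using wint F_nonneg hs0 by (intro nn_integral_eq_integral[symmetric]) auto
    also have "\<dots> = (\<integral>\<^sup>+y. \<integral>\<^sup>+v. indicator (cbox x (x + h *\<^sub>R One)) y * ennreal (F y v * hs x v) \<partial>lborel \<partial>lborel)"
      unfolding nn_integral_lborel_iterated(1)[OF wm]
      by (intro nn_integral_cong) (simp split: split_indicator)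
    also have "\<dots> = (\<integral>\<^sup>+y. indicator (cbox x (x + h *\<^sub>R One)) y * \<kappa> (x, y) \<partial>lborel)"
      unfolding \<kappa>_def using fm by (intro nn_integral_cong) (simp add: nn_integral_cmult)
    finally have eq: "ennreal (lse_hess P c e x (qform (avg_matrix h x))) = ennreal (1 / hd) * (\<integral>\<^sup>+y. indicator (cbox x (x + h *\<^sub>R One)) y * \<kappa> (x, y) \<partial>lborel)" .
    have \<kappa>x: "(\<lambda>y. indicator (cbox x (x + h *\<^sub>R One)) y * \<kappa> (x, y)) \<in> borel_measurable lborel"
      using measurable_compose[OF _ \<kappa>_meas, of "\<lambda>y. (x, y)" borel]
      by (intro borel_measurable_times_ennreal borel_measurable_indicator) (auto simp: borel_measurable_continuous_onI continuous_intros)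
    have "ennreal (lse_hess P c e x (qform (avg_matrix h x))) * indicator (cbox a b) x
      = (\<integral>\<^sup>+y. (ennreal (1 / hd) * indicator (cbox a b) x) * (indicator (cbox x (x + h *\<^sub>R One)) y * \<kappa> (x, y)) \<partial>lborel)"
      unfolding eq nn_integral_cmult[OF \<kappa>x] by (simp add: ac_simps)
    also have "\<dots> = (\<integral>\<^sup>+y. indicator (cbox 0 (h *\<^sub>R One)) (y - x) * G (x, y) \<partial>lborel)"
      by (intro nn_integral_cong) (simp add: G_def memz ac_simps indicator_def)
    finally show "ennreal (lse_hess P c e x (qform (avg_matrix h x))) * indicator (cbox a b) x
      = (\<integral>\<^sup>+y. indicator (cbox 0 (h *\<^sub>R One)) (y - x) * G (x, y) \<partial>lborel)" .
  qed
  also have "\<dots> = (\<integral>\<^sup>+x. \<integral>\<^sup>+z. indicator (cbox 0 (h *\<^sub>R One)) z * G (x, z + x) \<partial>lborel \<partial>lborel)"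
  proof (rule nn_integral_cong)
    fix x :: "real \<times> (real^'n)"
    have "(\<lambda>y. indicator (cbox 0 (h *\<^sub>R One)) (y - x) * G (x, y)) \<in> borel_measurable borel"
    proof (intro borel_measurable_times_ennreal)
      show "(\<lambda>y. indicator (cbox 0 (h *\<^sub>R One)) (y - x)) \<in> borel_measurable borel"
        by (rule measurable_compose[of "\<lambda>y. y - x" borel borel])
          (auto intro!: borel_measurable_continuous_onI continuous_intros)
      show "(\<lambda>y. G (x, y)) \<in> borel_measurable borel"
        by (rule measurable_compose[OF _ G_meas]) (intro borel_measurable_continuous_onI continuous_intros)
    qed
    from nn_integral_lborel_translate[OF this, of x]
    show "(\<integral>\<^sup>+y. indicator (cbox 0 (h *\<^sub>R One)) (y - x) * G (x, y) \<partial>lborel)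
      = (\<integral>\<^sup>+z. indicator (cbox 0 (h *\<^sub>R One)) z * G (x, z + x) \<partial>lborel)" by simp
  qed
  also have "\<dots> = (\<integral>\<^sup>+z. \<integral>\<^sup>+x. indicator (cbox 0 (h *\<^sub>R One)) z * G (x, z + x) \<partial>lborel \<partial>lborel)"
  proof -
    have "(\<lambda>xz. indicator (cbox 0 (h *\<^sub>R One)) (snd xz) * G (fst xz, snd xz + fst xz)) \<in> borel_measurable borel"
    proof (intro borel_measurable_times_ennreal)
      show "(\<lambda>xz :: (real \<times> (real^'n)) \<times> (real \<times> (real^'n)). indicator (cbox 0 (h *\<^sub>R One)) (snd xz)) \<in> borel_measurable borel"
        by (rule measurable_compose[of snd borel borel])
          (auto intro!: borel_measurable_continuous_onI continuous_intros)
      show "(\<lambda>xz. G (fst xz, snd xz + fst xz)) \<in> borel_measurable borel"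
        by (rule measurable_compose[OF _ G_meas]) (intro borel_measurable_continuous_onI continuous_intros)
    qed
    from nn_integral_lborel_swap[OF this] show ?thesis by simp
  qed
  also have "\<dots> \<le> (\<integral>\<^sup>+z. ennreal (B / hd) * indicator (cbox 0 (h *\<^sub>R One)) z \<partial>(lborel :: (real \<times> (real^'n)) measure))"
  proof (rule nn_integral_mono)
    fix z :: "real \<times> (real^'n)"
    have gm: "(\<lambda>x. G (x, z + x)) \<in> borel_measurable borel"
      by (rule measurable_compose[OF _ G_meas]) (intro borel_measurable_continuous_onI continuous_intros)
    show "(\<integral>\<^sup>+x. indicator (cbox 0 (h *\<^sub>R One)) z * G (x, z + x) \<partial>lborel) \<le> ennreal (B / hd) * indicator (cbox 0 (h *\<^sub>R One)) z"
    proof (cases "z \<in> cbox 0 (h *\<^sub>R One)")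
      case True
      have "(\<integral>\<^sup>+x. G (x, z + x) \<partial>lborel) = (\<integral>\<^sup>+x. G (x - z, x) \<partial>lborel)"
        using nn_integral_lborel_translate[OF gm, of "- z"] by simp
      also have "\<dots> = (\<integral>\<^sup>+y. ennreal (1 / hd) * (indicator (cbox a b) (y - z) * \<kappa> (y - z, y)) \<partial>lborel)"
        by (simp add: G_def)
      also have "\<dots> \<le> (\<integral>\<^sup>+y. ennreal (1 / hd) * (\<integral>\<^sup>+v. ennreal (F y v * (cutoff T \<tau> R (y - z) * hs (y - z) v)) \<partial>lborel) \<partial>lborel)"
      proof (intro nn_integral_mono mult_left_mono)
        fix y
        show "indicator (cbox a b) (y - z) * \<kappa> (y - z, y) \<le> (\<integral>\<^sup>+v. ennreal (F y v * (cutoff T \<tau> R (y - z) * hs (y - z) v)) \<partial>lborel)"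
          by (cases "y - z \<in> cbox a b") (simp_all add: \<kappa>_def box)
      qed simp
      also have "\<dots> = ennreal (1 / hd) * (\<integral>\<^sup>+y. \<integral>\<^sup>+v. ennreal (F y v * (cutoff T \<tau> R (y - z) * hs (y - z) v)) \<partial>lborel \<partial>lborel)"
      proof -
        have "continuous_on UNIV (\<lambda>w :: (real \<times> (real^'n)) \<times> (real^'n). cutoff T \<tau> R (fst w - z) * hs (fst w - z) (snd w))"
        proof (rule continuous_on_mult)
          show "continuous_on UNIV (\<lambda>w :: (real \<times> (real^'n)) \<times> (real^'n). cutoff T \<tau> R (fst w - z))"
            by (rule continuous_on_compose2[OF smooth_funs_continuous_on[OF smooth_funs_cutoff[OF \<tau> R], of UNIV]])
              (auto intro!: continuous_intros)
          show "continuous_on UNIV (\<lambda>w :: (real \<times> (real^'n)) \<times> (real^'n). hs (fst w - z) (snd w))"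
            using continuous_on_compose2[OF hs_cont, of UNIV "\<lambda>w. (fst w - z, snd w)"] by (simp add: continuous_intros)
        qed
        then have fm: "(\<lambda>w. ennreal (F (fst w) (snd w) * (cutoff T \<tau> R (fst w - z) * hs (fst w - z) (snd w)))) \<in> borel_measurable borel"
          by (intro F_times_measurable borel_measurable_continuous_onI)
        show ?thesis
          using nn_integral_lborel_iterated(2)[OF fm] by (intro nn_integral_cmult) simp
      qed
      also have "\<dots> \<le> ennreal (1 / hd) * ennreal B"
      proof (rule mult_left_mono)
        have "continuous_on UNIV (\<lambda>w :: (real \<times> (real^'n)) \<times> (real^'n). cutoff T \<tau> R (fst w - z) * hs (fst w - z) (snd w))"
        proof (rule continuous_on_mult)
          show "continuous_on UNIV (\<lambda>w :: (real \<times> (real^'n)) \<times> (real^'n). cutoff T \<tau> R (fst w - z))"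
            by (rule continuous_on_compose2[OF smooth_funs_continuous_on[OF smooth_funs_cutoff[OF \<tau> R], of UNIV]])
              (auto intro!: continuous_intros)
          show "continuous_on UNIV (\<lambda>w :: (real \<times> (real^'n)) \<times> (real^'n). hs (fst w - z) (snd w))"
            using continuous_on_compose2[OF hs_cont, of UNIV "\<lambda>w. (fst w - z, snd w)"] by (simp add: continuous_intros)
        qed
        then have fm: "(\<lambda>w. ennreal (F (fst w) (snd w) * (cutoff T \<tau> R (fst w - z) * hs (fst w - z) (snd w)))) \<in> borel_measurable borel"
          by (intro F_times_measurable borel_measurable_continuous_onI)
        show "(\<integral>\<^sup>+y. \<integral>\<^sup>+v. ennreal (F y v * (cutoff T \<tau> R (y - z) * hs (y - z) v)) \<partial>lborel \<partial>lborel) \<le> ennreal B"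
          using flux[OF True] nn_integral_lborel_iterated(1)[OF fm] by (simp add: hs_def)
      qed simp
      also have "\<dots> = ennreal (B / hd)" using hd by (simp add: ennreal_mult'[symmetric])
      finally show ?thesis using True by simp
    qed simp
  qed
  also have "\<dots> = ennreal (B / hd) * emeasure lborel (cbox 0 (h *\<^sub>R One) :: (real \<times> (real^'n)) set)"
    by (rule nn_integral_cmult_indicator) simp
  also have "emeasure lborel (cbox 0 (h *\<^sub>R One) :: (real \<times> (real^'n)) set) = ennreal hd"
    using h by (subst emeasure_lborel_cbox) (simp_all add: hd_def prod_constant)
  also have "ennreal (B / hd) * ennreal hd = ennreal B"
    using hd by (simp add: ennreal_mult''[symmetric])
  finally show ?thesis .
qed

end

section \<open>Compensated integrability\<close>

text \<open>By contradiction with \<open>det_transport\<close>: were the integral above four times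
  the measure of the box \<open>K\<close>, that measure would be at most C times the flux bound of
  \<open>K\<close>. The box is chosen with measure exactly 2 C times its flux bound, and four times
  that measure is the right-hand side.\<close>

lemma det_transport_optimised:
  fixes A :: "real \<times> (real^'n::finite) \<Rightarrow> 'n option \<Rightarrow> 'n option \<Rightarrow> real" and u :: "real^'n"
  assumes cont: "\<And>i j. continuous_on (cbox a b) (\<lambda>x. A x i j)"
    and sym: "\<And>x i j. x \<in> cbox a b \<Longrightarrow> A x i j = A x j i"
    and psd: "\<And>x y. x \<in> cbox a b \<Longrightarrow> 0 \<le> qform (A x) y"
    and MN: "0 < M" "0 < N"
    and bound: "\<And>\<alpha> \<beta> P c e. 0 < \<alpha> \<Longrightarrow> 0 < \<beta> \<Longrightarrow> finite P \<Longrightarrow> P \<noteq> {} \<Longrightarrow> P \<subseteq> slope_box u \<alpha> \<beta> \<Longrightarrow> 0 < e \<Longrightarrow>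
       (\<integral>\<^sup>+x\<in>cbox a b. ennreal (lse_hess P c e x (qform (A x))) \<partial>lborel) \<le> ennreal (\<alpha> * M + \<beta> * N)"
  shows "(\<integral>\<^sup>+x\<in>cbox a b. ennreal (det (\<chi> i j. A x i j) powr (1 / CARD('n))) \<partial>lborel)
    \<le> ennreal (4 * (2 * (64 / 7 * 4 ^ (CARD('n) + 1))) powr (1 + 1 / CARD('n)) * N * M powr (1 / CARD('n)))"
proof (rule ccontr)
  assume contra: "\<not> ?thesis"
  define n where "n = CARD('n)"
  have n: "0 < n" by (simp add: n_def)
  define C :: real where "C = 64 / 7 * 4 ^ (n + 1)"
  have C: "(0::real) < C" by (simp add: C_def)
  \<comment> \<open>The half-widths \<open>\<mu> * N / 2\<close> and \<open>\<mu> * M / 2\<close>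
    balance the two terms of the flux bound, whose sum is then \<mu> M N. The factor \<mu> solves
    \<mu> N (\<mu> M)^n = 2 C \<mu> M N.\<close>
  define \<mu> where "\<mu> = (2 * C * M) powr (1 / n) / M"
  have \<mu>: "0 < \<mu>" using C MN by (simp add: \<mu>_def)
  have \<mu>M: "(\<mu> * M) ^ n = 2 * C * M"
    using MN C n by (simp add: \<mu>_def powr_realpow[symmetric] powr_powr)
  define K where "K = slope_box u (\<mu> * N / 2) (\<mu> * M / 2)"
  have "measure lborel K = 2 * (\<mu> * N / 2) * (2 * (\<mu> * M / 2)) ^ n"
    unfolding K_def n_def using \<mu> MN by (intro measure_slope_box) auto
  also have "\<dots> = 2 * C * (\<mu> * N * M)" by (simp add: \<mu>M)
  finally have K: "measure lborel K = 2 * C * (\<mu> * N * M)" .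
  have "\<mu> * M = (2 * C) powr (1 / n) * M powr (1 / n)"
    using MN C by (simp add: \<mu>_def powr_mult)
  then have K': "4 * measure lborel K = 4 * (2 * C) powr (1 + 1 / n) * N * M powr (1 / n)"
    using C unfolding K powr_add by (simp add: ac_simps)
  have pos: "0 < measure lborel K" unfolding K using C \<mu> MN by simp
  have "measure lborel K \<le> C * (\<mu> * N / 2 * M + \<mu> * M / 2 * N)"
    unfolding C_def n_def
  proof (rule det_transport[OF cont sym psd])
    show "compact K" unfolding K_def by (rule slope_box_compact)
    show "ennreal (4 * measure lborel K) \<le> (\<integral>\<^sup>+x\<in>cbox a b. ennreal (det (\<chi> i j. A x i j) powr (1 / CARD('n))) \<partial>lborel)"
      using contra unfolding K' C_def n_def by simp
    show "(\<integral>\<^sup>+x\<in>cbox a b. ennreal (lse_hess P c e x (qform (A x))) \<partial>lborel) \<le> ennreal (\<mu> * N / 2 * M + \<mu> * M / 2 * N)"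
      if "finite P" "P \<noteq> {}" "P \<subseteq> K" "0 < e" for P c e
      using \<mu> MN that by (intro bound) (auto simp: K_def)
  qed (use pos \<mu> MN in auto)
  also have "\<dots> = measure lborel K / 2" unfolding K by simp
  finally show False using pos by simp
qed

section \<open>Passage to the limit in the cubes, the cutoffs and the box\<close>

lemma nn_integral_Fatou_bound:
  assumes meas: "\<And>n. q n \<in> borel_measurable M"
    and lim: "AE x in M. (\<lambda>n. q n x) \<longlonglongrightarrow> g x"
    and bnd: "\<forall>\<^sub>F n in sequentially. (\<integral>\<^sup>+x. q n x \<partial>M) \<le> (B :: ennreal)"
  shows "(\<integral>\<^sup>+x. g x \<partial>M) \<le> B"
proof -
  have "AE x in M. g x = liminf (\<lambda>n. q n x)"
    using lim by eventually_elim (simp add: lim_imp_Liminf)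
  then have "(\<integral>\<^sup>+x. g x \<partial>M) = (\<integral>\<^sup>+x. liminf (\<lambda>n. q n x) \<partial>M)"
    by (rule nn_integral_cong_AE)
  also have "\<dots> \<le> liminf (\<lambda>n. \<integral>\<^sup>+x. q n x \<partial>M)"
    by (rule nn_integral_liminf[OF meas])
  also have "\<dots> \<le> limsup (\<lambda>n. \<integral>\<^sup>+x. q n x \<partial>M)"
    by (rule Liminf_le_Limsup) simp
  also have "\<dots> \<le> B"
    by (rule Limsup_bounded[OF bnd])
  finally show ?thesis .
qed

context kinetic_flow
begin

lemma avg_matrix_sym: "avg_matrix h x i j = avg_matrix h x j i"
  unfolding avg_matrix_def by (simp add: mult.commute)

lemma qform_avg_matrix_nonneg: "0 < h \<Longrightarrow> 0 \<le> qform (avg_matrix h x) y"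
  unfolding qform_avg_matrix by (rule window_avg_nonneg) auto

lemma flux_matrix_measurable: "(\<lambda>x. flux_matrix x i j) \<in> borel_measurable borel"
  using borel_measurable_integrable[OF flux_matrix_integrable] by simp

lemma avg_matrix_measurable: "(\<lambda>x. avg_matrix h x i j) \<in> borel_measurable borel"
  by (rule borel_measurable_continuous_onI[OF avg_matrix_continuous])

lemma det_powr_measurable:
  fixes A :: "real \<times> (real^'n) \<Rightarrow> 'n option \<Rightarrow> 'n option \<Rightarrow> real"
  assumes "\<And>i j. (\<lambda>x. A x i j) \<in> borel_measurable borel"
  shows "(\<lambda>x. ennreal (det (\<chi> i j. A x i j) powr p)) \<in> borel_measurable borel"
proof -
  have [measurable]: "(\<lambda>x. A x i j) \<in> borel_measurable borel" for i j by (rule assms)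
  show ?thesis unfolding det_def by simp
qed

lemma det_avg_matrix_nonneg:
  assumes "0 < h"
  shows "0 \<le> det (\<chi> i j. avg_matrix h x i j)"
proof (rule psd_det_nonneg)
  let ?A = "\<chi> i j. avg_matrix h x i j"
  have b: "y \<bullet> (?A *v z) = (\<Sum>i\<in>UNIV. \<Sum>j\<in>UNIV. y $ i * z $ j * avg_matrix h x i j)" for y z
    by (simp add: inner_vec_def matrix_vector_mult_def sum_distrib_left ac_simps)
  show "y \<bullet> (?A *v z) = z \<bullet> (?A *v y)" for y z
    unfolding b by (subst sum.swap) (simp add: avg_matrix_sym[of _ x] mult.commute mult.left_commute)
  show "0 \<le> y \<bullet> (?A *v y)" for y
  proof -
    define \<xi> :: "real \<times> (real^'n)" where "\<xi> = (y $ None, \<chi> j. y $ Some j)"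
    have "coord i \<xi> = y $ i" for i by (cases i) (simp_all add: \<xi>_def coord_def)
    then have "y \<bullet> (?A *v y) = qform (avg_matrix h x) \<xi>"
      unfolding b qform_def by simp
    then show ?thesis using qform_avg_matrix_nonneg[OF assms] by simp
  qed
qed

lemma det_flux_matrix_nonneg:
  assumes "\<And>i j. (\<lambda>h. avg_matrix (inverse (real (Suc h))) x i j) \<longlonglongrightarrow> flux_matrix x i j"
  shows "0 \<le> det (\<chi> i j. flux_matrix x i j)"
proof (rule LIMSEQ_le_const)
  show "(\<lambda>h. det (\<chi> i j. avg_matrix (inverse (real (Suc h))) x i j)) \<longlonglongrightarrow> det (\<chi> i j. flux_matrix x i j)"
    unfolding det_def using assms by (auto intro!: tendsto_intros)
  show "\<exists>N. \<forall>h\<ge>N. 0 \<le> det (\<chi> i j. avg_matrix (inverse (real (Suc h))) x i j)"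
    using det_avg_matrix_nonneg[of "inverse (real (Suc _))" x] by simp
qed

text \<open>A large \<open>R\<close> makes the spatial cutoff errors smaller than
  \<open>\<delta>\<close>, and Fatou's lemma removes the averaging as the cubes shrink. The surplus
  \<open>\<delta>\<close> also keeps both constants positive when \<open>M\<close> or
  \<open>N\<close> vanishes, as the optimisation over boxes divides by \<open>M\<close>.\<close>

lemma compensated_integrability_box:
  assumes M: "0 \<le> M" "\<And>t. t \<in> {0<..<T} \<Longrightarrow> (\<integral>\<^sup>+y. \<integral>\<^sup>+v. ennreal (F (t, y) v) \<partial>lborel \<partial>lborel) \<le> ennreal M"
    and N: "0 \<le> N" "\<And>t. t \<in> {0<..<T} \<Longrightarrow>
       (\<integral>\<^sup>+y. \<integral>\<^sup>+v. ennreal (F (t, y) v * (\<Sum>k\<in>UNIV. \<bar>v $ k - u $ k\<bar>)) \<partial>lborel \<partial>lborel) \<le> ennreal N"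
    and \<tau>: "0 < \<tau>" and \<delta>: "0 < \<delta>"
    and box: "\<And>x. x \<in> cbox a b \<Longrightarrow> 2 * \<tau> \<le> fst x \<and> fst x \<le> T - 2 * \<tau>"
  shows "(\<integral>\<^sup>+x\<in>cbox a b. ennreal (det (\<chi> i j. flux_matrix x i j) powr (1 / CARD('n))) \<partial>lborel)
    \<le> ennreal (4 * (2 * (64 / 7 * 4 ^ (CARD('n) + 1))) powr (1 + 1 / CARD('n)) * (2 * N + \<delta>) * (2 * M + \<delta>) powr (1 / CARD('n)))"
proof -
  let ?l = "\<lambda>v. \<Sum>k\<in>UNIV. \<bar>v $ k - u $ k\<bar>"
  obtain C where C: "0 < C" "\<And>s. smooth_step' s \<le> C" using smooth_step'_bounded by blast
  have norm_le: "norm v \<le> 1 + (norm v)\<^sup>2" for v :: "real^'n"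
    using zero_le_power2[of "norm v - 1"] zero_le_power2[of "norm v"] by (simp add: power2_eq_square algebra_simps) (smt (verit) norm_ge_zero mult_nonneg_nonneg)
  have i1: "integrable lborel (\<lambda>w. F (fst w) (snd w) * norm (snd w))"
    by (rule F_integrable[where k = 1]) (auto intro!: borel_measurable_continuous_onI continuous_intros norm_le)
  have l_le: "?l v \<le> CARD('n) * (1 + norm u) * (1 + norm v)" for v
  proof -
    have "?l v \<le> (\<Sum>k\<in>(UNIV :: 'n set). (1 + norm u) * (1 + norm v))"
    proof (rule sum_mono)
      fix k
      have "\<bar>v $ k - u $ k\<bar> \<le> norm v + norm u"
        using component_le_norm_cart[of v k] component_le_norm_cart[of u k] by linarith
      also have "\<dots> \<le> (1 + norm u) * (1 + norm v)" by (simp add: algebra_simps)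
      finally show "\<bar>v $ k - u $ k\<bar> \<le> (1 + norm u) * (1 + norm v)" .
    qed
    then show ?thesis by (simp add: mult.assoc)
  qed
  have i2: "integrable lborel (\<lambda>w. F (fst w) (snd w) * (norm (snd w) * ?l (snd w)))"
  proof (rule F_integrable[where k = "CARD('n) * (1 + norm u) * 2"])
    show "(\<lambda>w :: (real \<times> (real^'n)) \<times> (real^'n). norm (snd w) * ?l (snd w)) \<in> borel_measurable borel"
      by (intro borel_measurable_continuous_onI continuous_intros)
    fix w :: "(real \<times> (real^'n)) \<times> (real^'n)"
    let ?v = "snd w"
    have l0: "0 \<le> ?l ?v" by (intro sum_nonneg) auto
    have "\<bar>norm ?v * ?l ?v\<bar> \<le> (1 + norm ?v) * (CARD('n) * (1 + norm u) * (1 + norm ?v))"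
      unfolding abs_mult using l_le[of ?v] l0 by (intro mult_mono) auto
    also have "\<dots> = (CARD('n) * (1 + norm u)) * ((1 + norm ?v) * (1 + norm ?v))" by (simp only: ac_simps)
    also have "\<dots> \<le> (CARD('n) * (1 + norm u)) * (2 * (1 + (norm ?v)\<^sup>2))"
      by (intro mult_left_mono one_plus_norm_square_le) auto
    finally show "\<bar>norm ?v * ?l ?v\<bar> \<le> CARD('n) * (1 + norm u) * 2 * (1 + (norm ?v)\<^sup>2)" by (simp only: mult.assoc)
  qed
  define j1 where "j1 = (\<integral>w. F (fst w) (snd w) * norm (snd w) \<partial>lborel)"
  define j2 where "j2 = (\<integral>w. F (fst w) (snd w) * (norm (snd w) * ?l (snd w)) \<partial>lborel)"
  have j1: "0 \<le> j1" "(\<integral>\<^sup>+w. ennreal (F (fst w) (snd w) * norm (snd w)) \<partial>lborel) \<le> ennreal j1"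
    unfolding j1_def using F_nonneg i1 by (auto intro!: integral_nonneg simp: nn_integral_eq_integral)
  have j2: "0 \<le> j2" "(\<integral>\<^sup>+w. ennreal (F (fst w) (snd w) * (norm (snd w) * ?l (snd w))) \<partial>lborel) \<le> ennreal j2"
    unfolding j2_def using F_nonneg i2 by (auto intro!: integral_nonneg mult_nonneg_nonneg sum_nonneg simp: nn_integral_eq_integral)
  obtain r where r: "\<And>x. x \<in> cbox a b \<Longrightarrow> norm x \<le> r"
    using bounded_cbox[of a b] unfolding bounded_iff by blast
  \<comment> \<open>The first summands make the cutoff equal to 1 on the box, the last two bring
    both error terms below \<open>\<delta>\<close>.\<close>
  define R where "R = \<bar>r\<bar> + 1 + 4 * C * j1 / \<delta> + 4 * C * j2 / \<delta>"
  have Rp: "0 \<le> 4 * C * j1 / \<delta>" "0 \<le> 4 * C * j2 / \<delta>" using C j1(1) j2(1) \<delta> by simp_all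
  then have R: "0 < R" "r \<le> R" "4 * C * j1 / \<delta> \<le> R" "4 * C * j2 / \<delta> \<le> R"
    unfolding R_def by linarith+
  have Rj: "4 * C / R * j1 \<le> \<delta>" "4 * C / R * j2 \<le> \<delta>"
    using R \<delta> by (simp_all add: pos_divide_le_eq mult.commute)
  have cut1: "cutoff T \<tau> R x = 1" if x: "x \<in> cbox a b" for x
  proof (rule cutoff_props(3)[OF \<tau> R(1)])
    have "norm (snd x) \<le> norm x" by (cases x) (simp add: norm_snd_le)
    then show "norm (snd x) \<le> R" using r[OF x] R(2) by linarith
  qed (use box[OF x] in auto)
  let ?K = "4 * (2 * (64 / 7 * 4 ^ (CARD('n) + 1))) powr (1 + 1 / CARD('n)) * (2 * N + \<delta>) * (2 * M + \<delta>) powr (1 / CARD('n))"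
  let ?q = "\<lambda>n x. ennreal (det (\<chi> i j. avg_matrix (inverse (real (Suc n))) x i j) powr (1 / CARD('n))) * indicator (cbox a b) x"
  show ?thesis
  proof (rule nn_integral_Fatou_bound[where q = ?q])
    show "?q n \<in> borel_measurable lborel" for n
      using det_powr_measurable[OF avg_matrix_measurable] by simp
    show "AE x in lborel. (\<lambda>n. ?q n x) \<longlonglongrightarrow> ennreal (det (\<chi> i j. flux_matrix x i j) powr (1 / CARD('n))) * indicator (cbox a b) x"
      using avg_matrix_tendsto
    proof eventually_elim
      case (elim x)
      then have l: "(\<lambda>n. avg_matrix (inverse (real (Suc n))) x i j) \<longlonglongrightarrow> flux_matrix x i j" for i j by blast
      have d0: "0 \<le> det (\<chi> i j. flux_matrix x i j)" by (rule det_flux_matrix_nonneg[OF l])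
      have "(\<lambda>n. det (\<chi> i j. avg_matrix (inverse (real (Suc n))) x i j)) \<longlonglongrightarrow> det (\<chi> i j. flux_matrix x i j)"
        unfolding det_def using l by (auto intro!: tendsto_intros)
      \<comment> \<open>The absolute value gives a function continuous on the whole line; it changes
        nothing here because the determinants of the averages and of their limit are
        nonnegative.\<close>
      moreover have cp: "continuous_on UNIV (\<lambda>s::real. \<bar>s\<bar> powr (1 / CARD('n)))"
        by (intro continuous_on_powr' continuous_intros) auto
      ultimately have "(\<lambda>n. \<bar>det (\<chi> i j. avg_matrix (inverse (real (Suc n))) x i j)\<bar> powr (1 / CARD('n)))
          \<longlonglongrightarrow> \<bar>det (\<chi> i j. flux_matrix x i j)\<bar> powr (1 / CARD('n))"
        by (intro continuous_on_tendsto_compose[OF cp]) auto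
      moreover have "0 \<le> det (\<chi> i j. avg_matrix (inverse (real (Suc n))) x i j)" for n
        by (rule det_avg_matrix_nonneg) simp
      ultimately have "(\<lambda>n. det (\<chi> i j. avg_matrix (inverse (real (Suc n))) x i j) powr (1 / CARD('n)))
          \<longlonglongrightarrow> det (\<chi> i j. flux_matrix x i j) powr (1 / CARD('n))" using d0 by simp
      then have "(\<lambda>n. ennreal (det (\<chi> i j. avg_matrix (inverse (real (Suc n))) x i j) powr (1 / CARD('n))))
          \<longlonglongrightarrow> ennreal (det (\<chi> i j. flux_matrix x i j) powr (1 / CARD('n)))" by (rule tendsto_ennrealI)
      then show ?case by (cases "x \<in> cbox a b") simp_all
    qed
    \<comment> \<open>Cubes of side below \<open>\<tau>\<close> keep the shifted cutoffs supported
      in the slab. Fatou's lemma asks for the bound only eventually.\<close>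
    obtain n0 where n0: "inverse (real (Suc n0)) < \<tau>" using reals_Archimedean[OF \<tau>] by blast
    show "\<forall>\<^sub>F n in sequentially. (\<integral>\<^sup>+x. ?q n x \<partial>lborel) \<le> ennreal ?K"
      unfolding eventually_sequentially
    proof (intro exI[of _ n0] allI impI)
      fix n assume "n0 \<le> n"
      define h where "h = inverse (real (Suc n))"
      have "inverse (real (Suc n)) \<le> inverse (real (Suc n0))" using \<open>n0 \<le> n\<close> by (intro le_imp_inverse_le) auto
      then have h: "0 < h" "h < \<tau>" using order.strict_trans1[OF _ n0] by (simp_all add: h_def)
      show "(\<integral>\<^sup>+x. ?q n x \<partial>lborel) \<le> ennreal ?K"
        unfolding h_def[symmetric]
      proof (rule det_transport_optimised[where u = u and M = "2 * M + \<delta>" and N = "2 * N + \<delta>"])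
        show "0 < 2 * M + \<delta>" "0 < 2 * N + \<delta>" using M(1) N(1) \<delta> by linarith+
        fix \<alpha> \<beta> e :: real and P :: "(real \<times> (real^'n)) set" and c
        assume \<alpha>\<beta>: "0 < \<alpha>" "0 < \<beta>" and P: "finite P" "P \<noteq> {}" "P \<subseteq> slope_box u \<alpha> \<beta>" and e: "0 < e"
        show "(\<integral>\<^sup>+x\<in>cbox a b. ennreal (lse_hess P c e x (qform (avg_matrix h x))) \<partial>lborel) \<le> ennreal (\<alpha> * (2 * M + \<delta>) + \<beta> * (2 * N + \<delta>))"
        proof (rule averaged_flux_bound[OF P(1,2) e h(1) \<tau> R(1) cut1])
          fix z assume z: "z \<in> cbox 0 (h *\<^sub>R One :: real \<times> (real^'n))"
          have e1: "(1, 0) \<in> (Basis :: (real \<times> (real^'n)) set)" by (simp add: Basis_prod_def)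
          have "0 \<le> fst z" "fst z \<le> h"
            using bspec[OF z[unfolded mem_box] e1] inner_sum_left_Basis[OF e1, of "\<lambda>_. 1"]
            by (simp_all add: inner_prod_def[of z] inner_scaleR_left)
          then have zz: "0 \<le> fst z" "fst z < \<tau>" using h by linarith+
          show "(\<integral>\<^sup>+w. ennreal (F (fst w) (snd w) * (cutoff T \<tau> R (fst w - z) * lse_hess P c e (fst w - z) (\<lambda>\<xi>. (\<xi> \<bullet> (1, snd w))\<^sup>2))) \<partial>lborel)
            \<le> ennreal (\<alpha> * (2 * M + \<delta>) + \<beta> * (2 * N + \<delta>))"
          proof (rule order_trans[OF flux_bound[OF P(1,2) e \<tau> R(1) zz P(3) _ _ C(2) M N j1 j2] ennreal_leI])
            show "\<alpha> * (2 * M + 4 * C / R * j1) + \<beta> * (2 * N + 4 * C / R * j2) \<le> \<alpha> * (2 * M + \<delta>) + \<beta> * (2 * N + \<delta>)"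
              using Rj \<alpha>\<beta> by (intro add_mono mult_left_mono) auto
          qed (use \<alpha>\<beta> in auto)
        qed
      qed (use h in \<open>auto intro: avg_matrix_continuous avg_matrix_sym qform_avg_matrix_nonneg\<close>)
    qed
  qed
qed

text \<open>On each box \<open>\<delta>\<close> tends to 0, and then boxes exhaust the open slab.
  Outside the slab the flux matrix is zero, so the integral may run over all of time-space.\<close>

theorem compensated_integrability:
  assumes M: "0 \<le> M" "\<And>t. t \<in> {0<..<T} \<Longrightarrow> (\<integral>\<^sup>+y. \<integral>\<^sup>+v. ennreal (F (t, y) v) \<partial>lborel \<partial>lborel) \<le> ennreal M"
    and N: "0 \<le> N" "\<And>t. t \<in> {0<..<T} \<Longrightarrow>
       (\<integral>\<^sup>+y. \<integral>\<^sup>+v. ennreal (F (t, y) v * (\<Sum>k\<in>UNIV. \<bar>v $ k - u $ k\<bar>)) \<partial>lborel \<partial>lborel) \<le> ennreal N"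
    and T: "0 < T"
  shows "(\<integral>\<^sup>+x. ennreal (det (\<chi> i j. flux_matrix x i j) powr (1 / CARD('n))) \<partial>lborel)
    \<le> ennreal (4 * (2 * (64 / 7 * 4 ^ (CARD('n) + 1))) powr (1 + 1 / CARD('n)) * (2 * N) * (2 * M) powr (1 / CARD('n)))"
proof -
  let ?g = "\<lambda>x. ennreal (det (\<chi> i j. flux_matrix x i j) powr (1 / CARD('n)))"
  let ?K = "\<lambda>\<delta>. 4 * (2 * (64 / 7 * 4 ^ (CARD('n) + 1))) powr (1 + 1 / CARD('n)) * (2 * N + \<delta>) * (2 * M + \<delta>) powr (1 / CARD('n))"
  \<comment> \<open>The time margin 2 \<tau> is T / (m + 2): it shrinks to 0 and leaves a nonempty
    time interval or its midpoint already for m = 0.\<close>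
  define \<tau> where "\<tau> m = T / (2 * real (Suc (Suc m)))" for m
  define a b :: "nat \<Rightarrow> real \<times> (real^'n)"
    where "a m = (2 * \<tau> m, \<chi> k. - real m)" and "b m = (T - 2 * \<tau> m, \<chi> k. real m)" for m
  have box: "(\<integral>\<^sup>+x. ?g x * indicator (cbox (a m) (b m)) x \<partial>lborel) \<le> ennreal (?K 0)" for m
  proof (rule LIMSEQ_le_const)
    have "(\<lambda>k. ?K (inverse (real (Suc k)))) \<longlonglongrightarrow> ?K 0"
    proof (rule tendsto_mult[OF tendsto_mult[OF tendsto_const] tendsto_powr'])
      show "(\<lambda>k. 2 * N + inverse (real (Suc k))) \<longlonglongrightarrow> 2 * N + 0" "(\<lambda>k. 2 * M + inverse (real (Suc k))) \<longlonglongrightarrow> 2 * M + 0"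
        by (intro tendsto_add tendsto_const LIMSEQ_inverse_real_of_nat)+
      \<comment> \<open>The base of the power may converge to 0 when \<open>M\<close> is 0;
        continuity of the power then rests on the positive exponent and the nonnegative
        base.\<close>
      show "2 * M + 0 \<noteq> 0 \<or> 0 < 1 / real CARD('n) \<and> (\<forall>\<^sub>F k in sequentially. 0 \<le> 2 * M + inverse (real (Suc k)))"
        using M(1) by auto
    qed (rule tendsto_const)
    then show "(\<lambda>k. ennreal (?K (inverse (real (Suc k))))) \<longlonglongrightarrow> ennreal (?K 0)"
      by (rule tendsto_ennrealI)
    show "\<exists>N0. \<forall>k\<ge>N0. (\<integral>\<^sup>+x. ?g x * indicator (cbox (a m) (b m)) x \<partial>lborel) \<le> ennreal (?K (inverse (real (Suc k))))"
    proof (intro exI allI impI compensated_integrability_box[OF M N])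
      show "0 < \<tau> m" using T by (simp add: \<tau>_def)
      show "2 * \<tau> m \<le> fst x \<and> fst x \<le> T - 2 * \<tau> m" if "x \<in> cbox (a m) (b m)" for x
        using that by (cases x) (auto simp: a_def b_def cbox_Pair_eq)
    qed auto
  qed
  have "(\<integral>\<^sup>+x. ?g x \<partial>lborel) \<le> ennreal (?K 0)"
  proof (rule nn_integral_Fatou_bound[where q = "\<lambda>m x. ?g x * indicator (cbox (a m) (b m)) x"])
    show "(\<lambda>x. ?g x * indicator (cbox (a m) (b m)) x) \<in> borel_measurable lborel" for m
      using det_powr_measurable[OF flux_matrix_measurable] by simp
    show "AE x in lborel. (\<lambda>m. ?g x * indicator (cbox (a m) (b m)) x) \<longlonglongrightarrow> ?g x"
    proof (rule AE_I2)
      fix x :: "real \<times> (real^'n)"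
      show "(\<lambda>m. ?g x * indicator (cbox (a m) (b m)) x) \<longlonglongrightarrow> ?g x"
      proof (cases "fst x \<in> {0<..<T}")
        case False
        then have "flux_matrix x i j = 0" for i j by (simp add: flux_matrix_def F_supp)
        then have "?g x = 0" by (simp add: det_def)
        then show ?thesis by simp
      next
        case True
        obtain m1 where m1: "norm (snd x) \<le> real m1" using real_arch_simple by blast
        obtain m2 where m2: "T / fst x \<le> real m2" using real_arch_simple by blast
        obtain m3 where m3: "T / (T - fst x) \<le> real m3" using real_arch_simple by blast
        have "x \<in> cbox (a m) (b m)" if m: "max m1 (max m2 m3) \<le> m" for m
        proof -
          have "2 * \<tau> m \<le> fst x"
          proof -
            have "T / fst x \<le> real (Suc (Suc m))" using m2 m by simp
            then show ?thesis using True T by (simp add: \<tau>_def field_simps)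
          qed
          moreover have "2 * \<tau> m \<le> T - fst x"
          proof -
            have "T / (T - fst x) \<le> real (Suc (Suc m))" using m3 m by simp
            then show ?thesis using True T by (simp add: \<tau>_def field_simps)
          qed
          moreover have "\<bar>snd x $ k\<bar> \<le> real m" for k
            using component_le_norm_cart[of "snd x" k] m1 m by simp
          ultimately show ?thesis
            by (cases x) (auto simp: a_def b_def cbox_Pair_eq mem_box_cart abs_le_iff minus_le_iff)
        qed
        then have "\<forall>\<^sub>F m in sequentially. ?g x * indicator (cbox (a m) (b m)) x = ?g x"
          unfolding eventually_sequentially by (intro exI[of _ "max m1 (max m2 m3)"]) simp
        then show ?thesis by (rule tendsto_eventually)
      qed
    qed
  qed (use box in simp)
  then show ?thesis by simp
qed

end

section \<open>Moments of a velocity density\<close>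

lemma norm_diff_square: "(norm (v - u))\<^sup>2 = (norm u)\<^sup>2 + (- 2 *\<^sub>R u) \<bullet> v + 1 * (norm v)\<^sup>2" for u v :: "'a::real_inner"
  by (simp add: power2_norm_eq_inner inner_diff_left inner_diff_right inner_commute)

lemma norm_diff_square_le: "(norm (v - u))\<^sup>2 \<le> (2 + 2 * (norm u)\<^sup>2) * (1 + (norm v)\<^sup>2)" for u v :: "'a::real_inner"
proof -
  have "(norm (v - u))\<^sup>2 \<le> (norm v + norm u)\<^sup>2" by (intro power_mono norm_triangle_ineq4) simp
  also have "\<dots> \<le> 2 * (norm v)\<^sup>2 + 2 * (norm u)\<^sup>2"
    using sum_squares_bound[of "norm v" "norm u"] by (simp add: power2_sum)
  also have "\<dots> \<le> (2 + 2 * (norm u)\<^sup>2) * (1 + (norm v)\<^sup>2)" by (simp add: algebra_simps)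
  finally show ?thesis .
qed

lemma norm_le_one_plus_square: "norm v \<le> 1 + (norm v)\<^sup>2" for v :: "'a::real_normed_vector"
proof -
  have "2 * norm v \<le> 1 + (norm v)\<^sup>2"
    using sum_power2_ge_zero[of "norm v - 1" 0] by (simp add: power2_diff)
  then show ?thesis using norm_ge_zero[of v] by linarith
qed

locale velocity_density =
  fixes g :: "real^'n::finite \<Rightarrow> real^'n \<Rightarrow> real"
  assumes g_measurable: "(\<lambda>p. g (fst p) (snd p)) \<in> borel_measurable borel"
    and g_nonneg: "\<And>y v. 0 \<le> g y v"
    and g_mass: "mass g < \<infinity>" and g_energy: "energy g < \<infinity>"
begin

definition moment :: "(real^'n \<Rightarrow> real) \<Rightarrow> real" where
  "moment H = (\<integral>p. g (fst p) (snd p) * H (snd p) \<partial>lborel)"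

lemma g_times_measurable:
  assumes "H \<in> borel_measurable borel"
  shows "(\<lambda>p. g (fst p) (snd p) * H (snd p)) \<in> borel_measurable borel"
  by (intro borel_measurable_times g_measurable measurable_compose[OF _ assms]
      borel_measurable_continuous_onI continuous_intros)

lemma g_section_measurable: "(\<lambda>v. g y v) \<in> borel_measurable borel"
proof -
  have "Pair y \<in> borel \<rightarrow>\<^sub>M (borel :: ((real^'n) \<times> (real^'n)) measure)"
    by (intro borel_measurable_continuous_onI continuous_intros)
  from measurable_compose[OF this g_measurable] show ?thesis by simp
qed

lemma nn_integral_g:
  assumes H: "H \<in> borel_measurable borel"
  shows "(\<integral>\<^sup>+p. ennreal (g (fst p) (snd p) * H (snd p)) \<partial>lborel) = (\<integral>\<^sup>+y. \<integral>\<^sup>+v. ennreal (g y v * H v) \<partial>lborel \<partial>lborel)"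
  using nn_integral_lborel_iterated(1)[of "\<lambda>p. ennreal (g (fst p) (snd p) * H (snd p))"] g_times_measurable[OF H] by simp

lemma mass_eq_nn: "mass g = (\<integral>\<^sup>+p. ennreal (g (fst p) (snd p) * 1) \<partial>lborel)"
  unfolding mass_def by (subst nn_integral_g) simp_all

lemma energy_eq_nn: "energy g = (\<integral>\<^sup>+p. ennreal (g (fst p) (snd p) * ((norm (snd p))\<^sup>2 / 2)) \<partial>lborel)"
  unfolding energy_def by (subst nn_integral_g[where H = "\<lambda>v. (norm v)\<^sup>2 / 2"]) simp_all

lemma weight_nn_integral:
  "(\<integral>\<^sup>+p. ennreal (g (fst p) (snd p) * (1 + (norm (snd p))\<^sup>2)) \<partial>lborel) = mass g + 2 * energy g"
proof -
  have s: "ennreal (g (fst p) (snd p) * (1 + (norm (snd p))\<^sup>2))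
      = ennreal (g (fst p) (snd p) * 1) + 2 * ennreal (g (fst p) (snd p) * ((norm (snd p))\<^sup>2 / 2))" for p
  proof -
    have "2 * ennreal (g (fst p) (snd p) * ((norm (snd p))\<^sup>2 / 2)) = ennreal (2 * (g (fst p) (snd p) * ((norm (snd p))\<^sup>2 / 2)))"
      using g_nonneg by (subst ennreal_mult) auto
    moreover have "g (fst p) (snd p) * (1 + (norm (snd p))\<^sup>2) = g (fst p) (snd p) * 1 + 2 * (g (fst p) (snd p) * ((norm (snd p))\<^sup>2 / 2))"
      by (simp add: distrib_left)
    ultimately show ?thesis using g_nonneg by (simp only: ennreal_plus mult_nonneg_nonneg zero_le_one zero_le_numeral zero_le_power2 divide_nonneg_pos zero_less_numeral)
  qed
  have m1: "(\<lambda>p. ennreal (g (fst p) (snd p) * 1)) \<in> borel_measurable lborel"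
    using g_times_measurable[of "\<lambda>_. 1"] by simp
  have m2: "(\<lambda>p. ennreal (g (fst p) (snd p) * ((norm (snd p))\<^sup>2 / 2))) \<in> borel_measurable lborel"
    using g_times_measurable[of "\<lambda>v. (norm v)\<^sup>2 / 2"] by simp
  show ?thesis
    unfolding s mass_eq_nn energy_eq_nn using m1 m2 by (simp add: nn_integral_add nn_integral_cmult)
qed

lemma weight_integrable: "integrable lborel (\<lambda>p. g (fst p) (snd p) * (1 + (norm (snd p))\<^sup>2))"
proof (rule integrableI_nonneg)
  show "(\<lambda>p. g (fst p) (snd p) * (1 + (norm (snd p))\<^sup>2)) \<in> borel_measurable lborel"
    using g_times_measurable[of "\<lambda>v. 1 + (norm v)\<^sup>2"] by simp
  show "(\<integral>\<^sup>+p. ennreal (g (fst p) (snd p) * (1 + (norm (snd p))\<^sup>2)) \<partial>lborel) < \<infinity>"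
    unfolding weight_nn_integral using g_mass g_energy by (simp add: ennreal_mult_less_top)
qed (use g_nonneg in auto)

lemma g_integrable:
  assumes H: "H \<in> borel_measurable borel" and b: "\<And>v. \<bar>H v\<bar> \<le> k * (1 + (norm v)\<^sup>2)"
  shows "integrable lborel (\<lambda>p. g (fst p) (snd p) * H (snd p))"
proof (rule Bochner_Integration.integrable_bound)
  show "integrable lborel (\<lambda>p. k * (g (fst p) (snd p) * (1 + (norm (snd p))\<^sup>2)))"
    using weight_integrable by simp
  show "(\<lambda>p. g (fst p) (snd p) * H (snd p)) \<in> borel_measurable lborel"
    using g_times_measurable[OF H] by simp
  show "AE p in lborel. norm (g (fst p) (snd p) * H (snd p)) \<le> norm (k * (g (fst p) (snd p) * (1 + (norm (snd p))\<^sup>2)))"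
  proof (rule AE_I2)
    fix p :: "(real^'n) \<times> (real^'n)"
    have "norm (g (fst p) (snd p) * H (snd p)) \<le> g (fst p) (snd p) * (k * (1 + (norm (snd p))\<^sup>2))"
      using g_nonneg b by (auto simp: abs_mult intro: mult_left_mono)
    also have "\<dots> = k * (g (fst p) (snd p) * (1 + (norm (snd p))\<^sup>2))" by simp
    finally show "norm (g (fst p) (snd p) * H (snd p)) \<le> norm (k * (g (fst p) (snd p) * (1 + (norm (snd p))\<^sup>2)))"
      unfolding real_norm_def by (rule order_trans) (rule abs_ge_self)
  qed
qed

lemma moment_iterated:
  assumes "H \<in> borel_measurable borel" "\<And>v. \<bar>H v\<bar> \<le> k * (1 + (norm v)\<^sup>2)"
  shows "moment H = (\<integral>y. \<integral>v. g y v * H v \<partial>lborel \<partial>lborel)"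
    and "integrable lborel (\<lambda>y. \<integral>v. g y v * H v \<partial>lborel)"
proof -
  have i: "integrable (lborel \<Otimes>\<^sub>M lborel) (\<lambda>p. g (fst p) (snd p) * H (snd p))"
    unfolding lborel_prod by (rule g_integrable[OF assms])
  show "moment H = (\<integral>y. \<integral>v. g y v * H v \<partial>lborel \<partial>lborel)"
    unfolding moment_def using lborel_pair.integral_fst'[OF i] by (simp add: lborel_prod)
  show "integrable lborel (\<lambda>y. \<integral>v. g y v * H v \<partial>lborel)"
    using lborel_pair.integrable_fst'[OF i] by simp
qed

lemma nn_integral_moment:
  assumes H: "H \<in> borel_measurable borel" "\<And>v. \<bar>H v\<bar> \<le> k * (1 + (norm v)\<^sup>2)" and "\<And>v. 0 \<le> H v"
  shows "(\<integral>\<^sup>+p. ennreal (g (fst p) (snd p) * H (snd p)) \<partial>lborel) = ennreal (moment H)"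
  unfolding moment_def by (rule nn_integral_eq_integral[OF g_integrable[OF H]]) (use g_nonneg assms(3) in auto)

lemma moment_nonneg: "(\<And>v. 0 \<le> H v) \<Longrightarrow> 0 \<le> moment H"
  unfolding moment_def using g_nonneg by (intro Bochner_Integration.integral_nonneg) auto

lemma moment_mono:
  assumes "H \<in> borel_measurable borel" "\<And>v. \<bar>H v\<bar> \<le> k * (1 + (norm v)\<^sup>2)"
    and "H' \<in> borel_measurable borel" "\<And>v. \<bar>H' v\<bar> \<le> k' * (1 + (norm v)\<^sup>2)"
    and "\<And>v. H v \<le> H' v"
  shows "moment H \<le> moment H'"
  unfolding moment_def
  by (rule Bochner_Integration.integral_mono[OF g_integrable[OF assms(1,2)] g_integrable[OF assms(3,4)]]) (use assms(5) g_nonneg in \<open>auto intro: mult_left_mono\<close>)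

lemma moment_quadratic:
  "moment (\<lambda>v. a + b \<bullet> v + c * (norm v)\<^sup>2)
    = a * moment (\<lambda>_. 1) + b \<bullet> (\<chi> i. moment (\<lambda>v. v $ i)) + c * moment (\<lambda>v. (norm v)\<^sup>2)"
proof -
  have i1: "integrable lborel (\<lambda>p. g (fst p) (snd p) * 1)"
    by (rule g_integrable[where k = 1 and H = "\<lambda>_. 1"]) auto
  have i2: "integrable lborel (\<lambda>p. g (fst p) (snd p) * snd p $ i)" for i
  proof (rule g_integrable[where k = 1 and H = "\<lambda>v. v $ i"])
    show "\<bar>v $ i\<bar> \<le> 1 * (1 + (norm v)\<^sup>2)" for v :: "real^'n"
      using component_le_norm_cart[of v i] sum_power2_ge_zero[of "norm v - 1" 0] by (simp add: power2_diff)
  qed auto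
  have i3: "integrable lborel (\<lambda>p. g (fst p) (snd p) * (norm (snd p))\<^sup>2)"
    by (rule g_integrable[where k = 1 and H = "\<lambda>v. (norm v)\<^sup>2"]) auto
  have "(\<lambda>p. g (fst p) (snd p) * (a + b \<bullet> snd p + c * (norm (snd p))\<^sup>2))
    = (\<lambda>p. a * (g (fst p) (snd p) * 1) + (\<Sum>i\<in>UNIV. b $ i * (g (fst p) (snd p) * snd p $ i)) + c * (g (fst p) (snd p) * (norm (snd p))\<^sup>2))"
    by (auto simp: inner_vec_def algebra_simps sum_distrib_left)
  then show ?thesis
    unfolding moment_def inner_vec_def using i1 i2 i3 by simp
qed

text \<open>Expanding |v' - v|^2 and integrating over (y', v') leaves a quadratic polynomial in v,
  whose moment is again explicit. The two square terms contribute equally, which absorbs the factor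
  1/2.\<close>

lemma Dzero_eq:
  "Dzero g = ennreal (moment (\<lambda>_. 1) * moment (\<lambda>v. (norm v)\<^sup>2) - (norm (\<chi> i. moment (\<lambda>v. v $ i)))\<^sup>2)"
proof -
  let ?M = "moment (\<lambda>_. 1)" and ?E = "moment (\<lambda>v. (norm v)\<^sup>2)" and ?P = "\<chi> i. moment (\<lambda>v. v $ i)"
  let ?k = "\<lambda>y v y' v'. ennreal (g y v * g y' v' * (norm (v' - v))\<^sup>2 / 2)"
  have k_meas: "(\<lambda>q. ?k (a q) (b q) (c q) (d q)) \<in> borel_measurable borel"
    if "continuous_on UNIV a" "continuous_on UNIV b" "continuous_on UNIV c" "continuous_on UNIV d"
    for a b c d :: "'q::euclidean_space \<Rightarrow> real^'n"
  proof -
    have p: "(\<lambda>q. (a q, b q)) \<in> borel \<rightarrow>\<^sub>M borel" "(\<lambda>q. (c q, d q)) \<in> borel \<rightarrow>\<^sub>M borel"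
      using that by (auto intro!: borel_measurable_continuous_onI continuous_intros)
    have "(\<lambda>q. norm (d q - b q)) \<in> borel_measurable borel"
      using that by (auto intro!: borel_measurable_continuous_onI continuous_intros)
    then show ?thesis
      using measurable_compose[OF p(1) g_measurable] measurable_compose[OF p(2) g_measurable] by simp
  qed
  \<comment> \<open>The definition integrates over both positions before both velocities; exchanging
    y' and v brings the pair (y', v') together, to be integrated as one moment.\<close>
  have "Dzero g = (\<integral>\<^sup>+y. \<integral>\<^sup>+v. \<integral>\<^sup>+y'. \<integral>\<^sup>+v'. ?k y v y' v' \<partial>lborel \<partial>lborel \<partial>lborel \<partial>lborel)"
    unfolding Dzero_def
  proof (rule nn_integral_cong)
    fix y :: "real^'n"
    have "(\<lambda>r. ?k y (snd (fst r)) (fst (fst r)) (snd r)) \<in> borel_measurable borel"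
      by (rule k_meas) (intro continuous_intros)+
    from nn_integral_lborel_iterated(2)[OF this]
    show "(\<integral>\<^sup>+y'. \<integral>\<^sup>+v. \<integral>\<^sup>+v'. ?k y v y' v' \<partial>lborel \<partial>lborel \<partial>lborel) = (\<integral>\<^sup>+v. \<integral>\<^sup>+y'. \<integral>\<^sup>+v'. ?k y v y' v' \<partial>lborel \<partial>lborel \<partial>lborel)"
      using nn_integral_lborel_swap[of "\<lambda>q. \<integral>\<^sup>+v'. ?k y (snd q) (fst q) v' \<partial>lborel"] by simp
  qed
  also have "\<dots> = (\<integral>\<^sup>+y. \<integral>\<^sup>+v. ennreal (g y v * ((norm v)\<^sup>2 * ?M / 2 - ?P \<bullet> v + ?E / 2)) \<partial>lborel \<partial>lborel)"
  proof (intro nn_integral_cong)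
    fix y v :: "real^'n"
    have m: "(\<lambda>w. (norm (w - v))\<^sup>2) \<in> borel_measurable borel" by simp
    have b: "\<bar>(norm (w - v))\<^sup>2\<bar> \<le> (2 + 2 * (norm v)\<^sup>2) * (1 + (norm w)\<^sup>2)" for w
      using norm_diff_square_le[of w v] by simp
    have "(\<integral>\<^sup>+y'. \<integral>\<^sup>+v'. ?k y v y' v' \<partial>lborel \<partial>lborel) = (\<integral>\<^sup>+p. ennreal (g y v / 2) * ennreal (g (fst p) (snd p) * (norm (snd p - v))\<^sup>2) \<partial>lborel)"
    proof -
      have "ennreal (g y v / 2) * ennreal (g y' v' * (norm (v' - v))\<^sup>2) = ?k y v y' v'" for y' v'
        using g_nonneg by (simp add: ennreal_mult'[symmetric] mult_ac)
      moreover have "(\<lambda>p. ennreal (g y v / 2) * ennreal (g (fst p) (snd p) * (norm (snd p - v))\<^sup>2)) \<in> borel_measurable borel"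
        using g_times_measurable[OF m] by simp
      note nn_integral_lborel_iterated(1)[OF this]
      ultimately show ?thesis by (simp only: fst_conv snd_conv)
    qed
    also have "\<dots> = ennreal (g y v / 2) * ennreal (moment (\<lambda>w. (norm (w - v))\<^sup>2))"
      using g_times_measurable[OF m] by (simp add: nn_integral_cmult nn_integral_moment[OF m b])
    also have "\<dots> = ennreal (g y v * ((norm v)\<^sup>2 * ?M / 2 - ?P \<bullet> v + ?E / 2))"
    proof -
      have "moment (\<lambda>w. (norm (w - v))\<^sup>2) = (norm v)\<^sup>2 * ?M - 2 * (?P \<bullet> v) + ?E"
        unfolding norm_diff_square moment_quadratic by (simp add: inner_commute)
      then have "g y v / 2 * moment (\<lambda>w. (norm (w - v))\<^sup>2) = g y v * ((norm v)\<^sup>2 * ?M / 2 - ?P \<bullet> v + ?E / 2)"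
        by (simp only:) (simp add: algebra_simps)
      moreover have "ennreal (g y v / 2) * ennreal (moment (\<lambda>w. (norm (w - v))\<^sup>2)) = ennreal (g y v / 2 * moment (\<lambda>w. (norm (w - v))\<^sup>2))"
        using g_nonneg[of y v] by (intro ennreal_mult'[symmetric]) simp
      ultimately show ?thesis by (simp only:)
    qed
    finally show "(\<integral>\<^sup>+y'. \<integral>\<^sup>+v'. ?k y v y' v' \<partial>lborel \<partial>lborel) = ennreal (g y v * ((norm v)\<^sup>2 * ?M / 2 - ?P \<bullet> v + ?E / 2))" .
  qed
  also have "\<dots> = ennreal (?M * ?E - (norm ?P)\<^sup>2)"
  proof -
    let ?H = "\<lambda>v. ?E / 2 + (- ?P) \<bullet> v + ?M / 2 * (norm v)\<^sup>2"
    have H: "?H v = moment (\<lambda>w. (norm (w - v))\<^sup>2) / 2" for v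
      unfolding norm_diff_square moment_quadratic by (simp add: inner_commute)
    have Hm: "?H \<in> borel_measurable borel" by simp
    have Hb: "\<bar>?H v\<bar> \<le> (\<bar>?E\<bar> + norm ?P + \<bar>?M\<bar>) * (1 + (norm v)\<^sup>2)" for v
    proof -
      have "\<bar>?P \<bullet> v\<bar> \<le> norm ?P * (1 + (norm v)\<^sup>2)"
        using Cauchy_Schwarz_ineq2[of ?P v] mult_left_mono[OF norm_le_one_plus_square[of v] norm_ge_zero[of ?P]] by linarith
      moreover have "\<bar>?E / 2\<bar> \<le> \<bar>?E\<bar> * (1 + (norm v)\<^sup>2)"
        using mult_left_mono[of 1 "1 + (norm v)\<^sup>2" "\<bar>?E\<bar>"] by simp
      moreover have "\<bar>?M / 2 * (norm v)\<^sup>2\<bar> \<le> \<bar>?M\<bar> * (1 + (norm v)\<^sup>2)"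
      proof -
        have "\<bar>?M / 2 * (norm v)\<^sup>2\<bar> = \<bar>?M\<bar> * (norm v)\<^sup>2 / 2" by (simp add: abs_mult)
        moreover have "0 \<le> \<bar>?M\<bar> * (norm v)\<^sup>2" by simp
        moreover have "\<bar>?M\<bar> * (norm v)\<^sup>2 \<le> \<bar>?M\<bar> * (1 + (norm v)\<^sup>2)" by (intro mult_left_mono) auto
        ultimately show ?thesis by linarith
      qed
      ultimately show ?thesis unfolding distrib_right inner_minus_left by linarith
    qed
    have "(\<integral>\<^sup>+y. \<integral>\<^sup>+v. ennreal (g y v * ?H v) \<partial>lborel \<partial>lborel) = ennreal (moment ?H)"
      unfolding nn_integral_g[OF Hm, symmetric]
      by (rule nn_integral_moment[OF Hm Hb]) (unfold H, intro divide_nonneg_pos moment_nonneg, auto)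
    moreover have "moment ?H = ?M * ?E - (norm ?P)\<^sup>2"
      using moment_quadratic[of "?E / 2" "- ?P" "?M / 2"] by (simp add: inner_minus_left dot_square_norm)
    moreover have "?H v = (norm v)\<^sup>2 * ?M / 2 - ?P \<bullet> v + ?E / 2" for v by (simp add: mult.commute)
    ultimately show ?thesis by (simp only:)
  qed
  finally show ?thesis .
qed

text \<open>AM-GM in the form \<open>2 |v - u| \<le> s + |v - u|\<^sup>2 / s\<close>, with \<open>s\<close> slightly above
  \<open>sqrt D / M\<close>, replaces the Cauchy--Schwarz inequality.\<close>

lemma absolute_moment_bound:
  assumes D: "moment (\<lambda>_. 1) * moment (\<lambda>v. (norm (v - u))\<^sup>2) \<le> D" "0 \<le> D"
  shows "(\<integral>\<^sup>+y. \<integral>\<^sup>+v. ennreal (g y v * (\<Sum>k\<in>UNIV. \<bar>v $ k - u $ k\<bar>)) \<partial>lborel \<partial>lborel) \<le> ennreal (CARD('n) * sqrt D)"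
proof -
  let ?M = "moment (\<lambda>_. 1)" and ?W = "moment (\<lambda>v. (norm (v - u))\<^sup>2)" and ?l = "\<lambda>v. (\<Sum>k\<in>UNIV. \<bar>v $ k - u $ k\<bar>)"
  have lm: "?l \<in> borel_measurable borel" by simp
  have l0: "0 \<le> ?l v" for v by (intro sum_nonneg) auto
  have l1: "?l v \<le> CARD('n) * norm (v - u)" for v
    using sum_bounded_above[of UNIV "\<lambda>k. \<bar>v $ k - u $ k\<bar>" "norm (v - u)"] component_le_norm_cart[of "v - u"] by simp
  have M0: "0 \<le> ?M" by (rule moment_nonneg) simp
  have lb: "\<bar>?l v\<bar> \<le> CARD('n) * (1 + norm u) * (1 + (norm v)\<^sup>2)" for v
  proof -
    have "norm (v - u) \<le> norm v + norm u" by (rule norm_triangle_ineq4)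
    also have "\<dots> \<le> (1 + norm u) * (1 + (norm v)\<^sup>2)"
      using norm_le_one_plus_square[of v] mult_left_mono[of 1 "1 + (norm v)\<^sup>2" "norm u"] unfolding distrib_right by simp
    finally have "CARD('n) * norm (v - u) \<le> CARD('n) * ((1 + norm u) * (1 + (norm v)\<^sup>2))" by (intro mult_left_mono) auto
    then show ?thesis using l0[of v] l1[of v] by (simp only: mult.assoc)
  qed
  have "moment ?l \<le> CARD('n) * sqrt D"
  \<comment> \<open>Zero mass makes \<open>g\<close> vanish almost everywhere, so the moment on the
    left is 0; otherwise the division by the mass below is legitimate.\<close>
  proof (cases "?M = 0")
    case True
    have i: "integrable lborel (\<lambda>p. g (fst p) (snd p) * 1)"
      by (rule g_integrable[where k = 1 and H = "\<lambda>_. 1"]) auto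
    have "AE p in lborel. g (fst p) (snd p) * 1 = 0"
      using True integral_nonneg_eq_0_iff_AE[OF i] g_nonneg by (simp add: moment_def)
    then have "moment ?l = (\<integral>p. 0 \<partial>(lborel :: ((real^'n) \<times> (real^'n)) measure))"
      unfolding moment_def using g_times_measurable[OF lm] by (intro integral_cong_AE) auto
    then show ?thesis using D(2) by simp
  next
    case False
    then have M: "0 < ?M" using M0 by simp
    show ?thesis
    proof (rule field_le_epsilon)
      fix e :: real assume e: "0 < e"
      \<comment> \<open>The surplus e / n keeps \<open>s\<close> positive even if \<open>D\<close>
        is 0, and multiplied by n it costs exactly \<open>e\<close> at the end.\<close>
      define s where "s = (sqrt D + e / CARD('n)) / ?M"
      have en: "0 < e / CARD('n)" using e by simp
      have s: "0 < s" unfolding s_def by (intro divide_pos_pos add_nonneg_pos M en real_sqrt_ge_zero D(2))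
      have sM: "s * ?M = sqrt D + e / CARD('n)" using M by (simp add: s_def)
      have "?M * ?W \<le> (s * ?M)\<^sup>2"
      proof -
        have "D = (sqrt D)\<^sup>2" using D(2) by simp
        also have "\<dots> \<le> (s * ?M)\<^sup>2" unfolding sM using en D(2) by (intro power_mono) auto
        finally show ?thesis using D(1) by linarith
      qed
      then have W: "?W \<le> s\<^sup>2 * ?M" using M by (simp add: power2_eq_square mult_ac)
      have "moment ?l \<le> moment (\<lambda>v. CARD('n) * (s + (norm (v - u))\<^sup>2 / s) / 2)"
      proof (rule moment_mono[OF lm lb])
        fix v
        have "0 \<le> (norm (v - u) - s)\<^sup>2" by simp
        then have "2 * norm (v - u) \<le> s + (norm (v - u))\<^sup>2 / s"
          using s by (simp add: power2_eq_square field_simps)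
        then have "CARD('n) * (2 * norm (v - u)) \<le> CARD('n) * (s + (norm (v - u))\<^sup>2 / s)" by (intro mult_left_mono) auto
        then have "CARD('n) * (2 * norm (v - u)) / 2 \<le> CARD('n) * (s + (norm (v - u))\<^sup>2 / s) / 2" by (intro divide_right_mono) auto
        moreover have "CARD('n) * (2 * norm (v - u)) / 2 = CARD('n) * norm (v - u)" by simp
        ultimately show "?l v \<le> CARD('n) * (s + (norm (v - u))\<^sup>2 / s) / 2" using l1[of v] by (simp only:)
      next
        fix v
        have "(norm (v - u))\<^sup>2 / s \<le> (2 + 2 * (norm u)\<^sup>2) * (1 + (norm v)\<^sup>2) / s"
          using s norm_diff_square_le by (intro divide_right_mono) auto
        moreover have "s \<le> s * (1 + (norm v)\<^sup>2)" using s by simp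
        ultimately have "s + (norm (v - u))\<^sup>2 / s \<le> (s + (2 + 2 * (norm u)\<^sup>2) / s) * (1 + (norm v)\<^sup>2)"
          by (simp add: distrib_right)
        then have "CARD('n) / 2 * (s + (norm (v - u))\<^sup>2 / s) \<le> CARD('n) / 2 * ((s + (2 + 2 * (norm u)\<^sup>2) / s) * (1 + (norm v)\<^sup>2))"
          by (intro mult_left_mono) auto
        moreover have "0 \<le> CARD('n) / 2 * (s + (norm (v - u))\<^sup>2 / s)" using s by simp
        ultimately show "\<bar>CARD('n) * (s + (norm (v - u))\<^sup>2 / s) / 2\<bar> \<le> CARD('n) / 2 * (s + (2 + 2 * (norm u)\<^sup>2) / s) * (1 + (norm v)\<^sup>2)"
          by (simp only: mult.assoc times_divide_eq_left)
      qed simp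
      also have "\<dots> = CARD('n) / 2 * (s * ?M + ?W / s)"
      proof -
        have "(\<lambda>v. CARD('n) * (s + (norm (v - u))\<^sup>2 / s) / 2)
          = (\<lambda>v. CARD('n) / 2 * (s + (norm u)\<^sup>2 / s) + (- (CARD('n) / s) *\<^sub>R u) \<bullet> v + CARD('n) / (2 * s) * (norm v)\<^sup>2)"
          unfolding norm_diff_square using s by (auto simp: field_simps)
        moreover have "?W = (norm u)\<^sup>2 * ?M - 2 * (u \<bullet> (\<chi> i. moment (\<lambda>v. v $ i))) + moment (\<lambda>v. (norm v)\<^sup>2)"
          unfolding norm_diff_square moment_quadratic by simp
        ultimately show ?thesis
          using moment_quadratic[of "CARD('n) / 2 * (s + (norm u)\<^sup>2 / s)" "- (CARD('n) / s) *\<^sub>R u" "CARD('n) / (2 * s)"] s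
          by (simp only:) (simp add: field_simps)
      qed
      also have "\<dots> \<le> CARD('n) / 2 * (s * ?M + s * ?M)"
      proof -
        have "?W / s \<le> s * ?M" using W s by (simp add: pos_divide_le_eq power2_eq_square mult_ac)
        then show ?thesis by (intro mult_left_mono) auto
      qed
      also have "\<dots> = CARD('n) * sqrt D + e" unfolding sM by (simp add: field_simps)
      finally show "moment ?l \<le> CARD('n) * sqrt D + e" .
    qed
  qed
  then show ?thesis
    unfolding nn_integral_g[OF lm, symmetric] nn_integral_moment[OF lm lb l0] by (rule ennreal_leI)
qed

end

section \<open>Conservative flows\<close>

lemma test_fun_derivative:
  fixes \<phi> :: "'a::euclidean_space \<Rightarrow> real"
  assumes "test_fun U \<phi>"
  shows "(\<phi> has_derivative frechet_derivative \<phi> (at x)) (at x)"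
    and "continuous_on UNIV (\<lambda>x. frechet_derivative \<phi> (at x) u)"
    and "x \<notin> U \<Longrightarrow> frechet_derivative \<phi> (at x) u = 0"
    and "\<exists>B. \<forall>x. \<bar>frechet_derivative \<phi> (at x) u\<bar> \<le> B"
proof -
  obtain K where K: "compact K" "K \<subseteq> U" "\<And>x. x \<notin> K \<Longrightarrow> \<phi> x = 0" and C: "C_infinity \<phi>"
    using assms unfolding test_fun_def by blast
  have "iter_dderiv \<phi> [] differentiable (at x)" for x
    using C unfolding C_infinity_def by blast
  then show "(\<phi> has_derivative frechet_derivative \<phi> (at x)) (at x)"
    using frechet_derivative_works by auto
  have "iter_dderiv \<phi> [u] differentiable (at x)" for x
    using C unfolding C_infinity_def by blast
  then have "(\<lambda>x. frechet_derivative \<phi> (at x) u) differentiable (at x)" for x by simp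
  then have "continuous (at x) (\<lambda>x. frechet_derivative \<phi> (at x) u)" for x
    by (rule differentiable_imp_continuous_within)
  then show c: "continuous_on UNIV (\<lambda>x. frechet_derivative \<phi> (at x) u)"
    by (simp add: continuous_at_imp_continuous_on)
  have z: "frechet_derivative \<phi> (at x) u = 0" if x: "x \<notin> K" for x
  proof -
    have "(\<phi> has_derivative (\<lambda>_. 0)) (at x)"
    proof (rule has_derivative_transform_within_open[OF has_derivative_const])
      show "open (- K)" by (intro open_Compl compact_imp_closed K(1))
    qed (use x K(3) in auto)
    then show ?thesis by (simp add: frechet_derivative_at[symmetric])
  qed
  then show "x \<notin> U \<Longrightarrow> frechet_derivative \<phi> (at x) u = 0" using K(2) by blast
  have "bounded ((\<lambda>x. frechet_derivative \<phi> (at x) u) ` K)"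
    by (intro compact_imp_bounded compact_continuous_image K(1) continuous_on_subset[OF c]) simp
  then obtain B where B: "\<And>x. x \<in> K \<Longrightarrow> \<bar>frechet_derivative \<phi> (at x) u\<bar> \<le> B"
    unfolding bounded_iff by auto
  have "\<bar>frechet_derivative \<phi> (at x) u\<bar> \<le> max B 0" for x
    using B[of x] z[of x] by (cases "x \<in> K") auto
  then show "\<exists>B. \<forall>x. \<bar>frechet_derivative \<phi> (at x) u\<bar> \<le> B" by blast
qed

lemma linear_lift_expand:
  fixes D :: "real \<times> (real^'n::finite) \<Rightarrow> real"
  assumes "linear D"
  shows "D (1, v) = (\<Sum>j\<in>UNIV. lift v j * D (unit j))"
  unfolding sum_lift_unit[symmetric] using assms by (simp add: linear_sum linear_scale)

context kinetic_density
begin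

lemma F_fubini:
  assumes "H \<in> borel_measurable borel" "\<And>z. \<bar>H z\<bar> \<le> k * (1 + (norm (snd z))\<^sup>2)"
  shows "(\<integral>z. F (fst z) (snd z) * H z \<partial>lborel) = (\<integral>x. \<integral>v. F x v * H (x, v) \<partial>lborel \<partial>lborel)"
    and "AE x in lborel. integrable lborel (\<lambda>v. F x v * H (x, v))"
    and "integrable lborel (\<lambda>x. \<integral>v. F x v * H (x, v) \<partial>lborel)"
proof -
  have i: "integrable (lborel \<Otimes>\<^sub>M lborel) (\<lambda>z. F (fst z) (snd z) * H z)"
    unfolding lborel_prod by (rule F_integrable[OF assms])
  show "(\<integral>z. F (fst z) (snd z) * H z \<partial>lborel) = (\<integral>x. \<integral>v. F x v * H (x, v) \<partial>lborel \<partial>lborel)"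
    using lborel_pair.integral_fst'[OF i] by (simp add: lborel_prod)
  show "AE x in lborel. integrable lborel (\<lambda>v. F x v * H (x, v))"
    using lborel_pair.AE_integrable_fst'[OF i] by simp
  show "integrable lborel (\<lambda>x. \<integral>v. F x v * H (x, v) \<partial>lborel)"
    using lborel_pair.integrable_fst'[OF i] by simp
qed

lemma lift_mult_snd_measurable:
  "(\<lambda>z :: (real \<times> (real^'n)) \<times> (real^'n). lift (snd z) i * lift (snd z) j) \<in> borel_measurable borel"
  by (intro borel_measurable_times measurable_compose[OF _ lift_measurable] borel_measurable_continuous_onI continuous_intros)

lemmas F_lift_fubini = F_fubini[OF lift_mult_snd_measurable lift_mult_le, unfolded snd_conv]

lemma F_lift_integrable: "AE x in lborel. \<forall>i j. integrable lborel (\<lambda>v. F x v * (lift v i * lift v j))"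
  unfolding AE_all_countable using F_lift_fubini(2) by blast

text \<open>Passes from conservation laws stated for velocity moments to one integral over time,
  space and velocity. Fubini applies because the derivative of the test function is bounded and the
  remaining factor grows at most quadratically in v.\<close>

lemma transport_from_moments:
  assumes \<phi>: "test_fun ({0<..<T} \<times> UNIV) \<phi>"
    and eq: "(\<integral>x. (\<Sum>j\<in>UNIV. (\<integral>v. F x v * (lift v i * lift v j) \<partial>lborel) * frechet_derivative \<phi> (at x) (unit j)) \<partial>lborel) = 0"
  shows "(\<integral>z. F (fst z) (snd z) * lift (snd z) i * frechet_derivative \<phi> (at (fst z)) (1, snd z) \<partial>lborel) = 0"
proof -
  let ?D = "\<lambda>x. frechet_derivative \<phi> (at x)"
  have D: "?D x (1, v) = (\<Sum>j\<in>UNIV. lift v j * ?D x (unit j))" for x v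
    by (intro linear_lift_expand has_derivative_linear[OF test_fun_derivative(1)[OF \<phi>]])
  have "\<exists>B. \<forall>j x. \<bar>?D x (unit j)\<bar> \<le> B j"
    by (rule choice) (use test_fun_derivative(4)[OF \<phi>] in blast)
  then obtain B where B: "\<And>j x. \<bar>?D x (unit j)\<bar> \<le> B j" by blast
  define H where "H z = lift (snd z) i * ?D (fst z) (1, snd z)" for z
  have H: "H z = (\<Sum>j\<in>UNIV. lift (snd z) i * lift (snd z) j * ?D (fst z) (unit j))" for z
    by (simp add: H_def D sum_distrib_left mult.assoc)
  have Hm: "H \<in> borel_measurable borel"
    unfolding H[abs_def]
    by (intro borel_measurable_sum borel_measurable_times measurable_compose[OF _ lift_measurable]
        measurable_compose[OF _ borel_measurable_continuous_onI[OF test_fun_derivative(2)[OF \<phi>]]]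
        borel_measurable_continuous_onI continuous_intros)
  have Hb: "\<bar>H z\<bar> \<le> (\<Sum>j\<in>UNIV. 2 * B j) * (1 + (norm (snd z))\<^sup>2)" for z
  proof -
    have "\<bar>H z\<bar> \<le> (\<Sum>j\<in>UNIV. \<bar>lift (snd z) i * lift (snd z) j * ?D (fst z) (unit j)\<bar>)"
      unfolding H by (rule sum_abs)
    also have "\<dots> \<le> (\<Sum>j\<in>UNIV. 2 * B j * (1 + (norm (snd z))\<^sup>2))"
    proof (rule sum_mono)
      fix j
      have "\<bar>lift (snd z) i * lift (snd z) j * ?D (fst z) (unit j)\<bar> \<le> (2 * (1 + (norm (snd z))\<^sup>2)) * B j"
        unfolding abs_mult[of "_ * _" "?D _ _"] by (intro mult_mono lift_mult_le B) auto
      then show "\<bar>lift (snd z) i * lift (snd z) j * ?D (fst z) (unit j)\<bar> \<le> 2 * B j * (1 + (norm (snd z))\<^sup>2)"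
        by (simp only: ac_simps)
    qed
    finally show ?thesis by (simp only: sum_distrib_right)
  qed
  have "(\<integral>z. F (fst z) (snd z) * H z \<partial>lborel) = (\<integral>x. \<integral>v. F x v * H (x, v) \<partial>lborel \<partial>lborel)"
    by (rule F_fubini(1)[OF Hm Hb])
  also have "\<dots> = (\<integral>x. (\<Sum>j\<in>UNIV. (\<integral>v. F x v * (lift v i * lift v j) \<partial>lborel) * ?D x (unit j)) \<partial>lborel)"
  proof (rule integral_cong_AE)
    show "(\<lambda>x. \<integral>v. F x v * H (x, v) \<partial>lborel) \<in> borel_measurable lborel"
      using F_fubini(3)[OF Hm Hb] by (rule borel_measurable_integrable)
    have "(\<lambda>x. \<integral>v. F x v * (lift v i * lift v j) \<partial>lborel) \<in> borel_measurable lborel" for j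
      by (rule borel_measurable_integrable[OF F_lift_fubini(3)])
    moreover have "(\<lambda>x. ?D x (unit j)) \<in> borel_measurable lborel" for j
      using borel_measurable_continuous_onI[OF test_fun_derivative(2)[OF \<phi>]] by simp
    ultimately show "(\<lambda>x. \<Sum>j\<in>UNIV. (\<integral>v. F x v * (lift v i * lift v j) \<partial>lborel) * ?D x (unit j)) \<in> borel_measurable lborel"
      by (intro borel_measurable_sum borel_measurable_times)
    show "AE x in lborel. (\<integral>v. F x v * H (x, v) \<partial>lborel) = (\<Sum>j\<in>UNIV. (\<integral>v. F x v * (lift v i * lift v j) \<partial>lborel) * ?D x (unit j))"
      using F_lift_integrable
    proof eventually_elim
      case (elim x)
      have "(\<integral>v. F x v * H (x, v) \<partial>lborel) = (\<integral>v. (\<Sum>j\<in>UNIV. F x v * (lift v i * lift v j) * ?D x (unit j)) \<partial>lborel)"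
        by (simp add: H sum_distrib_left mult.assoc)
      also have "\<dots> = (\<Sum>j\<in>UNIV. (\<integral>v. F x v * (lift v i * lift v j) * ?D x (unit j) \<partial>lborel))"
        using elim by (intro Bochner_Integration.integral_sum) simp
      finally show ?case by simp
    qed
  qed
  also have "\<dots> = 0" by (rule eq)
  finally show ?thesis by (simp add: H_def mult.assoc)
qed

end

locale conservative_flow =
  fixes T :: real and f :: "real \<Rightarrow> real^'n::finite \<Rightarrow> real^'n \<Rightarrow> real" and f0
  assumes T: "0 < T" and adm: "admissible_flow T f f0"
begin

text \<open>Cut to the open time interval: outside [0, T] neither a sign nor moment bounds for
  \<open>f\<close> are available.\<close>

definition F :: "real \<times> (real^'n) \<Rightarrow> real^'n \<Rightarrow> real" where
  "F x v = (if fst x \<in> {0<..<T} then f (fst x) (snd x) v else 0)"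

lemma f_measurable: "(\<lambda>q. f (fst q) (fst (snd q)) (snd (snd q))) \<in> borel_measurable borel"
  using adm unfolding admissible_flow_def by (simp add: case_prod_beta')

lemma f_nonneg: "t \<in> {0..T} \<Longrightarrow> 0 \<le> f t y v"
  using adm unfolding admissible_flow_def by blast

lemma f0_eq: "f 0 = f0"
  using adm unfolding admissible_flow_def by (intro ext) blast

lemma mass_f: "t \<in> {0..T} \<Longrightarrow> mass (f t) = mass f0" and mass_f0: "mass f0 < \<infinity>"
  using adm unfolding admissible_flow_def by blast+

lemma energy_f: "t \<in> {0..T} \<Longrightarrow> energy (f t) \<le> energy f0" and energy_f0: "energy f0 < \<infinity>"
  using adm unfolding admissible_flow_def by blast+

lemma density: "t \<in> {0..T} \<Longrightarrow> velocity_density (f t)"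
proof
  assume t: "t \<in> {0..T}"
  have "(\<lambda>p. (t, p)) \<in> borel \<rightarrow>\<^sub>M (borel :: (real \<times> (real^'n) \<times> (real^'n)) measure)"
    by (intro borel_measurable_continuous_onI continuous_intros)
  from measurable_compose[OF this f_measurable]
  show "(\<lambda>p. f t (fst p) (snd p)) \<in> borel_measurable borel" by simp
  show "0 \<le> f t y v" for y v by (rule f_nonneg[OF t])
  show "mass (f t) < \<infinity>" using mass_f[OF t] mass_f0 by simp
  show "energy (f t) < \<infinity>" using energy_f[OF t] energy_f0 by (rule le_less_trans)
qed

lemma F_measurable: "(\<lambda>z. F (fst z) (snd z)) \<in> borel_measurable borel"
proof -
  have "(\<lambda>z. (fst (fst z), snd (fst z), snd z)) \<in> borel \<rightarrow>\<^sub>M (borel :: (real \<times> (real^'n) \<times> (real^'n)) measure)"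
    by (intro borel_measurable_continuous_onI continuous_intros)
  from measurable_compose[OF this f_measurable]
  have m: "(\<lambda>z. f (fst (fst z)) (snd (fst z)) (snd z)) \<in> borel_measurable borel" by simp
  have "{z :: (real \<times> (real^'n)) \<times> (real^'n). fst (fst z) \<in> {0<..<T}} \<in> sets borel"
    by (intro borel_open open_vimage[of "{0<..<T}" "\<lambda>z. fst (fst z)", unfolded vimage_def] continuous_intros open_greaterThanLessThan)
  then show ?thesis unfolding F_def using m by (intro measurable_If) auto
qed

lemma F_slice:
  assumes "H \<in> borel_measurable borel"
  shows "t \<in> {0<..<T} \<Longrightarrow> (\<integral>\<^sup>+y. \<integral>\<^sup>+v. ennreal (F (t, y) v * H v) \<partial>lborel \<partial>lborel)
    = (\<integral>\<^sup>+p. ennreal (f t (fst p) (snd p) * H (snd p)) \<partial>lborel)"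
proof -
  assume t: "t \<in> {0<..<T}"
  then interpret velocity_density "f t" by (intro density) auto
  show ?thesis using t by (simp add: F_def nn_integral_g[OF assms])
qed

sublocale kinetic_density T F
proof
  show "0 \<le> F x v" for x v using f_nonneg by (simp add: F_def)
  show "fst x \<notin> {0<..<T} \<Longrightarrow> F x v = 0" for x v by (simp only: F_def if_False)
  have m: "(\<lambda>z. ennreal (F (fst z) (snd z) * (1 + (norm (snd z))\<^sup>2))) \<in> borel_measurable borel"
  proof -
    have "(\<lambda>z :: (real \<times> (real^'n)) \<times> (real^'n). 1 + (norm (snd z))\<^sup>2) \<in> borel_measurable borel"
      by (intro borel_measurable_continuous_onI continuous_intros)
    then show ?thesis using F_measurable by simp
  qed
  let ?c = "mass f0 + 2 * energy f0"
  have "(\<integral>\<^sup>+z. ennreal (F (fst z) (snd z) * (1 + (norm (snd z))\<^sup>2)) \<partial>lborel)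
    = (\<integral>\<^sup>+t. \<integral>\<^sup>+y. \<integral>\<^sup>+v. ennreal (F (t, y) v * (1 + (norm v)\<^sup>2)) \<partial>lborel \<partial>lborel \<partial>lborel)"
    using nn_integral_lborel_iterated(1)[OF m] nn_integral_lborel_iterated(1)[OF nn_integral_lborel_iterated(2)[OF m]] by simp
  also have "\<dots> \<le> (\<integral>\<^sup>+t. ?c * indicator {0<..<T} t \<partial>lborel)"
  proof (rule nn_integral_mono)
    fix t
    show "(\<integral>\<^sup>+y. \<integral>\<^sup>+v. ennreal (F (t, y) v * (1 + (norm v)\<^sup>2)) \<partial>lborel \<partial>lborel) \<le> ?c * indicator {0<..<T} t"
    proof (cases "t \<in> {0<..<T}")
      case True
      then interpret velocity_density "f t" by (intro density) auto
      have "(\<integral>\<^sup>+y. \<integral>\<^sup>+v. ennreal (F (t, y) v * (1 + (norm v)\<^sup>2)) \<partial>lborel \<partial>lborel) = mass (f t) + 2 * energy (f t)"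
        using F_slice[of "\<lambda>v. 1 + (norm v)\<^sup>2", OF _ True] weight_nn_integral by simp
      also have "\<dots> \<le> ?c" using True mass_f energy_f by (intro add_mono mult_left_mono) auto
      finally show ?thesis using True by simp
    next
      case False
      then have "F (t, y) v = 0" for y v by (simp only: F_def fst_conv if_False)
      then show ?thesis by simp
    qed
  qed
  also have "\<dots> = ?c * ennreal T" using T by (simp add: nn_integral_cmult_indicator)
  also have "\<dots> < \<infinity>" using mass_f0 energy_f0 by (simp add: ennreal_mult_less_top)
  finally show "(\<integral>\<^sup>+z. ennreal (F (fst z) (snd z) * (1 + (norm (snd z))\<^sup>2)) \<partial>lborel) < \<infinity>" .
qed (rule F_measurable)

lemma flux_moments:
  assumes "t \<in> {0<..<T}"
  shows "(\<integral>v. F (t, y) v * (lift v None * lift v None) \<partial>lborel) = enn2real (rho f t y)"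
    and "(\<integral>v. F (t, y) v * (lift v None * lift v (Some j)) \<partial>lborel) = mom f t y j"
    and "(\<integral>v. F (t, y) v * (lift v (Some j) * lift v None) \<partial>lborel) = mom f t y j"
    and "(\<integral>v. F (t, y) v * (lift v (Some i) * lift v (Some j)) \<partial>lborel) = str f t y i j"
proof -
  interpret velocity_density "f t" using assms by (intro density) auto
  have "(\<integral>v. f t y v \<partial>lborel) = enn2real (rho f t y)"
    unfolding rho_def using g_section_measurable g_nonneg by (intro integral_eq_nn_integral) auto
  then show "(\<integral>v. F (t, y) v * (lift v None * lift v None) \<partial>lborel) = enn2real (rho f t y)"
    using assms by (simp add: F_def lift_def)
qed (use assms in \<open>simp_all add: F_def lift_def mom_def str_def mult.assoc\<close>)

sublocale kinetic_flow T F
proof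
  fix \<phi> :: "real \<times> (real^'n) \<Rightarrow> real" and i :: "'n option"
  assume \<phi>: "test_fun ({0<..<T} \<times> UNIV) \<phi>"
  show "(\<integral>z. F (fst z) (snd z) * lift (snd z) i * frechet_derivative \<phi> (at (fst z)) (1, snd z) \<partial>lborel) = 0"
  proof (rule transport_from_moments[OF \<phi>])
    \<comment> \<open>Outside the slab the moments of \<open>f\<close> and of \<open>F\<close> need
      not agree, but there the derivatives of the test function vanish.\<close>
    have off: "frechet_derivative \<phi> (at x) u = 0" if "fst x \<notin> {0<..<T}" for x u
      using that by (intro test_fun_derivative(3)[OF \<phi>]) (auto simp: mem_Times_iff)
    show "(\<integral>x. (\<Sum>j\<in>UNIV. (\<integral>v. F x v * (lift v i * lift v j) \<partial>lborel) * frechet_derivative \<phi> (at x) (unit j)) \<partial>lborel) = 0"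
    proof (cases i)
      case None
      have "(\<Sum>j\<in>UNIV. (\<integral>v. F x v * (lift v i * lift v j) \<partial>lborel) * frechet_derivative \<phi> (at x) (unit j))
        = enn2real (rho f (fst x) (snd x)) * dt \<phi> x + (\<Sum>j\<in>UNIV. mom f (fst x) (snd x) j * dy \<phi> j x)" for x
      proof (cases "fst x \<in> {0<..<T}")
        case True
        show ?thesis using flux_moments(1,2)[OF True, of "snd x"] by (simp add: None sum_option unit_def dt_def dy_def)
      qed (simp add: off dt_def dy_def)
      then show ?thesis using adm \<phi> unfolding admissible_flow_def by simp
    next
      case (Some k)
      have "(\<Sum>j\<in>UNIV. (\<integral>v. F x v * (lift v i * lift v j) \<partial>lborel) * frechet_derivative \<phi> (at x) (unit j))
        = mom f (fst x) (snd x) k * dt \<phi> x + (\<Sum>j\<in>UNIV. str f (fst x) (snd x) k j * dy \<phi> j x)" for x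
      proof (cases "fst x \<in> {0<..<T}")
        case True
        show ?thesis using flux_moments(3,4)[OF True, of "snd x"] by (simp add: Some sum_option unit_def dt_def dy_def)
      qed (simp add: off dt_def dy_def)
      then show ?thesis using adm \<phi> unfolding admissible_flow_def by simp
    qed
  qed
qed

end

section \<open>Conservation of total momentum\<close>

context kinetic_flow
begin

text \<open>The weak formulation with a test function of the time alone: the spatial cutoff
  \<open>space_bump R\<close> disappears as \<open>R\<close> tends to infinity.\<close>

lemma transport_time:
  assumes \<delta>: "0 < \<delta>" and s: "0 < s1" "s1 + \<delta> < T" "0 < s2" "s2 + \<delta> < T"
  defines "r \<equiv> \<lambda>t. smooth_step' ((t - s1) / \<delta>) / \<delta> - smooth_step' ((t - s2) / \<delta>) / \<delta>"
  shows "(\<integral>z. F (fst z) (snd z) * (lift (snd z) i * r (fst (fst z))) \<partial>lborel) = 0"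
proof -
  obtain C where C0: "0 < C" and C: "\<And>s. smooth_step' s \<le> C" by (rule smooth_step'_bounded) blast
  \<comment> \<open>A primitive of \<open>r\<close>. As the difference of two steps it vanishes
    before both of them and after both, so it has compact support inside (0, T).\<close>
  define \<theta> where "\<theta> t = smooth_step ((t - s1) / \<delta>) - smooth_step ((t - s2) / \<delta>)" for t
  define \<phi> :: "nat \<Rightarrow> real \<times> (real^'n) \<Rightarrow> real" where "\<phi> m x = \<theta> (fst x) * space_bump (real (Suc m)) (snd x)" for m x
  define q :: "nat \<Rightarrow> real^'n \<Rightarrow> real^'n \<Rightarrow> real"
    where "q m y v = - (2 * smooth_step' (2 - (y \<bullet> y) / (real (Suc m))\<^sup>2) * (y \<bullet> v) / (real (Suc m))\<^sup>2)" for m y v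
  let ?D = "\<lambda>m z. \<theta> (fst (fst z)) * q m (snd (fst z)) (snd z) + r (fst (fst z)) * space_bump (real (Suc m)) (snd (fst z))"
  have \<theta>1: "\<bar>\<theta> t\<bar> \<le> 1" for t
    unfolding \<theta>_def using smooth_step_range[of "(t - s1) / \<delta>"] smooth_step_range[of "(t - s2) / \<delta>"] by linarith
  have rb: "\<bar>r t\<bar> \<le> C / \<delta>" for t
  proof -
    have "0 \<le> smooth_step' ((t - s) / \<delta>) / \<delta>" "smooth_step' ((t - s) / \<delta>) / \<delta> \<le> C / \<delta>" for s
      using \<delta> C smooth_step'_nonneg by (auto intro: divide_right_mono)
    from this[of s1] this[of s2] show ?thesis unfolding r_def by linarith
  qed
  have d: "frechet_derivative (\<phi> m) (at x) (1, v) = \<theta> (fst x) * q m (snd x) v + r (fst x) * space_bump (real (Suc m)) (snd x)" for m x v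
  proof -
    have "(\<theta> has_real_derivative r t) (at t)" for t
      unfolding \<theta>_def[abs_def] r_def by (intro DERIV_diff DERIV_smooth_step_affine)
    then have "((\<lambda>x. \<theta> (fst x)) has_derivative (\<lambda>u. r (fst x) * fst u)) (at x)"
      by (intro has_derivative_compose[OF has_derivative_fst[OF has_derivative_ident]]) (simp add: has_field_derivative_def)
    moreover have "((\<lambda>x. space_bump (real (Suc m)) (snd x)) has_derivative (\<lambda>u. q m (snd x) (snd u))) (at x)"
      unfolding q_def by (rule has_derivative_compose[OF has_derivative_snd[OF has_derivative_ident] space_bump_props(5)]) simp
    ultimately have "(\<phi> m has_derivative
      (\<lambda>u. \<theta> (fst x) * q m (snd x) (snd u) + r (fst x) * fst u * space_bump (real (Suc m)) (snd x))) (at x)"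
      unfolding \<phi>_def[abs_def] by (rule has_derivative_mult)
    then show ?thesis by (simp add: frechet_derivative_at[symmetric])
  qed
  have test: "test_fun ({0<..<T} \<times> UNIV) (\<phi> m)" for m
  proof -
    define K :: "(real \<times> (real^'n)) set" where "K = {min s1 s2..max s1 s2 + \<delta>} \<times> cball 0 (2 * real (Suc m))"
    have "(\<lambda>x. \<theta> (fst x)) \<in> smooth_funs"
      unfolding \<theta>_def using \<delta>
      by (intro smooth_step_smooth smooth_funs_divide smooth_funs_diff smooth_funs.const smooth_funs.linear bounded_linear_fst) auto
    then have "\<phi> m \<in> smooth_funs"
      unfolding \<phi>_def[abs_def] by (intro smooth_funs.mult smooth_funs_space_bump) simp_all
    moreover have "\<phi> m x = 0" if x: "x \<notin> K" for x
    proof (cases "fst x \<in> {min s1 s2..max s1 s2 + \<delta>}")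
      case True
      then have "2 * real (Suc m) < norm (snd x)" using x by (auto simp: K_def mem_Times_iff simp del: of_nat_Suc)
      then show ?thesis using space_bump_props(4)[of "real (Suc m)" "snd x"] by (simp add: \<phi>_def)
    next
      case False
      then consider "fst x < s1" "fst x < s2" | "s1 + \<delta> < fst x" "s2 + \<delta> < fst x" by (auto simp: min_def max_def split: if_splits)
      then have "\<theta> (fst x) = 0"
      proof cases
        case 1
        then have "(fst x - s1) / \<delta> \<le> 0" "(fst x - s2) / \<delta> \<le> 0" using \<delta> by (simp_all add: divide_nonpos_pos)
        then show ?thesis by (simp add: \<theta>_def smooth_step_eq_0)
      next
        case 2
        then have "1 \<le> (fst x - s1) / \<delta>" "1 \<le> (fst x - s2) / \<delta>" using \<delta> by (simp_all add: pos_le_divide_eq)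
        then show ?thesis by (simp add: \<theta>_def smooth_step_eq_1)
      qed
      then show ?thesis by (simp add: \<phi>_def)
    qed
    moreover have "compact K" unfolding K_def by (intro compact_Times) auto
    moreover have "K \<subseteq> {0<..<T} \<times> UNIV" unfolding K_def using s by auto
    ultimately show ?thesis
      unfolding test_fun_def using smooth_funs_C_infinity by blast
  qed
  have meas: "(\<lambda>z. lift (snd z) i * ?D m z) \<in> borel_measurable borel" for m
  proof -
    have "continuous_on UNIV r"
      unfolding r_def using \<delta>
      by (intro continuous_intros continuous_on_compose2[OF smooth_step'_cont[of UNIV]]) auto
    then have rm: "r \<in> borel_measurable borel" by (rule borel_measurable_continuous_onI)
    have c\<theta>: "continuous_on UNIV \<theta>"
      unfolding \<theta>_def[abs_def] using \<delta>
      by (intro continuous_intros continuous_on_compose2[OF smooth_funs_continuous_on[OF smooth_step_id, of UNIV]]) auto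
    have cq: "continuous_on UNIV (\<lambda>z :: (real \<times> (real^'n)) \<times> (real^'n). q m (snd (fst z)) (snd z))"
      unfolding q_def by (intro continuous_intros continuous_on_compose2[OF smooth_step'_cont[of UNIV]]) auto
    have cs: "continuous_on UNIV (\<lambda>z :: (real \<times> (real^'n)) \<times> (real^'n). space_bump (real (Suc m)) (snd (fst z)))"
      unfolding space_bump_def by (intro continuous_intros continuous_on_compose2[OF smooth_funs_continuous_on[OF smooth_step_id, of UNIV]]) auto
    show ?thesis
      by (intro borel_measurable_times borel_measurable_add measurable_compose[OF _ lift_measurable]
          measurable_compose[OF _ rm] measurable_compose[OF _ borel_measurable_continuous_onI[OF c\<theta>]]
          borel_measurable_continuous_onI[OF cq] borel_measurable_continuous_onI[OF cs]
          borel_measurable_continuous_onI continuous_intros)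
  qed
  have eventually_r: "\<forall>\<^sub>F m in sequentially. ?D m z = r (fst (fst z))" for z :: "(real \<times> (real^'n)) \<times> (real^'n)"
  proof -
    obtain m0 where m0: "norm (snd (fst z)) < real m0" using reals_Archimedean2 by blast
    have "?D m z = r (fst (fst z))" if m: "m0 \<le> m" for m
    proof -
      let ?y = "snd (fst z)"
      have n: "norm ?y < real (Suc m)" using m0 m by simp
      then have "(norm ?y)\<^sup>2 < (real (Suc m))\<^sup>2" by (intro power_strict_mono) auto
      then have "(?y \<bullet> ?y) / (real (Suc m))\<^sup>2 < 1" by (simp add: dot_square_norm)
      then have "smooth_step' (2 - (?y \<bullet> ?y) / (real (Suc m))\<^sup>2) = 0" by (intro smooth_step'_eq_0) auto
      moreover have "space_bump (real (Suc m)) ?y = 1" using n by (intro space_bump_props(3)) auto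
      ultimately show ?thesis by (simp add: q_def)
    qed
    then show ?thesis unfolding eventually_sequentially by blast
  qed
  \<comment> \<open>Uniform in \<open>m\<close>: the gradient of the spatial cutoff is of order 1 /
    (m + 1), hence bounded by a constant. This is the majorant for dominated convergence.\<close>
  have bound: "\<bar>lift (snd z) i * ?D m z\<bar> \<le> (8 * C + 2 * (C / \<delta>)) * (1 + (norm (snd z))\<^sup>2)" for m z
  proof -
    let ?v = "snd z"
    have R: "0 < real (Suc m)" by simp
    have "\<bar>q m (snd (fst z)) ?v\<bar> \<le> 4 * C / real (Suc m) * norm ?v"
      unfolding q_def abs_minus_cancel by (rule space_bump_slope_bound[OF R C])
    also have "\<dots> \<le> 4 * C * norm ?v"
    proof (rule mult_right_mono)
      show "4 * C / real (Suc m) \<le> 4 * C" using C0 by (simp add: pos_divide_le_eq)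
    qed simp
    finally have "\<bar>\<theta> (fst (fst z)) * q m (snd (fst z)) ?v\<bar> \<le> 1 * (4 * C * norm ?v)"
      unfolding abs_mult by (intro mult_mono \<theta>1) auto
    moreover have "\<bar>r (fst (fst z)) * space_bump (real (Suc m)) (snd (fst z))\<bar> \<le> C / \<delta> * 1"
      unfolding abs_mult using space_bump_props(1,2)[OF R, of "snd (fst z)"] C0 \<delta> by (intro mult_mono rb) auto
    ultimately have "\<bar>?D m z\<bar> \<le> 4 * C * norm ?v + C / \<delta>" by linarith
    also have "\<dots> \<le> (4 * C + C / \<delta>) * (1 + norm ?v)"
      using C0 \<delta> by (simp add: distrib_right distrib_left)
    finally have "\<bar>lift ?v i * ?D m z\<bar> \<le> (1 + norm ?v) * ((4 * C + C / \<delta>) * (1 + norm ?v))"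
      unfolding abs_mult[of "lift _ _"] by (intro mult_mono abs_lift_le) auto
    also have "\<dots> = (4 * C + C / \<delta>) * ((1 + norm ?v) * (1 + norm ?v))" by (simp only: ac_simps)
    also have "\<dots> \<le> (4 * C + C / \<delta>) * (2 * (1 + (norm ?v)\<^sup>2))"
      using C0 \<delta> by (intro mult_left_mono one_plus_norm_square_le) auto
    also have "\<dots> = (8 * C + 2 * (C / \<delta>)) * (1 + (norm ?v)\<^sup>2)" by (simp add: algebra_simps)
    finally show ?thesis .
  qed
  have zero: "(\<integral>z. F (fst z) (snd z) * (lift (snd z) i * ?D m z) \<partial>lborel) = 0" for m
    using F_transport[OF test[of m], of i] unfolding d by (simp add: mult.assoc)
  have "(\<lambda>m. \<integral>z. F (fst z) (snd z) * (lift (snd z) i * ?D m z) \<partial>lborel)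
      \<longlonglongrightarrow> (\<integral>z. F (fst z) (snd z) * (lift (snd z) i * r (fst (fst z))) \<partial>lborel)"
  proof (rule integral_dominated_convergence[where w = "\<lambda>z. F (fst z) (snd z) * ((8 * C + 2 * (C / \<delta>)) * (1 + (norm (snd z))\<^sup>2))"])
    show "integrable lborel (\<lambda>z. F (fst z) (snd z) * ((8 * C + 2 * (C / \<delta>)) * (1 + (norm (snd z))\<^sup>2)))"
      using integrable_mult_right[OF F_weight_integrable, of "8 * C + 2 * (C / \<delta>)"] by (simp only: mult.left_commute)
    show s_meas: "(\<lambda>z. F (fst z) (snd z) * (lift (snd z) i * ?D m z)) \<in> borel_measurable lborel" for m
      using borel_measurable_times[OF F_measurable meas[of m]] by simp
    show lim: "AE z in lborel. (\<lambda>m. F (fst z) (snd z) * (lift (snd z) i * ?D m z)) \<longlonglongrightarrow> F (fst z) (snd z) * (lift (snd z) i * r (fst (fst z)))"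
      by (intro AE_I2 tendsto_mult tendsto_const tendsto_eventually eventually_r)
    have "(\<lambda>m. F (fst z) (snd z) * (lift (snd z) i * ?D m z)) \<longlonglongrightarrow> F (fst z) (snd z) * (lift (snd z) i * r (fst (fst z)))" for z
      by (intro tendsto_mult tendsto_const tendsto_eventually eventually_r)
    then show "(\<lambda>z. F (fst z) (snd z) * (lift (snd z) i * r (fst (fst z)))) \<in> borel_measurable lborel"
      using s_meas by (rule borel_measurable_LIMSEQ_metric[rotated])
    show "AE z in lborel. norm (F (fst z) (snd z) * (lift (snd z) i * ?D m z))
        \<le> F (fst z) (snd z) * ((8 * C + 2 * (C / \<delta>)) * (1 + (norm (snd z))\<^sup>2))" for m
      unfolding real_norm_def abs_mult[of "F _ _"] abs_of_nonneg[OF F_nonneg]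
      by (intro AE_I2 mult_left_mono bound F_nonneg)
  qed
  then show ?thesis unfolding zero by (rule LIMSEQ_unique[OF _ tendsto_const])
qed

end

context conservative_flow
begin

definition flux_in_time :: "'n option \<Rightarrow> real \<Rightarrow> real" where
  "flux_in_time i t = (\<integral>y. \<integral>v. F (t, y) v * lift v i \<partial>lborel \<partial>lborel)"

text \<open>Integrates out y and v, so that a weight in time alone turns the weak formulation into a
  statement about a function of one variable.\<close>

lemma time_weight_fubini:
  assumes k: "k \<in> borel_measurable borel" "\<And>t. \<bar>k t\<bar> \<le> B"
  shows "(\<integral>z. F (fst z) (snd z) * (lift (snd z) i * k (fst (fst z))) \<partial>lborel) = (\<integral>t. k t * flux_in_time i t \<partial>lborel)"
    and "integrable lborel (\<lambda>t. k t * flux_in_time i t)"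
proof -
  define H where "H z = lift (snd z) i * k (fst (fst z))" for z :: "(real \<times> (real^'n)) \<times> (real^'n)"
  have Hm: "H \<in> borel_measurable borel"
    unfolding H_def[abs_def]
    by (intro borel_measurable_times measurable_compose[OF _ lift_measurable] measurable_compose[OF _ k(1)]
        borel_measurable_continuous_onI continuous_intros)
  have Hb: "\<bar>H z\<bar> \<le> 2 * B * (1 + (norm (snd z))\<^sup>2)" for z
  proof -
    have "\<bar>lift (snd z) i\<bar> \<le> 2 * (1 + (norm (snd z))\<^sup>2)"
      using lift_mult_le[of "snd z" i None] by (simp add: lift_def)
    then have "\<bar>H z\<bar> \<le> 2 * (1 + (norm (snd z))\<^sup>2) * B"
      unfolding H_def abs_mult using k(2) by (intro mult_mono) auto
    then show ?thesis by (simp only: ac_simps)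
  qed
  have e: "(\<integral>v. F x v * H (x, v) \<partial>lborel) = k (fst x) * (\<integral>v. F x v * lift v i \<partial>lborel)" for x
  proof -
    have "(\<lambda>v. F x v * H (x, v)) = (\<lambda>v. k (fst x) * (F x v * lift v i))" by (simp add: H_def ac_simps)
    then show ?thesis by simp
  qed
  have i: "integrable (lborel \<Otimes>\<^sub>M lborel) (\<lambda>x. k (fst x) * (\<integral>v. F x v * lift v i \<partial>lborel))"
    unfolding lborel_prod e[symmetric] by (rule F_fubini(3)[OF Hm Hb])
  have "(\<integral>z. F (fst z) (snd z) * H z \<partial>lborel) = (\<integral>x. k (fst x) * (\<integral>v. F x v * lift v i \<partial>lborel) \<partial>lborel)"
    unfolding F_fubini(1)[OF Hm Hb] e ..
  also have "\<dots> = (\<integral>t. \<integral>y. k t * (\<integral>v. F (t, y) v * lift v i \<partial>lborel) \<partial>lborel \<partial>lborel)"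
    using lborel_pair.integral_fst'[OF i] by (simp add: lborel_prod)
  finally show "(\<integral>z. F (fst z) (snd z) * (lift (snd z) i * k (fst (fst z))) \<partial>lborel) = (\<integral>t. k t * flux_in_time i t \<partial>lborel)"
    unfolding H_def flux_in_time_def by simp
  show "integrable lborel (\<lambda>t. k t * flux_in_time i t)"
    using lborel_pair.integrable_fst'[OF i] by (simp add: flux_in_time_def)
qed

definition momentum :: "'n \<Rightarrow> real \<Rightarrow> real" where
  "momentum j t = (\<integral>y. mom f t y j \<partial>lborel)"

text \<open>The constant 1 is a bounded test function, so weak continuity in L^1 includes the total
  momentum: nothing escapes to infinity in space.\<close>

lemma momentum_continuous: "continuous_on {0..T} (momentum j)"
proof -
  have "(\<lambda>_. 1) \<in> borel_measurable (lborel :: (real^'n) measure) \<and> bounded (range (\<lambda>_ :: real^'n. 1 :: real))" by simp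
  then have "\<forall>i. continuous_on {0..T} (\<lambda>t. \<integral>y. mom f t y i * 1 \<partial>lborel)"
    using adm unfolding admissible_flow_def by blast
  then show ?thesis unfolding momentum_def[abs_def] by simp
qed

lemma momentum_eq_moment: "t \<in> {0..T} \<Longrightarrow> momentum j t = velocity_density.moment (f t) (\<lambda>v. v $ j)"
proof -
  assume "t \<in> {0..T}"
  then interpret velocity_density "f t" by (rule density)
  show ?thesis
    unfolding momentum_def mom_def
    by (rule moment_iterated(1)[symmetric, where k = 1])
      (auto intro: order_trans[OF component_le_norm_cart norm_le_one_plus_square])
qed

lemma flux_in_time_eq: "t \<in> {0<..<T} \<Longrightarrow> flux_in_time (Some j) t = momentum j t"
  unfolding flux_in_time_def momentum_def mom_def F_def by (simp add: lift_def)

text \<open>The mollifier is supported in [s, s + \<delta>]. For small \<delta> this lies in (0, T),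
  where the flux in time is the momentum, and continuity of the momentum at s gives the
  estimate.\<close>

lemma momentum_average_tendsto:
  assumes s: "s \<in> {0<..<T}" and e: "0 < e"
  shows "\<exists>d>0. \<forall>\<delta>. 0 < \<delta> \<and> \<delta> < d \<longrightarrow>
    \<bar>(\<integral>t. smooth_step' ((t - s) / \<delta>) / \<delta> * flux_in_time (Some j) t \<partial>lborel) - momentum j s\<bar> \<le> e"
proof -
  obtain d where d: "0 < d" "\<And>t. t \<in> {0..T} \<Longrightarrow> dist t s < d \<Longrightarrow> dist (momentum j t) (momentum j s) < e"
  proof -
    have "s \<in> {0..T}" using s by simp
    from momentum_continuous[of j, unfolded continuous_on_iff, rule_format, OF this e] show ?thesis using that by blast
  qed
  have "\<bar>(\<integral>t. smooth_step' ((t - s) / \<delta>) / \<delta> * flux_in_time (Some j) t \<partial>lborel) - momentum j s\<bar> \<le> e"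
    if \<delta>: "0 < \<delta>" "\<delta> < min d (T - s)" for \<delta>
  proof -
    let ?k = "\<lambda>t. smooth_step' ((t - s) / \<delta>) / \<delta>"
    obtain C where C: "0 < C" "\<And>s. smooth_step' s \<le> C" by (rule smooth_step'_bounded) blast
    have k0: "0 \<le> ?k t" for t using \<delta> smooth_step'_nonneg by simp
    have km: "?k \<in> borel_measurable borel" by measurable
    have kb: "\<bar>?k t\<bar> \<le> C / \<delta>" for t
      using C(2) \<delta>(1) smooth_step'_nonneg by (simp add: divide_right_mono)
    have ki: "integrable lborel ?k" "(\<integral>t. ?k t \<partial>lborel) = 1"
    proof -
      have "has_bochner_integral lborel ?k 1"
        using km k0 nn_integral_smooth_step'(1)[OF \<delta>(1), of s] by (intro has_bochner_integral_nn_integral) auto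
      then show "integrable lborel ?k" "(\<integral>t. ?k t \<partial>lborel) = 1"
        by (auto simp: has_bochner_integral_iff)
    qed
    note fi = time_weight_fubini(2)[OF km kb, of "Some j"]
    have pi: "integrable lborel (\<lambda>t. ?k t * momentum j s)" by (rule Bochner_Integration.integrable_mult_left[OF ki(1)])
    have di: "integrable lborel (\<lambda>t. ?k t * flux_in_time (Some j) t - ?k t * momentum j s)"
      by (rule Bochner_Integration.integrable_diff[OF fi pi])
    have ai: "integrable lborel (\<lambda>t. \<bar>?k t * flux_in_time (Some j) t - ?k t * momentum j s\<bar>)"
      by (rule integrable_abs[OF di])
    have ei: "integrable lborel (\<lambda>t. ?k t * e)"
      by (rule Bochner_Integration.integrable_mult_left[OF ki(1)])
    have eq: "(\<integral>t. ?k t * flux_in_time (Some j) t \<partial>lborel) - momentum j s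
      = (\<integral>t. ?k t * flux_in_time (Some j) t - ?k t * momentum j s \<partial>lborel)"
      unfolding Bochner_Integration.integral_diff[OF fi pi] using ki(2) by simp
    have "\<bar>\<integral>t. ?k t * flux_in_time (Some j) t - ?k t * momentum j s \<partial>lborel\<bar> \<le> (\<integral>t. \<bar>?k t * flux_in_time (Some j) t - ?k t * momentum j s\<bar> \<partial>lborel)"
      by (rule integral_abs_bound)
    also have "\<dots> \<le> (\<integral>t. ?k t * e \<partial>lborel)"
    proof (rule Bochner_Integration.integral_mono[OF ai ei])
      fix t
      show "\<bar>?k t * flux_in_time (Some j) t - ?k t * momentum j s\<bar> \<le> ?k t * e"
      proof (cases "t \<in> {s..s + \<delta>}")
        case True
        have "\<delta> < d" "\<delta> < T - s" using \<delta>(2) by simp_all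
        then have t: "t \<in> {0<..<T}" "t \<in> {0..T}" "dist t s < d"
          using s True unfolding dist_real_def by simp_all
        have "\<bar>flux_in_time (Some j) t - momentum j s\<bar> \<le> e"
          using d(2)[OF t(2,3)] unfolding flux_in_time_eq[OF t(1)] dist_real_def by linarith
        then show ?thesis
          unfolding right_diff_distrib[symmetric] abs_mult abs_of_nonneg[OF k0] by (rule mult_left_mono[OF _ k0])
      next
        case False
        then have nt: "(t - s) / \<delta> \<notin> {0..1}" using \<delta>(1) by (simp add: zero_le_divide_iff pos_divide_le_eq diff_le_eq add.commute)
        have "?k t = 0" by (simp only: smooth_step'_eq_0[OF nt] div_0)
        then show ?thesis by (simp only: mult_zero_left diff_self abs_zero)
      qed
    qed
    also have "(\<integral>t. ?k t * e \<partial>lborel) = e" using ki(2) by simp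
    finally show ?thesis unfolding eq .
  qed
  moreover have "0 < min d (T - s)" using d(1) s by simp
  ultimately show ?thesis by blast
qed

text \<open>The mollified momenta at two interior times coincide by \<open>transport_time\<close>,
  and shrinking the mollifier equates the momenta themselves. Continuity extends this to the closed
  interval, in particular to the initial time.\<close>

lemma momentum_conserved: "t \<in> {0..T} \<Longrightarrow> momentum j t = momentum j 0"
proof -
  assume t: "t \<in> {0..T}"
  have le: "\<bar>momentum j s1 - momentum j s2\<bar> \<le> 0" if s: "s1 \<in> {0<..<T}" "s2 \<in> {0<..<T}" for s1 s2
  proof (rule field_le_epsilon)
    fix e :: real assume e: "0 < e"
    then have e2: "0 < e / 2" by simp
    obtain d1 where d1: "0 < d1" "\<And>\<delta>. 0 < \<delta> \<Longrightarrow> \<delta> < d1 \<Longrightarrow>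
      \<bar>(\<integral>t. smooth_step' ((t - s1) / \<delta>) / \<delta> * flux_in_time (Some j) t \<partial>lborel) - momentum j s1\<bar> \<le> e / 2"
      using momentum_average_tendsto[OF s(1) e2, of j] by blast
    obtain d2 where d2: "0 < d2" "\<And>\<delta>. 0 < \<delta> \<Longrightarrow> \<delta> < d2 \<Longrightarrow>
      \<bar>(\<integral>t. smooth_step' ((t - s2) / \<delta>) / \<delta> * flux_in_time (Some j) t \<partial>lborel) - momentum j s2\<bar> \<le> e / 2"
      using momentum_average_tendsto[OF s(2) e2, of j] by blast
    define \<delta> where "\<delta> = min (min d1 d2) (min (T - s1) (T - s2)) / 2"
    have \<delta>: "0 < \<delta>" "\<delta> < d1" "\<delta> < d2" "s1 + \<delta> < T" "s2 + \<delta> < T"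
    proof -
      have "2 * \<delta> \<le> d1" "2 * \<delta> \<le> d2" "2 * \<delta> \<le> T - s1" "2 * \<delta> \<le> T - s2"
        unfolding \<delta>_def by simp_all
      moreover show "0 < \<delta>" using d1(1) d2(1) s unfolding \<delta>_def by simp
      ultimately show "\<delta> < d1" "\<delta> < d2" "s1 + \<delta> < T" "s2 + \<delta> < T" by linarith+
    qed
    obtain C where C: "0 < C" "\<And>s. smooth_step' s \<le> C" by (rule smooth_step'_bounded) blast
    have km: "(\<lambda>t. smooth_step' ((t - s) / \<delta>) / \<delta>) \<in> borel_measurable borel" for s by measurable
    have kb: "\<bar>smooth_step' ((t - s) / \<delta>) / \<delta>\<bar> \<le> C / \<delta>" for t s
      using C(2) \<delta>(1) smooth_step'_nonneg by (simp add: divide_right_mono)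
    let ?r = "\<lambda>t. smooth_step' ((t - s1) / \<delta>) / \<delta> - smooth_step' ((t - s2) / \<delta>) / \<delta>"
    have rb: "\<bar>?r t\<bar> \<le> C / \<delta> + C / \<delta>" for t
      using kb[of t s1] kb[of t s2] by linarith
    have "0 = (\<integral>t. ?r t * flux_in_time (Some j) t \<partial>lborel)"
      using transport_time[OF \<delta>(1) _ \<delta>(4) _ \<delta>(5), of "Some j"] s
        time_weight_fubini(1)[OF borel_measurable_diff[OF km km] rb, of "Some j"] by simp
    also have "\<dots> = (\<integral>t. smooth_step' ((t - s1) / \<delta>) / \<delta> * flux_in_time (Some j) t \<partial>lborel)
        - (\<integral>t. smooth_step' ((t - s2) / \<delta>) / \<delta> * flux_in_time (Some j) t \<partial>lborel)"
      unfolding left_diff_distrib by (intro Bochner_Integration.integral_diff time_weight_fubini(2)[OF km kb])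
    finally show "\<bar>momentum j s1 - momentum j s2\<bar> \<le> 0 + e"
      using d1(2)[OF \<delta>(1,2)] d2(2)[OF \<delta>(1,3)] by linarith
  qed
  have mid: "T / 2 \<in> {0<..<T}" using T by simp
  have cl: "closure {0<..<T} = {0..T}" using T by simp
  have "momentum j s = momentum j (T / 2)" if "s \<in> {0..T}" for s
  proof (rule continuous_constant_on_closure[of "{0<..<T}" "momentum j"])
    show "continuous_on (closure {0<..<T}) (momentum j)" unfolding cl by (rule momentum_continuous)
    show "momentum j x = momentum j (T / 2)" if "x \<in> {0<..<T}" for x using le[OF that mid] by simp
    show "s \<in> closure {0<..<T}" using that cl by simp
  qed
  from this[OF t] this[of 0] T show ?thesis by simp
qed

end

section \<open>The determinant functional and the final constants\<close>

lemma enn_root_ennreal: "0 \<le> x \<Longrightarrow> enn_root k (ennreal x) = ennreal (x powr (1 / real k))"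
  by (simp add: enn_root_def)

context conservative_flow
begin

text \<open>Two things hold almost everywhere: all second velocity moments are integrable, as
  Andreief's identity requires, and the flux matrix is a limit of positive semidefinite averages, so
  its determinant is nonnegative.\<close>

lemma det_functional_root:
  "AE x in lborel. fst x \<in> {0<..<T} \<longrightarrow>
    enn_root CARD('n) (det_functional f (fst x) (snd x)) = ennreal (det (\<chi> i j. flux_matrix x i j) powr (1 / CARD('n)))"
  using F_lift_integrable avg_matrix_tendsto
proof eventually_elim
  case (elim x)
  have pos: "0 \<le> det (\<chi> i j. flux_matrix x i j)" using elim(2) by (intro det_flux_matrix_nonneg) blast
  show ?case
  proof
    assume x: "fst x \<in> {0<..<T}"
    let ?d = "det (\<chi> i j. flux_matrix x i j)"
    have Fx: "f (fst x) (snd x) = F x" using x by (simp add: F_def fun_eq_iff)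
    have "(\<integral>\<^sup>+ V. ennreal ((\<Prod>i\<in>UNIV. F x (V i)) * (Delta V)\<^sup>2) \<partial>(PiM UNIV (\<lambda>_::'n option. lborel)))
      = ennreal (fact (CARD('n) + 1) * ?d)"
      using det_integral_Andreief[of "F x"] F_nonneg elim(1) by (simp only: flux_matrix_def mult.assoc)
    then have "det_functional f (fst x) (snd x) = ennreal (fact (CARD('n) + 1) * ?d) / ennreal (fact (CARD('n) + 1))"
      by (simp only: det_functional_def Fx)
    also have "\<dots> = ennreal (fact (CARD('n) + 1) * ?d / fact (CARD('n) + 1))"
      using pos by (intro divide_ennreal mult_nonneg_nonneg) (simp_all only: fact_ge_zero fact_gt_zero)
    also have "fact (CARD('n) + 1) * ?d / fact (CARD('n) + 1) = ?d"
      by (rule nonzero_mult_div_cancel_left[OF fact_nonzero])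
    finally show "enn_root CARD('n) (det_functional f (fst x) (snd x)) = ennreal (?d powr (1 / CARD('n)))"
      using pos by (simp only: enn_root_ennreal)
  qed
qed

text \<open>The identification on a set of full measure in time-space is split by Fubini into one
  for almost every t and almost every y, so that only the measurable determinant has to be treated
  as a function on the product.\<close>

lemma nn_integral_det_functional:
  "(\<integral>\<^sup>+ t \<in> {0<..<T}. (\<integral>\<^sup>+ y. enn_root CARD('n) (det_functional f t y) \<partial>lborel) \<partial>lborel)
    = (\<integral>\<^sup>+x. ennreal (det (\<chi> i j. flux_matrix x i j) powr (1 / CARD('n))) \<partial>lborel)"
proof -
  let ?h = "\<lambda>x. ennreal (det (\<chi> i j. flux_matrix x i j) powr (1 / CARD('n)))"
  have off: "?h (t, y) = 0" if "t \<notin> {0<..<T}" for t y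
  proof -
    have "flux_matrix (t, y) i j = 0" for i j using that by (simp add: flux_matrix_def F_supp)
    then show ?thesis by (simp add: det_def)
  qed
  have "AE x in lborel \<Otimes>\<^sub>M lborel. fst x \<in> {0<..<T} \<longrightarrow> enn_root CARD('n) (det_functional f (fst x) (snd x)) = ?h x"
    unfolding lborel_prod by (rule det_functional_root)
  from lborel_pair.AE_pair[OF this]
  have ae: "AE t in lborel. AE y in lborel. t \<in> {0<..<T} \<longrightarrow> enn_root CARD('n) (det_functional f t y) = ?h (t, y)"
    by simp
  have "(\<integral>\<^sup>+ t \<in> {0<..<T}. (\<integral>\<^sup>+ y. enn_root CARD('n) (det_functional f t y) \<partial>lborel) \<partial>lborel)
    = (\<integral>\<^sup>+t. \<integral>\<^sup>+y. ?h (t, y) \<partial>lborel \<partial>lborel)"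
  proof (rule nn_integral_cong_AE)
    show "AE t in lborel. (\<integral>\<^sup>+ y. enn_root CARD('n) (det_functional f t y) \<partial>lborel) * indicator {0<..<T} t = (\<integral>\<^sup>+y. ?h (t, y) \<partial>lborel)"
      using ae
    proof eventually_elim
      case (elim t)
      show ?case
      proof (cases "t \<in> {0<..<T}")
        case True
        then have "AE y in lborel. enn_root CARD('n) (det_functional f t y) = ?h (t, y)" using elim by simp
        then show ?thesis using True by (simp cong: nn_integral_cong_AE)
      next
        case False
        have "(\<integral>\<^sup>+y. ?h (t, y) \<partial>lborel) = (\<integral>\<^sup>+y. 0 \<partial>(lborel :: (real^'n) measure))"
          by (intro nn_integral_cong off False)
        then show ?thesis using False by simp
      qed
    qed
  qed
  also have "\<dots> = (\<integral>\<^sup>+x. ?h x \<partial>lborel)"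
    by (rule nn_integral_lborel_iterated(1)[OF det_powr_measurable[OF flux_matrix_measurable], symmetric])
  finally show ?thesis .
qed

definition total_mass :: real where "total_mass = enn2real (mass f0)"
definition dispersion :: real where "dispersion = enn2real (Dzero f0)"

lemma initial_density: "velocity_density f0"
  using density[of 0] T by (simp add: f0_eq)

lemma mass_eq: "mass f0 = ennreal total_mass" "0 \<le> total_mass"
  using mass_f0 by (simp_all add: total_mass_def)

lemma dispersion_eq: "Dzero f0 = ennreal dispersion" "0 \<le> dispersion"
  unfolding dispersion_def velocity_density.Dzero_eq[OF initial_density] by simp_all

lemma moment_one: "t \<in> {0..T} \<Longrightarrow> velocity_density.moment (f t) (\<lambda>_. 1) = total_mass"
proof -
  assume t: "t \<in> {0..T}"
  then interpret velocity_density "f t" by (rule density)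
  have "ennreal (moment (\<lambda>_. 1)) = mass (f t)"
    unfolding mass_eq_nn by (rule nn_integral_moment[symmetric, where k = 1]) auto
  then have "ennreal (moment (\<lambda>_. 1)) = ennreal total_mass" using mass_f[OF t] mass_eq(1) by simp
  then show ?thesis using moment_nonneg[of "\<lambda>_. 1"] mass_eq(2) by (simp add: ennreal_inj)
qed

lemma moment_square: "t \<in> {0..T} \<Longrightarrow> ennreal (velocity_density.moment (f t) (\<lambda>v. (norm v)\<^sup>2) / 2) = energy (f t)"
proof -
  assume "t \<in> {0..T}"
  then interpret velocity_density "f t" by (rule density)
  have "energy (f t) = ennreal (moment (\<lambda>v. (norm v)\<^sup>2 / 2))"
    unfolding energy_eq_nn by (rule nn_integral_moment[where k = 1]) auto
  moreover have "moment (\<lambda>v. (norm v)\<^sup>2 / 2) = moment (\<lambda>v. (norm v)\<^sup>2) / 2"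
    unfolding moment_def by simp
  ultimately show ?thesis by simp
qed

text \<open>Mass and momentum being conserved and the energy nonincreasing, the velocity variance
  about the mean velocity is at most its initial value, which is \<open>dispersion / total_mass\<close>.\<close>

lemma variance_bound:
  assumes t: "t \<in> {0<..<T}"
  defines "u \<equiv> (1 / total_mass) *\<^sub>R (\<chi> j. momentum j 0)"
  shows "velocity_density.moment (f t) (\<lambda>_. 1) * velocity_density.moment (f t) (\<lambda>v. (norm (v - u))\<^sup>2) \<le> dispersion"
proof -
  have t': "t \<in> {0..T}" and z: "(0::real) \<in> {0..T}" using t by auto
  interpret velocity_density "f t" by (rule density[OF t'])
  let ?P = "\<chi> j. momentum j 0" and ?E = "moment (\<lambda>v. (norm v)\<^sup>2)"
    and ?Einit = "velocity_density.moment f0 (\<lambda>v. (norm v)\<^sup>2)"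
  have M: "moment (\<lambda>_. 1) = total_mass" by (rule moment_one[OF t'])
  have P: "(\<chi> j. moment (\<lambda>v. v $ j)) = ?P"
    unfolding momentum_eq_moment[OF t', symmetric] momentum_conserved[OF t'] ..
  have "ennreal (?E / 2) \<le> ennreal (?Einit / 2)"
    using energy_f[OF t'] moment_square[OF t'] moment_square[OF z] by (simp add: f0_eq)
  moreover have "0 \<le> ?Einit" by (rule velocity_density.moment_nonneg[OF initial_density]) simp
  ultimately have E: "?E \<le> ?Einit" by (simp add: ennreal_le_iff)
  have "Dzero f0 = ennreal (total_mass * ?Einit - (norm ?P)\<^sup>2)"
    using velocity_density.Dzero_eq[OF initial_density] moment_one[OF z] momentum_eq_moment[OF z] by (simp add: f0_eq)
  then have D: "total_mass * ?Einit - (norm ?P)\<^sup>2 \<le> dispersion"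
  proof -
    \<comment> \<open>\<open>Dzero_eq\<close> truncates the variance expression at 0. Undoing the
      truncation can only increase the value, which is the direction wanted.\<close>
    have "x \<le> enn2real (ennreal x)" for x
      by (cases "0 \<le> x") (auto intro: order_trans[OF _ enn2real_nonneg])
    then show ?thesis unfolding dispersion_def by (simp only: \<open>Dzero f0 = _\<close>)
  qed
  show ?thesis
  \<comment> \<open>Without mass the mean velocity is 0 by the convention for division, and the
    product on the left vanishes.\<close>
  proof (cases "total_mass = 0")
    case True
    then show ?thesis unfolding M using dispersion_eq(2) by simp
  next
    case False
    have "moment (\<lambda>v. (norm (v - u))\<^sup>2) = (norm u)\<^sup>2 * total_mass - 2 * (u \<bullet> ?P) + ?E"
      unfolding norm_diff_square moment_quadratic M P by simp
    also have "(norm u)\<^sup>2 = (norm ?P)\<^sup>2 / total_mass\<^sup>2" by (simp add: u_def power_divide)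
    also have "u \<bullet> ?P = (norm ?P)\<^sup>2 / total_mass" by (simp add: u_def dot_square_norm)
    finally have "total_mass * moment (\<lambda>v. (norm (v - u))\<^sup>2) = total_mass * ?E - (norm ?P)\<^sup>2"
      using False by (simp add: field_simps power2_eq_square)
    also have "\<dots> \<le> total_mass * ?Einit - (norm ?P)\<^sup>2" using mult_left_mono[OF E mass_eq(2)] by linarith
    finally show ?thesis unfolding M using D by linarith
  qed
qed

text \<open>Compensated integrability about the conserved mean velocity, with the total mass for
  \<open>M\<close> and n times the root of the dispersion for \<open>N\<close>; the factor n comes
  from comparing the l1 norm with the Euclidean one.\<close>

lemma det_functional_bound:
  "(\<integral>\<^sup>+ t \<in> {0<..<T}. (\<integral>\<^sup>+ y. enn_root CARD('n) (det_functional f t y) \<partial>lborel) \<partial>lborel)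
    \<le> ennreal (4 * (2 * (64 / 7 * 4 ^ (CARD('n) + 1))) powr (1 + 1 / CARD('n)) * (2 * (CARD('n) * sqrt dispersion)) * (2 * total_mass) powr (1 / CARD('n)))"
  unfolding nn_integral_det_functional
proof (rule compensated_integrability[OF mass_eq(2) _ _ _ T])
  fix t assume t: "t \<in> {0<..<T}"
  then have t': "t \<in> {0..T}" by simp
  interpret velocity_density "f t" by (rule density[OF t'])
  have "(\<integral>\<^sup>+y. \<integral>\<^sup>+v. ennreal (F (t, y) v) \<partial>lborel \<partial>lborel) = mass (f t)"
    using t by (simp add: F_def mass_def)
  then show "(\<integral>\<^sup>+y. \<integral>\<^sup>+v. ennreal (F (t, y) v) \<partial>lborel \<partial>lborel) \<le> ennreal total_mass"
    using mass_f[OF t'] mass_eq(1) by simp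
  show "(\<integral>\<^sup>+y. \<integral>\<^sup>+v. ennreal (F (t, y) v * (\<Sum>k\<in>UNIV. \<bar>v $ k - ((1 / total_mass) *\<^sub>R (\<chi> j. momentum j 0)) $ k\<bar>)) \<partial>lborel \<partial>lborel)
    \<le> ennreal (CARD('n) * sqrt dispersion)"
    using absolute_moment_bound[OF variance_bound[OF t] dispersion_eq(2)] t by (simp only: F_def fst_conv snd_conv if_True)
qed (use dispersion_eq(2) in simp)

end

theorem theorem3p3:
  shows "\<exists>c::real. c > 0 \<and>
    (\<forall>(T::real) (f::real \<Rightarrow> real^'n::finite \<Rightarrow> real^'n \<Rightarrow> real) f0.
       T > 0 \<longrightarrow> admissible_flow T f f0 \<longrightarrow>
       (\<integral>\<^sup>+ t \<in> {0<..<T}. (\<integral>\<^sup>+ y. enn_root CARD('n) (det_functional f t y) \<partial>lborel) \<partial>lborel)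
         \<le> ennreal (2 * c) * enn_root CARD('n) (mass f0) * enn_root 2 (Dzero f0))"
proof -
  let ?n = "real CARD('n)"
  define K :: real where "K = (2 * (64 / 7 * 4 ^ (CARD('n) + 1))) powr (1 + 1 / ?n)"
  \<comment> \<open>Half of what remains of 4 * 2 n \<open>K\<close> 2^(1/n) once the powers of mass
    and dispersion are split off.\<close>
  define c where "c = 4 * ?n * K * 2 powr (1 / ?n)"
  have c: "0 < c" unfolding c_def K_def by simp
  show ?thesis
  proof (intro exI[of _ c] conjI allI impI c)
    fix T :: real and f :: "real \<Rightarrow> real^'n \<Rightarrow> real^'n \<Rightarrow> real" and f0
    assume "0 < T" "admissible_flow T f f0"
    then interpret conservative_flow T f f0 by unfold_locales
    have "4 * K * (2 * (?n * sqrt dispersion)) * (2 * total_mass) powr (1 / ?n)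
      = 2 * c * total_mass powr (1 / ?n) * dispersion powr (1 / 2)"
      using mass_eq(2) dispersion_eq(2) by (simp add: c_def powr_mult powr_half_sqrt)
    then have "(\<integral>\<^sup>+ t \<in> {0<..<T}. (\<integral>\<^sup>+ y. enn_root CARD('n) (det_functional f t y) \<partial>lborel) \<partial>lborel)
      \<le> ennreal (2 * c * total_mass powr (1 / ?n) * dispersion powr (1 / 2))"
      using det_functional_bound unfolding K_def by (simp only:)
    also have "\<dots> = ennreal (2 * c) * enn_root CARD('n) (mass f0) * enn_root 2 (Dzero f0)"
      using c by (simp add: mass_eq dispersion_eq enn_root_ennreal ennreal_mult'' mult.assoc)
    finally show "(\<integral>\<^sup>+ t \<in> {0<..<T}. (\<integral>\<^sup>+ y. enn_root CARD('n) (det_functional f t y) \<partial>lborel) \<partial>lborel)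
      \<le> ennreal (2 * c) * enn_root CARD('n) (mass f0) * enn_root 2 (Dzero f0)" .
  qed
qed

end
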